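(* Let $k \leq n$ be positive integers and let $R_{n,k} = \mathbb{Q}[x_1,\ldots,x_n]/I_{n,k}$, where $I_{n,k} = \langle x_1^k, \ldots, x_n^k, e_n, e_{n-1}, \ldots, e_{n-k+1}\rangle$. Consider the set $$\mathcal{B}_{n,k} := \{ F_T^S \cdot e_1^{i_1} e_2^{i_2} \cdots e_{n-k}^{i_{n-k}} \},$$ consisting of all such polynomials where $S, T$ are standard Young tableaux with $n$ boxes of the same shape and $(i_1, \ldots, i_{n-k})$ is a tuple of $n-k$ nonnegative integers whose sum is $< k - \mathrm{des}(S)$. Then $\mathcal{B}_{n,k}$ descends to a higher Specht basis for $R_{n,k}$.
   Context: Here $e_d = \sum_{1\le j_1<\cdots<j_d\le n} x_{j_1}\cdots x_{j_d}$ is the elementary symmetric polynomial, and $S_n$ acts on $\mathbb{Q}[x_1,\ldots,x_n]$ by permuting variables, $\omega\cdot x_i = x_{\omega(i)}$. Tableaux are drawn in French convention (first row at the bottom); a standard Young tableau (SYT) of shape $\lambda \vdash n$ is a filling of the diagram with $1,\ldots,n$ increasing left to right along rows and bottom to top along columns. A descent of an SYT $S$ is an entry $i$ such that $i+1$ lies in a strictly higher row than $i$; $\mathrm{des}(S)$ is the number of descents. Cocharge word: for a permutation $\pi=\pi_1\cdots\pi_n$, label the letter $1$ by $0$; if the letter $i$ has label $j$, give the letter $i+1$ label $j$ if $i+1$ appears to the right of $i$ in $\pi$, and label $j+1$ if it appears to the left. The reading word of an SYT $S$ is the concatenation of its rows from top to bottom, each read left to right; the cocharge label of a box of $S$ is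 the label of its entry in the reading word. For SYT $S,T$ of the same shape, $\mathbf{x}_T^{\mathrm{cw}(S)} = \prod_{i=1}^n x_i^{c(i)}$, where $c(i)$ is the cocharge label of $S$ in the box occupied by $i$ in $T$. The Young idempotent is $\varepsilon_T = \sum_{\tau\in C(T)}\sum_{\sigma\in R(T)} \mathrm{sgn}(\tau)\tau\sigma \in \mathbb{Q}[S_n]$, where $C(T)$ (resp. $R(T)$) is the group of permutations preserving each column (resp. row) of $T$ as a set. The higher Specht polynomial is $F_T^S = \varepsilon_T\cdot \mathbf{x}_T^{\mathrm{cw}(S)}$. A set of polynomials descends to a higher Specht basis of a graded $S_n$-module quotient $R$ if its images form a basis of $R$ and can be partitioned into subsets $\mathcal{B}_{\lambda,i}$ such that each $\mathcal{B}_{\lambda,i}$ is a basis of an $S_n$-submodule isomorphic to the irreducible $V_\lambda$, these submodules giving a direct sum decomposition of $R$ into irreducibles. *)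

theory Defs
  imports
    "HOL-Algebra.QuotRing"
    "HOL-Combinatorics.Permutations"
    "HOL-Library.Disjoint_Sets"
    "HOL-Library.Poly_Mapping"
    "Jordan_Normal_Form.VS_Connect"
begin

section \<open>The polynomial ring and its quotients\<close>

text \<open>
  The type below is the polynomial ring over the rationals in variables indexed by all naturals:
  the monoid algebra of the monoid of finitely supported exponent vectors.
  The ring in $x_1, \dots, x_n$ is singled out by its carrier.
\<close>

type_synonym qpoly = "(nat \<Rightarrow>\<^sub>0 nat) \<Rightarrow>\<^sub>0 rat"

definition const :: "rat \<Rightarrow> qpoly" where
  "const c = Poly_Mapping.single 0 c"

definition pvar :: "nat \<Rightarrow> qpoly" where
  "pvar i = Poly_Mapping.single (Poly_Mapping.single i 1) 1"

definition poly_ring :: "nat \<Rightarrow> qpoly ring" where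
  "poly_ring n =
     \<lparr>carrier = {p. \<forall>m\<in>Poly_Mapping.keys p. Poly_Mapping.keys m \<subseteq> {1..n}},
      mult = (*), one = 1, zero = 0, add = (+)\<rparr>"

definition esym :: "nat \<Rightarrow> nat \<Rightarrow> qpoly" where
  "esym n d = (\<Sum>J | J \<subseteq> {1..n} \<and> card J = d. \<Prod>j\<in>J. pvar j)"

definition ideal_I :: "nat \<Rightarrow> nat \<Rightarrow> qpoly set" where
  "ideal_I n k =
     genideal (poly_ring n) ({pvar i ^ k | i. i \<in> {1..n}} \<union> {esym n d | d. d \<in> {n - k + 1..n}})"

text \<open>The quotient algebra; scalars act through the constant polynomials.\<close>

definition quotient_module :: "nat \<Rightarrow> qpoly set \<Rightarrow> (rat, qpoly set) module" where
  "quotient_module n I =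
     (let Q = poly_ring n Quot I in
      \<lparr>carrier = carrier Q, mult = mult Q, one = one Q, zero = zero Q, add = add Q,
       smult = (\<lambda>c Y. (I +>\<^bsub>poly_ring n\<^esub> const c) \<otimes>\<^bsub>Q\<^esub> Y)\<rparr>)"

text \<open>The algebra endomorphism with $x_i \mapsto x_{\omega(i)}$.\<close>

definition perm_act :: "(nat \<Rightarrow> nat) \<Rightarrow> qpoly \<Rightarrow> qpoly" where
  "perm_act \<omega> p =
     (\<Sum>m\<in>Poly_Mapping.keys p. const (Poly_Mapping.lookup p m) *
        (\<Prod>i\<in>Poly_Mapping.keys m. pvar (\<omega> i) ^ Poly_Mapping.lookup m i))"

text \<open>
  For an ideal stable under the symmetric group, the image of the coset of $p$ under $\omega$
  is the coset of $\omega \cdot p$.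
\<close>

definition coset_act :: "(nat \<Rightarrow> nat) \<Rightarrow> qpoly set \<Rightarrow> qpoly set" where
  "coset_act \<omega> Y = perm_act \<omega> ` Y"


section \<open>Tableaux\<close>

text \<open>
  A tableau is the list of its rows, the first (bottom) row at index 0; the box \<open>(r, c)\<close>
  is in row \<open>r\<close> and column \<open>c\<close>, both counted from 0.
\<close>

definition is_partition :: "nat \<Rightarrow> nat list \<Rightarrow> bool" where
  "is_partition n lam \<longleftrightarrow> sorted_wrt (\<ge>) lam \<and> 0 \<notin> set lam \<and> sum_list lam = n"

definition shape :: "nat list list \<Rightarrow> nat list" where
  "shape T = map length T"

definition SYT :: "nat \<Rightarrow> nat list list set" where
  "SYT n = {T. is_partition n (shape T) \<and> distinct (concat T) \<and> set (concat T) = {1..n} \<and>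
     (\<forall>row\<in>set T. sorted_wrt (<) row) \<and>
     (\<forall>r c. Suc r < length T \<and> c < length (T ! Suc r) \<longrightarrow> T ! r ! c < T ! Suc r ! c)}"

definition boxes :: "nat list list \<Rightarrow> (nat \<times> nat) set" where
  "boxes T = {(r, c). r < length T \<and> c < length (T ! r)}"

definition entry :: "nat list list \<Rightarrow> nat \<times> nat \<Rightarrow> nat" where
  "entry T b = T ! fst b ! snd b"

definition box_of :: "nat list list \<Rightarrow> nat \<Rightarrow> nat \<times> nat" where
  "box_of T i = (THE b. b \<in> boxes T \<and> entry T b = i)"

definition column :: "nat list list \<Rightarrow> nat \<Rightarrow> nat set" where
  "column T c = {T ! r ! c | r. (r, c) \<in> boxes T}"

definition descents :: "nat list list \<Rightarrow> nat set" where
  "descents S =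
     {i. \<exists>r r'. r < r' \<and> r' < length S \<and> i \<in> set (S ! r) \<and> Suc i \<in> set (S ! r')}"

definition des :: "nat list list \<Rightarrow> nat" where
  "des S = card (descents S)"

definition before :: "nat list \<Rightarrow> nat \<Rightarrow> nat \<Rightarrow> bool" where
  "before w a b \<longleftrightarrow> (\<exists>p q. p < q \<and> q < length w \<and> w ! p = a \<and> w ! q = b)"

text \<open>The value at 0, which is not a letter, is irrelevant.\<close>

primrec cocharge_label :: "nat list \<Rightarrow> nat \<Rightarrow> nat" where
  "cocharge_label w 0 = 0"
| "cocharge_label w (Suc i) =
     (if i = 0 then 0
      else if before w i (Suc i) then cocharge_label w i
      else cocharge_label w i + 1)"

definition reading_word :: "nat list list \<Rightarrow> nat list" where
  "reading_word S = concat (rev S)"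

definition cw_monomial :: "nat \<Rightarrow> nat list list \<Rightarrow> nat list list \<Rightarrow> qpoly" where
  "cw_monomial n S T =
     (\<Prod>i=1..n. pvar i ^ cocharge_label (reading_word S) (entry S (box_of T i)))"


section \<open>The group algebra of the symmetric group and higher Specht polynomials\<close>

text \<open>
  Elements of the rational group algebra of $S_n$ are functions on permutations of
  \<open>{1..n}\<close>, extended by 0 to all functions.
\<close>

type_synonym gralg = "(nat \<Rightarrow> nat) \<Rightarrow> rat"

definition gdelta :: "(nat \<Rightarrow> nat) \<Rightarrow> gralg" where
  "gdelta \<omega> = (\<lambda>\<pi>. if \<pi> = \<omega> then 1 else 0)"

definition gmult :: "nat \<Rightarrow> gralg \<Rightarrow> gralg \<Rightarrow> gralg" where
  "gmult n f g = (\<lambda>\<pi>. \<Sum>\<sigma> | \<sigma> permutes {1..n}. \<Sum>\<tau> | \<tau> permutes {1..n}.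
     if \<sigma> \<circ> \<tau> = \<pi> then f \<sigma> * g \<tau> else 0)"

definition group_algebra :: "nat \<Rightarrow> (rat, gralg) module" where
  "group_algebra n =
     \<lparr>carrier = {f. \<forall>\<pi>. \<not> \<pi> permutes {1..n} \<longrightarrow> f \<pi> = 0},
      mult = gmult n, one = gdelta id, zero = (\<lambda>_. 0), add = (\<lambda>f g \<pi>. f \<pi> + g \<pi>),
      smult = (\<lambda>c f \<pi>. c * f \<pi>)\<rparr>"

definition gact :: "nat \<Rightarrow> gralg \<Rightarrow> qpoly \<Rightarrow> qpoly" where
  "gact n f p = (\<Sum>\<pi> | \<pi> permutes {1..n}. const (f \<pi>) * perm_act \<pi> p)"

definition row_group :: "nat \<Rightarrow> nat list list \<Rightarrow> (nat \<Rightarrow> nat) set" where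
  "row_group n T = {\<pi>. \<pi> permutes {1..n} \<and> (\<forall>r<length T. \<pi> ` set (T ! r) = set (T ! r))}"

definition column_group :: "nat \<Rightarrow> nat list list \<Rightarrow> (nat \<Rightarrow> nat) set" where
  "column_group n T = {\<pi>. \<pi> permutes {1..n} \<and> (\<forall>c. \<pi> ` column T c = column T c)}"

definition young_idempotent :: "nat \<Rightarrow> nat list list \<Rightarrow> gralg" where
  "young_idempotent n T = (\<lambda>\<pi>. \<Sum>\<tau>\<in>column_group n T. \<Sum>\<sigma>\<in>row_group n T.
     if \<tau> \<circ> \<sigma> = \<pi> then of_int (sign \<tau>) else 0)"

definition higher_specht :: "nat \<Rightarrow> nat list list \<Rightarrow> nat list list \<Rightarrow> qpoly" where
  "higher_specht n S T = gact n (young_idempotent n T) (cw_monomial n S T)"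


section \<open>Modules over the symmetric group\<close>

locale Sn_module = vectorspace class_ring M
  for n :: nat and M :: "(rat, 'a) module" and act :: "(nat \<Rightarrow> nat) \<Rightarrow> 'a \<Rightarrow> 'a" +
  assumes act_hom: "\<sigma> permutes {1..n} \<Longrightarrow> act \<sigma> \<in> LinearCombinations.module_hom class_ring M M"
    and act_id: "v \<in> carrier M \<Longrightarrow> act id v = v"
    and act_comp: "\<sigma> permutes {1..n} \<Longrightarrow> \<tau> permutes {1..n} \<Longrightarrow> v \<in> carrier M \<Longrightarrow>
      act (\<sigma> \<circ> \<tau>) v = act \<sigma> (act \<tau> v)"

definition Sn_submodule ::
    "nat \<Rightarrow> (rat, 'a) module \<Rightarrow> ((nat \<Rightarrow> nat) \<Rightarrow> 'a \<Rightarrow> 'a) \<Rightarrow> 'a set \<Rightarrow> bool" where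
  "Sn_submodule n M act W \<longleftrightarrow> VectorSpace.subspace class_ring W M \<and>
     (\<forall>\<sigma>. \<sigma> permutes {1..n} \<longrightarrow> act \<sigma> ` W \<subseteq> W)"

definition Sn_irreducible ::
    "nat \<Rightarrow> (rat, 'a) module \<Rightarrow> ((nat \<Rightarrow> nat) \<Rightarrow> 'a \<Rightarrow> 'a) \<Rightarrow> bool" where
  "Sn_irreducible n M act \<longleftrightarrow> Sn_module n M act \<and> carrier M \<noteq> {\<zero>\<^bsub>M\<^esub>} \<and>
     (\<forall>U. Sn_submodule n M act U \<longrightarrow> U = {\<zero>\<^bsub>M\<^esub>} \<or> U = carrier M)"

definition Sn_isomorphic ::
    "nat \<Rightarrow> (rat, 'a) module \<Rightarrow> ((nat \<Rightarrow> nat) \<Rightarrow> 'a \<Rightarrow> 'a) \<Rightarrow>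
     (rat, 'b) module \<Rightarrow> ((nat \<Rightarrow> nat) \<Rightarrow> 'b \<Rightarrow> 'b) \<Rightarrow> bool" where
  "Sn_isomorphic n M actM N actN \<longleftrightarrow>
     (\<exists>f \<in> LinearCombinations.module_hom class_ring M N. bij_betw f (carrier M) (carrier N) \<and>
        (\<forall>\<sigma> v. \<sigma> permutes {1..n} \<longrightarrow> v \<in> carrier M \<longrightarrow> f (actM \<sigma> v) = actN \<sigma> (f v)))"

definition internal_direct_sum :: "(rat, 'a) module \<Rightarrow> 'i set \<Rightarrow> ('i \<Rightarrow> 'a set) \<Rightarrow> bool" where
  "internal_direct_sum M J W \<longleftrightarrow> finite J \<and> (\<forall>j\<in>J. W j \<subseteq> carrier M) \<and>
     (\<forall>v\<in>carrier M. \<exists>!w. w \<in> (\<Pi>\<^sub>E j\<in>J. W j) \<and> v = (\<Oplus>\<^bsub>M\<^esub>j\<in>J. w j))"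

text \<open>
  The irreducible module indexed by a partition is realised as the left ideal of the group
  algebra generated by the Young idempotent of the tableau whose rows, from the first on, are
  filled with 1, 2, 3, ... consecutively.  With the column sum to the left of the row sum this is
  the usual indexing: a single row gives the trivial module, a single column the sign module.
\<close>

primrec fill_rows :: "nat \<Rightarrow> nat list \<Rightarrow> nat list list" where
  "fill_rows s [] = []"
| "fill_rows s (l # ls) = [s..<s + l] # fill_rows (s + l) ls"

definition irrep :: "nat \<Rightarrow> nat list \<Rightarrow> (rat, gralg) module" where
  "irrep n lam = (group_algebra n)
     \<lparr>carrier := {gmult n f (young_idempotent n (fill_rows 1 lam)) | f.
                   f \<in> carrier (group_algebra n)}\<rparr>"

definition irrep_act :: "nat \<Rightarrow> (nat \<Rightarrow> nat) \<Rightarrow> gralg \<Rightarrow> gralg" where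
  "irrep_act n \<omega> f = gmult n (gdelta \<omega>) f"


section \<open>Higher Specht bases\<close>

definition higher_specht_basis ::
    "nat \<Rightarrow> (rat, 'a) module \<Rightarrow> ((nat \<Rightarrow> nat) \<Rightarrow> 'a \<Rightarrow> 'a) \<Rightarrow> 'a set \<Rightarrow> bool" where
  "higher_specht_basis n M act B \<longleftrightarrow>
     Sn_module n M act \<and> vectorspace.basis class_ring M B \<and>
     (\<exists>\<P> lam W. partition_on B \<P> \<and>
        (\<forall>C\<in>\<P>. is_partition n (lam C) \<and>
           Sn_submodule n M act (W C) \<and>
           vectorspace.basis class_ring (M\<lparr>carrier := W C\<rparr>) C \<and>
           Sn_isomorphic n (M\<lparr>carrier := W C\<rparr>) act (irrep n (lam C)) (irrep_act n) \<and>
           Sn_irreducible n (M\<lparr>carrier := W C\<rparr>) act) \<and>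
        internal_direct_sum M \<P> W)"

text \<open>
  That the images of the members of \<open>B\<close> form a basis includes that distinct
  members have distinct images.
\<close>

definition descends_to_higher_specht_basis :: "nat \<Rightarrow> qpoly set \<Rightarrow> qpoly set \<Rightarrow> bool" where
  "descends_to_higher_specht_basis n I B \<longleftrightarrow>
     (let q = (\<lambda>p. I +>\<^bsub>poly_ring n\<^esub> p) in
      B \<subseteq> carrier (poly_ring n) \<and> inj_on q B \<and>
      higher_specht_basis n (quotient_module n I) coset_act (q ` B))"

definition basis_B :: "nat \<Rightarrow> nat \<Rightarrow> qpoly set" where
  "basis_B n k =
     {higher_specht n S T * (\<Prod>d=1..n - k. esym n d ^ i d) | S T i.
        S \<in> SYT n \<and> T \<in> SYT n \<and> shape S = shape T \<and>
        int (\<Sum>d=1..n - k. i d) < int k - int (des S)}"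

end

theory Submission
  imports Defs "HOL-Computational_Algebra.Formal_Power_Series"
begin

text \<open>
  Independence. For a weakly increasing exponent vector \<open>\<nu>\<close> take the pairs \<open>(S, T)\<close> such that
  \<open>\<nu> a = \<nu> (a + 1)\<close> only at non-descents of \<open>S\<close>. Young symmetrizers applied to polynomials with a
  positive leading coefficient at the monomial in which the entry of \<open>T\<close> in a box of \<open>S\<close>-entry \<open>a\<close>
  has exponent \<open>\<nu> a\<close> are linearly independent. There are as many such pairs as rearrangements of
  \<open>\<nu>\<close>: this is the Kostka number identity behind RSK, proved here by the commutation of adding
  horizontal strips with removing boxes. So these polynomials span the rearrangements of the
  monomial.

  Spanning. The cocharge monomial times \<open>e\<^sub>1\<close>, \<open>e\<^sub>2\<close>, ... has such a leading part, up to monomials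
  with a smaller sum of squared exponents. Hence every monomial is, modulo a subspace containing
  all monomials with an exponent at least \<open>k\<close> and all multiples of \<open>e\<^sub>r\<close> with \<open>r > n - k\<close>, a
  combination of the proposed basis.

  Linear independence modulo the ideal. Let \<open>X\<close> be the set of surjections \<open>{1..n} \<rightarrow> {1..k}\<close>,
  viewed as points of rational \<open>n\<close>-space. On \<open>X\<close> every ideal generator agrees with a polynomial of
  smaller degree, so the proposed basis spans all functions on \<open>X\<close>; as it has at most \<open>card X\<close>
  members, its restriction to \<open>X\<close> is independent. The ideal being homogeneous, a dependence
  modulo it gives, degree by degree, a dependence on \<open>X\<close>.

  For fixed \<open>S\<close> and exponents of the \<open>e\<^sub>d\<close>, the members with \<open>T\<close> varying span the cyclic module
  generated by one of them, which is a copy of the left ideal of the Young idempotent because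
  \<open>e\<^sub>d\<close> is symmetric and the standard \<open>T\<close> suffice to span that left ideal.
\<close>

text \<open>The obstacle is that the leading part of a product is not one monomial. Multiplication
  by \<open>e_r\<close> raises the \<open>r\<close> largest exponents, and when exponents coincide
  there are several ways to choose them, all with the same sum of squares. The choices differ by
  permutations of entries with equal cocharge labels and occur with nonnegative coefficients.
  Entries with equal labels lie in different columns, so pairing exponents with column numbers
  singles out one choice as the maximum. Independence is therefore proved for every leading part of
  this kind; plain monomials are a special case, which serves for the count and, with \<nu> the
  identity, for the regular representation. The bound by \<open>card X\<close> is a double count.
  The exponent tuples allowed for \<open>S\<close> are at most as many as the sets \<open>D\<close>
  of \<open>k - 1\<close> positions that contain the descents of \<open>S\<close>. For fixed
  \<open>D\<close>, the pairs with descents in \<open>D\<close> are at most as many as the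
  rearrangements of the sorted word that jumps exactly at \<open>D\<close>. Over all
  \<open>D\<close> these words are surjections. Spanning on \<open>X\<close> makes this inequality
  sufficient.\<close>

declare One_nat_def [simp del]

section \<open>Polynomials as a permutation module\<close>

abbreviation keys :: "('a \<Rightarrow>\<^sub>0 'b::zero) \<Rightarrow> 'a set" where "keys \<equiv> Poly_Mapping.keys"
abbreviation pinv :: "('a \<Rightarrow> 'b) \<Rightarrow> 'b \<Rightarrow> 'a" where "pinv \<equiv> inv_into UNIV"
abbreviation lookup :: "('a \<Rightarrow>\<^sub>0 'b::zero) \<Rightarrow> 'a \<Rightarrow> 'b" where "lookup \<equiv> Poly_Mapping.lookup"

section \<open>Linear maps on polynomials\<close>

definition qlin :: "(qpoly \<Rightarrow> qpoly) \<Rightarrow> bool" where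
  "qlin F \<longleftrightarrow> (\<forall>p q. F (p + q) = F p + F q) \<and> (\<forall>c p. F (const c * p) = const c * F p)"

lemma const_simps [simp]: "const 0 = 0" "const 1 = 1"
  by (simp_all add: const_def)

lemma const_arith:
  "const (a + b) = const a + const b" "const (a * b) = const a * const b" "const (- a) = - const a"
  by (simp_all add: const_def single_add mult_single single_uminus)

lemma const_eq_iff [simp]: "const a = const b \<longleftrightarrow> a = b" "const a = 0 \<longleftrightarrow> a = 0"
  by (metis const_def lookup_single_eq, metis const_def lookup_single_eq single_zero)

lemma const_sum: "const (sum f A) = (\<Sum>x\<in>A. const (f x))"
  by (induction A rule: infinite_finite_induct) (auto simp: const_arith)

lemma lookup_const_mult [simp]: "lookup (const c * p) m = c * lookup p m"
  by (simp add: const_def map.rep_eq when_def flip: mult_map_scale_conv_mult)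

interpretation qv: vector_space "\<lambda>c p. const c * (p :: qpoly)"
  by unfold_locales (simp_all add: algebra_simps const_arith)

lemma qlin_add: "qlin F \<Longrightarrow> F (p + q) = F p + F q"
  and qlin_scale: "qlin F \<Longrightarrow> F (const c * p) = const c * F p"
  by (simp_all add: qlin_def)

lemma qlin_0: "qlin F \<Longrightarrow> F 0 = 0"
  using qlin_scale[of F 0 0] by simp

lemma qlin_sum: "qlin F \<Longrightarrow> F (sum f A) = (\<Sum>x\<in>A. F (f x))"
  by (induction A rule: infinite_finite_induct) (auto simp: qlin_add qlin_0)

lemma qlin_uminus: "qlin F \<Longrightarrow> F (- p) = - F p"
  using qlin_scale[of F "-1" p] by (simp add: const_arith)

lemma qlin_diff: "qlin F \<Longrightarrow> F (p - q) = F p - F q"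
  using qlin_add[of F p "-q"] qlin_uminus[of F q] by simp

lemma qlin_comp: "qlin F \<Longrightarrow> qlin G \<Longrightarrow> qlin (\<lambda>p. F (G p))"
  by (simp add: qlin_def)

lemma qlin_sumI: "(\<And>x. x \<in> A \<Longrightarrow> qlin (F x)) \<Longrightarrow> qlin (\<lambda>p. \<Sum>x\<in>A. F x p)"
  unfolding qlin_def sum_distrib_left by (simp add: sum.distrib)

lemma qlin_scaleI: "qlin F \<Longrightarrow> qlin (\<lambda>p. const c * F p)"
  by (simp add: qlin_def distrib_left mult.left_commute)

lemma qlin_mult: "qlin (\<lambda>p. p * e)" "qlin (\<lambda>p. e * p)"
  by (simp_all add: qlin_def distrib_left distrib_right mult.assoc mult.left_commute)

lemma qlin_span:
  assumes "qlin F" "p \<in> qv.span A" shows "F p \<in> qv.span (F ` A)"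
  using assms(2)
proof (induction rule: qv.span_induct_alt)
  case base
  show ?case using assms(1) qv.span_zero by (simp add: qlin_0)
next
  case (step c x y)
  then show ?case using assms(1)
    by (simp add: qlin_add qlin_scale qv.span_add qv.span_scale qv.span_base)
qed

lemma single_eq_const: "Poly_Mapping.single m c = const c * Poly_Mapping.single m 1"
  by (simp add: const_def mult_single)

lemma qpoly_expand: "p = (\<Sum>m\<in>keys p. const (lookup p m) * Poly_Mapping.single m 1)"
proof (rule poly_mapping_eqI)
  fix k
  show "lookup p k = lookup (\<Sum>m\<in>keys p. const (lookup p m) * Poly_Mapping.single m 1) k"
    by (simp add: lookup_sum lookup_single when_def in_keys_iff if_distrib cong: if_cong)
qed

lemma qlin_eqI:
  assumes "qlin F" "qlin G" "\<And>m. m \<in> keys p \<Longrightarrow> F (Poly_Mapping.single m 1) = G (Poly_Mapping.single m 1)"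
  shows "F p = G p"
  by (subst (1 2) qpoly_expand) (auto simp: assms qlin_sum qlin_scale intro!: sum.cong)

lemma pvar_power: "pvar i ^ k = Poly_Mapping.single (Poly_Mapping.single i k) 1"
  by (induction k) (simp_all add: pvar_def mult_single plus_1_eq_Suc flip: single_add)

lemma prod_single_one: "(\<Prod>i\<in>A. Poly_Mapping.single (g i) (1::rat)) = Poly_Mapping.single (\<Sum>i\<in>A. g i) 1"
  by (induction A rule: infinite_finite_induct) (simp_all add: mult_single)

section \<open>The permutation action on coefficients\<close>

lemma inj_inv_bij: "bij \<omega> \<Longrightarrow> inj (pinv \<omega>)"
  by (simp add: bij_imp_bij_inv bij_is_inj)

lemma map_key_inv: "bij \<omega> \<Longrightarrow> Poly_Mapping.map_key \<omega> (Poly_Mapping.map_key (pinv \<omega>) m) = m"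
  "bij \<omega> \<Longrightarrow> Poly_Mapping.map_key (pinv \<omega>) (Poly_Mapping.map_key \<omega> m) = m"
  by (rule poly_mapping_eqI; simp add: map_key.rep_eq inj_inv_bij bij_is_inj bij_is_surj surj_f_inv_f)+

lemma sum_single_rename:
  assumes "bij \<omega>"
  shows "(\<Sum>i\<in>keys m. Poly_Mapping.single (\<omega> i) (lookup m i :: nat)) = Poly_Mapping.map_key (pinv \<omega>) m"
proof (rule poly_mapping_eqI)
  fix k
  have "(\<Sum>i\<in>keys m. lookup m i when \<omega> i = k) = (\<Sum>i\<in>keys m. if i = pinv \<omega> k then lookup m i else 0)"
    using assms by (intro sum.cong) (auto simp: when_def bij_inv_eq_iff)
  also have "\<dots> = lookup m (pinv \<omega> k)" by (simp add: in_keys_iff)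
  finally show "lookup (\<Sum>i\<in>keys m. Poly_Mapping.single (\<omega> i) (lookup m i)) k = lookup (Poly_Mapping.map_key (pinv \<omega>) m) k"
    using assms by (simp add: lookup_sum lookup_single map_key.rep_eq inj_inv_bij)
qed

lemma perm_act_alt:
  assumes "bij \<omega>"
  shows "perm_act \<omega> p = (\<Sum>m\<in>keys p. Poly_Mapping.single (Poly_Mapping.map_key (pinv \<omega>) m) (lookup p m))"
  unfolding perm_act_def
  by (rule sum.cong) (simp_all add: pvar_power prod_single_one sum_single_rename assms single_eq_const[symmetric])

text \<open>The action moves an exponent vector by the inverse permutation, so reading off a
  coefficient composes the exponents with \<omega> itself. Most identities of the action reduce to
  this formula.\<close>

lemma lookup_perm_act:
  assumes "bij \<omega>"
  shows "lookup (perm_act \<omega> p) m = lookup p (Poly_Mapping.map_key \<omega> m)"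
proof -
  have "lookup (perm_act \<omega> p) m = (\<Sum>k\<in>keys p. if k = Poly_Mapping.map_key \<omega> m then lookup p k else 0)"
    unfolding perm_act_alt[OF assms] lookup_sum
    by (rule sum.cong) (auto simp: lookup_single when_def map_key_inv assms)
  then show ?thesis by (simp add: in_keys_iff)
qed

lemma qlin_perm_act: "bij \<omega> \<Longrightarrow> qlin (perm_act \<omega>)"
  by (auto simp: qlin_def lookup_perm_act lookup_add intro!: poly_mapping_eqI)

lemma perm_act_single:
  "bij \<omega> \<Longrightarrow> perm_act \<omega> (Poly_Mapping.single m c) = Poly_Mapping.single (Poly_Mapping.map_key (pinv \<omega>) m) c"
  by (cases "c = 0") (simp_all add: perm_act_alt)

lemma map_key_add: "inj \<omega> \<Longrightarrow> Poly_Mapping.map_key \<omega> (a + b) = Poly_Mapping.map_key \<omega> a + Poly_Mapping.map_key \<omega> b"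
  by (rule poly_mapping_eqI) (simp add: map_key.rep_eq lookup_add)

lemma perm_act_mult:
  assumes "bij \<omega>" shows "perm_act \<omega> (p * q) = perm_act \<omega> p * perm_act \<omega> q"
proof -
  have *: "qlin (\<lambda>p. perm_act \<omega> (p * q))" "qlin (\<lambda>p. perm_act \<omega> p * perm_act \<omega> q)" for q
    using qlin_perm_act[OF assms] by (simp_all add: qlin_def distrib_right distrib_left mult.assoc mult.left_commute[of _ "const _"])
  have **: "qlin (\<lambda>q. perm_act \<omega> (p * q))" "qlin (\<lambda>q. perm_act \<omega> p * perm_act \<omega> q)" for p
    using qlin_perm_act[OF assms] by (simp_all add: qlin_def distrib_right distrib_left mult.left_commute[of _ "const _"])
  show ?thesis
    by (rule qlin_eqI[OF *], rule qlin_eqI[OF **])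
      (simp add: mult_single perm_act_single assms map_key_add inj_inv_bij)
qed

lemma perm_act_const [simp]: "bij \<omega> \<Longrightarrow> perm_act \<omega> (const c) = const c"
  by (simp add: const_def perm_act_single map_key.rep_eq inj_inv_bij poly_mapping_eqI)

lemma perm_act_one [simp]: "bij \<omega> \<Longrightarrow> perm_act \<omega> 1 = 1"
  using perm_act_const[of \<omega> 1] by simp

lemma perm_act_power: "bij \<omega> \<Longrightarrow> perm_act \<omega> (p ^ k) = perm_act \<omega> p ^ k"
  by (induction k) (simp_all add: perm_act_mult)

lemma perm_act_prod: "bij \<omega> \<Longrightarrow> perm_act \<omega> (prod f A) = (\<Prod>x\<in>A. perm_act \<omega> (f x))"
  by (induction A rule: infinite_finite_induct) (simp_all add: perm_act_mult)

lemma perm_act_comp: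
  assumes "bij \<sigma>" "bij \<tau>" shows "perm_act (\<sigma> \<circ> \<tau>) p = perm_act \<sigma> (perm_act \<tau> p)"
proof -
  have "Poly_Mapping.map_key (\<sigma> \<circ> \<tau>) m = Poly_Mapping.map_key \<tau> (Poly_Mapping.map_key \<sigma> m)" for m :: "nat \<Rightarrow>\<^sub>0 nat"
    using assms by (intro poly_mapping_eqI) (simp add: map_key.rep_eq bij_is_inj inj_compose)
  then show ?thesis
    using assms by (intro poly_mapping_eqI) (simp add: lookup_perm_act bij_comp)
qed

lemma perm_act_id [simp]: "perm_act id p = p"
proof -
  have "Poly_Mapping.map_key id m = m" for m :: "nat \<Rightarrow>\<^sub>0 nat"
    by (intro poly_mapping_eqI) (simp add: map_key.rep_eq)
  then show ?thesis by (intro poly_mapping_eqI) (simp add: lookup_perm_act)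
qed

lemma perm_act_pvar: "bij \<omega> \<Longrightarrow> perm_act \<omega> (pvar i) = pvar (\<omega> i)"
  using perm_act_def[of \<omega> "pvar i"] by (simp add: pvar_def)

lemma permutes_bij': "\<pi> permutes A \<Longrightarrow> bij \<pi>"
  by (rule permutes_bij)

lemma perm_act_esym:
  assumes "\<pi> permutes {1..n}" shows "perm_act \<pi> (esym n d) = esym n d"
proof -
  let ?A = "{J. J \<subseteq> {1..n} \<and> card J = d}"
  have b: "bij \<pi>" using assms by (rule permutes_bij)
  have "perm_act \<pi> (esym n d) = (\<Sum>J\<in>?A. \<Prod>j\<in>J. pvar (\<pi> j))"
    unfolding esym_def by (simp add: qlin_sum qlin_perm_act b perm_act_prod perm_act_pvar)
  also have "\<dots> = (\<Sum>J\<in>?A. \<Prod>j\<in>\<pi> ` J. pvar j)"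
    using b by (intro sum.cong) (auto simp: prod.reindex inj_on_def bij_def)
  also have "\<dots> = (\<Sum>J\<in>?A. \<Prod>j\<in>J. pvar j)"
  proof (rule sum.reindex_bij_witness[of _ "\<lambda>J. pinv \<pi> ` J" "\<lambda>J. \<pi> ` J"])
    have i: "pinv \<pi> permutes {1..n}" using assms by (rule permutes_inv)
    fix J assume J: "J \<in> ?A"
    show "pinv \<pi> ` \<pi> ` J = J" using b by (simp add: image_inv_f_f bij_def)
    show "\<pi> ` pinv \<pi> ` J = J" using b by (simp add: image_f_inv_f bij_def)
    have *: "\<rho> ` J \<in> ?A" if "\<rho> permutes {1..n}" for \<rho>
      using J image_mono[of J "{1..n}" \<rho>] permutes_image[OF that] card_image[OF permutes_inj_on[OF that], of J] by simp
    show "\<pi> ` J \<in> ?A" "pinv \<pi> ` J \<in> ?A" using *[OF assms] *[OF i] by blast+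
  qed (rule refl)
  finally show ?thesis by (simp only: esym_def)
qed

section \<open>Monomials given by exponent functions\<close>

definition expo :: "nat \<Rightarrow> (nat \<Rightarrow> nat) \<Rightarrow> nat \<Rightarrow>\<^sub>0 nat" where
  "expo n b = Abs_poly_mapping (\<lambda>i. if i \<in> {1..n} then b i else 0)"

lemma lookup_expo [simp]: "lookup (expo n b) i = (if i \<in> {1..n} then b i else 0)"
  unfolding expo_def by (subst lookup_Abs_poly_mapping) (auto intro: finite_subset[of _ "{1..n}"])

lemma expo_eq_iff: "expo n b = expo n b' \<longleftrightarrow> (\<forall>i\<in>{1..n}. b i = b' i)"
proof
  assume e: "expo n b = expo n b'"
  have "lookup (expo n b) i = lookup (expo n b') i" for i using e by simp
  then show "\<forall>i\<in>{1..n}. b i = b' i" by (auto split: if_splits) (metis atLeastAtMost_iff)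
qed (auto intro: poly_mapping_eqI)

lemma keys_expo: "keys (expo n b) \<subseteq> {1..n}"
  by (auto simp: in_keys_iff split: if_splits)

lemma expo_lookup: "keys m \<subseteq> {1..n} \<Longrightarrow> expo n (lookup m) = m"
  by (rule poly_mapping_eqI) (auto simp: in_keys_iff subset_iff)

text \<open>Exponents are total functions of which only the values at \<open>1..n\<close> count;
  permuting the variables then becomes composition of functions.\<close>

definition xm :: "nat \<Rightarrow> (nat \<Rightarrow> nat) \<Rightarrow> qpoly" where
  "xm n b = Poly_Mapping.single (expo n b) 1"

lemma lookup_xm: "lookup (xm n b) m = (if m = expo n b then 1 else 0)"
  by (simp add: xm_def lookup_single when_def)

lemma xm_cong: "(\<And>i. i \<in> {1..n} \<Longrightarrow> b i = b' i) \<Longrightarrow> xm n b = xm n b'"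
  unfolding xm_def using expo_eq_iff[of n b b'] by simp

lemma xm_prod: "xm n b = (\<Prod>i=1..n. pvar i ^ b i)"
proof -
  have "expo n b = (\<Sum>i=1..n. Poly_Mapping.single i (b i))"
    by (rule poly_mapping_eqI) (simp add: lookup_sum lookup_single when_def)
  then show ?thesis unfolding xm_def pvar_power prod_single_one by simp
qed

lemma xm_mult: "xm n a * xm n b = xm n (\<lambda>i. a i + b i)"
  by (simp add: xm_prod power_add prod.distrib)

lemma perm_act_xm:
  assumes "\<pi> permutes {1..n}" shows "perm_act \<pi> (xm n b) = xm n (b \<circ> pinv \<pi>)"
proof -
  have b: "bij \<pi>" using assms by (rule permutes_bij)
  have "Poly_Mapping.map_key (pinv \<pi>) (expo n b) = expo n (b \<circ> pinv \<pi>)"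
    using permutes_in_image[OF permutes_inv[OF assms]]
    by (intro poly_mapping_eqI) (simp add: map_key.rep_eq inj_inv_bij[OF b])
  then show ?thesis by (simp add: xm_def perm_act_single b)
qed

lemma esym_alt: "esym n d = (\<Sum>J | J \<subseteq> {1..n} \<and> card J = d. xm n (\<lambda>i. if i \<in> J then 1 else 0))"
proof -
  have "(\<Prod>j\<in>J. pvar j) = xm n (\<lambda>i. if i \<in> J then 1 else 0)" if "J \<subseteq> {1..n}" for J
  proof -
    have "xm n (\<lambda>i. if i \<in> J then 1 else 0) = (\<Prod>i=1..n. if i \<in> J then pvar i else 1)"
      unfolding xm_prod by (rule prod.cong) auto
    also have "\<dots> = (\<Prod>j\<in>J. pvar j)"
      using that by (simp add: prod.If_cases Int_absorb1)
    finally show ?thesis ..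
  qed
  then show ?thesis unfolding esym_def by (auto intro: sum.cong)
qed

section \<open>The inner product with orthonormal monomials\<close>

definition ip :: "qpoly \<Rightarrow> qpoly \<Rightarrow> rat" where
  "ip p q = (\<Sum>m\<in>keys p. lookup p m * lookup q m)"

lemma ip_superset: "finite A \<Longrightarrow> keys p \<subseteq> A \<Longrightarrow> ip p q = (\<Sum>m\<in>A. lookup p m * lookup q m)"
  unfolding ip_def by (rule sum.mono_neutral_left) (auto simp: in_keys_iff)

lemma ip_commute: "ip p q = ip q p"
  using ip_superset[of "keys p \<union> keys q" p q] ip_superset[of "keys p \<union> keys q" q p]
  by (simp add: mult.commute)

lemma ip_scale_left: "ip (const c * p) q = c * ip p q"
proof -
  have "keys (const c * p) \<subseteq> keys p" by (auto simp: in_keys_iff)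
  then show ?thesis by (simp add: ip_superset[of "keys p"] sum_distrib_left mult.assoc)
qed

lemma ip_add_left: "ip (p + p') q = ip p q + ip p' q"
  using ip_superset[of "keys p \<union> keys p'" "p + p'" q] ip_superset[of "keys p \<union> keys p'" p q]
    ip_superset[of "keys p \<union> keys p'" p' q] keys_add[of p p']
  by (simp add: lookup_add distrib_right sum.distrib)

lemma ip_zero [simp]: "ip 0 q = 0" "ip p 0 = 0"
  by (simp_all add: ip_def)

lemma ip_sum_left: "ip (sum f A) q = (\<Sum>x\<in>A. ip (f x) q)"
  by (induction A rule: infinite_finite_induct) (auto simp: ip_add_left)

lemma ip_scale_right: "ip p (const c * q) = c * ip p q"
  by (metis ip_commute ip_scale_left)

lemma ip_sum_right: "ip p (sum f A) = (\<Sum>x\<in>A. ip p (f x))"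
  unfolding ip_commute[of p] by (rule ip_sum_left)

text \<open>Positive definiteness over the rationals, together with permutations being isometries,
  takes the place of complete reducibility: it shows that certain products of symmetrizers cannot
  vanish.\<close>

lemma ip_self_eq_0: "ip p p = 0 \<Longrightarrow> p = 0"
  unfolding ip_def by (subst (asm) sum_nonneg_eq_0_iff) (auto simp: in_keys_iff poly_mapping_eqI)

lemma ip_perm_act:
  assumes "bij \<pi>" shows "ip (perm_act \<pi> p) q = ip p (perm_act (pinv \<pi>) q)"
proof -
  have bi: "bij (pinv \<pi>)" using assms by (rule bij_imp_bij_inv)
  let ?f = "Poly_Mapping.map_key (pinv \<pi>) :: (nat \<Rightarrow>\<^sub>0 nat) \<Rightarrow> _"
  have "inj ?f" by (metis assms injI map_key_inv(1))
  then have inj: "inj_on ?f (keys p)" by (rule inj_on_subset) simp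
  have "keys (perm_act \<pi> p) \<subseteq> ?f ` keys p"
  proof
    fix m assume "m \<in> keys (perm_act \<pi> p)"
    then have "Poly_Mapping.map_key \<pi> m \<in> keys p" by (simp add: in_keys_iff lookup_perm_act assms)
    then show "m \<in> ?f ` keys p" using map_key_inv(2)[OF assms, of m] by force
  qed
  then have "ip (perm_act \<pi> p) q = (\<Sum>m\<in>?f ` keys p. lookup (perm_act \<pi> p) m * lookup q m)"
    by (intro ip_superset) auto
  also have "\<dots> = (\<Sum>m\<in>keys p. lookup p m * lookup q (?f m))"
    by (subst sum.reindex[OF inj]) (simp add: lookup_perm_act assms map_key_inv)
  finally show ?thesis by (simp add: ip_def lookup_perm_act bi)
qed

section \<open>Row and column operators\<close>

text \<open>With the row function of a tableau this is the row group, with the column function the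
  column group. Describing the groups by level functions makes conjugation a composition and frees
  the theory of Young symmetrizers from lists.\<close>

definition Stab :: "nat \<Rightarrow> (nat \<Rightarrow> nat) \<Rightarrow> (nat \<Rightarrow> nat) set" where
  "Stab n f = {\<pi>. \<pi> permutes {1..n} \<and> (\<forall>i. f (\<pi> i) = f i)}"

definition rowop :: "nat \<Rightarrow> (nat \<Rightarrow> nat) \<Rightarrow> qpoly \<Rightarrow> qpoly" where
  "rowop n f p = (\<Sum>\<pi>\<in>Stab n f. perm_act \<pi> p)"

definition colop :: "nat \<Rightarrow> (nat \<Rightarrow> nat) \<Rightarrow> qpoly \<Rightarrow> qpoly" where
  "colop n h p = (\<Sum>\<pi>\<in>Stab n h. const (of_int (sign \<pi>)) * perm_act \<pi> p)"

lemma finite_Stab [simp]: "finite (Stab n f)"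
  unfolding Stab_def by (rule finite_subset[OF _ finite_permutations[of "{1..n}"]]) auto

lemma StabD: "\<pi> \<in> Stab n f \<Longrightarrow> \<pi> permutes {1..n}" "\<pi> \<in> Stab n f \<Longrightarrow> f (\<pi> i) = f i" "\<pi> \<in> Stab n f \<Longrightarrow> bij \<pi>"
  by (auto simp: Stab_def permutes_bij)

lemma Stab_comp: "\<pi> \<in> Stab n f \<Longrightarrow> \<rho> \<in> Stab n f \<Longrightarrow> \<pi> \<circ> \<rho> \<in> Stab n f"
  by (auto simp: Stab_def permutes_compose)

lemma Stab_inv: "\<pi> \<in> Stab n f \<Longrightarrow> pinv \<pi> \<in> Stab n f"
  by (auto simp: Stab_def permutes_inv) (metis permutes_inverses(1))

lemma Stab_id [simp]: "id \<in> Stab n f"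
  by (simp add: Stab_def permutes_id)

lemma sign_perm_inv: "\<pi> permutes {1..n::nat} \<Longrightarrow> sign (pinv \<pi>) = sign \<pi>"
  by (rule sign_inverse) (rule permutation_permutes[THEN iffD2], auto)

lemma sign_perm_comp: "\<pi> permutes {1..n::nat} \<Longrightarrow> \<rho> permutes {1..n} \<Longrightarrow> sign (\<pi> \<circ> \<rho>) = sign \<pi> * sign \<rho>"
  by (rule sign_compose) (rule permutation_permutes[THEN iffD2], auto)+

lemma Stab_conj:
  assumes "g permutes {1..n}"
  shows "(\<lambda>\<pi>. g \<circ> \<pi> \<circ> pinv g) ` Stab n f = Stab n (f \<circ> pinv g)"
proof -
  have sub: "(\<lambda>\<pi>. g \<circ> \<pi> \<circ> pinv g) ` Stab n f \<subseteq> Stab n (f \<circ> pinv g)" if "g permutes {1..n}" for g f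
    using that by (auto simp: Stab_def permutes_compose permutes_inv permutes_inverses)
  show ?thesis
  proof
    show "Stab n (f \<circ> pinv g) \<subseteq> (\<lambda>\<pi>. g \<circ> \<pi> \<circ> pinv g) ` Stab n f"
    proof
      fix \<pi> assume p: "\<pi> \<in> Stab n (f \<circ> pinv g)"
      have ig: "pinv g permutes {1..n}" using assms by (rule permutes_inv)
      have "pinv g \<circ> \<pi> \<circ> pinv (pinv g) \<in> Stab n (f \<circ> pinv g \<circ> pinv (pinv g))"
        using sub[OF ig] p by blast
      then have "pinv g \<circ> \<pi> \<circ> g \<in> Stab n f"
        using assms by (simp add: permutes_inv_inv comp_assoc permutes_inv_o)
      moreover have "g \<circ> (pinv g \<circ> \<pi> \<circ> g) \<circ> pinv g = \<pi>"
        using assms by (simp add: fun_eq_iff permutes_inverses)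
      ultimately show "\<pi> \<in> (\<lambda>\<pi>. g \<circ> \<pi> \<circ> pinv g) ` Stab n f"
        by (intro image_eqI[of _ _ "pinv g \<circ> \<pi> \<circ> g"]) simp_all
    qed
  qed (rule sub[OF assms])
qed

lemma qlin_rowop: "qlin (rowop n f)"
  unfolding rowop_def by (rule qlin_sumI) (simp add: qlin_perm_act StabD)

lemma qlin_colop: "qlin (colop n f)"
  unfolding colop_def by (rule qlin_sumI, rule qlin_scaleI) (simp add: qlin_perm_act StabD)

lemma rowop_sym:
  assumes "\<And>\<pi>. \<pi> permutes {1..n} \<Longrightarrow> perm_act \<pi> e = e" shows "rowop n f (p * e) = rowop n f p * e"
  unfolding rowop_def by (auto simp: sum_distrib_right perm_act_mult StabD assms[OF StabD(1)] intro!: sum.cong)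

lemma colop_sym:
  assumes "\<And>\<pi>. \<pi> permutes {1..n} \<Longrightarrow> perm_act \<pi> e = e" shows "colop n f (p * e) = colop n f p * e"
  unfolding colop_def by (auto simp: sum_distrib_right perm_act_mult StabD assms[OF StabD(1)] mult.assoc intro!: sum.cong)

lemma Stab_reindex:
  assumes "\<rho> \<in> Stab n f"
  shows "bij_betw (\<lambda>\<pi>. \<pi> \<circ> \<rho>) (Stab n f) (Stab n f)" "bij_betw (\<lambda>\<pi>. \<rho> \<circ> \<pi>) (Stab n f) (Stab n f)"
proof -
  have r: "pinv \<rho> \<circ> \<rho> = id" "\<rho> \<circ> pinv \<rho> = id"
    using assms by (auto simp: Stab_def permutes_inv_o)
  show "bij_betw (\<lambda>\<pi>. \<pi> \<circ> \<rho>) (Stab n f) (Stab n f)"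
    by (rule bij_betw_byWitness[where f' = "\<lambda>\<pi>. \<pi> \<circ> pinv \<rho>"])
       (use assms r in \<open>auto simp: comp_assoc Stab_comp Stab_inv\<close>)
  show "bij_betw (\<lambda>\<pi>. \<rho> \<circ> \<pi>) (Stab n f) (Stab n f)"
    by (rule bij_betw_byWitness[where f' = "\<lambda>\<pi>. pinv \<rho> \<circ> \<pi>"])
       (use assms r in \<open>auto simp: comp_assoc[symmetric] Stab_comp Stab_inv\<close>)
qed

lemma rowop_perm:
  assumes "\<rho> \<in> Stab n f" shows "rowop n f (perm_act \<rho> p) = rowop n f p" "perm_act \<rho> (rowop n f p) = rowop n f p"
proof -
  show "rowop n f (perm_act \<rho> p) = rowop n f p"
    unfolding rowop_def
    by (subst (2) sum.reindex_bij_betw[OF Stab_reindex(1)[OF assms], symmetric])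
      (simp add: perm_act_comp StabD assms StabD(3)[OF assms])
  show "perm_act \<rho> (rowop n f p) = rowop n f p"
    unfolding rowop_def
    by (subst (2) sum.reindex_bij_betw[OF Stab_reindex(2)[OF assms], symmetric])
      (simp add: perm_act_comp StabD StabD(3)[OF assms] qlin_sum qlin_perm_act)
qed

lemma sign_sq: "of_int (sign \<rho>) * (of_int (sign \<rho>) :: rat) = 1"
  by (simp add: sign_def)

lemma const_sign_sq: "\<rho> permutes {1..n::nat} \<Longrightarrow> const (of_int (sign \<rho>)) * (const (of_int (sign \<rho>)) * x) = x"
  by (simp only: mult.assoc[symmetric] const_arith(2)[symmetric] sign_sq) simp

lemma colop_perm:
  assumes "\<rho> \<in> Stab n f"
  shows "colop n f (perm_act \<rho> p) = const (of_int (sign \<rho>)) * colop n f p"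
    "perm_act \<rho> (colop n f p) = const (of_int (sign \<rho>)) * colop n f p"
proof -
  have r: "bij \<rho>" "\<rho> permutes {1..n}" using assms by (auto intro: StabD)
  let ?s = "\<lambda>\<pi>. const (of_int (sign \<pi>))"
  have c1: "?s (\<pi> \<circ> \<rho>) = ?s \<rho> * ?s \<pi>" if "\<pi> \<in> Stab n f" for \<pi>
    unfolding sign_perm_comp[OF StabD(1)[OF that] r(2)] of_int_mult const_arith by (rule mult.commute)
  have c2: "?s (\<rho> \<circ> \<pi>) = ?s \<rho> * ?s \<pi>" if "\<pi> \<in> Stab n f" for \<pi>
    unfolding sign_perm_comp[OF r(2) StabD(1)[OF that]] of_int_mult const_arith by (rule refl)
  have "?s \<rho> * colop n f p = ?s \<rho> * (\<Sum>\<pi>\<in>Stab n f. ?s (\<pi> \<circ> \<rho>) * perm_act (\<pi> \<circ> \<rho>) p)"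
    unfolding colop_def by (subst sum.reindex_bij_betw[OF Stab_reindex(1)[OF assms]]) (rule refl)
  also have "\<dots> = (\<Sum>\<pi>\<in>Stab n f. ?s \<rho> * (?s \<rho> * (?s \<pi> * perm_act \<pi> (perm_act \<rho> p))))"
    unfolding sum_distrib_left
    by (rule sum.cong) (simp_all only: c1 perm_act_comp[OF StabD(3) r(1)] mult.assoc)
  finally show "colop n f (perm_act \<rho> p) = ?s \<rho> * colop n f p"
    by (simp only: const_sign_sq[OF r(2)] colop_def)
  have "?s \<rho> * colop n f p = ?s \<rho> * (\<Sum>\<pi>\<in>Stab n f. ?s (\<rho> \<circ> \<pi>) * perm_act (\<rho> \<circ> \<pi>) p)"
    unfolding colop_def by (subst sum.reindex_bij_betw[OF Stab_reindex(2)[OF assms]]) (rule refl)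
  also have "\<dots> = (\<Sum>\<pi>\<in>Stab n f. ?s \<rho> * (?s \<rho> * (?s \<pi> * perm_act \<rho> (perm_act \<pi> p))))"
    unfolding sum_distrib_left
    by (rule sum.cong) (simp_all only: c2 perm_act_comp[OF r(1) StabD(3)] mult.assoc)
  also have "\<dots> = perm_act \<rho> (colop n f p)"
    unfolding colop_def qlin_sum[OF qlin_perm_act[OF r(1)]]
    by (rule sum.cong) (simp_all only: const_sign_sq[OF r(2)] qlin_scale[OF qlin_perm_act[OF r(1)]])
  finally show "perm_act \<rho> (colop n f p) = ?s \<rho> * colop n f p" ..
qed

lemma rowop_conj:
  assumes "g permutes {1..n}" shows "perm_act g (rowop n f p) = rowop n (f \<circ> pinv g) (perm_act g p)"
proof -
  have b: "bij g" "bij (pinv g)" "pinv g \<circ> g = id" using assms by (auto simp: permutes_bij permutes_inv_o bij_imp_bij_inv)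
  have inj: "inj_on (\<lambda>\<pi>. g \<circ> \<pi> \<circ> pinv g) (Stab n f)"
    by (rule inj_on_inverseI[of _ "\<lambda>\<pi>. pinv g \<circ> \<pi> \<circ> g"]) (use assms in \<open>simp add: fun_eq_iff permutes_inverses\<close>)
  show ?thesis
    unfolding rowop_def Stab_conj[OF assms, symmetric] sum.reindex[OF inj]
    using b by (auto simp: qlin_sum qlin_perm_act perm_act_comp[symmetric] bij_comp StabD comp_assoc intro!: sum.cong)
qed

lemma colop_conj:
  assumes "g permutes {1..n}" shows "perm_act g (colop n f p) = colop n (f \<circ> pinv g) (perm_act g p)"
proof -
  have b: "bij g" "bij (pinv g)" "pinv g \<circ> g = id" using assms by (auto simp: permutes_bij permutes_inv_o bij_imp_bij_inv)
  have inj: "inj_on (\<lambda>\<pi>. g \<circ> \<pi> \<circ> pinv g) (Stab n f)"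
    by (rule inj_on_inverseI[of _ "\<lambda>\<pi>. pinv g \<circ> \<pi> \<circ> g"]) (use assms in \<open>simp add: fun_eq_iff permutes_inverses\<close>)
  have sg: "sign (g \<circ> \<pi> \<circ> pinv g) = sign \<pi>" if "\<pi> \<in> Stab n f" for \<pi>
  proof -
    have "sign (g \<circ> \<pi> \<circ> pinv g) = sign g * sign \<pi> * sign (pinv g)"
      using assms that by (subst sign_perm_comp[where n = n] | simp add: permutes_compose permutes_inv StabD(1))+
    then show ?thesis using sign_perm_inv[OF assms] by (simp add: sign_def)
  qed
  show ?thesis
    unfolding colop_def Stab_conj[OF assms, symmetric] sum.reindex[OF inj]
    using b by (auto simp: qlin_sum qlin_perm_act perm_act_comp[symmetric] bij_comp StabD comp_assoc sg[unfolded comp_assoc]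
        qlin_scale[OF qlin_perm_act] intro!: sum.cong)
qed

lemma transpose_Stab:
  "i \<in> {1..n} \<Longrightarrow> j \<in> {1..n} \<Longrightarrow> f i = f j \<Longrightarrow> Transposition.transpose i j \<in> Stab n f"
  by (auto simp: Stab_def permutes_swap_id Transposition.transpose_def)

lemma rat_poly_double_0: "(x :: qpoly) = - x \<Longrightarrow> x = 0"
proof (rule poly_mapping_eqI)
  fix m assume "x = - x"
  then have "lookup x m = - lookup x m" by (metis lookup_uminus)
  then show "lookup x m = lookup 0 m" by simp
qed

text \<open>The transposition of \<open>i\<close> and \<open>j\<close> lies in both groups. The row
  operator absorbs it and the column operator turns it into a sign, so the product equals its own
  negative.\<close>

lemma rowop_colop_0:
  assumes "i \<in> {1..n}" "j \<in> {1..n}" "i \<noteq> j" "f i = f j" "h i = h j"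
  shows "rowop n f (colop n h p) = 0" "colop n h (rowop n f p) = 0"
proof -
  let ?t = "Transposition.transpose i j"
  have t: "?t \<in> Stab n f" "?t \<in> Stab n h" using assms by (auto intro: transpose_Stab)
  have s: "sign ?t = - 1" using assms by (simp add: sign_swap_id)
  have "rowop n f (colop n h p) = rowop n f (perm_act ?t (colop n h p))"
    using rowop_perm(1)[OF t(1)] by simp
  also have "\<dots> = - rowop n f (colop n h p)"
    unfolding colop_perm(2)[OF t(2)] s by (simp add: const_arith qlin_uminus qlin_rowop)
  finally show "rowop n f (colop n h p) = 0" by (rule rat_poly_double_0)
  have "colop n h (rowop n f p) = colop n h (perm_act ?t (rowop n f p))"
    using rowop_perm(2)[OF t(1)] by simp
  also have "\<dots> = - colop n h (rowop n f p)"
    unfolding colop_perm(1)[OF t(2)] s by (simp add: const_arith)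
  finally show "colop n h (rowop n f p) = 0" by (rule rat_poly_double_0)
qed

lemma bij_betw_inv_Stab: "bij_betw pinv (Stab n f) (Stab n f)"
  by (rule bij_betw_byWitness[where f' = pinv]) (auto simp: Stab_inv StabD inv_inv_eq)

lemma ip_rowop: "ip (rowop n f p) q = ip p (rowop n f q)"
  unfolding rowop_def ip_sum_left ip_sum_right
  by (subst sum.reindex_bij_betw[OF bij_betw_inv_Stab, symmetric])
    (auto simp: ip_perm_act StabD Stab_inv inv_inv_eq intro!: sum.cong)

lemma ip_colop: "ip (colop n f p) q = ip p (colop n f q)"
  unfolding colop_def ip_sum_left ip_sum_right
  by (subst sum.reindex_bij_betw[OF bij_betw_inv_Stab, symmetric])
    (auto simp: ip_perm_act StabD Stab_inv inv_inv_eq ip_scale_left ip_scale_right sign_perm_inv[OF StabD(1)] intro!: sum.cong)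

lemma rowop_rowop: "rowop n f (rowop n f p) = const (of_nat (card (Stab n f))) * rowop n f p"
proof -
  have "rowop n f (rowop n f p) = (\<Sum>\<pi>\<in>Stab n f. rowop n f p)"
    unfolding rowop_def[of n f "rowop n f p"] by (rule sum.cong) (auto simp: rowop_perm)
  then show ?thesis by (simp add: const_def single_of_nat)
qed

lemma colop_colop: "colop n f (colop n f p) = const (of_nat (card (Stab n f))) * colop n f p"
proof -
  have "colop n f (colop n f p) = (\<Sum>\<pi>\<in>Stab n f. colop n f p)"
    unfolding colop_def[of n f "colop n f p"]
    by (rule sum.cong) (simp_all add: colop_perm sign_sq)
  then show ?thesis by (simp add: const_def single_of_nat)
qed

text \<open>Both operators are self-adjoint and idempotent up to a positive factor.\<close>

lemma rowop_colop_rowop_0: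
  assumes "rowop n f (colop n h (rowop n f p)) = 0" shows "colop n h (rowop n f p) = 0"
proof -
  let ?x = "rowop n f p"
  have "ip (colop n h ?x) (colop n h ?x) = ip ?x (colop n h (colop n h ?x))" by (rule ip_colop)
  also have "\<dots> = of_nat (card (Stab n h)) * ip p (rowop n f (colop n h ?x))"
    by (simp add: colop_colop ip_scale_right ip_rowop)
  finally show ?thesis using assms by (intro ip_self_eq_0) simp
qed

section \<open>Operators of the group algebra\<close>

lemma finite_perms [simp]: "finite {\<pi>. \<pi> permutes {1..n::nat}}"
  by (rule finite_permutations) simp

text \<open>Group algebra elements are handled as operators, so that convolution becomes
  composition. Nothing is lost, since polynomials contain the regular representation.\<close>

definition galg_op :: "nat \<Rightarrow> (qpoly \<Rightarrow> qpoly) \<Rightarrow> bool" where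
  "galg_op n F \<longleftrightarrow> (\<exists>y. F = gact n y)"

lemma qlin_gact: "qlin (gact n y)"
  unfolding gact_def by (rule qlin_sumI, rule qlin_scaleI) (simp add: qlin_perm_act permutes_bij)

lemma galg_op_qlin: "galg_op n F \<Longrightarrow> qlin F"
  by (auto simp: galg_op_def qlin_gact)

lemma gact_gmult: "gact n (gmult n f g) p = gact n f (gact n g p)"
proof -
  let ?P = "{\<pi>. \<pi> permutes {1..n}}"
  have if_const: "const (if b then a else 0) * x = (if b then const a * x else 0)" for b a x by simp
  have "gact n (gmult n f g) p = (\<Sum>\<pi>\<in>?P. \<Sum>\<sigma>\<in>?P. \<Sum>\<tau>\<in>?P. if \<sigma> \<circ> \<tau> = \<pi> then const (f \<sigma> * g \<tau>) * perm_act \<pi> p else 0)"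
    unfolding gact_def gmult_def const_sum sum_distrib_right if_const ..
  also have "\<dots> = (\<Sum>\<sigma>\<in>?P. \<Sum>\<tau>\<in>?P. \<Sum>\<pi>\<in>?P. if \<sigma> \<circ> \<tau> = \<pi> then const (f \<sigma> * g \<tau>) * perm_act \<pi> p else 0)"
    by (subst sum.swap, rule sum.cong[OF refl], rule sum.swap)
  also have "\<dots> = (\<Sum>\<sigma>\<in>?P. \<Sum>\<tau>\<in>?P. const (f \<sigma>) * perm_act \<sigma> (const (g \<tau>) * perm_act \<tau> p))"
    by (intro sum.cong refl)
      (simp add: permutes_compose perm_act_comp permutes_bij qlin_scale[OF qlin_perm_act] mult.assoc)
  also have "\<dots> = gact n f (gact n g p)"
    unfolding gact_def
    by (intro sum.cong refl) (simp add: sum_distrib_left qlin_sum[OF qlin_perm_act] permutes_bij)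
  finally show ?thesis .
qed

lemma galg_op_comp: "galg_op n F \<Longrightarrow> galg_op n G \<Longrightarrow> galg_op n (\<lambda>p. F (G p))"
  unfolding galg_op_def by (metis gact_gmult ext)

lemma gact_gdelta: "\<pi> permutes {1..n} \<Longrightarrow> gact n (gdelta \<pi>) p = perm_act \<pi> p"
  unfolding gact_def gdelta_def
  by (subst sum.mono_neutral_right[of _ "{\<pi>}"]) auto

lemma galg_op_perm: "\<pi> permutes {1..n} \<Longrightarrow> galg_op n (perm_act \<pi>)"
  unfolding galg_op_def by (metis gact_gdelta ext)

lemma galg_op_scale: "galg_op n F \<Longrightarrow> galg_op n (\<lambda>p. const c * F p)"
proof -
  assume "galg_op n F"
  then obtain y where y: "F = gact n y" by (auto simp: galg_op_def)
  have "(\<lambda>p. const c * F p) = gact n (\<lambda>\<pi>. c * y \<pi>)"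
    unfolding y gact_def sum_distrib_left const_arith(2) mult.assoc ..
  then show ?thesis by (auto simp: galg_op_def)
qed

lemma galg_op_id: "galg_op n (\<lambda>p. p)"
proof -
  have "perm_act id = (\<lambda>p. p)" by (rule ext) simp
  then show ?thesis using galg_op_perm[OF permutes_id, of n] by simp
qed

lemma gact_stab:
  "gact n (\<lambda>\<pi>. if \<pi> \<in> Stab n f then c \<pi> else 0) p = (\<Sum>\<pi>\<in>Stab n f. const (c \<pi>) * perm_act \<pi> p)"
  unfolding gact_def
  by (rule sum.mono_neutral_cong_right) (auto simp: StabD)

lemma galg_op_rowop: "galg_op n (rowop n f)" and galg_op_colop: "galg_op n (colop n f)"
proof -
  have "rowop n f = gact n (\<lambda>\<pi>. if \<pi> \<in> Stab n f then 1 else 0)"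
    by (rule ext) (simp add: gact_stab rowop_def)
  then show "galg_op n (rowop n f)" by (auto simp: galg_op_def)
  have "colop n f = gact n (\<lambda>\<pi>. if \<pi> \<in> Stab n f then of_int (sign \<pi>) else 0)"
    by (rule ext) (simp add: gact_stab colop_def)
  then show "galg_op n (colop n f)" by (auto simp: galg_op_def)
qed

text \<open>The orbit of \<open>xm n id\<close> is a copy of the regular representation.\<close>

lemma lookup_gact_id:
  assumes "\<pi> permutes {1..n}" shows "lookup (gact n y (xm n id)) (expo n (pinv \<pi>)) = y \<pi>"
proof -
  have e: "expo n (pinv \<pi>) = expo n (pinv \<rho>) \<longleftrightarrow> \<rho> = \<pi>" if "\<rho> permutes {1..n}" for \<rho>
  proof -
    have "(\<forall>i\<in>{1..n}. pinv \<pi> i = pinv \<rho> i) \<longleftrightarrow> pinv \<pi> = pinv \<rho>"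
      using permutes_not_in[OF permutes_inv[OF assms]] permutes_not_in[OF permutes_inv[OF that]] by (metis ext)
    also have "\<dots> \<longleftrightarrow> \<rho> = \<pi>" using permutes_inv_inv[OF assms] permutes_inv_inv[OF that] by metis
    finally show ?thesis by (simp only: expo_eq_iff)
  qed
  have "lookup (gact n y (xm n id)) (expo n (pinv \<pi>)) = (\<Sum>\<rho> | \<rho> permutes {1..n}. if \<rho> = \<pi> then y \<rho> else 0)"
    unfolding gact_def lookup_sum
    by (rule sum.cong) (auto simp: perm_act_xm lookup_xm e)
  then show ?thesis using assms by simp
qed

lemma gact_eqI:
  assumes "gact n y (xm n id) = gact n z (xm n id)"
  shows "gact n y = gact n z" "\<pi> permutes {1..n} \<Longrightarrow> y \<pi> = z \<pi>"
proof -
  have *: "y \<pi> = z \<pi>" if "\<pi> permutes {1..n}" for \<pi>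
    using lookup_gact_id[OF that, of y] lookup_gact_id[OF that, of z] assms by simp
  then show "\<pi> permutes {1..n} \<Longrightarrow> y \<pi> = z \<pi>" .
  show "gact n y = gact n z"
    by (rule ext) (auto simp: gact_def * intro!: sum.cong)
qed

lemma galg_op_eqI: "galg_op n F \<Longrightarrow> galg_op n G \<Longrightarrow> F (xm n id) = G (xm n id) \<Longrightarrow> F p = G p"
  unfolding galg_op_def by (metis gact_eqI(1))

lemma galg_op_zero: "galg_op n (\<lambda>p. 0)"
  using galg_op_scale[OF galg_op_id, of n 0] by simp

lemma galg_op_add: "galg_op n F \<Longrightarrow> galg_op n G \<Longrightarrow> galg_op n (\<lambda>p. F p + G p)"
proof -
  assume "galg_op n F" "galg_op n G"
  then obtain y z where y: "F = gact n y" "G = gact n z" by (auto simp: galg_op_def)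
  have "(\<lambda>p. F p + G p) = gact n (\<lambda>\<pi>. y \<pi> + z \<pi>)"
    by (simp add: y gact_def sum.distrib distrib_right fun_eq_iff const_arith)
  then show ?thesis by (auto simp: galg_op_def)
qed

lemma galg_op_sum: "(\<And>x. x \<in> A \<Longrightarrow> galg_op n (F x)) \<Longrightarrow> galg_op n (\<lambda>p. \<Sum>x\<in>A. F x p)"
  by (induction A rule: infinite_finite_induct) (auto simp: galg_op_zero galg_op_add)

section \<open>Young symmetrizers\<close>

text \<open>\<open>f\<close> and \<open>h\<close> give the row and the column of each entry, \<open>lam\<close> the row lengths.\<close>

definition tab :: "nat \<Rightarrow> (nat \<Rightarrow> nat) \<Rightarrow> (nat \<Rightarrow> nat) \<Rightarrow> (nat \<Rightarrow> nat) \<Rightarrow> bool" where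
  "tab n lam f h \<longleftrightarrow> antimono lam \<and> bij_betw (\<lambda>i. (f i, h i)) {1..n} {(r, c). c < lam r}"

definition young :: "nat \<Rightarrow> (nat \<Rightarrow> nat) \<Rightarrow> (nat \<Rightarrow> nat) \<Rightarrow> qpoly \<Rightarrow> qpoly" where
  "young n f h p = colop n h (rowop n f p)"

lemma galg_op_young: "galg_op n (young n f h)"
  using galg_op_comp[OF galg_op_colop galg_op_rowop] by (simp add: young_def[abs_def])

lemmas qlin_young = galg_op_qlin[OF galg_op_young]

lemma young_conj:
  "g permutes {1..n} \<Longrightarrow> perm_act g (young n f h p) = young n (f \<circ> pinv g) (h \<circ> pinv g) (perm_act g p)"
  by (simp add: young_def rowop_conj colop_conj)

lemma tab_conj:
  assumes "tab n lam f h" "g permutes {1..n}" shows "tab n lam (f \<circ> g) (h \<circ> g)"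
  using assms bij_betw_trans[OF permutes_imp_bij[OF assms(2)], of "\<lambda>i. (f i, h i)"]
  by (auto simp: tab_def comp_def)

lemma tab_inj: "tab n lam f h \<Longrightarrow> i \<in> {1..n} \<Longrightarrow> j \<in> {1..n} \<Longrightarrow> f i = f j \<Longrightarrow> h i = h j \<Longrightarrow> i = j"
  unfolding tab_def by (metis (mono_tags, lifting) bij_betw_imp_inj_on inj_onD)

lemma tab_mem: "tab n lam f h \<Longrightarrow> i \<in> {1..n} \<Longrightarrow> h i < lam (f i)"
proof -
  assume "tab n lam f h" "i \<in> {1..n}"
  then have "(f i, h i) \<in> {(r, c). c < lam r}" unfolding tab_def by (metis (no_types, lifting) bij_betwE)
  then show ?thesis by simp
qed

lemma tab_ex: "tab n lam f h \<Longrightarrow> c < lam r \<Longrightarrow> \<exists>i\<in>{1..n}. f i = r \<and> h i = c"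
proof -
  assume "tab n lam f h" "c < lam r"
  then have "(r, c) \<in> (\<lambda>i. (f i, h i)) ` {1..n}" unfolding tab_def bij_betw_def by simp
  then show ?thesis by auto
qed

text \<open>Row lengths decrease weakly, so the rows met by a column are closed downwards and form
  an initial segment.\<close>

lemma tab_column:
  assumes "tab n lam f h"
  shows "bij_betw f {i\<in>{1..n}. h i = c} {..<card {i\<in>{1..n}. h i = c}}"
proof -
  let ?C = "{i\<in>{1..n}. h i = c}"
  have inj: "inj_on f ?C" using tab_inj[OF assms] by (auto simp: inj_on_def)
  have im: "f ` ?C = {r. c < lam r}"
    using tab_mem[OF assms] tab_ex[OF assms, of c] by (fastforce simp: image_iff)
  have down: "r' \<in> f ` ?C" if "r \<in> f ` ?C" "r' \<le> r" for r r'
    using that assms unfolding im tab_def antimono_def by (auto intro: less_le_trans)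
  have "f ` ?C = {..<card (f ` ?C)}"
  proof -
    have fin: "finite (f ` ?C)" by simp
    show ?thesis
    proof (cases "f ` ?C = {}")
      case True
      then show ?thesis by (metis card.empty lessThan_0)
    next
      case False
      then have M: "Max (f ` ?C) \<in> f ` ?C" using fin by (intro Max_in)
      have "f ` ?C = {..Max (f ` ?C)}"
        using down[OF M] Max_ge[OF fin] by auto
      then show ?thesis by (metis card_atMost lessThan_Suc_atMost)
    qed
  qed
  then show ?thesis using inj by (simp add: bij_betw_def card_image)
qed

lemma tab_rowcount:
  assumes "tab n lam f h" shows "card {i\<in>{1..n}. f i < R} = (\<Sum>r<R. lam r)"
proof -
  have "bij_betw (\<lambda>i. (f i, h i)) {i\<in>{1..n}. f i < R} (SIGMA r:{..<R}. {..<lam r})"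
    unfolding bij_betw_def
  proof
    show "inj_on (\<lambda>i. (f i, h i)) {i\<in>{1..n}. f i < R}"
      using tab_inj[OF assms] by (auto simp: inj_on_def)
    show "(\<lambda>i. (f i, h i)) ` {i\<in>{1..n}. f i < R} = (SIGMA r:{..<R}. {..<lam r})"
      using tab_mem[OF assms] by (fastforce dest: tab_ex[OF assms] simp: image_iff)
  qed
  then have "card {i\<in>{1..n}. f i < R} = card (SIGMA r:{..<R}. {..<lam r})" by (rule bij_betw_same_card)
  then show ?thesis by simp
qed

text \<open>Sorting every column by the row an entry has in the other tableau.\<close>

lemma column_sort:
  assumes t: "tab n lam f h"
    and np: "\<And>i j. i \<in> {1..n} \<Longrightarrow> j \<in> {1..n} \<Longrightarrow> i \<noteq> j \<Longrightarrow> f' i = f' j \<Longrightarrow> h i \<noteq> h j"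
  obtains \<tau> where "\<tau> \<in> Stab n h" "\<And>i. i \<in> {1..n} \<Longrightarrow> f (\<tau> i) \<le> f' i"
proof -
  define C where "C c = {i\<in>{1..n}. h i = c}" for c
  \<comment> \<open>The rank of an entry within its column according to \<open>f'\<close>. The
    values of \<open>f'\<close> in a column are distinct, so the rank is at most
    \<open>f' a\<close>; the ranks are exactly the rows that the column occupies, so entries can be
    moved to them.\<close>
  define rk where "rk a = card {b\<in>C (h a). f' b < f' a}" for a
  have finC [simp]: "finite (C c)" for c by (simp add: C_def)
  have rkless: "rk a < card (C (h a))" if "a \<in> {1..n}" for a
    unfolding rk_def using that by (intro psubset_card_mono) (auto simp: C_def)
  have injC: "inj_on f' (C c)" for c
  proof (rule inj_onI)
    fix x y assume "x \<in> C c" "y \<in> C c" "f' x = f' y"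
    then show "x = y" using np[of x y] by (cases "x = y") (auto simp: C_def)
  qed
  have rkle: "rk a \<le> f' a" for a
  proof -
    have "card (f' ` {b\<in>C (h a). f' b < f' a}) \<le> card {..<f' a}" by (intro card_mono) auto
    moreover have "card (f' ` {b\<in>C (h a). f' b < f' a}) = rk a"
      unfolding rk_def by (rule card_image) (rule inj_on_subset[OF injC], auto)
    ultimately show ?thesis by simp
  qed
  have rkinj: "a = b" if "a \<in> {1..n}" "b \<in> {1..n}" "h a = h b" "rk a = rk b" for a b
  proof (rule ccontr)
    assume "a \<noteq> b"
    then have "f' a \<noteq> f' b" using np that by auto
    moreover have "rk x < rk y" if "x \<in> {1..n}" "y \<in> {1..n}" "h x = h y" "f' x < f' y" for x y
      unfolding rk_def using that by (intro psubset_card_mono) (auto simp: C_def)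
    ultimately show False using that by (metis linorder_neqE_nat less_irrefl)
  qed
  have "\<exists>b. b \<in> {1..n} \<and> f b = rk a \<and> h b = h a" if "a \<in> {1..n}" for a
  proof -
    have "rk a \<in> f ` {i\<in>{1..n}. h i = h a}"
      unfolding bij_betw_imp_surj_on[OF tab_column[OF t]] using rkless[OF that] by (simp only: C_def lessThan_iff)
    then obtain b where "b \<in> {i\<in>{1..n}. h i = h a}" "rk a = f b" by (rule imageE)
    then show ?thesis by auto
  qed
  then obtain \<tau>0 where \<tau>0: "\<And>a. a \<in> {1..n} \<Longrightarrow> \<tau>0 a \<in> {1..n} \<and> f (\<tau>0 a) = rk a \<and> h (\<tau>0 a) = h a"
    by metis
  define \<tau> where "\<tau> a = (if a \<in> {1..n} then \<tau>0 a else a)" for a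
  have "inj_on \<tau>0 {1..n}" using \<tau>0 rkinj by (metis inj_onI)
  then have "bij_betw \<tau>0 {1..n} {1..n}"
    using \<tau>0 by (simp add: bij_betw_def endo_inj_surj image_subset_iff)
  then have "bij_betw \<tau> {1..n} {1..n}" by (rule bij_betw_cong[THEN iffD1, rotated]) (simp add: \<tau>_def)
  then have "\<tau> permutes {1..n}" by (rule bij_imp_permutes) (simp only: \<tau>_def if_False)
  then have "\<tau> \<in> Stab n h" using \<tau>0 by (auto simp: Stab_def \<tau>_def)
  moreover have "f (\<tau> i) \<le> f' i" if "i \<in> {1..n}" for i using \<tau>0[OF that] rkle[of i] that by (simp add: \<tau>_def)
  ultimately show ?thesis by (rule that)
qed

text \<open>After column sorting no entry lies higher in the first tableau than in the second, so
  the first \<open>R\<close> rows of the second fit into the first \<open>R\<close> rows of the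
  first. For equal shapes both sets have the same size for every \<open>R\<close>, and the
  inequality of rows becomes an equality.\<close>

lemma tab_dominance:
  assumes t: "tab n lam f h" and t': "tab n lam' f' h'"
    and np: "\<And>i j. i \<in> {1..n} \<Longrightarrow> j \<in> {1..n} \<Longrightarrow> i \<noteq> j \<Longrightarrow> f' i = f' j \<Longrightarrow> h i \<noteq> h j"
  shows "(\<Sum>r<R. lam' r) \<le> (\<Sum>r<R. lam r)"
    and "lam' = lam \<Longrightarrow> \<exists>\<tau>\<in>Stab n h. \<forall>i\<in>{1..n}. f' i = f (\<tau> i)"
proof -
  obtain \<tau> where \<tau>: "\<tau> \<in> Stab n h" "\<And>i. i \<in> {1..n} \<Longrightarrow> f (\<tau> i) \<le> f' i"
    using column_sort[OF t np] by blast
  have sub: "{i\<in>{1..n}. f' i < R} \<subseteq> {i\<in>{1..n}. f (\<tau> i) < R}" for R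
    using \<tau>(2) by (auto intro: le_less_trans)
  have c: "card {i\<in>{1..n}. f (\<tau> i) < R} = (\<Sum>r<R. lam r)" for R
    using tab_rowcount[OF tab_conj[OF t StabD(1)[OF \<tau>(1)]]] by simp
  show "(\<Sum>r<R. lam' r) \<le> (\<Sum>r<R. lam r)"
    using card_mono[OF _ sub[of R]] unfolding c tab_rowcount[OF t'] by simp
  assume "lam' = lam"
  then have "{i\<in>{1..n}. f' i < R} = {i\<in>{1..n}. f (\<tau> i) < R}" for R
    using card_subset_eq[OF _ sub[of R]] unfolding c tab_rowcount[OF t'] by simp
  then have "f' i = f (\<tau> i)" if "i \<in> {1..n}" for i
    using that by (smt (verit) \<tau>(2) le_neq_implies_less less_irrefl mem_Collect_eq)
  then show "\<exists>\<tau>\<in>Stab n h. \<forall>i\<in>{1..n}. f' i = f (\<tau> i)" using \<tau>(1) by blast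
qed

text \<open>Either two entries share a row of the translated tableau and a column, and the product
  vanishes, or \<open>tab_dominance\<close> factors \<open>g\<close> into a column permutation after
  a row permutation, which the operators absorb up to a sign.\<close>

lemma colop_perm_rowop:
  assumes t: "tab n lam f h" and g: "g permutes {1..n}"
  shows "\<exists>c. \<forall>p. colop n h (perm_act g (rowop n f p)) = const c * colop n h (rowop n f p)"
proof (cases "\<exists>i\<in>{1..n}. \<exists>j\<in>{1..n}. i \<noteq> j \<and> f (pinv g i) = f (pinv g j) \<and> h i = h j")
  case True
  then obtain i j where ij: "i \<in> {1..n}" "j \<in> {1..n}" "i \<noteq> j" "(f \<circ> pinv g) i = (f \<circ> pinv g) j" "h i = h j" by auto
  have "colop n h (perm_act g (rowop n f p)) = const 0 * colop n h (rowop n f p)" for p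
    by (simp add: rowop_conj[OF g] rowop_colop_0(2)[OF ij])
  then show ?thesis by blast
next
  case False
  then have np: "\<And>i j. i \<in> {1..n} \<Longrightarrow> j \<in> {1..n} \<Longrightarrow> i \<noteq> j \<Longrightarrow> (f \<circ> pinv g) i = (f \<circ> pinv g) j \<Longrightarrow> h i \<noteq> h j"
    unfolding comp_def by metis
  have "tab n lam (f \<circ> pinv g) (h \<circ> pinv g)" by (rule tab_conj[OF t permutes_inv[OF g]])
  from tab_dominance(2)[OF t this np] obtain \<tau> where
    \<tau>: "\<tau> \<in> Stab n h" "\<forall>i\<in>{1..n}. (f \<circ> pinv g) i = f (\<tau> i)" by blast
  have \<tau>p: "\<tau> permutes {1..n}" "bij \<tau>" using \<tau>(1) by (auto intro: StabD)
  have "f ((\<tau> \<circ> g) i) = f i" for i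
  proof (cases "i \<in> {1..n}")
    case True
    then have "g i \<in> {1..n}" using permutes_in_image[OF g] by blast
    then have "(f \<circ> pinv g) (g i) = f (\<tau> (g i))" using \<tau>(2) by blast
    then show ?thesis by (simp add: permutes_inverses(2)[OF g])
  next
    case False
    then show ?thesis using permutes_not_in[OF g] permutes_not_in[OF \<tau>p(1)] by simp
  qed
  then have \<rho>: "\<tau> \<circ> g \<in> Stab n f" using \<tau>p g by (auto simp: Stab_def permutes_compose)
  have g': "g = pinv \<tau> \<circ> (\<tau> \<circ> g)" using \<tau>p by (simp add: fun_eq_iff permutes_inverses)
  have "colop n h (perm_act g (rowop n f p)) = const (of_int (sign (pinv \<tau>))) * colop n h (rowop n f p)" for p
  proof -
    have "perm_act g (rowop n f p) = perm_act (pinv \<tau>) (rowop n f p)"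
      by (subst g', subst perm_act_comp)
        (use \<tau>p \<rho> in \<open>simp_all add: bij_imp_bij_inv StabD rowop_perm\<close>)
    then show ?thesis by (simp add: colop_perm Stab_inv \<tau>)
  qed
  then show ?thesis by blast
qed

lemma galg_op_expand:
  "galg_op n F \<Longrightarrow> \<exists>y. \<forall>p. F p = (\<Sum>\<pi> | \<pi> permutes {1..n}. const (y \<pi>) * perm_act \<pi> p)"
  unfolding galg_op_def by (elim exE, intro exI allI) (simp only: gact_def)

text \<open>Linear extension of \<open>colop_perm_rowop\<close>. The scalar is chosen before
  \<open>p\<close>: this is the one-dimensionality that makes Young symmetrizers primitive.\<close>

lemma colop_galg_op_rowop:
  assumes t: "tab n lam f h" and F: "galg_op n F"
  shows "\<exists>c. \<forall>p. colop n h (F (rowop n f p)) = const c * young n f h p"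
proof -
  from galg_op_expand[OF F] obtain y where "\<forall>p. F p = (\<Sum>\<pi> | \<pi> permutes {1..n}. const (y \<pi>) * perm_act \<pi> p)" ..
  then have y: "\<And>p. F p = (\<Sum>\<pi> | \<pi> permutes {1..n}. const (y \<pi>) * perm_act \<pi> p)" by (rule spec)
  from colop_perm_rowop[OF t] obtain c where
    c: "\<And>g p. g permutes {1..n} \<Longrightarrow> colop n h (perm_act g (rowop n f p)) = const (c g) * young n f h p"
    unfolding young_def by metis
  have "colop n h (F (rowop n f p)) = const (\<Sum>\<pi> | \<pi> permutes {1..n}. y \<pi> * c \<pi>) * young n f h p" for p
    unfolding y qlin_sum[OF qlin_colop] qlin_scale[OF qlin_colop] const_sum sum_distrib_right
    by (rule sum.cong) (simp_all add: c mult.assoc)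
  then show ?thesis by blast
qed

text \<open>For different shapes dominance fails in one direction for some \<open>R\<close>.
  Depending on the direction, every product of the second row operator, a permutation and the first
  column operator vanishes, or every product of the second column operator, a permutation and the
  first row operator does.\<close>

lemma young_young_distinct:
  assumes t: "tab n lam f h" and t': "tab n lam' f' h'" and "lam \<noteq> lam'" and F: "galg_op n F"
  shows "young n f' h' (F (young n f h p)) = 0"
proof -
  have part: "lam = lam'" if "\<And>R. (\<Sum>r<R. lam r) = (\<Sum>r<R. lam' r)"
  proof
    fix r show "lam r = lam' r" using that[of "Suc r"] that[of r] by simp
  qed
  with \<open>lam \<noteq> lam'\<close> consider R where "\<not> (\<Sum>r<R. lam' r) \<le> (\<Sum>r<R. lam r)" | R where "\<not> (\<Sum>r<R. lam r) \<le> (\<Sum>r<R. lam' r)"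
    by (meson le_antisym)
  then show ?thesis
  proof cases
    case 1
    have z: "rowop n f' (perm_act g (colop n h q)) = 0" if g: "g permutes {1..n}" for g q
    proof -
      have "tab n lam (f \<circ> pinv g) (h \<circ> pinv g)" by (rule tab_conj[OF t permutes_inv[OF g]])
      from tab_dominance(1)[OF this t', of R] 1 obtain i j where
        "i \<in> {1..n}" "j \<in> {1..n}" "i \<noteq> j" "f' i = f' j" "(h \<circ> pinv g) i = (h \<circ> pinv g) j" by blast
      then show ?thesis by (simp only: colop_conj[OF g] rowop_colop_0(1))
    qed
    from galg_op_expand[OF F] obtain y where "\<forall>p. F p = (\<Sum>\<pi> | \<pi> permutes {1..n}. const (y \<pi>) * perm_act \<pi> p)" ..
    then have y: "\<And>p. F p = (\<Sum>\<pi> | \<pi> permutes {1..n}. const (y \<pi>) * perm_act \<pi> p)" by (rule spec)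
    have "rowop n f' (F (young n f h p)) = 0"
      unfolding y young_def qlin_sum[OF qlin_rowop] qlin_scale[OF qlin_rowop]
      by (rule sum.neutral) (simp add: z)
    then show ?thesis unfolding young_def[of n f' h'] by (simp add: qlin_0[OF qlin_colop])
  next
    case 2
    have z: "colop n h' (perm_act g (rowop n f q)) = 0" if g: "g permutes {1..n}" for g q
    proof -
      have "tab n lam (f \<circ> pinv g) (h \<circ> pinv g)" by (rule tab_conj[OF t permutes_inv[OF g]])
      from tab_dominance(1)[OF t' this, of R] 2 obtain i j where
        "i \<in> {1..n}" "j \<in> {1..n}" "i \<noteq> j" "(f \<circ> pinv g) i = (f \<circ> pinv g) j" "h' i = h' j" by blast
      then show ?thesis by (simp only: rowop_conj[OF g] rowop_colop_0(2))
    qed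
    have "galg_op n (\<lambda>q. rowop n f' (F (colop n h q)))"
      by (intro galg_op_comp[OF galg_op_rowop] galg_op_comp[OF F] galg_op_colop)
    from galg_op_expand[OF this] obtain y where
      "\<forall>q. rowop n f' (F (colop n h q)) = (\<Sum>\<pi> | \<pi> permutes {1..n}. const (y \<pi>) * perm_act \<pi> q)" ..
    then have y: "\<And>q. rowop n f' (F (colop n h q)) = (\<Sum>\<pi> | \<pi> permutes {1..n}. const (y \<pi>) * perm_act \<pi> q)"
      by (rule spec)
    show ?thesis
      unfolding young_def y qlin_sum[OF qlin_colop] qlin_scale[OF qlin_colop]
      by (rule sum.neutral) (simp add: z)
  qed
qed

text \<open>The coefficient at the monomial itself is 1: row and column group meet only in the
  identity, so only the pair of identities contributes.\<close>

lemma young_nonzero: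
  assumes "tab n lam f h" shows "young n f h (xm n id) \<noteq> 0"
proof
  assume z: "young n f h (xm n id) = 0"
  have st: "\<tau> \<circ> \<sigma> = id \<longleftrightarrow> \<tau> = id \<and> \<sigma> = id" if "\<tau> \<in> Stab n h" "\<sigma> \<in> Stab n f" for \<tau> \<sigma>
  proof
    assume e: "\<tau> \<circ> \<sigma> = id"
    have "\<sigma> i = i" for i
    proof (cases "i \<in> {1..n}")
      case True
      moreover have "\<sigma> i \<in> {1..n}" using True permutes_in_image[OF StabD(1)[OF that(2)]] by blast
      moreover have "h (\<sigma> i) = h i" using StabD(2)[OF that(1), of "\<sigma> i"] e by (metis comp_apply id_apply)
      ultimately show ?thesis using tab_inj[OF assms] StabD(2)[OF that(2), of i] by blast
    qed (use permutes_not_in[OF StabD(1)[OF that(2)]] in blast)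
    then have "\<sigma> = id" by auto
    then show "\<tau> = id \<and> \<sigma> = id" using e by simp
  qed simp
  have pid: "pinv \<rho> = id \<longleftrightarrow> \<rho> = id" if "\<rho> permutes {1..n}" for \<rho> :: "nat \<Rightarrow> nat"
    using permutes_inv_inv[OF that] by (metis inv_id)
  have e: "expo n id = expo n (pinv \<rho>) \<longleftrightarrow> \<rho> = id" if "\<rho> permutes {1..n}" for \<rho>
  proof -
    have "(\<forall>i\<in>{1..n}. id i = pinv \<rho> i) \<longleftrightarrow> pinv \<rho> = id"
      using permutes_not_in[OF permutes_inv[OF that]] by (metis ext id_apply)
    then show ?thesis by (simp only: expo_eq_iff pid[OF that])
  qed
  have "lookup (young n f h (xm n id)) (expo n id)
      = (\<Sum>\<tau>\<in>Stab n h. \<Sum>\<sigma>\<in>Stab n f. of_int (sign \<tau>) * lookup (perm_act (\<tau> \<circ> \<sigma>) (xm n id)) (expo n id))"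
    unfolding young_def colop_def rowop_def
    by (simp add: qlin_sum[OF qlin_perm_act] StabD lookup_sum sum_distrib_left perm_act_comp)
  also have "\<dots> = (\<Sum>\<tau>\<in>Stab n h. \<Sum>\<sigma>\<in>Stab n f. if \<tau> = id then if \<sigma> = id then 1 else 0 else 0)"
    by (intro sum.cong refl)
      (simp add: perm_act_xm[OF permutes_compose[OF StabD(1) StabD(1)]] lookup_xm
        e[OF permutes_compose[OF StabD(1) StabD(1)]] st)
  also have "\<dots> = (\<Sum>\<tau>\<in>Stab n h. if \<tau> = id then 1 else 0)"
    by (rule sum.cong) (simp_all add: sum.delta'[of "Stab n f" id "\<lambda>_. 1"])
  also have "\<dots> = 1" by (simp add: sum.delta'[of "Stab n h" id "\<lambda>_. 1"])
  finally show False using z by simp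
qed

text \<open>If the scalar were 0, the self-adjoint operator row, column, row would square to 0. By
  positivity it would vanish, and then so would the symmetrizer.\<close>

lemma young_idem:
  assumes t: "tab n lam f h"
  obtains c where "c \<noteq> 0" "\<And>p. young n f h (young n f h p) = const c * young n f h p"
proof -
  have "galg_op n (\<lambda>p. rowop n f (colop n h p))" by (rule galg_op_comp[OF galg_op_rowop galg_op_colop])
  from colop_galg_op_rowop[OF t this] obtain c where c: "\<And>p. young n f h (young n f h p) = const c * young n f h p"
    unfolding young_def by blast
  have "c \<noteq> 0"
  proof
    assume "c = 0"
    then have z: "young n f h (young n f h p) = 0" for p using c by simp
    let ?X = "\<lambda>p. rowop n f (colop n h (rowop n f p))"
    have "?X (?X p) = 0" for p
      using z[of p] unfolding young_def
      by (simp add: rowop_rowop qlin_scale[OF qlin_colop] qlin_scale[OF qlin_rowop] qlin_0[OF qlin_rowop])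
    then have "ip (?X p) (?X p) = 0" for p
      using ip_rowop[of n f _ "?X p"] ip_colop[of n h _ ] by (simp add: ip_rowop ip_colop)
    then have "?X p = 0" for p by (rule ip_self_eq_0)
    then have "young n f h (xm n id) = 0" unfolding young_def by (rule rowop_colop_rowop_0)
    then show False using young_nonzero[OF t] by simp
  qed
  then show ?thesis using c that by blast
qed

text \<open>Minimality of the left ideal. If every column operator after a translate killed the
  image under \<open>F\<close>, then \<open>F (young n f h p0)\<close> would be orthogonal to all
  translates of \<open>young n f h p0\<close>, of which it is a combination, hence to itself. So
  some such composite is a nonzero multiple of the symmetrizer and can be rescaled.\<close>

lemma young_irreducible:
  assumes t: "tab n lam f h" and F: "galg_op n F" and nz: "F (young n f h p0) \<noteq> 0"
  obtains G where "galg_op n G" "\<And>p. G (F (young n f h p)) = young n f h p"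
proof -
  from galg_op_expand[OF F] obtain y where "\<forall>p. F p = (\<Sum>\<pi> | \<pi> permutes {1..n}. const (y \<pi>) * perm_act \<pi> p)" ..
  then have y: "\<And>p. F p = (\<Sum>\<pi> | \<pi> permutes {1..n}. const (y \<pi>) * perm_act \<pi> p)" by (rule spec)
  have "\<exists>g p. g permutes {1..n} \<and> colop n h (perm_act g (F (young n f h p))) \<noteq> 0"
  proof (rule ccontr)
    assume "\<nexists>g p. g permutes {1..n} \<and> colop n h (perm_act g (F (young n f h p))) \<noteq> 0"
    then have z: "colop n h (perm_act g (F (young n f h p))) = 0" if "g permutes {1..n}" for g p using that by blast
    let ?u = "F (young n f h p0)"
    have o: "ip ?u (perm_act g (young n f h p0)) = 0" if g: "g permutes {1..n}" for g
    proof -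
      have "ip ?u (perm_act g (young n f h p0)) = ip (perm_act g (young n f h p0)) ?u" by (rule ip_commute)
      also have "\<dots> = ip (colop n h (rowop n f p0)) (perm_act (pinv g) ?u)"
        unfolding ip_perm_act[OF permutes_bij[OF g]] young_def ..
      also have "\<dots> = 0" unfolding ip_colop z[OF permutes_inv[OF g]] by simp
      finally show ?thesis .
    qed
    have "ip ?u ?u = (\<Sum>\<pi> | \<pi> permutes {1..n}. ip ?u (const (y \<pi>) * perm_act \<pi> (young n f h p0)))"
      by (subst (2) y) (rule ip_sum_right)
    also have "\<dots> = 0" by (rule sum.neutral) (simp add: ip_scale_right o)
    finally show False using nz ip_self_eq_0 by blast
  qed
  then obtain g p1 where g: "g permutes {1..n}" and nz1: "colop n h (perm_act g (F (young n f h p1))) \<noteq> 0" by blast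
  have "galg_op n (\<lambda>p. perm_act g (F (colop n h p)))"
    by (intro galg_op_comp[OF galg_op_perm[OF g]] galg_op_comp[OF F] galg_op_colop)
  from colop_galg_op_rowop[OF t this] obtain c where
    c: "\<And>p. colop n h (perm_act g (F (young n f h p))) = const c * young n f h p" unfolding young_def by blast
  have c0: "c \<noteq> 0" using nz1 c by auto
  show ?thesis
  proof (rule that)
    show "galg_op n (\<lambda>p. const (inverse c) * colop n h (perm_act g p))"
      by (rule galg_op_scale, rule galg_op_comp[OF galg_op_colop galg_op_perm[OF g]])
    show "const (inverse c) * colop n h (perm_act g (F (young n f h p))) = young n f h p" for p
      unfolding c mult.assoc[symmetric] const_arith(2)[symmetric] using c0 by simp
  qed
qed

section \<open>Standard tableaux\<close>

definition rw :: "nat list list \<Rightarrow> nat \<Rightarrow> nat" where "rw T i = fst (box_of T i)"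
definition cl :: "nat list list \<Rightarrow> nat \<Rightarrow> nat" where "cl T i = snd (box_of T i)"
definition lens :: "nat list list \<Rightarrow> nat \<Rightarrow> nat" where "lens T r = (if r < length T then length (T ! r) else 0)"

lemma boxes_Sigma: "boxes T = (SIGMA r:{..<length T}. {..<length (T ! r)})"
  by (auto simp: boxes_def)

lemma SYT_entry_bij:
  assumes "T \<in> SYT n" shows "bij_betw (entry T) (boxes T) {1..n}"
proof -
  have im: "entry T ` boxes T = set (concat T)"
    by (fastforce simp: boxes_def entry_def in_set_conv_nth image_iff)
  have "card (boxes T) = (\<Sum>r<length T. length (T ! r))"
    unfolding boxes_Sigma by (subst card_SigmaI) auto
  also have "\<dots> = length (concat T)"
    by (simp add: length_concat sum_list_sum_nth atLeast0LessThan)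
  also have "\<dots> = card (set (concat T))"
    using assms by (intro distinct_card[symmetric]) (simp add: SYT_def)
  finally have "inj_on (entry T) (boxes T)"
    using im by (intro eq_card_imp_inj_on) (auto simp: boxes_Sigma)
  then show ?thesis using im assms by (simp add: bij_betw_def SYT_def)
qed

lemma SYT_box:
  assumes "T \<in> SYT n" "i \<in> {1..n}"
  shows "box_of T i \<in> boxes T" "entry T (box_of T i) = i"
proof -
  have "i \<in> entry T ` boxes T"
    unfolding bij_betw_imp_surj_on[OF SYT_entry_bij[OF assms(1)]] by (rule assms(2))
  then obtain b where "b \<in> boxes T" "i = entry T b" by (rule imageE)
  then have "\<exists>!b. b \<in> boxes T \<and> entry T b = i"
    using inj_onD[OF bij_betw_imp_inj_on[OF SYT_entry_bij[OF assms(1)]]] by (intro ex1I[of _ b]) auto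
  from theI'[OF this] show "box_of T i \<in> boxes T" "entry T (box_of T i) = i"
    unfolding box_of_def by auto
qed

lemma SYT_box_of_entry:
  assumes "T \<in> SYT n" "b \<in> boxes T"
  shows "entry T b \<in> {1..n}" "box_of T (entry T b) = b"
proof -
  show e: "entry T b \<in> {1..n}" using bij_betwE[OF SYT_entry_bij[OF assms(1)]] assms(2) by blast
  show "box_of T (entry T b) = b"
    using SYT_box[OF assms(1) e] bij_betw_imp_inj_on[OF SYT_entry_bij[OF assms(1)]] assms(2)
    by (auto dest: inj_onD)
qed

lemma SYT_rwcl:
  assumes "T \<in> SYT n" "i \<in> {1..n}"
  shows "rw T i < length T" "cl T i < length (T ! rw T i)" "T ! rw T i ! cl T i = i"
  using SYT_box[OF assms] by (auto simp: rw_def cl_def boxes_def entry_def)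

lemma SYT_nth:
  assumes "T \<in> SYT n" "r < length T" "c < length (T ! r)"
  shows "T ! r ! c \<in> {1..n}" "rw T (T ! r ! c) = r" "cl T (T ! r ! c) = c"
  using SYT_box_of_entry[OF assms(1), of "(r, c)"] assms(2,3)
  by (auto simp: rw_def cl_def boxes_def entry_def)

lemma antimono_lens: assumes "T \<in> SYT n" shows "antimono (lens T)"
proof (rule antimonoI)
  fix r r' :: nat assume "r \<le> r'"
  moreover have "sorted_wrt (\<ge>) (map length T)" using assms by (simp add: SYT_def is_partition_def shape_def)
  ultimately show "lens T r' \<le> lens T r"
    using sorted_wrt_nth_less[of "(\<ge>)" "map length T" r r'] by (cases "r = r'") (auto simp: lens_def)
qed

lemma SYT_tab: assumes "T \<in> SYT n" shows "tab n (lens T) (rw T) (cl T)"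
proof -
  have "bij_betw (\<lambda>i. (rw T i, cl T i)) {1..n} (boxes T)"
    by (rule bij_betw_byWitness[where f' = "entry T"])
      (use SYT_box[OF assms] SYT_box_of_entry[OF assms] in \<open>auto simp: rw_def cl_def\<close>)
  moreover have "boxes T = {(r, c). c < lens T r}" by (auto simp: boxes_def lens_def split: if_splits)
  ultimately show ?thesis using antimono_lens[OF assms] by (simp add: tab_def)
qed

lemma SYT_row_less:
  assumes T: "T \<in> SYT n" and i: "i \<in> {1..n}" and j: "j \<in> {1..n}" and e: "rw T i = rw T j"
  shows "cl T i < cl T j \<longleftrightarrow> i < j"
proof -
  have *: "i < j" if "i \<in> {1..n}" "j \<in> {1..n}" "rw T i = rw T j" "cl T i < cl T j" for i j
  proof -
    have "T ! rw T j \<in> set T" using SYT_rwcl[OF T that(2)] by simp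
    then have "sorted_wrt (<) (T ! rw T j)" using T by (simp add: SYT_def)
    from sorted_wrt_nth_less[OF this that(4)] show ?thesis
      using SYT_rwcl[OF T that(1)] SYT_rwcl[OF T that(2)] that(3) by simp
  qed
  show ?thesis
    using *[OF i j e] *[OF j i e[symmetric]] tab_inj[OF SYT_tab[OF T] i j e]
    by (metis less_asym linorder_neqE_nat less_irrefl)
qed

lemma SYT_col_nth:
  assumes T: "T \<in> SYT n"
  shows "r < r' \<Longrightarrow> r' < length T \<Longrightarrow> c < length (T ! r') \<Longrightarrow> T ! r ! c < T ! r' ! c"
proof (induction r')
  case (Suc r')
  have c: "c < length (T ! r')"
    using antimonoD[OF antimono_lens[OF T], of r' "Suc r'"] Suc.prems by (simp add: lens_def)
  have "T ! r' ! c < T ! Suc r' ! c" using T Suc.prems by (simp add: SYT_def)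
  then show ?case using Suc c by (cases "r = r'") auto
qed simp

lemma SYT_col_less:
  assumes T: "T \<in> SYT n" and i: "i \<in> {1..n}" and j: "j \<in> {1..n}" and e: "cl T i = cl T j"
  shows "rw T i < rw T j \<longleftrightarrow> i < j"
proof -
  have *: "i < j" if "i \<in> {1..n}" "j \<in> {1..n}" "cl T i = cl T j" "rw T i < rw T j" for i j
    using SYT_col_nth[OF T that(4) SYT_rwcl(1,2)[OF T that(2)]] SYT_rwcl(3)[OF T that(1)] SYT_rwcl(3)[OF T that(2)] that(3)
    by simp
  show ?thesis
    using *[OF i j e] *[OF j i e[symmetric]] tab_inj[OF SYT_tab[OF T] i j _ e]
    by (metis less_asym linorder_neqE_nat less_irrefl)
qed

lemma SYT_row_set:
  assumes "T \<in> SYT n" "r < length T" shows "set (T ! r) = {i\<in>{1..n}. rw T i = r}"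
proof (intro equalityI subsetI)
  fix x assume "x \<in> set (T ! r)"
  then show "x \<in> {i\<in>{1..n}. rw T i = r}" using SYT_nth[OF assms] by (auto simp: in_set_conv_nth)
next
  fix x assume "x \<in> {i\<in>{1..n}. rw T i = r}"
  then show "x \<in> set (T ! r)" using SYT_rwcl[OF assms(1), of x] by (metis (mono_tags, lifting) mem_Collect_eq nth_mem)
qed

lemma SYT_column_set:
  assumes "T \<in> SYT n" shows "column T c = {i\<in>{1..n}. cl T i = c}"
proof (intro equalityI subsetI)
  fix x assume "x \<in> column T c"
  then show "x \<in> {i\<in>{1..n}. cl T i = c}" using SYT_nth[OF assms] by (auto simp: column_def boxes_def)
next
  fix x assume "x \<in> {i\<in>{1..n}. cl T i = c}"
  then show "x \<in> column T c" using SYT_rwcl[OF assms(1), of x] by (force simp: column_def boxes_def)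
qed

lemma Stab_image:
  assumes "\<pi> permutes {1..n}"
  shows "\<pi> \<in> Stab n f \<longleftrightarrow> (\<forall>c. \<pi> ` {i\<in>{1..n}. f i = c} = {i\<in>{1..n}. f i = c})"
proof
  assume s: "\<pi> \<in> Stab n f"
  have "\<pi> ` {i\<in>{1..n}. f i = c} \<subseteq> {i\<in>{1..n}. f i = c}" for c
    using permutes_in_image[OF assms] StabD(2)[OF s] by auto
  then show "\<forall>c. \<pi> ` {i\<in>{1..n}. f i = c} = {i\<in>{1..n}. f i = c}"
    by (intro allI endo_inj_surj permutes_inj_on[OF assms]) auto
next
  assume *: "\<forall>c. \<pi> ` {i\<in>{1..n}. f i = c} = {i\<in>{1..n}. f i = c}"
  have "f (\<pi> i) = f i" for i
  proof (cases "i \<in> {1..n}")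
    case True
    then have "\<pi> i \<in> \<pi> ` {j\<in>{1..n}. f j = f i}" by blast
    then show ?thesis using * by blast
  qed (simp add: permutes_not_in[OF assms])
  then show "\<pi> \<in> Stab n f" using assms by (simp add: Stab_def)
qed

lemma row_group_Stab: assumes "T \<in> SYT n" shows "row_group n T = Stab n (rw T)"
proof -
  have "(\<forall>r<length T. \<pi> ` set (T ! r) = set (T ! r)) \<longleftrightarrow> \<pi> \<in> Stab n (rw T)" if p: "\<pi> permutes {1..n}" for \<pi>
  proof -
    define E where "E r = {i\<in>{1..n}. rw T i = r}" for r
    have "E r = {}" if "\<not> r < length T" for r
      using SYT_rwcl(1)[OF assms] that by (auto simp: E_def)
    then have "(\<forall>r<length T. \<pi> ` E r = E r) \<longleftrightarrow> (\<forall>r. \<pi> ` E r = E r)" by (metis image_empty)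
    moreover have "set (T ! r) = E r" if "r < length T" for r
      using SYT_row_set[OF assms that] by (simp only: E_def)
    ultimately show ?thesis unfolding Stab_image[OF p] E_def[symmetric] by simp
  qed
  then show ?thesis unfolding row_group_def set_eq_iff mem_Collect_eq using StabD(1)[of _ n "rw T"] by blast
qed

lemma column_group_Stab:
  assumes "T \<in> SYT n" shows "column_group n T = Stab n (cl T)"
  unfolding column_group_def SYT_column_set[OF assms]
  unfolding set_eq_iff mem_Collect_eq using Stab_image[of _ n "cl T"] StabD(1)[of _ n "cl T"] by blast

lemma gact_young_idempotent:
  assumes "T \<in> SYT n" shows "gact n (young_idempotent n T) p = young n (rw T) (cl T) p"
proof -
  let ?P = "{\<pi>. \<pi> permutes {1..n}}" and ?C = "Stab n (cl T)" and ?R = "Stab n (rw T)"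
  have if_const: "const (if b then a else 0) * x = (if b then const a * x else 0)" for b a x by simp
  have "gact n (young_idempotent n T) p
     = (\<Sum>\<pi>\<in>?P. \<Sum>\<tau>\<in>?C. \<Sum>\<sigma>\<in>?R. if \<tau> \<circ> \<sigma> = \<pi> then const (of_int (sign \<tau>)) * perm_act \<pi> p else 0)"
    unfolding gact_def young_idempotent_def row_group_Stab[OF assms] column_group_Stab[OF assms] const_sum
      sum_distrib_right if_const ..
  also have "\<dots> = (\<Sum>\<tau>\<in>?C. \<Sum>\<sigma>\<in>?R. \<Sum>\<pi>\<in>?P. if \<tau> \<circ> \<sigma> = \<pi> then const (of_int (sign \<tau>)) * perm_act \<pi> p else 0)"
    by (subst sum.swap, rule sum.cong[OF refl], rule sum.swap)
  also have "\<dots> = (\<Sum>\<tau>\<in>?C. \<Sum>\<sigma>\<in>?R. const (of_int (sign \<tau>)) * perm_act \<tau> (perm_act \<sigma> p))"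
    by (intro sum.cong refl) (simp add: permutes_compose[OF StabD(1) StabD(1)] perm_act_comp StabD(3))
  also have "\<dots> = young n (rw T) (cl T) p"
    unfolding young_def rowop_def colop_def
    by (intro sum.cong refl) (simp add: sum_distrib_left qlin_sum[OF qlin_perm_act] StabD(3))
  finally show ?thesis .
qed

section \<open>Cocharge labels\<close>

lemma descents_rw:
  assumes "S \<in> SYT n"
  shows "a \<in> descents S \<longleftrightarrow> a \<in> {1..n} \<and> Suc a \<in> {1..n} \<and> rw S a < rw S (Suc a)"
proof
  assume "a \<in> descents S"
  then obtain r r' where "r < r'" "r' < length S" "a \<in> set (S ! r)" "Suc a \<in> set (S ! r')"
    by (auto simp: descents_def)
  then show "a \<in> {1..n} \<and> Suc a \<in> {1..n} \<and> rw S a < rw S (Suc a)"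
    using SYT_row_set[OF assms, of r] SYT_row_set[OF assms, of r'] by auto
next
  assume a: "a \<in> {1..n} \<and> Suc a \<in> {1..n} \<and> rw S a < rw S (Suc a)"
  then have "a \<in> set (S ! rw S a)" "Suc a \<in> set (S ! rw S (Suc a))" "rw S (Suc a) < length S"
    using SYT_rwcl[OF assms] by (metis nth_mem)+
  then show "a \<in> descents S" using a by (auto simp: descents_def)
qed

lemma before_append: "a \<in> set u \<Longrightarrow> b \<in> set v \<Longrightarrow> before (u @ v) a b"
proof -
  assume "a \<in> set u" "b \<in> set v"
  then obtain p q where "p < length u" "u ! p = a" "q < length v" "v ! q = b" by (auto simp: in_set_conv_nth)
  then show ?thesis unfolding before_def
    by (intro exI[of _ p] exI[of _ "length u + q"]) (simp add: nth_append)
qed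

lemma before_mid: "before u a b \<Longrightarrow> before (x @ u @ y) a b"
proof -
  assume "before u a b"
  then obtain p q where "p < q" "q < length u" "u ! p = a" "u ! q = b" by (auto simp: before_def)
  then show ?thesis unfolding before_def
    by (intro exI[of _ "length x + p"] exI[of _ "length x + q"]) (simp add: nth_append)
qed

lemma before_asym: "distinct w \<Longrightarrow> before w a b \<Longrightarrow> \<not> before w b a"
proof
  assume w: "distinct w" and "before w a b" "before w b a"
  then obtain p q p' q' where "p < q" "q < length w" "w ! p = a" "w ! q = b" "p' < q'" "q' < length w" "w ! p' = b" "w ! q' = a"
    by (auto simp: before_def)
  moreover have "q = p'" "p = q'" using w calculation by (metis nth_eq_iff_index_eq less_trans)+
  ultimately show False by simp
qed

lemma reading_word_before:
  assumes "r' < r" "r < length S" "a \<in> set (S ! r)" "b \<in> set (S ! r')"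
  shows "before (reading_word S) a b"
proof -
  have S: "S = take r S @ drop r S" by simp
  have "S ! r \<in> set (drop r S)" using assms(2) by (metis Cons_nth_drop_Suc list.set_intros(1))
  then have a: "a \<in> set (concat (rev (drop r S)))" using assms(3) by auto
  have "S ! r' \<in> set (take r S)" using assms(1,2) by (auto simp: in_set_conv_nth intro!: exI[of _ r'])
  then have b: "b \<in> set (concat (rev (take r S)))" using assms(4) by auto
  have "reading_word S = concat (rev (drop r S)) @ concat (rev (take r S))"
    unfolding reading_word_def by (subst S, subst rev_append) simp
  then show ?thesis using before_append[OF a b] by simp
qed

lemma reading_word_before_row:
  assumes "r < length S" "c < c'" "c' < length (S ! r)"
  shows "before (reading_word S) (S ! r ! c) (S ! r ! c')"
proof -
  have "before (S ! r) (S ! r ! c) (S ! r ! c')" using assms by (auto simp: before_def)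
  then have "before (concat (rev (drop (Suc r) S)) @ S ! r @ concat (rev (take r S))) (S ! r ! c) (S ! r ! c')"
    by (rule before_mid)
  also have "concat (rev (drop (Suc r) S)) @ S ! r @ concat (rev (take r S)) = reading_word S"
    unfolding reading_word_def by (subst (4) id_take_nth_drop[OF assms(1)]) simp
  finally show ?thesis .
qed

definition lab :: "nat list list \<Rightarrow> nat \<Rightarrow> nat" where "lab S = cocharge_label (reading_word S)"

lemma lab_1 [simp]: "lab S 1 = 0" by (simp add: lab_def One_nat_def)

lemma lab_Suc:
  assumes S: "S \<in> SYT n" and a: "1 \<le> a" "a < n"
  shows "lab S (Suc a) = lab S a + (if a \<in> descents S then 1 else 0)"
proof -
  have i: "a \<in> {1..n}" "Suc a \<in> {1..n}" using a by auto
  note B = SYT_rwcl[OF S i(1)] SYT_rwcl[OF S i(2)]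
  have w: "distinct (reading_word S)"
  proof -
    have "mset (reading_word S) = mset (concat S)" by (simp add: reading_word_def mset_concat rev_map[symmetric] sum_list_rev)
    then show ?thesis using mset_eq_imp_distinct_iff S unfolding SYT_def by blast
  qed
  have "before (reading_word S) a (Suc a) \<longleftrightarrow> a \<notin> descents S"
  proof (cases "rw S a < rw S (Suc a)")
    case True
    then have "before (reading_word S) (Suc a) a"
      using reading_word_before[OF True B(4)] B by (metis nth_mem)
    then show ?thesis using before_asym[OF w] True i descents_rw[OF S] by blast
  next
    case False
    have "before (reading_word S) a (Suc a)"
    proof (cases "rw S a = rw S (Suc a)")
      case True
      then have "cl S a < cl S (Suc a)" using SYT_row_less[OF S i] by simp
      from reading_word_before_row[OF B(1) this] show ?thesis using B True by simp
    next
      case neq: False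
      then have "rw S (Suc a) < rw S a" using False by simp
      from reading_word_before[OF this B(1)] show ?thesis using B by (metis nth_mem)
    qed
    then show ?thesis using False descents_rw[OF S] by blast
  qed
  then show ?thesis using a by (simp add: lab_def)
qed

lemma lab_mono:
  assumes S: "S \<in> SYT n" and "1 \<le> a" "a \<le> b" "b \<le> n" shows "lab S a \<le> lab S b"
  using assms(3,4)
proof (induction b rule: dec_induct)
  case (step m) then show ?case using lab_Suc[OF S, of m] assms(2) by simp
qed simp

text \<open>\<open>Suc a\<close> is not higher than \<open>a\<close>. If it were in a lower row and
  not to the right, the box in its row below \<open>a\<close> would hold an entry less than
  \<open>a\<close> and at least \<open>Suc a\<close>.\<close>

lemma non_descent_cl:
  assumes S: "S \<in> SYT n" and a: "1 \<le> a" "a < n" and d: "a \<notin> descents S"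
  shows "cl S a < cl S (Suc a)"
proof -
  have i: "a \<in> {1..n}" "Suc a \<in> {1..n}" using a by auto
  note B = SYT_rwcl[OF S i(1)] SYT_rwcl[OF S i(2)]
  have le: "rw S (Suc a) \<le> rw S a" using d i descents_rw[OF S] by (metis not_le)
  show ?thesis
  proof (cases "rw S (Suc a) = rw S a")
    case True
    then show ?thesis using SYT_row_less[OF S i] by simp
  next
    case False
    then have lt: "rw S (Suc a) < rw S a" using le by simp
    show ?thesis
    proof (rule ccontr)
      assume "\<not> cl S a < cl S (Suc a)"
      then have c: "cl S (Suc a) \<le> cl S a" by simp
      let ?x = "S ! rw S (Suc a) ! cl S a"
      have "lens S (rw S a) \<le> lens S (rw S (Suc a))" using antimono_lens[OF S] lt by (auto simp: antimono_def)
      then have len: "cl S a < length (S ! rw S (Suc a))" using B by (simp add: lens_def)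
      note x = SYT_nth[OF S B(4) len]
      have "?x < a" using SYT_col_less[OF S x(1) i(1)] x lt by simp
      moreover have "Suc a \<le> ?x" using SYT_row_less[OF S x(1) i(2)] x c by (metis not_le)
      ultimately show False by simp
    qed
  qed
qed

text \<open>Between equal labels there are no descents, so every step moves right: the entries with
  one label form a horizontal strip, numbered from left to right.\<close>

lemma lab_eq_cl:
  assumes S: "S \<in> SYT n" and "1 \<le> a" "a < b" "b \<le> n" "lab S a = lab S b" shows "cl S a < cl S b"
  using assms(3-)
proof (induction b)
  case (Suc b)
  have m: "lab S a \<le> lab S b" "lab S b \<le> lab S (Suc b)" using lab_mono[OF S, of a b] lab_mono[OF S, of b "Suc b"] assms(2) Suc.prems by auto
  then have e: "lab S a = lab S b" "lab S b = lab S (Suc b)" using Suc.prems by auto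
  have b: "1 \<le> b" "b < n" using Suc.prems assms(2) by auto
  from lab_Suc[OF S this] e have "b \<notin> descents S" by (simp split: if_splits)
  with non_descent_cl[OF S b] have "cl S b < cl S (Suc b)" .
  moreover have "cl S a < cl S b" if "a \<noteq> b" using Suc.IH Suc.prems e that by simp
  ultimately show ?case by (cases "a = b") auto
qed simp

lemma lab_column:
  assumes S: "S \<in> SYT n" and i: "i \<in> {1..n}" "j \<in> {1..n}" and c: "cl S i = cl S j" "rw S i < rw S j"
  shows "lab S i < lab S j"
proof -
  have "i < j" using SYT_col_less[OF S i c(1)] c(2) by simp
  then show ?thesis using lab_mono[OF S, of i j] lab_eq_cl[OF S, of i j] i c(1) by (cases "lab S i = lab S j") auto
qed

text \<open>Filling the box of entry \<open>a\<close> with \<open>\<nu> a\<close> gives a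
  semistandard tableau whose standardization is \<open>S\<close>; the compatible \<open>S\<close>
  correspond to the semistandard tableaux of content \<nu>.\<close>

definition compat :: "nat \<Rightarrow> (nat \<Rightarrow> nat) \<Rightarrow> nat list list \<Rightarrow> bool" where
  "compat n \<nu> S \<longleftrightarrow> (\<forall>a b. 1 \<le> a \<longrightarrow> a \<le> b \<longrightarrow> b \<le> n \<longrightarrow> \<nu> a \<le> \<nu> b) \<and>
     (\<forall>a. 1 \<le> a \<longrightarrow> a < n \<longrightarrow> \<nu> a = \<nu> (Suc a) \<longrightarrow> a \<notin> descents S)"

lemma compat_mono: "compat n \<nu> S \<Longrightarrow> 1 \<le> a \<Longrightarrow> a \<le> b \<Longrightarrow> b \<le> n \<Longrightarrow> \<nu> a \<le> \<nu> b"
  by (simp add: compat_def)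

lemma compat_lab_le:
  assumes S: "S \<in> SYT n" and c: "compat n \<nu> S" and "1 \<le> a" "a \<le> b" "b \<le> n" "\<nu> a = \<nu> b"
  shows "lab S a = lab S b"
  using assms(4-)
proof (induction b)
  case (Suc b)
  show ?case
  proof (cases "a = Suc b")
    case False
    then have m: "\<nu> a \<le> \<nu> b" "\<nu> b \<le> \<nu> (Suc b)"
      using compat_mono[OF c, of a b] compat_mono[OF c, of b "Suc b"] assms(3) Suc.prems by auto
    then have "\<nu> b = \<nu> (Suc b)" "\<nu> a = \<nu> b" using Suc.prems by auto
    moreover have "b \<notin> descents S" using c assms(3) Suc.prems False \<open>\<nu> b = \<nu> (Suc b)\<close> unfolding compat_def by auto
    ultimately show ?thesis using Suc False lab_Suc[OF S, of b] assms(3) by auto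
  qed simp
qed simp

lemma compat_lab:
  assumes S: "S \<in> SYT n" and c: "compat n \<nu> S" and "a \<in> {1..n}" "b \<in> {1..n}" "\<nu> a = \<nu> b"
  shows "lab S a = lab S b"
proof (cases "a \<le> b")
  case True
  then show ?thesis using compat_lab_le[OF S c _ True] assms(3-) by simp
next
  case False
  then show ?thesis using compat_lab_le[OF S c, of b a] assms(3-) by simp
qed

lemma compat_strict:
  assumes S: "S \<in> SYT n" and c: "compat n \<nu> S" and i: "a \<in> {1..n}" "b \<in> {1..n}" and l: "lab S a < lab S b"
  shows "\<nu> a < \<nu> b"
proof -
  have "a < b" using lab_mono[OF S, of b a] l i by (metis atLeastAtMost_iff not_le)
  then have "\<nu> a \<le> \<nu> b" using compat_mono[OF c] i by auto
  moreover have "\<nu> a \<noteq> \<nu> b" using compat_lab[OF S c i] l by auto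
  ultimately show ?thesis by simp
qed

section \<open>Comparing fillings\<close>

definition tperm :: "nat \<Rightarrow> nat list list \<Rightarrow> nat list list \<Rightarrow> nat \<Rightarrow> nat" where
  "tperm n S T i = (if i \<in> {1..n} then entry S (box_of T i) else i)"

lemma boxes_shape: "shape S = shape T \<Longrightarrow> boxes S = boxes T"
  unfolding boxes_def shape_def by (metis (no_types, lifting) length_map nth_map)

lemma tperm_spec:
  assumes "S \<in> SYT n" "T \<in> SYT n" "shape S = shape T" "i \<in> {1..n}"
  shows "tperm n S T i \<in> {1..n}" "rw S (tperm n S T i) = rw T i" "cl S (tperm n S T i) = cl T i"
  using SYT_box_of_entry[OF assms(1), of "box_of T i"] SYT_box[OF assms(2,4)] boxes_shape[OF assms(3)] assms(4)
  by (auto simp: tperm_def rw_def cl_def)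

lemma tperm_permutes:
  assumes "S \<in> SYT n" "T \<in> SYT n" "shape S = shape T"
  shows "tperm n S T permutes {1..n}"
proof (rule bij_imp_permutes)
  have inj: "inj_on (tperm n S T) {1..n}"
    using tperm_spec[OF assms] tab_inj[OF SYT_tab[OF assms(2)]] by (metis inj_onI)
  then show "bij_betw (tperm n S T) {1..n} {1..n}"
    using tperm_spec(1)[OF assms] by (simp add: bij_betw_def endo_inj_surj image_subset_iff)
qed (simp only: tperm_def if_False)

lemma higher_specht_young:
  assumes "S \<in> SYT n" "T \<in> SYT n" "shape S = shape T"
  shows "higher_specht n S T = young n (rw T) (cl T) (xm n (\<lambda>i. lab S (tperm n S T i)))"
proof -
  have "cw_monomial n S T = xm n (\<lambda>i. lab S (tperm n S T i))"
    unfolding cw_monomial_def xm_prod by (rule prod.cong) (auto simp: lab_def tperm_def)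
  then show ?thesis by (simp add: higher_specht_def gact_young_idempotent assms(2))
qed

lemma SYT_eqI:
  assumes S: "S \<in> SYT n" and T: "T \<in> SYT n" and sh: "shape S = shape T" and e: "\<And>i. i \<in> {1..n} \<Longrightarrow> rw S i = rw T i"
  shows "S = T"
proof (rule nth_equalityI)
  show l: "length S = length T" using sh by (metis length_map shape_def)
  fix r assume r: "r < length S"
  have "set (S ! r) = set (T ! r)"
    unfolding SYT_row_set[OF S r] SYT_row_set[OF T r[unfolded l]] using e by auto
  moreover have "sorted_wrt (<) (S ! r)" "sorted_wrt (<) (T ! r)" using S T r l by (auto simp: SYT_def)
  ultimately show "S ! r = T ! r" by (metis strict_sorted_equal)
qed

lemma SYT_eqI_rw:
  assumes S: "S \<in> SYT n" and T: "T \<in> SYT n" and e: "\<And>i. i \<in> {1..n} \<Longrightarrow> rw S i = rw T i"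
  shows "S = T"
proof (rule SYT_eqI[OF S T _ e])
  have ne: "r < length U \<longleftrightarrow> (\<exists>i\<in>{1..n}. rw U i = r)" if U: "U \<in> SYT n" for U r
  proof
    assume r: "r < length U"
    then have "length (U ! r) \<in> set (shape U)" by (simp add: shape_def)
    moreover have "0 \<notin> set (shape U)" using U by (simp add: SYT_def is_partition_def)
    ultimately have "U ! r \<noteq> []" by (metis list.size(3))
    then show "\<exists>i\<in>{1..n}. rw U i = r" using SYT_nth[OF U r, of 0] by auto
  qed (use SYT_rwcl(1)[OF U] in blast)
  have l: "length S = length T" using ne[OF S] ne[OF T] e by (metis linorder_neqE_nat less_irrefl)
  have "length (S ! r) = length (T ! r)" if r: "r < length S" for r
  proof -
    have "distinct (S ! r)" "distinct (T ! r)" using S T r l by (auto simp: SYT_def strict_sorted_iff)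
    moreover have "set (S ! r) = set (T ! r)"
      unfolding SYT_row_set[OF S r] SYT_row_set[OF T r[unfolded l]] using e by auto
    ultimately show ?thesis by (metis distinct_card)
  qed
  then show "shape S = shape T" using l by (auto simp: shape_def intro!: nth_equalityI)
qed

lemma tperm_eqI:
  assumes "S \<in> SYT n" "S2 \<in> SYT n" "T \<in> SYT n" "shape S = shape T" "shape S2 = shape T"
    and e: "\<And>i. i \<in> {1..n} \<Longrightarrow> tperm n S T i = tperm n S2 T i"
  shows "S = S2"
proof (rule SYT_eqI_rw[OF assms(1,2)])
  fix j assume "j \<in> {1..n}"
  then obtain i where "i \<in> {1..n}" "j = tperm n S T i"
    using permutes_image[OF tperm_permutes[OF assms(1,3,4)]] by blast
  then show "rw S j = rw S2 j" using tperm_spec(2)[OF assms(1,3,4)] tperm_spec(2)[OF assms(2,3,5)] e by metis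
qed

text \<open>On each fibre of \<open>f\<close> the functions \<open>u\<close> and \<open>v\<close>
  take the same values with the same multiplicities and are both sorted by \<open>key\<close>, so
  they agree. This is the uniqueness argument behind all comparisons of fillings below.\<close>

lemma sorted_rearrangement_eq:
  fixes u v f key \<theta> :: "nat \<Rightarrow> nat"
  assumes \<theta>: "\<theta> permutes {1..n}" and f: "\<And>i. i \<in> {1..n} \<Longrightarrow> f (\<theta> i) = f i" and v: "\<And>i. i \<in> {1..n} \<Longrightarrow> v i = u (\<theta> i)"
    and inj: "\<And>i j. i \<in> {1..n} \<Longrightarrow> j \<in> {1..n} \<Longrightarrow> f i = f j \<Longrightarrow> key i = key j \<Longrightarrow> i = j"
    and us: "\<And>i j. i \<in> {1..n} \<Longrightarrow> j \<in> {1..n} \<Longrightarrow> f i = f j \<Longrightarrow> key i < key j \<Longrightarrow> u i \<le> u j"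
    and vs: "\<And>i j. i \<in> {1..n} \<Longrightarrow> j \<in> {1..n} \<Longrightarrow> f i = f j \<Longrightarrow> key i < key j \<Longrightarrow> v i \<le> v j"
    and i: "i \<in> {1..n}"
  shows "u i = v i"
proof -
  define A B where "A t = {j\<in>{1..n}. f j = f i \<and> u j \<le> t}" and "B t = {j\<in>{1..n}. f j = f i \<and> v j \<le> t}" for t
  have "A t = B t" for t
  proof -
    have fin: "finite (A t)" "finite (B t)" by (auto simp: A_def B_def)
    have "\<theta> ` B t = A t"
    proof (intro equalityI subsetI)
      fix x assume "x \<in> \<theta> ` B t"
      then obtain y where y: "y \<in> B t" "x = \<theta> y" by blast
      then have "y \<in> {1..n}" "\<theta> y \<in> {1..n}" using permutes_in_image[OF \<theta>, of y] by (auto simp: B_def)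
      then show "x \<in> A t" using y f[of y] v[of y] by (simp add: A_def B_def)
    next
      fix x assume x: "x \<in> A t"
      then obtain y where y: "y \<in> {1..n}" "x = \<theta> y" using permutes_image[OF \<theta>] unfolding A_def by blast
      then have "y \<in> B t" using x f v by (auto simp: A_def B_def)
      then show "x \<in> \<theta> ` B t" using y by blast
    qed
    then have card: "card (A t) = card (B t)" using card_image[OF permutes_inj_on[OF \<theta>], of "B t"] by simp
    \<comment> \<open>Both are initial segments of the fibre in the order given by
      \<open>key\<close>.\<close>
    have "A t \<subseteq> B t \<or> B t \<subseteq> A t"
    proof (rule ccontr)
      assume "\<not> (A t \<subseteq> B t \<or> B t \<subseteq> A t)"
      then obtain x y where x: "x \<in> A t" "x \<notin> B t" and y: "y \<in> B t" "y \<notin> A t" by blast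
      have xy: "x \<in> {1..n}" "y \<in> {1..n}" "f x = f y" using x y by (auto simp: A_def B_def)
      consider "key x < key y" | "key y < key x" | "key x = key y" by linarith
      then show False
      proof cases
        case 1 then have "v x \<le> v y" using vs xy by blast
        then show False using x y by (auto simp: A_def B_def)
      next
        case 2 then have "u y \<le> u x" using us xy by metis
        then show False using x y by (auto simp: A_def B_def)
      next
        case 3 then show False using inj[OF xy] x y by blast
      qed
    qed
    then show ?thesis using card fin by (metis card_subset_eq)
  qed
  then have "u i \<le> t \<longleftrightarrow> v i \<le> t" for t using i by (auto simp: A_def B_def set_eq_iff)
  then show ?thesis by (metis le_antisym le_refl)
qed

lemma sum_swap_less:
  fixes h b :: "nat \<Rightarrow> nat"
  assumes ij: "i \<in> {1..n}" "j \<in> {1..n}" and h: "h i < h j" and b: "b j < b i"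
  shows "(\<Sum>a=1..n. h a * b a) < (\<Sum>a=1..n. h a * (b \<circ> Transposition.transpose i j) a)"
proof -
  have ne: "i \<noteq> j" using h by auto
  have s: "(\<Sum>a=1..n. g a) = g i + g j + (\<Sum>a\<in>{1..n} - {i, j}. g a)" for g :: "nat \<Rightarrow> nat"
  proof -
    have "(\<Sum>a=1..n. g a) = (\<Sum>a\<in>{i, j}. g a) + (\<Sum>a\<in>{1..n} - {i, j}. g a)"
      using ij by (subst sum.subset_diff[of "{i, j}"]) auto
    then show ?thesis using ne by simp
  qed
  have r: "(\<Sum>a\<in>{1..n} - {i, j}. h a * (b \<circ> Transposition.transpose i j) a) = (\<Sum>a\<in>{1..n} - {i, j}. h a * b a)"
    by (rule sum.cong) (auto simp: Transposition.transpose_def)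
  obtain x y where xy: "h j = h i + x" "b i = b j + y" "x > 0" "y > 0"
    by (metis less_imp_add_positive[OF h] less_imp_add_positive[OF b])
  have "h i * b i + h j * b j < h i * b j + h j * b i"
    unfolding xy(1,2) using xy(3,4) by (simp add: algebra_simps)
  then show ?thesis unfolding s[of "\<lambda>a. h a * b a"] s[of "\<lambda>a. h a * (b \<circ> Transposition.transpose i j) a"] r
    by (simp add: Transposition.transpose_def)
qed

text \<open>A permutation of the fibres that maximizes the pairing leaves \<open>u\<close> sorted by
  \<open>key\<close>, since a transposition would improve it otherwise; hence it reproduces
  \<open>u\<close>.\<close>

lemma rearrangement:
  fixes u f key :: "nat \<Rightarrow> nat"
  assumes \<tau>: "\<tau> \<in> Stab n f"
    and inj: "\<And>i j. i \<in> {1..n} \<Longrightarrow> j \<in> {1..n} \<Longrightarrow> f i = f j \<Longrightarrow> key i = key j \<Longrightarrow> i = j"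
    and us: "\<And>i j. i \<in> {1..n} \<Longrightarrow> j \<in> {1..n} \<Longrightarrow> f i = f j \<Longrightarrow> key i < key j \<Longrightarrow> u i \<le> u j"
  shows "(\<Sum>a=1..n. key a * u (\<tau> a)) \<le> (\<Sum>a=1..n. key a * u a)"
    and "(\<Sum>a=1..n. key a * u (\<tau> a)) = (\<Sum>a=1..n. key a * u a) \<Longrightarrow> i \<in> {1..n} \<Longrightarrow> u (\<tau> i) = u i"
proof -
  let ?P = "\<lambda>\<tau>. \<Sum>a=1..n. key a * u (\<tau> a)"
  have mx: "u i = u (\<rho> i)" if \<rho>: "\<rho> \<in> Stab n f" and m: "\<And>\<sigma>. \<sigma> \<in> Stab n f \<Longrightarrow> ?P \<sigma> \<le> ?P \<rho>" and i: "i \<in> {1..n}" for \<rho> i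
  proof (rule sorted_rearrangement_eq[OF StabD(1)[OF \<rho>], where f = f and key = key and u = u and v = "\<lambda>i. u (\<rho> i)"])
    fix i j assume ij: "i \<in> {1..n}" "j \<in> {1..n}" "f i = f j" "key i < key j"
    show "u (\<rho> i) \<le> u (\<rho> j)"
    proof (rule ccontr)
      assume "\<not> u (\<rho> i) \<le> u (\<rho> j)"
      then have "?P \<rho> < ?P (\<rho> \<circ> Transposition.transpose i j)"
        using sum_swap_less[OF ij(1,2,4), of "u \<circ> \<rho>"] by (simp add: comp_def)
      moreover have "\<rho> \<circ> Transposition.transpose i j \<in> Stab n f"
        by (rule Stab_comp[OF \<rho> transpose_Stab]) (use ij in auto)
      ultimately show False using m by (metis not_le)
    qed
  next
    fix i j assume ij: "i \<in> {1..n}" "j \<in> {1..n}" "f i = f j"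
    show "i = j" if "key i = key j" using ij that by (rule inj)
    show "u i \<le> u j" if "key i < key j" using ij that by (rule us)
  qed (use StabD(2)[OF \<rho>] i in simp_all)
  have "finite (?P ` Stab n f)" "?P ` Stab n f \<noteq> {}" using Stab_id[of n f] by (auto simp del: Stab_id)
  from Max_in[OF this] obtain \<rho> where \<rho>: "\<rho> \<in> Stab n f" "?P \<rho> = Max (?P ` Stab n f)" by auto
  then have m: "?P \<sigma> \<le> ?P \<rho>" if "\<sigma> \<in> Stab n f" for \<sigma> using that by simp
  have e: "?P \<rho> = ?P id" using mx[OF \<rho>(1) m] by (auto intro!: sum.cong)
  show "?P \<tau> \<le> (\<Sum>a=1..n. key a * u a)" using m[OF \<tau>] e by simp
  assume "?P \<tau> = (\<Sum>a=1..n. key a * u a)" "i \<in> {1..n}"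
  then show "u (\<tau> i) = u i" using mx[OF \<tau>, of i] m e by simp
qed

section \<open>Linear independence of symmetrized fillings\<close>

text \<open>These permutations account for the ties met when elementary symmetric polynomials are
  multiplied in: equal exponents belong to entries with equal labels, and different choices among
  them differ by a permutation within label classes.\<close>

definition refs :: "nat \<Rightarrow> (nat \<Rightarrow> nat) \<Rightarrow> nat list list \<Rightarrow> (nat \<Rightarrow> nat) set" where
  "refs n \<nu> S = {\<rho>. \<rho> permutes {1..n} \<and> (\<forall>a\<in>{1..n}. lab S (\<rho> a) = lab S a)}"

lemma finite_refs [simp]: "finite (refs n \<nu> S)"
  unfolding refs_def by (rule finite_subset[OF _ finite_perms[of n]]) auto

lemma id_refs [simp]: "id \<in> refs n \<nu> S"
  by (simp add: refs_def permutes_id)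

text \<open>Pairing with column numbers breaks the ties. A maximizer is sorted by column along the
  rows and within the label classes, for otherwise a transposition improves it. Along the rows this
  puts the labels where \<open>S\<close> has them; within a label class the columns are distinct, so
  sortedness determines the exponents.\<close>

lemma refs_top:
  assumes S: "S \<in> SYT n" and T: "T \<in> SYT n" and sh: "shape S = shape T" and c: "compat n \<nu> S"
    and \<rho>: "\<rho> \<in> refs n \<nu> S" and \<sigma>: "\<sigma> \<in> Stab n (rw T)"
  defines "p \<equiv> tperm n S T"
  shows "(\<Sum>i=1..n. cl T i * \<nu> (\<rho> (p (\<sigma> i)))) \<le> (\<Sum>i=1..n. cl T i * \<nu> (p i))"
    and "(\<Sum>i=1..n. cl T i * \<nu> (\<rho> (p (\<sigma> i)))) = (\<Sum>i=1..n. cl T i * \<nu> (p i)) \<Longrightarrow> i \<in> {1..n} \<Longrightarrow> \<nu> (\<rho> (p (\<sigma> i))) = \<nu> (p i)"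
proof -
  let ?P = "\<lambda>(\<rho>, \<sigma>). \<Sum>i=1..n. cl T i * \<nu> (\<rho> (p (\<sigma> i)))"
  let ?X = "refs n \<nu> S \<times> Stab n (rw T)"
  note ps = tperm_spec[OF S T sh, folded p_def]
  note pp = tperm_permutes[OF S T sh, folded p_def]
  note tinj = tab_inj[OF SYT_tab[OF T]]
  have mx: "\<nu> (p i) = \<nu> (\<rho> (p (\<sigma> i)))"
    if \<rho>: "\<rho> \<in> refs n \<nu> S" and \<sigma>: "\<sigma> \<in> Stab n (rw T)" and m: "\<And>x. x \<in> ?X \<Longrightarrow> ?P x \<le> ?P (\<rho>, \<sigma>)" and i: "i \<in> {1..n}" for \<rho> \<sigma> i
  proof -
    have \<rho>p: "\<rho> permutes {1..n}" and \<rho>l: "\<And>a. a \<in> {1..n} \<Longrightarrow> lab S (\<rho> a) = lab S a" using \<rho> by (auto simp: refs_def)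
    note \<sigma>p = StabD(1)[OF \<sigma>]
    have \<sigma>i: "\<sigma> i \<in> {1..n}" if "i \<in> {1..n}" for i using permutes_in_image[OF \<sigma>p] that by blast
    have \<rho>i: "\<rho> i \<in> {1..n}" if "i \<in> {1..n}" for i using permutes_in_image[OF \<rho>p] that by blast
    have rows: "\<nu> (\<rho> (p (\<sigma> i))) \<le> \<nu> (\<rho> (p (\<sigma> j)))"
      if ij: "i \<in> {1..n}" "j \<in> {1..n}" "rw T i = rw T j" "cl T i < cl T j" for i j
    proof (rule ccontr)
      assume "\<not> \<nu> (\<rho> (p (\<sigma> i))) \<le> \<nu> (\<rho> (p (\<sigma> j)))"
      then have "?P (\<rho>, \<sigma>) < ?P (\<rho>, \<sigma> \<circ> Transposition.transpose i j)"
        using sum_swap_less[OF ij(1,2,4), of "\<lambda>i. \<nu> (\<rho> (p (\<sigma> i)))"] by (simp add: comp_def)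
      moreover have "\<sigma> \<circ> Transposition.transpose i j \<in> Stab n (rw T)"
        by (rule Stab_comp[OF \<sigma> transpose_Stab]) (use ij in auto)
      ultimately show False using m[of "(\<rho>, \<sigma> \<circ> Transposition.transpose i j)"] \<rho> by simp
    qed
    \<comment> \<open>Along a row the exponents of a maximizer increase weakly, hence so do the
      labels, which \<nu> refines. The labels of \<open>S\<close> itself do the same, so \<sigma>
      cannot move them.\<close>
    have labs: "lab S (p i) = lab S (p (\<sigma> i))" if i: "i \<in> {1..n}" for i
    proof (rule sorted_rearrangement_eq[OF \<sigma>p, where f = "rw T" and key = "cl T" and u = "\<lambda>i. lab S (p i)" and v = "\<lambda>i. lab S (p (\<sigma> i))"])
      fix i j assume ij: "i \<in> {1..n}" "j \<in> {1..n}" "rw T i = rw T j"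
      show "i = j" if "cl T i = cl T j" using tinj ij that by blast
      show "lab S (p i) \<le> lab S (p j)" if "cl T i < cl T j"
      proof -
        have "p i < p j" using SYT_row_less[OF S, of "p i" "p j"] ps ij that by simp
        then show ?thesis using lab_mono[OF S, of "p i" "p j"] ps(1)[OF ij(1)] ps(1)[OF ij(2)] by simp
      qed
      show "lab S (p (\<sigma> i)) \<le> lab S (p (\<sigma> j))" if "cl T i < cl T j"
      proof (rule ccontr)
        let ?a = "\<rho> (p (\<sigma> i))" and ?b = "\<rho> (p (\<sigma> j))"
        have in1: "?a \<in> {1..n}" "?b \<in> {1..n}" "p (\<sigma> i) \<in> {1..n}" "p (\<sigma> j) \<in> {1..n}"
          using \<rho>i ps(1) \<sigma>i ij by auto
        assume "\<not> lab S (p (\<sigma> i)) \<le> lab S (p (\<sigma> j))"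
        then have "lab S ?b < lab S ?a" using \<rho>l[OF in1(3)] \<rho>l[OF in1(4)] by simp
        from compat_strict[OF S c in1(2,1) this] rows[OF ij that] show False by simp
      qed
    qed (use StabD(2)[OF \<sigma>] i in simp_all)
    \<comment> \<open>Turns the permutation of entries into one of positions, which preserves labels
      by \<open>labs\<close> and can be compared with the identity.\<close>
    let ?\<theta> = "pinv p \<circ> \<rho> \<circ> p \<circ> \<sigma>"
    have \<theta>: "?\<theta> permutes {1..n}"
      using pp \<rho>p \<sigma>p by (intro permutes_compose permutes_inv)
    have p\<theta>: "p (?\<theta> i) = \<rho> (p (\<sigma> i))" for i
      by (simp add: permutes_inverses(1)[OF pp])
    show ?thesis
    proof (rule sorted_rearrangement_eq[OF \<theta>, where f = "\<lambda>i. lab S (p i)" and key = "cl T" and u = "\<lambda>i. \<nu> (p i)" and v = "\<lambda>i. \<nu> (\<rho> (p (\<sigma> i)))"])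
      fix j assume j: "j \<in> {1..n}"
      show "lab S (p (?\<theta> j)) = lab S (p j)"
        unfolding p\<theta> using \<rho>l[OF ps(1)[OF \<sigma>i[OF j]]] labs[OF j] by simp
      show "\<nu> (\<rho> (p (\<sigma> j))) = \<nu> (p (?\<theta> j))" unfolding p\<theta> ..
    next
      fix i j assume ij: "i \<in> {1..n}" "j \<in> {1..n}" "lab S (p i) = lab S (p j)"
      have pij: "p i \<in> {1..n}" "p j \<in> {1..n}" using ps(1) ij by auto
      have lt: "p i < p j \<longleftrightarrow> cl T i < cl T j"
        using lab_eq_cl[OF S, of "p i" "p j"] lab_eq_cl[OF S, of "p j" "p i"] pij ij ps(3)
        by (metis atLeastAtMost_iff less_asym linorder_neqE_nat order_less_irrefl)
      show "i = j" if "cl T i = cl T j"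
      proof -
        have "p i = p j"
          using lab_eq_cl[OF S, of "p i" "p j"] lab_eq_cl[OF S, of "p j" "p i"] pij ij ps(3) that
          by (metis atLeastAtMost_iff linorder_neqE_nat order_less_irrefl)
        then show ?thesis using permutes_inj[OF pp] by (auto dest: injD)
      qed
      show "\<nu> (p i) \<le> \<nu> (p j)" if "cl T i < cl T j"
        using compat_mono[OF c, of "p i" "p j"] lt that pij by simp
      show "\<nu> (\<rho> (p (\<sigma> i))) \<le> \<nu> (\<rho> (p (\<sigma> j)))" if clt: "cl T i < cl T j"
      proof (rule ccontr)
        \<comment> \<open>Swapping two positions of equal label stays within \<open>refs\<close>
          once everything is absorbed into \<rho>, leaving the row permutation trivial.\<close>
        define \<rho>' where "\<rho>' = p \<circ> ?\<theta> \<circ> Transposition.transpose i j \<circ> pinv p"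
        assume "\<not> \<nu> (\<rho> (p (\<sigma> i))) \<le> \<nu> (\<rho> (p (\<sigma> j)))"
        then have "?P (\<rho>, \<sigma>) < (\<Sum>a=1..n. cl T a * \<nu> (p (?\<theta> (Transposition.transpose i j a))))"
          unfolding p\<theta> using sum_swap_less[OF ij(1,2) clt, of "\<lambda>i. \<nu> (\<rho> (p (\<sigma> i)))"] by (simp add: comp_def)
        also have "\<dots> = ?P (\<rho>', id)"
          by (simp add: \<rho>'_def permutes_inverses[OF pp])
        finally have less: "?P (\<rho>, \<sigma>) < ?P (\<rho>', id)" .
        have "\<rho>' permutes {1..n}" unfolding \<rho>'_def
          using pp \<theta> permutes_swap_id[OF ij(1,2)] \<sigma>p \<rho>p by (intro permutes_compose permutes_inv)
        moreover have "lab S (\<rho>' a) = lab S a" if a: "a \<in> {1..n}" for a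
        proof -
          let ?j = "Transposition.transpose i j (pinv p a)"
          have ia: "pinv p a \<in> {1..n}" using permutes_in_image[OF permutes_inv[OF pp]] a by blast
          have j: "?j \<in> {1..n}" using permutes_in_image[OF permutes_swap_id[OF ij(1,2)]] ia by blast
          have "lab S (\<rho>' a) = lab S (\<rho> (p (\<sigma> ?j)))" unfolding \<rho>'_def using p\<theta>[of ?j] by simp
          also have "\<dots> = lab S (p ?j)" using \<rho>l[OF ps(1)[OF \<sigma>i[OF j]]] labs[OF j] by simp
          also have "\<dots> = lab S (p (pinv p a))" using ij(3) by (auto simp: Transposition.transpose_def)
          finally show ?thesis by (simp add: permutes_inverses(1)[OF pp])
        qed
        ultimately have "\<rho>' \<in> refs n \<nu> S" by (simp add: refs_def)
        then show False using m[of "(\<rho>', id)"] less by simp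
      qed
    qed (rule i)
  qed
  have "finite (?P ` ?X)" "?P ` ?X \<noteq> {}" using id_refs[of n \<nu> S] Stab_id[of n "rw T"] by (auto simp del: id_refs Stab_id)
  from Max_in[OF this] obtain \<rho>0 \<sigma>0 where 0: "\<rho>0 \<in> refs n \<nu> S" "\<sigma>0 \<in> Stab n (rw T)" "?P (\<rho>0, \<sigma>0) = Max (?P ` ?X)" by auto
  have m: "?P x \<le> ?P (\<rho>0, \<sigma>0)" if "x \<in> ?X" for x
    unfolding 0(3) by (rule Max_ge[OF \<open>finite (?P ` ?X)\<close> imageI[OF that]])
  have e0: "?P (\<rho>0, \<sigma>0) = (\<Sum>i=1..n. cl T i * \<nu> (p i))"
    using mx[OF 0(1,2) m] by (auto intro!: sum.cong)
  have m': "?P x \<le> (\<Sum>i=1..n. cl T i * \<nu> (p i))" if "x \<in> ?X" for x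
    using m[OF that] unfolding e0 .
  show "(\<Sum>i=1..n. cl T i * \<nu> (\<rho> (p (\<sigma> i)))) \<le> (\<Sum>i=1..n. cl T i * \<nu> (p i))"
    using m'[of "(\<rho>, \<sigma>)"] \<rho> \<sigma> by simp
  assume e: "(\<Sum>i=1..n. cl T i * \<nu> (\<rho> (p (\<sigma> i)))) = (\<Sum>i=1..n. cl T i * \<nu> (p i))" and i: "i \<in> {1..n}"
  have "?P x \<le> ?P (\<rho>, \<sigma>)" if "x \<in> ?X" for x using m'[OF that] e by simp
  from mx[OF \<rho> \<sigma> this i] show "\<nu> (\<rho> (p (\<sigma> i))) = \<nu> (p i)" by simp
qed

text \<open>Nonnegativity rules out cancellation when the row group adds up several
  rearrangements.\<close>

definition lead :: "nat \<Rightarrow> (nat \<Rightarrow> nat) \<Rightarrow> nat list list \<Rightarrow> nat list list \<Rightarrow> qpoly \<Rightarrow> bool" where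
  "lead n \<nu> S T v \<longleftrightarrow> (\<forall>m\<in>keys v. lookup v m \<ge> 0 \<and> (\<exists>\<rho>\<in>refs n \<nu> S. m = expo n (\<nu> \<circ> \<rho> \<circ> tperm n S T))) \<and>
     lookup v (expo n (\<nu> \<circ> tperm n S T)) > 0"

lemma lead_nonneg: "lead n \<nu> S T v \<Longrightarrow> lookup v m \<ge> 0"
  by (cases "m \<in> keys v") (simp add: lead_def, simp add: in_keys_iff)

lemma map_key_expo:
  assumes "\<pi> permutes {1..n}" shows "Poly_Mapping.map_key \<pi> (expo n b) = expo n (b \<circ> \<pi>)"
  using permutes_in_image[OF assms]
  by (intro poly_mapping_eqI) (simp add: map_key.rep_eq permutes_inj[OF assms])

lemma lookup_young:
  "lookup (young n f h v) (expo n b) =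
    (\<Sum>\<tau>\<in>Stab n h. \<Sum>\<sigma>\<in>Stab n f. of_int (sign \<tau>) * lookup v (expo n (b \<circ> \<tau> \<circ> \<sigma>)))"
  unfolding young_def colop_def rowop_def
  by (simp add: lookup_sum sum_distrib_left lookup_perm_act StabD(3) map_key_expo StabD(1))

text \<open>A nonzero contribution comes from a column permutation \<tau> and a row permutation
  \<sigma>. Column permutations do not change the pairing with column numbers, so
  \<open>refs_top\<close> for \<open>S2\<close> and the assumed maximality force equality there, and
  the two fillings agree up to \<tau>. Both increase strictly up the columns, so \<tau> is trivial
  and the fillings coincide.\<close>

lemma lookup_young_lead:
  assumes S: "S \<in> SYT n" "S2 \<in> SYT n" and T: "T \<in> SYT n" and sh: "shape S = shape T" "shape S2 = shape T"
    and c: "compat n \<nu> S" "compat n \<nu> S2" and v: "lead n \<nu> S2 T v"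
    and max: "(\<Sum>i=1..n. cl T i * \<nu> (tperm n S2 T i)) \<le> (\<Sum>i=1..n. cl T i * \<nu> (tperm n S T i))"
  shows "S2 \<noteq> S \<Longrightarrow> lookup (young n (rw T) (cl T) v) (expo n (\<nu> \<circ> tperm n S T)) = 0"
    and "S2 = S \<Longrightarrow> lookup (young n (rw T) (cl T) v) (expo n (\<nu> \<circ> tperm n S T)) > 0"
proof -
  let ?p = "tperm n S T" and ?q = "tperm n S2 T"
  let ?A = "\<nu> \<circ> ?p"
  note ps = tperm_spec[OF S(1) T sh(1)] and qs = tperm_spec[OF S(2) T sh(2)]
  note tinj = tab_inj[OF SYT_tab[OF T]]
  have colA: "(\<nu> \<circ> tperm n S T) i < (\<nu> \<circ> tperm n S T) j" if "S \<in> SYT n" "shape S = shape T" "compat n \<nu> S"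
      and ij: "i \<in> {1..n}" "j \<in> {1..n}" "cl T i = cl T j" "rw T i < rw T j" for S i j
    using compat_strict[OF that(1,3)] lab_column[OF that(1)] tperm_spec[OF that(1) T that(2)] ij by simp
  have key: "S2 = S \<and> \<tau> = id" if \<tau>: "\<tau> \<in> Stab n (cl T)" and \<sigma>: "\<sigma> \<in> Stab n (rw T)" and nz: "lookup v (expo n (?A \<circ> \<tau> \<circ> \<sigma>)) \<noteq> 0" for \<tau> \<sigma>
  proof -
    have k: "expo n (?A \<circ> \<tau> \<circ> \<sigma>) \<in> keys v" using nz by (simp add: in_keys_iff)
    have "\<exists>\<rho>\<in>refs n \<nu> S2. expo n (?A \<circ> \<tau> \<circ> \<sigma>) = expo n (\<nu> \<circ> \<rho> \<circ> ?q)"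
      using v k unfolding lead_def by blast
    then obtain \<rho> where \<rho>: "\<rho> \<in> refs n \<nu> S2" and e: "expo n (?A \<circ> \<tau> \<circ> \<sigma>) = expo n (\<nu> \<circ> \<rho> \<circ> ?q)"
      by (rule bexE)
    from e have e1: "(?A \<circ> \<tau> \<circ> \<sigma>) i = (\<nu> \<circ> \<rho> \<circ> ?q) i" if "i \<in> {1..n}" for i
      using that unfolding expo_eq_iff by blast
    note \<sigma>' = Stab_inv[OF \<sigma>]
    have e2: "(?A \<circ> \<tau>) i = \<nu> (\<rho> (?q (pinv \<sigma> i)))" if i: "i \<in> {1..n}" for i
    proof -
      have "pinv \<sigma> i \<in> {1..n}" using permutes_in_image[OF StabD(1)[OF \<sigma>']] i by blast
      from e1[OF this] show ?thesis by (simp add: permutes_inverses(1)[OF StabD(1)[OF \<sigma>]])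
    qed
    \<comment> \<open>The pairing of column numbers with exponents is unchanged by \<tau>, which
      preserves columns.\<close>
    have "(\<Sum>i=1..n. cl T i * \<nu> (\<rho> (?q (pinv \<sigma> i)))) = (\<Sum>i=1..n. cl T i * (?A \<circ> \<tau>) i)"
      by (rule sum.cong[OF refl]) (simp only: e2[symmetric])
    also have "\<dots> = (\<Sum>i=1..n. cl T (\<tau> i) * ?A (\<tau> i))"
      using StabD(2)[OF \<tau>] by simp
    also have "\<dots> = (\<Sum>i=1..n. cl T i * ?A i)"
      by (rule sum.permute[OF StabD(1)[OF \<tau>], symmetric, unfolded comp_def])
    finally have P: "(\<Sum>i=1..n. cl T i * \<nu> (\<rho> (?q (pinv \<sigma> i)))) = (\<Sum>i=1..n. cl T i * \<nu> (?p i))"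
      by (simp only: comp_apply)
    note top = refs_top[OF S(2) T sh(2) c(2) \<rho> \<sigma>']
    have "(\<Sum>i=1..n. cl T i * \<nu> (\<rho> (?q (pinv \<sigma> i)))) = (\<Sum>i=1..n. cl T i * \<nu> (?q i))"
      using top(1) max P by simp
    from top(2)[OF this] e2 have e3: "(?A \<circ> \<tau>) i = (\<nu> \<circ> ?q) i" if "i \<in> {1..n}" for i using that by simp
    have AA: "?A i = (\<nu> \<circ> ?q) i" if i: "i \<in> {1..n}" for i
    proof (rule sorted_rearrangement_eq[OF StabD(1)[OF \<tau>], where f = "cl T" and key = "rw T" and u = ?A and v = "\<nu> \<circ> ?q"])
      fix i j assume ij: "i \<in> {1..n}" "j \<in> {1..n}" "cl T i = cl T j"
      show "i = j" if "rw T i = rw T j" using tinj ij that by blast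
      show "?A i \<le> ?A j" if "rw T i < rw T j" using colA[OF S(1) sh(1) c(1) ij that] by simp
      show "(\<nu> \<circ> ?q) i \<le> (\<nu> \<circ> ?q) j" if "rw T i < rw T j" using colA[OF S(2) sh(2) c(2) ij that] by simp
    qed (use StabD(2)[OF \<tau>] e3 i in simp_all)
    have "\<tau> i = i" for i
    proof (cases "i \<in> {1..n}")
      case True
      have ti: "\<tau> i \<in> {1..n}" using permutes_in_image[OF StabD(1)[OF \<tau>]] True by blast
      have "?A (\<tau> i) = ?A i" using e3[OF True] AA[OF True] by simp
      then have "rw T (\<tau> i) = rw T i"
        using colA[OF S(1) sh(1) c(1) ti True] colA[OF S(1) sh(1) c(1) True ti] StabD(2)[OF \<tau>, of i]
        by (metis linorder_neqE_nat order_less_irrefl)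
      then show ?thesis using tinj[OF ti True] StabD(2)[OF \<tau>, of i] by simp
    qed (rule permutes_not_in[OF StabD(1)[OF \<tau>]])
    then have "\<tau> = id" by auto
    \<comment> \<open>Boxes with equal exponent are numbered from left to right in both tableaux, so
      the common filling determines them.\<close>
    moreover have "S2 = S"
    proof (rule tperm_eqI[OF S(2,1) T sh(2,1)])
      fix i assume i: "i \<in> {1..n}"
      let ?\<theta> = "pinv ?p \<circ> ?q"
      note pp = tperm_permutes[OF S(1) T sh(1)] and qp = tperm_permutes[OF S(2) T sh(2)]
      have \<theta>: "?\<theta> permutes {1..n}" by (intro permutes_compose permutes_inv pp qp)
      have p\<theta>: "?p (?\<theta> i) = ?q i" for i by (simp add: permutes_inverses(1)[OF pp])
      have lt: "tperm n S T i < tperm n S T j" if S: "S \<in> SYT n" "shape S = shape T" "compat n \<nu> S"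
        and ij: "i \<in> {1..n}" "j \<in> {1..n}" "\<nu> (tperm n S T i) = \<nu> (tperm n S T j)" "cl T i < cl T j" for S i j
      proof -
        note s = tperm_spec[OF S(1) T S(2)]
        have "lab S (tperm n S T i) = lab S (tperm n S T j)" using compat_lab[OF S(1,3)] s(1) ij by blast
        then show ?thesis using lab_eq_cl[OF S(1), of "tperm n S T j" "tperm n S T i"] s(1)[OF ij(1)] s(1)[OF ij(2)] s(3)[OF ij(1)] s(3)[OF ij(2)] ij(4)
          by (metis atLeastAtMost_iff linorder_neqE_nat not_less_iff_gr_or_eq)
      qed
      have "?p i = ?q i"
      proof (rule sorted_rearrangement_eq[OF \<theta>, where f = ?A and key = "cl T" and u = ?p and v = ?q])
        fix j assume j: "j \<in> {1..n}"
        show "?A (?\<theta> j) = ?A j" using AA[OF j] p\<theta>[of j] by simp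
        show "?q j = ?p (?\<theta> j)" using p\<theta> by simp
      next
        fix i j assume ij: "i \<in> {1..n}" "j \<in> {1..n}" "?A i = ?A j"
        then have ij2: "\<nu> (?p i) = \<nu> (?p j)" "\<nu> (?q i) = \<nu> (?q j)" using AA by simp_all
        show "?p i \<le> ?p j" if "cl T i < cl T j" using lt[OF S(1) sh(1) c(1) ij(1,2) ij2(1) that] by simp
        show "?q i \<le> ?q j" if "cl T i < cl T j" using lt[OF S(2) sh(2) c(2) ij(1,2) ij2(2) that] by simp
        show "i = j" if "cl T i = cl T j"
        proof -
          have "lab S (?p i) = lab S (?p j)" using compat_lab[OF S(1) c(1)] ps(1) ij(1,2) ij2(1) by blast
          then have "?p i = ?p j"
            using lab_eq_cl[OF S(1), of "?p i" "?p j"] lab_eq_cl[OF S(1), of "?p j" "?p i"] ps(1)[OF ij(1)] ps(1)[OF ij(2)]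
              ps(3)[OF ij(1)] ps(3)[OF ij(2)] that by (metis atLeastAtMost_iff linorder_neqE_nat order_less_irrefl)
          then show ?thesis using permutes_inj[OF pp] by (auto dest: injD)
        qed
      qed (rule i)
      then show "?q i = ?p i" by simp
    qed
    ultimately show ?thesis by simp
  qed
  show "lookup (young n (rw T) (cl T) v) (expo n ?A) = 0" if "S2 \<noteq> S"
    unfolding lookup_young using key that by (intro sum.neutral ballI) auto
  assume eq: "S2 = S"
  have "lookup (young n (rw T) (cl T) v) (expo n ?A)
      = (\<Sum>\<tau>\<in>{id}. \<Sum>\<sigma>\<in>Stab n (rw T). of_int (sign \<tau>) * lookup v (expo n (?A \<circ> \<tau> \<circ> \<sigma>)))"
    unfolding lookup_young
  proof (rule sum.mono_neutral_right)
    have key0: "lookup v (expo n (?A \<circ> \<tau> \<circ> \<sigma>)) = 0" if "\<tau> \<in> Stab n (cl T)" "\<sigma> \<in> Stab n (rw T)" "\<tau> \<noteq> id" for \<tau> \<sigma>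
      using key[OF that(1,2)] that(3) by blast
    show "\<forall>\<tau>\<in>Stab n (cl T) - {id}. (\<Sum>\<sigma>\<in>Stab n (rw T). of_int (sign \<tau>) * lookup v (expo n (?A \<circ> \<tau> \<circ> \<sigma>))) = 0"
      by (intro ballI sum.neutral) (simp only: key0 DiffE mult_zero_right Diff_iff singleton_iff simp_thms)
  qed auto
  also have "\<dots> = (\<Sum>\<sigma>\<in>Stab n (rw T). lookup v (expo n (?A \<circ> \<sigma>)))" by (simp add: sign_id)
  also have "\<dots> > 0"
  proof (rule sum_pos2[of _ id])
    show "0 < lookup v (expo n (?A \<circ> id))" using v eq by (simp add: lead_def)
  qed (use lead_nonneg[OF v] in auto)
  finally show "lookup (young n (rw T) (cl T) v) (expo n ?A) > 0" .
qed

text \<open>Orders standard tableaux of all shapes. The weights decrease with the entry, so a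
  standard tableau has the least value among its column rearrangements; they are positive, so
  raising one entry is noticed.\<close>

definition row_weight :: "nat \<Rightarrow> nat list list \<Rightarrow> nat" where
  "row_weight n T = (\<Sum>a=1..n. (n + 1 - a) * rw T a)"

text \<open>If no two entries share a row of \<open>T'\<close> and a column of \<open>T\<close>,
  column sorting yields a rearrangement of \<open>T\<close> whose weight lies between those of
  \<open>T\<close> and \<open>T'\<close>. Then all three weights agree, and so do the
  tableaux.\<close>

lemma rowop_colop_std:
  assumes T: "T \<in> SYT n" and T': "T' \<in> SYT n" and row_weight: "row_weight n T' \<le> row_weight n T" and ne: "T \<noteq> T'"
  shows "rowop n (rw T') (colop n (cl T) p) = 0"
proof (cases "\<exists>i\<in>{1..n}. \<exists>j\<in>{1..n}. i \<noteq> j \<and> rw T' i = rw T' j \<and> cl T i = cl T j")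
  case True
  then obtain i j where "i \<in> {1..n}" "j \<in> {1..n}" "i \<noteq> j" "rw T' i = rw T' j" "cl T i = cl T j" by blast
  then show ?thesis by (rule rowop_colop_0(1))
next
  case False
  then have "\<And>i j. i \<in> {1..n} \<Longrightarrow> j \<in> {1..n} \<Longrightarrow> i \<noteq> j \<Longrightarrow> rw T' i = rw T' j \<Longrightarrow> cl T i \<noteq> cl T j" by blast
  from column_sort[OF SYT_tab[OF T] this] obtain \<tau> where
    \<tau>: "\<tau> \<in> Stab n (cl T)" "\<And>i. i \<in> {1..n} \<Longrightarrow> rw T (\<tau> i) \<le> rw T' i" by blast
  let ?w = "\<lambda>g. \<Sum>a=1..n. (n + 1 - a) * g a :: nat"
  \<comment> \<open>Column permutations preserve the sum of the rows, so being least for the weights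
    \<open>n + 1 - a\<close> is the same as being greatest for the weights \<open>a\<close>, as the
    rearrangement inequality provides.\<close>
  have w: "?w g + (\<Sum>a=1..n. a * g a) = (n + 1) * (\<Sum>a=1..n. g a)" for g
    unfolding sum.distrib[symmetric] sum_distrib_left
    by (rule sum.cong) (auto simp flip: distrib_right)
  have s: "(\<Sum>a=1..n. rw T (\<tau> a)) = (\<Sum>a=1..n. rw T a)"
    by (rule sum.permute[OF StabD(1)[OF \<tau>(1)], symmetric, unfolded comp_def])
  have fib: "i = j" if "cl T i = cl T j" "i = j" for i j :: nat using that by simp
  have us: "rw T i \<le> rw T j" if "i \<in> {1..n}" "j \<in> {1..n}" "cl T i = cl T j" "i < j" for i j
    using SYT_col_less[OF T that(1-3)] that(4) by simp
  note ra = rearrangement[OF \<tau>(1), of "\<lambda>i. i" "rw T"]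
  have r1: "(\<Sum>a=1..n. a * rw T (\<tau> a)) \<le> (\<Sum>a=1..n. a * rw T a)"
    by (rule ra(1)) (use us in auto)
  have "row_weight n T \<le> ?w (\<lambda>a. rw T (\<tau> a))"
    using r1 w[of "rw T"] w[of "\<lambda>a. rw T (\<tau> a)"] s unfolding row_weight_def by simp
  moreover have "?w (\<lambda>a. rw T (\<tau> a)) \<le> row_weight n T'"
    unfolding row_weight_def using \<tau>(2) by (intro sum_mono mult_left_mono) auto
  ultimately have e: "?w (\<lambda>a. rw T (\<tau> a)) = row_weight n T'" "?w (\<lambda>a. rw T (\<tau> a)) = row_weight n T" using row_weight by auto
  have "(\<Sum>a=1..n. a * rw T (\<tau> a)) = (\<Sum>a=1..n. a * rw T a)"
    using e(2) w[of "rw T"] w[of "\<lambda>a. rw T (\<tau> a)"] s unfolding row_weight_def by simp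
  then have r2: "rw T (\<tau> i) = rw T i" if "i \<in> {1..n}" for i
    using ra(2)[OF _ us] that by blast
  have "rw T' i = rw T i" if i: "i \<in> {1..n}" for i
  proof (rule ccontr)
    assume "rw T' i \<noteq> rw T i"
    then have lt: "rw T (\<tau> i) < rw T' i" using \<tau>(2)[OF i] r2[OF i] by simp
    have "?w (\<lambda>a. rw T (\<tau> a)) < ?w (rw T')"
      by (rule sum_strict_mono_ex1) (use \<tau>(2) i lt in \<open>auto intro!: bexI[of _ i]\<close>)
    then show False using e(1) by (simp add: row_weight_def)
  qed
  then have "T' = T" by (rule SYT_eqI_rw[OF T' T])
  then show ?thesis using ne by simp
qed

definition fam :: "nat \<Rightarrow> (nat \<Rightarrow> nat) \<Rightarrow> (nat list list \<times> nat list list) set" where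
  "fam n \<nu> = {(S, T). S \<in> SYT n \<and> T \<in> SYT n \<and> shape S = shape T \<and> compat n \<nu> S}"

text \<open>Two triangularities in turn. Among the terms with nonzero coefficient, take a tableau
  \<open>T\<close> of least \<open>row_weight\<close>: its row operator kills the terms with another
  second tableau, and \<open>rowop_colop_rowop_0\<close> removes the operator again. Among the
  remaining first tableaux, one with the greatest column pairing has a monomial that the others
  lack.\<close>

theorem fam_independent:
  assumes fin: "finite (fam n \<nu>)" and v: "\<And>S T. (S, T) \<in> fam n \<nu> \<Longrightarrow> lead n \<nu> S T (v (S, T))"
    and z: "(\<Sum>x\<in>fam n \<nu>. const (c x) * young n (rw (snd x)) (cl (snd x)) (v x)) = 0"
    and x: "x \<in> fam n \<nu>"
  shows "c x = 0"
proof (rule ccontr)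
  assume "c x \<noteq> 0"
  let ?N = "{x \<in> fam n \<nu>. c x \<noteq> 0}"
  have N: "finite ?N" "?N \<noteq> {}" using fin x \<open>c x \<noteq> 0\<close> by (simp, blast)
  obtain x0 where x0: "x0 \<in> ?N" "\<And>x. x \<in> ?N \<Longrightarrow> row_weight n (snd x0) \<le> row_weight n (snd x)"
    using arg_min_if_finite[OF N, of "\<lambda>x. row_weight n (snd x)"] by (metis (no_types, lifting) not_less)
  define T where "T = snd x0"
  have T: "T \<in> SYT n" using x0(1) by (auto simp: fam_def T_def)
  let ?F = "{x \<in> fam n \<nu>. snd x = T}"
  let ?w = "\<Sum>x\<in>?F. const (c x) * v x"
  have "0 = rowop n (rw T) (\<Sum>x\<in>fam n \<nu>. const (c x) * young n (rw (snd x)) (cl (snd x)) (v x))"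
    unfolding z by (simp add: qlin_0[OF qlin_rowop])
  also have "\<dots> = (\<Sum>x\<in>fam n \<nu>. const (c x) * rowop n (rw T) (young n (rw (snd x)) (cl (snd x)) (v x)))"
    by (simp add: qlin_sum[OF qlin_rowop] qlin_scale[OF qlin_rowop])
  also have "\<dots> = (\<Sum>x\<in>?F. const (c x) * rowop n (rw T) (young n (rw T) (cl T) (v x)))"
  proof (rule sum.mono_neutral_cong_right[OF fin])
    show "\<forall>x\<in>fam n \<nu> - ?F. const (c x) * rowop n (rw T) (young n (rw (snd x)) (cl (snd x)) (v x)) = 0"
    proof
      fix x assume x: "x \<in> fam n \<nu> - ?F"
      show "const (c x) * rowop n (rw T) (young n (rw (snd x)) (cl (snd x)) (v x)) = 0"
      proof (cases "c x = 0")
        case False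
        then have "row_weight n T \<le> row_weight n (snd x)" unfolding T_def using x0(2)[of x] x by blast
        moreover have "snd x \<in> SYT n" using x by (auto simp: fam_def)
        ultimately show ?thesis unfolding young_def using rowop_colop_std[OF _ T] x by simp
      qed simp
    qed
  qed auto
  also have "\<dots> = rowop n (rw T) (young n (rw T) (cl T) ?w)"
    by (simp add: qlin_sum[OF qlin_rowop] qlin_scale[OF qlin_rowop] qlin_sum[OF qlin_young] qlin_scale[OF qlin_young])
  finally have "rowop n (rw T) (colop n (cl T) (rowop n (rw T) ?w)) = 0" by (simp add: young_def)
  from rowop_colop_rowop_0[OF this] have y0: "young n (rw T) (cl T) ?w = 0" by (simp only: young_def)
  \<comment> \<open>The maximality hypothesis of \<open>lookup_young_lead\<close>.\<close>
  let ?\<Psi> = "\<lambda>x. \<Sum>i=1..n. cl T i * \<nu> (tperm n (fst x) T i)"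
  let ?M = "{x \<in> ?F. c x \<noteq> 0}"
  have M: "finite ?M" "?M \<noteq> {}" using fin x0(1) unfolding T_def by (simp, blast)
  obtain y where y: "y \<in> ?M" "\<And>x. x \<in> ?M \<Longrightarrow> ?\<Psi> x \<le> ?\<Psi> y"
  proof -
    have "finite (?\<Psi> ` ?M)" "?\<Psi> ` ?M \<noteq> {}" using M by auto
    from Max_in[OF this] obtain y where y: "y \<in> ?M" "?\<Psi> y = Max (?\<Psi> ` ?M)" by auto
    then have "?\<Psi> x \<le> ?\<Psi> y" if "x \<in> ?M" for x using Max_ge[OF \<open>finite (?\<Psi> ` ?M)\<close> imageI[OF that]] by simp
    with y(1) show ?thesis by (rule that)
  qed
  define S where "S = fst y"
  have yeq: "y = (S, T)" and yF: "y \<in> fam n \<nu>" using y(1) by (auto simp: S_def)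
  then have S: "S \<in> SYT n" "shape S = shape T" "compat n \<nu> S" by (auto simp: fam_def)
  have "0 = lookup (young n (rw T) (cl T) ?w) (expo n (\<nu> \<circ> tperm n S T))" by (simp add: y0)
  also have "\<dots> = (\<Sum>x\<in>?F. c x * lookup (young n (rw T) (cl T) (v x)) (expo n (\<nu> \<circ> tperm n S T)))"
    by (simp add: qlin_sum[OF qlin_young] qlin_scale[OF qlin_young] lookup_sum)
  also have "\<dots> = (\<Sum>x\<in>{y}. c x * lookup (young n (rw T) (cl T) (v x)) (expo n (\<nu> \<circ> tperm n S T)))"
  proof (rule sum.mono_neutral_right)
    show "\<forall>x\<in>?F - {y}. c x * lookup (young n (rw T) (cl T) (v x)) (expo n (\<nu> \<circ> tperm n S T)) = 0"
    proof
      fix x assume x: "x \<in> ?F - {y}"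
      then obtain S2 where x': "x = (S2, T)" and S2: "S2 \<in> SYT n" "shape S2 = shape T" "compat n \<nu> S2" "S2 \<noteq> S" and xf: "(S2, T) \<in> fam n \<nu>"
        using yeq by (cases x) (auto simp: fam_def)
      show "c x * lookup (young n (rw T) (cl T) (v x)) (expo n (\<nu> \<circ> tperm n S T)) = 0"
      proof (cases "c x = 0")
        case False
        then have "?\<Psi> x \<le> ?\<Psi> y" using y(2) x by blast
        then show ?thesis
          using lookup_young_lead(1)[OF S(1) S2(1) T S(2) S2(2) S(3) S2(3) v[OF xf]] S2(4) unfolding x' yeq by simp
      qed simp
    qed
  qed (use fin y in auto)
  finally have "c y * lookup (young n (rw T) (cl T) (v y)) (expo n (\<nu> \<circ> tperm n S T)) = 0" by simp
  moreover have "lookup (young n (rw T) (cl T) (v y)) (expo n (\<nu> \<circ> tperm n S T)) > 0"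
    using lookup_young_lead(2)[OF S(1) S(1) T S(2) S(2) S(3) S(3)] v yF unfolding yeq by simp
  ultimately show False using y(1) by simp
qed

section \<open>Counting pairs of tableaux\<close>

definition hstrip :: "(nat \<Rightarrow> nat) \<Rightarrow> (nat \<Rightarrow> nat) \<Rightarrow> bool" where
  "hstrip lam kap \<longleftrightarrow> (\<forall>i. lam i \<le> kap i \<and> kap (Suc i) \<le> lam i)"

definition box_parts :: "nat \<Rightarrow> nat \<Rightarrow> (nat \<Rightarrow> nat) set" where
  "box_parts N m = {lam. antimono lam \<and> (\<forall>i\<ge>N. lam i = 0) \<and> (\<Sum>i<N. lam i) = m}"

lemma box_parts_le: "lam \<in> box_parts N m \<Longrightarrow> lam i \<le> m"
proof (cases "i < N")
  case True
  assume "lam \<in> box_parts N m"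
  then show ?thesis using member_le_sum[of i "{..<N}" lam] True by (simp add: box_parts_def)
qed (simp add: box_parts_def)

lemma finite_box_parts [simp]: "finite (box_parts N m)"
proof -
  have "finite {f. \<forall>i. (i \<in> {..<N} \<longrightarrow> f i \<in> {..m}) \<and> (i \<notin> {..<N} \<longrightarrow> f i = (0::nat))}"
    by (rule finite_set_of_finite_funs) auto
  moreover have "box_parts N m \<subseteq> {f. \<forall>i. (i \<in> {..<N} \<longrightarrow> f i \<in> {..m}) \<and> (i \<notin> {..<N} \<longrightarrow> f i = 0)}"
    using box_parts_le by (auto simp: box_parts_def)
  ultimately show ?thesis by (rule finite_subset[rotated])
qed

lemma box_parts_0: "box_parts N 0 = {\<lambda>_. 0}"
proof (intro equalityI subsetI)
  fix lam assume "lam \<in> box_parts N 0"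
  then have "lam i = 0" for i using box_parts_le[of lam N 0 i] by simp
  then show "lam \<in> {\<lambda>_. 0}" by auto
qed (auto simp: box_parts_def antimono_def)

lemma hstrip_antimono: "hstrip lam kap \<Longrightarrow> antimono kap" "hstrip lam kap \<Longrightarrow> antimono lam"
  unfolding antimono_iff_le_Suc hstrip_def by (meson le_trans)+

lemma hstrip_refl: "antimono lam \<Longrightarrow> hstrip lam lam"
  by (simp add: hstrip_def antimono_iff_le_Suc)

lemma hstrip_same_size:
  assumes "hstrip lam kap" "lam \<in> box_parts N m" "kap \<in> box_parts N m" shows "lam = kap"
proof
  fix i
  have "lam i = kap i" if "i < N"
  proof (rule ccontr)
    assume "lam i \<noteq> kap i"
    then have "(\<Sum>i<N. lam i) < (\<Sum>i<N. kap i)"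
      using assms(1) that by (intro sum_strict_mono_ex1) (auto simp: hstrip_def le_neq_implies_less intro!: bexI[of _ i])
    then show False using assms by (simp add: box_parts_def)
  qed
  then show "lam i = kap i" using assms by (cases "i < N") (auto simp: box_parts_def)
qed

lemma hstrip_Suc_size:
  assumes "hstrip lam kap" "lam \<in> box_parts N m" "kap \<in> box_parts N (Suc m)"
  obtains i where "i < N" "kap = lam(i := Suc (lam i))"
proof -
  define d where "d i = kap i - lam i" for i
  have k: "kap i = lam i + d i" for i using assms(1) by (simp add: hstrip_def d_def)
  have "(\<Sum>i<N. lam i) + (\<Sum>i<N. d i) = Suc m" using assms(3) by (simp add: box_parts_def k sum.distrib)
  then have "(\<Sum>i<N. d i) = 1" using assms(2) by (simp add: box_parts_def One_nat_def)
  then obtain i where i: "i < N" "d i = 1" "\<And>j. j < N \<Longrightarrow> j \<noteq> i \<Longrightarrow> d j = 0"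
    by (subst (asm) sum_eq_1_iff) auto
  have "kap j = (lam(i := Suc (lam i))) j" for j
  proof (cases "j < N")
    case True then show ?thesis using k i by (auto simp: One_nat_def)
  next
    case False then show ?thesis using assms i by (auto simp: box_parts_def)
  qed
  then show ?thesis using i that by blast
qed

lemma sum_upd_Suc: "i < N \<Longrightarrow> (\<Sum>j<N. (lam(i := Suc (lam i))) j) = Suc (\<Sum>j<N. lam j)" for lam :: "nat \<Rightarrow> nat"
  by (subst (1 2) sum.remove[of _ i]) auto

definition addable where "addable lam mu = {i. hstrip lam (mu(i := Suc (mu i)))}"
definition removable where "removable lam mu = {i. lam i > 0 \<and> hstrip (lam(i := lam i - 1)) mu}"

text \<open>Row \<open>Suc j\<close> can receive a box iff \<open>mu (Suc j) < lam j\<close>, which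
  is also the condition for row \<open>j\<close> of \<open>lam\<close> to lose one. Row 0 can always
  receive a box and has no partner.\<close>

lemma addable_removable_strip:
  assumes "hstrip lam mu" shows "addable lam mu = insert 0 (Suc ` removable lam mu)"
proof (rule Set.set_eqI)
  fix i
  have h: "lam j \<le> mu j" "mu (Suc j) \<le> lam j" for j using assms by (auto simp: hstrip_def)
  show "i \<in> addable lam mu \<longleftrightarrow> i \<in> insert 0 (Suc ` removable lam mu)"
  proof (cases i)
    case 0
    have "hstrip lam (mu(0 := Suc (mu 0)))" using h by (auto simp: hstrip_def intro: le_SucI)
    then show ?thesis using 0 by (simp add: addable_def)
  next
    case (Suc j)
    have "hstrip lam (mu(i := Suc (mu i))) \<longleftrightarrow> mu (Suc j) < lam j"
      using h unfolding hstrip_def Suc by (auto simp: Suc_le_eq le_SucI)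
    moreover have "lam j > 0 \<and> hstrip (lam(j := lam j - 1)) mu \<longleftrightarrow> mu (Suc j) < lam j"
    proof
      assume a: "lam j > 0 \<and> hstrip (lam(j := lam j - 1)) mu"
      then have "mu (Suc j) \<le> lam j - 1" unfolding hstrip_def by (metis fun_upd_same)
      then show "mu (Suc j) < lam j" using conjunct1[OF a] by linarith
    next
      assume a: "mu (Suc j) < lam j"
      have "hstrip (lam(j := lam j - 1)) mu"
        unfolding hstrip_def
      proof (intro allI conjI)
        fix i
        show "(lam(j := lam j - 1)) i \<le> mu i" using h(1)[of i] by auto
        show "mu (Suc i) \<le> (lam(j := lam j - 1)) i" using h(2)[of i] a by auto
      qed
      then show "lam j > 0 \<and> hstrip (lam(j := lam j - 1)) mu" using a by simp
    qed
    ultimately show ?thesis unfolding addable_def removable_def Suc by auto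
  qed
qed

text \<open>A single box can repair a failing strip only in the one row where \<open>lam\<close>
  exceeds \<open>mu\<close> by 1, and there adding to \<open>mu\<close> and removing from
  \<open>lam\<close> work equally well.\<close>

lemma addable_removable_no_strip:
  assumes nh: "\<not> hstrip lam mu" and am: "antimono lam" "antimono mu" shows "addable lam mu = removable lam mu"
proof (rule Set.set_eqI, rule iffI)
  fix i assume "i \<in> addable lam mu"
  then have H: "lam j \<le> (mu(i := Suc (mu i))) j" "(mu(i := Suc (mu i))) (Suc j) \<le> lam j" for j
    by (auto simp: addable_def hstrip_def)
  have H2: "mu (Suc j) \<le> lam j" for j using H(2)[of j] by (auto split: if_splits)
  have eq: "lam i = Suc (mu i)"
  proof (rule ccontr)
    assume "lam i \<noteq> Suc (mu i)"
    then have "lam j \<le> mu j" for j using H(1)[of j] H(1)[of i] by (cases "j = i") auto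
    then show False using nh H2 by (auto simp: hstrip_def)
  qed
  have "hstrip (lam(i := lam i - 1)) mu"
    unfolding hstrip_def
  proof (intro allI conjI)
    fix j
    show "(lam(i := lam i - 1)) j \<le> mu j" using H(1)[of j] eq by auto
    show "mu (Suc j) \<le> (lam(i := lam i - 1)) j" using H2[of j] eq am(2) by (auto simp: antimono_iff_le_Suc)
  qed
  then show "i \<in> removable lam mu" using eq by (simp add: removable_def)
next
  fix i assume "i \<in> removable lam mu"
  then have pos: "lam i > 0" and H: "(lam(i := lam i - 1)) j \<le> mu j" "mu (Suc j) \<le> (lam(i := lam i - 1)) j" for j
    by (auto simp: removable_def hstrip_def)
  have H2: "mu (Suc j) \<le> lam j" for j using H(2)[of j] by (auto split: if_splits)
  have eq: "lam i = Suc (mu i)"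
  proof (rule ccontr)
    assume "lam i \<noteq> Suc (mu i)"
    then have "lam j \<le> mu j" for j using H(1)[of j] H(1)[of i] by (cases "j = i") auto
    then show False using nh H2 by (auto simp: hstrip_def)
  qed
  have "hstrip lam (mu(i := Suc (mu i)))"
    unfolding hstrip_def
  proof (intro allI conjI)
    fix j
    show "lam j \<le> (mu(i := Suc (mu i))) j" using H(1)[of j] eq by (auto split: if_splits)
    show "(mu(i := Suc (mu i))) (Suc j) \<le> lam j"
      using H2[of j] eq antimonoD[OF am(1), of j "Suc j"] by (cases "Suc j = i") auto
  qed
  then show "i \<in> addable lam mu" by (simp add: addable_def)
qed

text \<open>A box above row \<open>N - 1\<close> would need all \<open>N\<close> rows of
  \<open>lam\<close> to be nonempty, but \<open>lam\<close> has fewer than \<open>N\<close>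
  boxes.\<close>

lemma addable_less:
  assumes "lam \<in> box_parts N s" "mu \<in> box_parts N m" "s < N" "i \<in> addable lam mu" shows "i < N"
proof (rule ccontr)
  assume "\<not> i < N"
  then have "N \<le> i" by simp
  have h: "hstrip lam (mu(i := Suc (mu i)))" using assms(4) by (simp add: addable_def)
  obtain j where j: "i = Suc j" using \<open>N \<le> i\<close> assms(3) by (cases i) auto
  have "Suc (mu i) \<le> lam j" using h unfolding hstrip_def j by (metis fun_upd_same)
  then have pos: "lam j \<ge> 1" by (simp add: One_nat_def)
  then have "j < N" using assms(1) by (metis (mono_tags, lifting) box_parts_def mem_Collect_eq not_less not_one_le_zero)
  then have "j = N - 1" using j \<open>N \<le> i\<close> by simp
  then have "lam k \<ge> 1" if "k < N" for k
  proof -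
    have "k \<le> j" using that \<open>j = N - 1\<close> by simp
    then have "lam j \<le> lam k" using assms(1) by (auto simp: box_parts_def dest: antimonoD)
    then show ?thesis using pos by simp
  qed
  then have "(\<Sum>k<N. 1) \<le> (\<Sum>k<N. lam k)" by (intro sum_mono) auto
  then show False using assms(1,3) by (simp add: box_parts_def)
qed

text \<open>Removing a box after adding a strip of \<open>r + 1\<close> boxes is the same as
  removing it before, plus adding a strip of only \<open>r\<close> boxes. Both sides are counted by
  addable and removable rows. The condition on the sum of \<open>rho\<close> forces \<open>s\<close>
  to be positive; for \<open>s = 0\<close> the truncated \<open>s - 1\<close> would let the empty
  shape in.\<close>

lemma local_rule:
  assumes lam: "lam \<in> box_parts N s" and mu: "mu \<in> box_parts N (s + r)" and N: "s < N"
  shows "card {kap \<in> box_parts N (Suc (s + r)). hstrip mu kap \<and> hstrip lam kap}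
       = card {rho. Suc (\<Sum>i<N. rho i) = s \<and> rho \<in> box_parts N (s - 1) \<and> hstrip rho lam \<and> hstrip rho mu} + (if hstrip lam mu then 1 else 0)"
proof -
  have am: "antimono lam" "antimono mu" and supp: "\<And>i. i \<ge> N \<Longrightarrow> lam i = 0" "\<And>i. i \<ge> N \<Longrightarrow> mu i = 0"
    using lam mu by (auto simp: box_parts_def)
  have "{kap \<in> box_parts N (Suc (s + r)). hstrip mu kap \<and> hstrip lam kap} = (\<lambda>i. mu(i := Suc (mu i))) ` addable lam mu"
  proof (intro equalityI subsetI)
    fix kap assume "kap \<in> {kap \<in> box_parts N (Suc (s + r)). hstrip mu kap \<and> hstrip lam kap}"
    then have k: "kap \<in> box_parts N (Suc (s + r))" "hstrip mu kap" "hstrip lam kap" by auto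
    from hstrip_Suc_size[OF k(2) mu k(1)] obtain i where "kap = mu(i := Suc (mu i))" by blast
    then show "kap \<in> (\<lambda>i. mu(i := Suc (mu i))) ` addable lam mu" using k(3) by (auto simp: addable_def)
  next
    fix kap assume "kap \<in> (\<lambda>i. mu(i := Suc (mu i))) ` addable lam mu"
    then obtain i where i: "i \<in> addable lam mu" and kap: "kap = mu(i := Suc (mu i))" by blast
    have iN: "i < N" using addable_less[OF lam mu N i] .
    have h: "hstrip lam kap" using i kap by (simp add: addable_def)
    have "kap (Suc j) \<le> mu j" for j
    proof (cases "Suc j = i")
      case True
      have "kap (Suc j) \<le> lam j" using h by (simp add: hstrip_def)
      also have "\<dots> \<le> kap j" using h by (simp add: hstrip_def)
      also have "kap j = mu j" using True kap by auto
      finally show ?thesis .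
    next
      case False then show ?thesis using am(2) kap by (simp add: antimono_iff_le_Suc)
    qed
    then have "hstrip mu kap" using kap by (auto simp: hstrip_def)
    moreover have "kap \<in> box_parts N (Suc (s + r))"
      using hstrip_antimono(1)[OF h] supp iN mu sum_upd_Suc[OF iN, of mu] unfolding box_parts_def kap by auto
    ultimately show "kap \<in> {kap \<in> box_parts N (Suc (s + r)). hstrip mu kap \<and> hstrip lam kap}" using h by simp
  qed
  moreover have "inj_on (\<lambda>i. mu(i := Suc (mu i))) (addable lam mu)"
    by (rule inj_onI) (metis fun_upd_def n_not_Suc_n)
  ultimately have A: "card {kap \<in> box_parts N (Suc (s + r)). hstrip mu kap \<and> hstrip lam kap} = card (addable lam mu)"
    by (simp add: card_image)
  have "{rho. Suc (\<Sum>i<N. rho i) = s \<and> rho \<in> box_parts N (s - 1) \<and> hstrip rho lam \<and> hstrip rho mu} = (\<lambda>i. lam(i := lam i - 1)) ` removable lam mu"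
  proof (intro equalityI subsetI)
    fix rho assume "rho \<in> {rho. Suc (\<Sum>i<N. rho i) = s \<and> rho \<in> box_parts N (s - 1) \<and> hstrip rho lam \<and> hstrip rho mu}"
    then have k: "Suc (\<Sum>i<N. rho i) = s" "rho \<in> box_parts N (s - 1)" "hstrip rho lam" "hstrip rho mu" by auto
    have "lam \<in> box_parts N (Suc (s - 1))" using lam k(1) by auto
    from hstrip_Suc_size[OF k(3,2) this] obtain i where "lam = rho(i := Suc (rho i))" by blast
    then have "lam i > 0" "rho = lam(i := lam i - 1)" by auto
    then show "rho \<in> (\<lambda>i. lam(i := lam i - 1)) ` removable lam mu" using k(4) by (auto simp: removable_def)
  next
    fix rho assume "rho \<in> (\<lambda>i. lam(i := lam i - 1)) ` removable lam mu"
    then obtain i where i: "i \<in> removable lam mu" and rho: "rho = lam(i := lam i - 1)" by blast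
    have pos: "lam i > 0" and h: "hstrip rho mu" using i rho by (auto simp: removable_def)
    have iN: "i < N" using supp(1)[of i] pos by (metis not_less_zero not_le)
    have l: "lam = rho(i := Suc (rho i))" using pos rho by auto
    have s: "Suc (\<Sum>i<N. rho i) = s" using sum_upd_Suc[OF iN, of rho] lam l by (simp add: box_parts_def)
    have "lam (Suc j) \<le> rho j" for j
    proof (cases "j = i")
      case True
      have "lam (Suc j) = rho (Suc j)" using True rho by simp
      also have "\<dots> \<le> mu (Suc j)" using h by (simp add: hstrip_def)
      also have "\<dots> \<le> rho j" using h by (simp add: hstrip_def)
      finally show ?thesis .
    next
      case False then show ?thesis using am(1) rho by (simp add: antimono_iff_le_Suc)
    qed
    then have "hstrip rho lam" using rho by (auto simp: hstrip_def)
    moreover have "rho \<in> box_parts N (s - 1)"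
      using hstrip_antimono(2)[OF h] supp s unfolding box_parts_def rho by auto
    ultimately show "rho \<in> {rho. Suc (\<Sum>i<N. rho i) = s \<and> rho \<in> box_parts N (s - 1) \<and> hstrip rho lam \<and> hstrip rho mu}" using h s by simp
  qed
  moreover have "inj_on (\<lambda>i. lam(i := lam i - 1)) (removable lam mu)"
    by (rule inj_onI) (metis (mono_tags, lifting) removable_def One_nat_def diff_Suc_less fun_upd_other fun_upd_same less_irrefl mem_Collect_eq)
  ultimately have B: "card {rho. Suc (\<Sum>i<N. rho i) = s \<and> rho \<in> box_parts N (s - 1) \<and> hstrip rho lam \<and> hstrip rho mu} = card (removable lam mu)"
    by (simp add: card_image)
  have fin: "finite (addable lam mu)" using addable_less[OF lam mu N] finite_subset[of "addable lam mu" "{..<N}"] by blast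
  show ?thesis
  proof (cases "hstrip lam mu")
    case True
    note e = addable_removable_strip[OF True]
    have "finite (removable lam mu)" using fin unfolding e by (simp add: finite_image_iff)
    then have "card (addable lam mu) = Suc (card (removable lam mu))"
      unfolding e by (subst card_insert_disjoint) (auto simp: card_image)
    then show ?thesis using A B True by (simp add: One_nat_def)
  next
    case False
    then show ?thesis using A B addable_removable_no_strip[OF False am] by simp
  qed
qed

text \<open>Kostka numbers, by removing the horizontal strip of the largest entry: the list is the content in
  reverse, the function the row lengths, \<open>N\<close> a bound on the number of rows.\<close>

fun kostka :: "nat \<Rightarrow> nat list \<Rightarrow> (nat \<Rightarrow> nat) \<Rightarrow> nat" where
  "kostka N [] kap = (if kap = (\<lambda>_. 0) then 1 else 0)"
| "kostka N (r # al) kap = (\<Sum>lam\<in>box_parts N (sum_list al). if hstrip lam kap then kostka N al lam else 0)"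

definition decr_at :: "nat list \<Rightarrow> nat \<Rightarrow> nat list" where "decr_at al j = al[j := al ! j - 1]"
definition positive_parts :: "nat list \<Rightarrow> nat set" where "positive_parts al = {j. j < length al \<and> al ! j > 0}"

lemma finite_positive_parts [simp]: "finite (positive_parts al)" by (simp add: positive_parts_def)

lemma positive_parts_Cons: "positive_parts (r # al) = (if r > 0 then {0} else {}) \<union> Suc ` positive_parts al"
proof -
  have "j \<in> positive_parts (r # al) \<longleftrightarrow> j \<in> (if r > 0 then {0} else {}) \<union> Suc ` positive_parts al" for j
    by (cases j) (auto simp: positive_parts_def)
  then show ?thesis by blast
qed

lemma decr_at_Cons [simp]: "decr_at (r # al) 0 = (r - 1) # al" "decr_at (r # al) (Suc j) = r # decr_at al j"
  by (simp_all add: decr_at_def)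

lemma sum_list_decr_at: "j \<in> positive_parts al \<Longrightarrow> Suc (sum_list (decr_at al j)) = sum_list al"
proof (induction al arbitrary: j)
  case (Cons r al)
  then show ?case by (cases j) (auto simp: positive_parts_def)
qed (simp add: positive_parts_def)

lemma positive_parts_empty: "positive_parts al = {} \<longleftrightarrow> sum_list al = 0"
  by (induction al) (auto simp: positive_parts_Cons positive_parts_def[of "[]"])

lemma sum_positive_parts_Cons: "(\<Sum>j\<in>positive_parts (r # al). g (decr_at (r # al) j)) = (if r > 0 then g ((r - 1) # al) else 0) + (\<Sum>j\<in>positive_parts al. g (r # decr_at al j))"
  unfolding positive_parts_Cons by (subst sum.union_disjoint) (auto simp: sum.reindex)

text \<open>Lowering a part can produce an empty strip, which changes nothing.\<close>

lemma kostka_0: "kap \<in> box_parts N (sum_list al) \<Longrightarrow> kostka N (0 # al) kap = kostka N al kap"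
proof -
  assume k: "kap \<in> box_parts N (sum_list al)"
  have "kostka N (0 # al) kap = (\<Sum>lam\<in>{kap}. if hstrip lam kap then kostka N al lam else 0)"
    unfolding kostka.simps by (rule sum.mono_neutral_right) (use k hstrip_same_size in \<open>auto\<close>)
  then show ?thesis using k hstrip_refl by (simp add: box_parts_def)
qed

text \<open>The removal of a box is pushed through the strips one by one with
  \<open>local_rule\<close>: at each strip it either passes on or shortens that strip by 1.\<close>

lemma kostka_down:
  "sum_list al = Suc m \<Longrightarrow> Suc m < N \<Longrightarrow> mu \<in> box_parts N m \<Longrightarrow>
   (\<Sum>kap\<in>box_parts N (Suc m). if hstrip mu kap then kostka N al kap else 0) = (\<Sum>j\<in>positive_parts al. kostka N (decr_at al j) mu)"
proof (induction al arbitrary: m mu)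
  case (Cons r al)
  let ?s = "sum_list al"
  show ?case
  proof (cases r)
    case 0
    then have s: "?s = Suc m" using Cons.prems by simp
    have d: "kostka N (0 # decr_at al j) mu = kostka N (decr_at al j) mu" if "j \<in> positive_parts al" for j
      by (rule kostka_0) (use sum_list_decr_at[OF that] s Cons.prems in simp)
    have "(\<Sum>kap\<in>box_parts N (Suc m). if hstrip mu kap then kostka N (r # al) kap else 0) = (\<Sum>kap\<in>box_parts N (Suc m). if hstrip mu kap then kostka N al kap else 0)"
      unfolding 0 using s kostka_0[of _ N al] by (intro sum.cong) (simp_all del: kostka.simps)
    also have "\<dots> = (\<Sum>j\<in>positive_parts al. kostka N (decr_at al j) mu)" by (rule Cons.IH[OF s Cons.prems(2,3)])
    also have "\<dots> = (\<Sum>j\<in>positive_parts (r # al). kostka N (decr_at (r # al) j) mu)"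
    proof -
      have "(\<Sum>j\<in>positive_parts (r # al). kostka N (decr_at (r # al) j) mu) = (\<Sum>j\<in>positive_parts al. kostka N (r # decr_at al j) mu)"
        unfolding sum_positive_parts_Cons[where g = "\<lambda>a. kostka N a mu"] 0 by (simp del: kostka.simps)
      then show ?thesis unfolding 0 using d by (metis (mono_tags, lifting) sum.cong)
    qed
    finally show ?thesis .
  next
    case (Suc r')
    then have m: "m = ?s + r'" and sN: "?s < N" using Cons.prems by auto
    let ?R = "\<lambda>lam. {rho. Suc (\<Sum>i<N. rho i) = ?s \<and> rho \<in> box_parts N (?s - 1) \<and> hstrip rho lam \<and> hstrip rho mu}"
    have "(\<Sum>kap\<in>box_parts N (Suc m). if hstrip mu kap then kostka N (r # al) kap else 0)
        = (\<Sum>kap\<in>box_parts N (Suc m). \<Sum>lam\<in>box_parts N ?s. if hstrip mu kap \<and> hstrip lam kap then kostka N al lam else 0)"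
      by (intro sum.cong refl) (auto simp: intro!: sum.cong sum.neutral)
    also have "\<dots> = (\<Sum>lam\<in>box_parts N ?s. \<Sum>kap\<in>box_parts N (Suc m). if hstrip mu kap \<and> hstrip lam kap then kostka N al lam else 0)"
      by (rule sum.swap)
    also have "\<dots> = (\<Sum>lam\<in>box_parts N ?s. card {kap\<in>box_parts N (Suc m). hstrip mu kap \<and> hstrip lam kap} * kostka N al lam)"
      by (intro sum.cong refl) (simp add: sum.If_cases Int_def conj_commute)
    \<comment> \<open>The first summand is the removal passing to the earlier strips, the second the
      shortening of the outermost strip from \<open>r\<close> to \<open>r'\<close>.\<close>
    also have "\<dots> = (\<Sum>lam\<in>box_parts N ?s. card (?R lam) * kostka N al lam + (if hstrip lam mu then kostka N al lam else 0))"
      using local_rule[of _ N ?s mu r'] sN Cons.prems(3) unfolding m by (intro sum.cong refl) (simp add: distrib_right)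
    also have "\<dots> = (\<Sum>lam\<in>box_parts N ?s. card (?R lam) * kostka N al lam) + kostka N (r' # al) mu"
      by (simp add: sum.distrib)
    also have "(\<Sum>lam\<in>box_parts N ?s. card (?R lam) * kostka N al lam) = (\<Sum>j\<in>positive_parts al. kostka N (r # decr_at al j) mu)"
    proof (cases ?s)
      case 0
      have Re: "card (?R lam) = 0" for lam unfolding 0 by simp
      have pe: "positive_parts al = {}" using 0 positive_parts_empty by blast
      show ?thesis unfolding Re pe by simp
    next
      case s: (Suc s')
      have R: "?R lam = {rho \<in> box_parts N s'. hstrip rho lam \<and> hstrip rho mu}" for lam using s by (auto simp: box_parts_def)
      have "(\<Sum>lam\<in>box_parts N ?s. card (?R lam) * kostka N al lam)
          = (\<Sum>lam\<in>box_parts N ?s. \<Sum>rho\<in>box_parts N s'. if hstrip rho mu \<and> hstrip rho lam then kostka N al lam else 0)"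
        unfolding R by (intro sum.cong refl) (simp add: sum.If_cases Int_def conj_commute)
      also have "\<dots> = (\<Sum>rho\<in>box_parts N s'. \<Sum>lam\<in>box_parts N ?s. if hstrip rho mu \<and> hstrip rho lam then kostka N al lam else 0)"
        by (rule sum.swap)
      also have "\<dots> = (\<Sum>rho\<in>box_parts N s'. if hstrip rho mu then (\<Sum>lam\<in>box_parts N (Suc s'). if hstrip rho lam then kostka N al lam else 0) else 0)"
        unfolding s by (intro sum.cong refl) (auto intro!: sum.neutral)
      also have "\<dots> = (\<Sum>rho\<in>box_parts N s'. if hstrip rho mu then (\<Sum>j\<in>positive_parts al. kostka N (decr_at al j) rho) else 0)"
        using Cons.IH[OF s] sN s by (intro sum.cong refl) auto
      also have "\<dots> = (\<Sum>rho\<in>box_parts N s'. \<Sum>j\<in>positive_parts al. if hstrip rho mu then kostka N (decr_at al j) rho else 0)"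
        by (intro sum.cong refl) auto
      also have "\<dots> = (\<Sum>j\<in>positive_parts al. \<Sum>rho\<in>box_parts N s'. if hstrip rho mu then kostka N (decr_at al j) rho else 0)"
        by (rule sum.swap)
      also have "\<dots> = (\<Sum>j\<in>positive_parts al. kostka N (r # decr_at al j) mu)"
      proof (rule sum.cong[OF refl])
        fix j assume "j \<in> positive_parts al"
        then have "sum_list (decr_at al j) = s'" using sum_list_decr_at s by (metis nat.inject)
        then show "(\<Sum>rho\<in>box_parts N s'. if hstrip rho mu then kostka N (decr_at al j) rho else 0) = kostka N (r # decr_at al j) mu" by simp
      qed
      finally show ?thesis .
    qed
    finally show ?thesis unfolding sum_positive_parts_Cons[where g = "\<lambda>a. kostka N a mu"] using Suc by (simp del: kostka.simps)
  qed
qed simp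

text \<open>The content of ones gives the number of standard tableaux, so this counts the pairs of a
  standard and a semistandard tableau of equal shape, as in RSK.\<close>

definition kostka_sum :: "nat \<Rightarrow> nat list \<Rightarrow> nat" where
  "kostka_sum N al = (\<Sum>kap\<in>box_parts N (sum_list al). kostka N (replicate (sum_list al) 1) kap * kostka N al kap)"

text \<open>The largest entry of the standard tableau is a removed box, and
  \<open>kostka_down\<close> transfers its removal to the content. This is the recursion of
  multinomial coefficients.\<close>

lemma kostka_sum_rec:
  assumes "sum_list al = Suc m" "Suc m < N" shows "kostka_sum N al = (\<Sum>j\<in>positive_parts al. kostka_sum N (decr_at al j))"
proof -
  let ?o = "\<lambda>m. replicate m 1"
  have o: "sum_list (?o m) = m" for m by (simp add: sum_list_replicate)
  have "kostka_sum N al = (\<Sum>kap\<in>box_parts N (Suc m). \<Sum>mu\<in>box_parts N m. kostka N (?o m) mu * (if hstrip mu kap then kostka N al kap else 0))"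
    unfolding kostka_sum_def assms(1) by (intro sum.cong refl) (auto simp: o sum_distrib_right intro!: sum.cong)
  also have "\<dots> = (\<Sum>mu\<in>box_parts N m. kostka N (?o m) mu * (\<Sum>kap\<in>box_parts N (Suc m). if hstrip mu kap then kostka N al kap else 0))"
    by (subst sum.swap) (simp add: sum_distrib_left)
  also have "\<dots> = (\<Sum>mu\<in>box_parts N m. \<Sum>j\<in>positive_parts al. kostka N (?o m) mu * kostka N (decr_at al j) mu)"
    using kostka_down[OF assms] by (intro sum.cong refl) (simp add: sum_distrib_left)
  also have "\<dots> = (\<Sum>j\<in>positive_parts al. kostka_sum N (decr_at al j))"
    unfolding kostka_sum_def using sum_list_decr_at[of _ al] assms(1) by (subst sum.swap, intro sum.cong refl) auto
  finally show ?thesis .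
qed

lemma kostka_sum_0: "sum_list al = 0 \<Longrightarrow> kostka_sum N al = 1"
proof -
  assume s: "sum_list al = 0"
  have "kostka N al (\<lambda>_. 0) = 1" using s
  proof (induction al)
    case (Cons r al)
    then have "sum_list al = 0" "kostka N al (\<lambda>_. 0) = 1" by auto
    then show ?case unfolding kostka.simps by (simp only: box_parts_0) (simp add: hstrip_def)
  qed simp
  then show ?thesis by (simp add: kostka_sum_def s box_parts_0)
qed

section \<open>Words of given content\<close>

definition content_words :: "nat list \<Rightarrow> nat list set" where
  "content_words al = {w. set w \<subseteq> {..<length al} \<and> (\<forall>j<length al. count_list w j = al ! j)}"

lemma content_words_length: "w \<in> content_words al \<Longrightarrow> length w = sum_list al"
proof -
  assume w: "w \<in> content_words al"
  have "length w = sum (count_list w) {..<length al}"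
    using w by (intro sum_count_set[symmetric]) (auto simp: content_words_def)
  also have "\<dots> = sum_list al" using w by (auto simp: content_words_def sum_list_sum_nth atLeast0LessThan intro!: sum.cong)
  finally show ?thesis .
qed

text \<open>Splitting off the first letter gives the recursion of
  \<open>kostka_sum_rec\<close>.\<close>

lemma card_content_words: "sum_list al < N \<Longrightarrow> finite (content_words al) \<and> card (content_words al) = kostka_sum N al"
proof (induction "sum_list al" arbitrary: al)
  case 0
  have "content_words al = {[]}"
  proof (intro equalityI subsetI)
    fix w assume "w \<in> content_words al" then show "w \<in> {[]}" using content_words_length[of w al] 0 by simp
  next
    fix w :: "nat list" assume "w \<in> {[]}"
    moreover have "al ! j = 0" if "j < length al" for j using 0 that by (metis nth_mem sum_list_eq_0_iff)
    ultimately show "w \<in> content_words al" by (simp add: content_words_def)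
  qed
  then show ?case using kostka_sum_0 0 by simp
next
  case (Suc m)
  have e: "content_words al = (\<Union>j\<in>positive_parts al. Cons j ` content_words (decr_at al j))"
  proof (intro equalityI subsetI)
    fix w assume w: "w \<in> content_words al"
    have "length w = Suc m" using content_words_length[OF w] Suc(2) by simp
    then obtain j w' where jw: "w = j # w'" by (auto simp: length_Suc_conv)
    then have j: "j < length al" "al ! j = Suc (count_list w' j)" using w by (auto simp: content_words_def)
    then have "w' \<in> content_words (decr_at al j)" using w jw by (auto simp: content_words_def decr_at_def nth_list_update)
    then show "w \<in> (\<Union>j\<in>positive_parts al. Cons j ` content_words (decr_at al j))" using j jw by (auto simp: positive_parts_def)
  next
    fix w assume "w \<in> (\<Union>j\<in>positive_parts al. Cons j ` content_words (decr_at al j))"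
    then obtain j w' where "j \<in> positive_parts al" "w = j # w'" "w' \<in> content_words (decr_at al j)" by blast
    then show "w \<in> content_words al" by (auto simp: content_words_def decr_at_def positive_parts_def nth_list_update split: if_splits)
  qed
  have IH: "finite (content_words (decr_at al j)) \<and> card (content_words (decr_at al j)) = kostka_sum N (decr_at al j)" if "j \<in> positive_parts al" for j
    using sum_list_decr_at[OF that] Suc by (intro Suc(1)) auto
  have "card (content_words al) = (\<Sum>j\<in>positive_parts al. card (Cons j ` content_words (decr_at al j)))"
    unfolding e by (rule card_UN_disjoint) (use IH in auto)
  also have "\<dots> = (\<Sum>j\<in>positive_parts al. kostka_sum N (decr_at al j))" using IH by (intro sum.cong refl) (simp add: card_image)
  also have "\<dots> = kostka_sum N al" using kostka_sum_rec[of al m N] Suc by simp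
  finally show ?case using IH e by auto
qed

section \<open>Tableaux from lattice words\<close>

text \<open>The letter at a position is the row of the corresponding entry. A strip is to be
  numbered from left to right, that is from its topmost row downwards, hence \<open>rev\<close>; so
  no descent arises inside it.\<close>

definition strip_word :: "nat \<Rightarrow> (nat \<Rightarrow> nat) \<Rightarrow> (nat \<Rightarrow> nat) \<Rightarrow> nat list" where
  "strip_word N lam kap = concat (map (\<lambda>i. replicate (kap i - lam i) i) (rev [0..<N]))"

lemma count_list_replicate: "count_list (replicate m x) y = (if x = y then m else 0)"
  by (induction m) auto

lemma count_strip_word: "count_list (strip_word N lam kap) i = (if i < N then kap i - lam i else 0)"
  by (induction N) (auto simp: strip_word_def count_list_append count_list_replicate less_Suc_eq)

lemma sorted_strip_word: "sorted_wrt (\<ge>) (strip_word N lam kap)"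
proof (induction N)
  case (Suc N)
  have "x < N" if "x \<in> set (strip_word N lam kap)" for x
    using that by (auto simp: strip_word_def)
  moreover have "sorted_wrt (\<ge>) (replicate m N)" for m by (induction m) auto
  moreover have "strip_word (Suc N) lam kap = replicate (kap N - lam N) N @ strip_word N lam kap" by (simp add: strip_word_def)
  ultimately show ?case using Suc by (auto simp: sorted_wrt_append intro: less_imp_le)
qed (simp add: strip_word_def)

fun strip_words :: "nat \<Rightarrow> nat list \<Rightarrow> (nat \<Rightarrow> nat) \<Rightarrow> nat list set" where
  "strip_words N [] kap = (if kap = (\<lambda>_. 0) then {[]} else {})"
| "strip_words N (r # al) kap = (\<Union>lam\<in>{lam \<in> box_parts N (sum_list al). hstrip lam kap}. (\<lambda>w. w @ strip_word N lam kap) ` strip_words N al lam)"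

lemma strip_words_count: "kap \<in> box_parts N (sum_list al) \<Longrightarrow> w \<in> strip_words N al kap \<Longrightarrow> count_list w i = kap i"
proof (induction al arbitrary: w kap)
  case (Cons r al)
  then obtain lam w' where l: "lam \<in> box_parts N (sum_list al)" "hstrip lam kap" "w' \<in> strip_words N al lam" "w = w' @ strip_word N lam kap" by auto
  have "count_list w' i = lam i" using Cons.IH l by blast
  moreover have "lam i \<le> kap i" using l by (simp add: hstrip_def)
  moreover have "i \<ge> N \<Longrightarrow> lam i = 0 \<and> kap i = 0" using l(1) Cons.prems by (simp add: box_parts_def)
  ultimately show ?case unfolding l(4) by (auto simp: count_list_append count_strip_word)
qed (auto split: if_splits)

lemma strip_words_length:
  assumes "kap \<in> box_parts N (sum_list al)" "w \<in> strip_words N al kap" shows "length w = sum_list al"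
proof -
  have "set w \<subseteq> {..<N}"
  proof
    fix x assume "x \<in> set w"
    then have "count_list w x \<noteq> 0" by (simp add: count_list_0_iff)
    then have "kap x \<noteq> 0" using strip_words_count[OF assms, of x] by simp
    moreover have "x \<ge> N \<Longrightarrow> kap x = 0" using assms(1) by (simp add: box_parts_def)
    ultimately show "x \<in> {..<N}" by (meson lessThan_iff not_le)
  qed
  then have "length w = (\<Sum>i<N. count_list w i)" by (simp only: sum_count_set finite_lessThan)
  also have "\<dots> = sum_list al" using strip_words_count[OF assms] assms(1) by (simp add: box_parts_def)
  finally show ?thesis .
qed

text \<open>The last strip can be recovered: the content fixes the length of the word before it, and
  the letter counts of that word are the inner shape. So the union is disjoint.\<close>

lemma card_strip_words: "kap \<in> box_parts N (sum_list al) \<Longrightarrow> finite (strip_words N al kap) \<and> card (strip_words N al kap) = kostka N al kap"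
proof (induction al arbitrary: kap)
  case (Cons r al)
  let ?L = "{lam \<in> box_parts N (sum_list al). hstrip lam kap}"
  have IH: "finite (strip_words N al lam) \<and> card (strip_words N al lam) = kostka N al lam" if "lam \<in> ?L" for lam using Cons.IH that by blast
  have inj: "inj_on (\<lambda>w. w @ strip_word N lam kap) (strip_words N al lam)" for lam by (rule inj_onI) simp
  have "card (strip_words N (r # al) kap) = (\<Sum>lam\<in>?L. card ((\<lambda>w. w @ strip_word N lam kap) ` strip_words N al lam))"
    unfolding strip_words.simps
  proof (rule card_UN_disjoint)
    show "\<forall>i\<in>?L. \<forall>j\<in>?L. i \<noteq> j \<longrightarrow> (\<lambda>w. w @ strip_word N i kap) ` strip_words N al i \<inter> (\<lambda>w. w @ strip_word N j kap) ` strip_words N al j = {}"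
    proof (intro ballI impI, rule ccontr)
      fix i j assume ij: "i \<in> ?L" "j \<in> ?L" "i \<noteq> j" "(\<lambda>w. w @ strip_word N i kap) ` strip_words N al i \<inter> (\<lambda>w. w @ strip_word N j kap) ` strip_words N al j \<noteq> {}"
      then obtain u v where uv: "u \<in> strip_words N al i" "v \<in> strip_words N al j" "u @ strip_word N i kap = v @ strip_word N j kap" by auto
      then have "u = v" using strip_words_length[of i N al u] strip_words_length[of j N al v] ij by auto
      then have "i x = j x" for x using strip_words_count[of i N al u x] strip_words_count[of j N al v x] ij uv by auto
      then show False using ij(3) by auto
    qed
  qed (use IH in auto)
  also have "\<dots> = (\<Sum>lam\<in>?L. kostka N al lam)" using IH inj by (intro sum.cong refl) (simp add: card_image)
  also have "\<dots> = kostka N (r # al) kap" by (simp add: sum.If_cases Int_def)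
  finally show ?case using IH by auto
qed simp

definition lattice :: "nat list \<Rightarrow> bool" where
  "lattice w \<longleftrightarrow> (\<forall>k r. count_list (take k w) (Suc r) \<le> count_list (take k w) r)"

lemma count_list_take_le: "count_list (take k w) x \<le> count_list w x"
  by (metis append_take_drop_id count_list_append le_add1)

text \<open>A prefix that reaches into the last strip contains \<open>r\<close> at least
  \<open>lam r\<close> times and \<open>Suc r\<close> at most \<open>kap (Suc r)\<close> times, and
  a horizontal strip has \<open>kap (Suc r) \<le> lam r\<close>.\<close>

lemma strip_words_lattice: "kap \<in> box_parts N (sum_list al) \<Longrightarrow> w \<in> strip_words N al kap \<Longrightarrow> lattice w"
proof (induction al arbitrary: w kap)
  case Nil
  then show ?case by (auto simp: lattice_def split: if_splits)
next
  case (Cons r al)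
  then obtain lam w' where l: "lam \<in> box_parts N (sum_list al)" "hstrip lam kap" "w' \<in> strip_words N al lam" "w = w' @ strip_word N lam kap" by auto
  have w': "lattice w'" using Cons.IH l by blast
  show ?case unfolding lattice_def
  proof (intro allI)
    fix k r
    show "count_list (take k w) (Suc r) \<le> count_list (take k w) r"
    proof (cases "k \<le> length w'")
      case True
      then show ?thesis using w' l(4) by (simp add: lattice_def)
    next
      case False
      then have "count_list w' x \<le> count_list (take k w) x" for x by (simp add: l(4) count_list_append)
      then have "lam r \<le> count_list (take k w) r" using strip_words_count[OF l(1,3)] by metis
      moreover have "count_list (take k w) (Suc r) \<le> kap (Suc r)"
        using count_list_take_le[of k w "Suc r"] strip_words_count[OF Cons.prems] by simp
      moreover have "kap (Suc r) \<le> lam r" using l(2) by (simp add: hstrip_def)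
      ultimately show ?thesis by simp
    qed
  qed
qed

text \<open>The content is listed in reverse, so the head is the multiplicity of the largest value,
  which equals the length of the tail.\<close>

fun sorted_content :: "nat list \<Rightarrow> nat list" where
  "sorted_content [] = []"
| "sorted_content (r # al) = sorted_content al @ replicate r (length al)"

lemma length_sorted_content [simp]: "length (sorted_content al) = sum_list al"
  by (induction al) auto

lemma set_sorted_content: "x \<in> set (sorted_content al) \<Longrightarrow> x < length al"
  by (induction al) (auto intro: less_SucI)

lemma sorted_sorted_content: "sorted (sorted_content al)"
  by (induction al) (auto simp: sorted_append dest!: set_sorted_content)

lemma count_sorted_content: "count_list (sorted_content al) v = (if v < length al then rev al ! v else 0)"
  by (induction al) (auto simp: count_list_append count_list_replicate nth_append)

text \<open>Positions with equal value lie in the same strip, and inside a strip the rows decrease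
  weakly. This is compatibility in terms of words.\<close>

lemma strip_words_blocks:
  "kap \<in> box_parts N (sum_list al) \<Longrightarrow> w \<in> strip_words N al kap \<Longrightarrow> Suc p < length w \<Longrightarrow> sorted_content al ! p = sorted_content al ! Suc p \<Longrightarrow> w ! Suc p \<le> w ! p"
proof (induction al arbitrary: w kap)
  case (Cons r al)
  then obtain lam w' where l: "lam \<in> box_parts N (sum_list al)" "hstrip lam kap" "w' \<in> strip_words N al lam" "w = w' @ strip_word N lam kap" by auto
  have len: "length w' = length (sorted_content al)" using strip_words_length[OF l(1,3)] by simp
  have lw: "length w = sum_list (r # al)" using strip_words_length Cons.prems by blast
  consider "Suc p < length w'" | "Suc p = length w'" | "length w' \<le> p" by linarith
  then show ?case
  proof cases
    case 1
    then have "sorted_content al ! p = sorted_content al ! Suc p" using Cons.prems(4) len by (simp add: nth_append)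
    then show ?thesis using Cons.IH[OF l(1,3) 1] 1 by (simp add: l(4) nth_append)
  next
    case 2
    then have p: "p < length (sorted_content al)" using len by simp
    have "sorted_content al ! p < length al" using set_sorted_content nth_mem[OF p] by blast
    moreover have "sorted_content (r # al) ! Suc p = length al" using 2 len lw Cons.prems(3) by (simp add: nth_append)
    ultimately show ?thesis using Cons.prems(4) p by (simp add: nth_append)
  next
    case 3
    have "strip_word N lam kap ! (Suc p - length w') \<le> strip_word N lam kap ! (p - length w')"
      using sorted_wrt_nth_less[OF sorted_strip_word, of "p - length w'" "Suc p - length w'"] 3 Cons.prems(3) l(4) by auto
    then show ?thesis using 3 by (simp add: l(4) nth_append)
  qed
qed (auto split: if_splits)

text \<open>Row \<open>r\<close> collects the positions of the letter \<open>r\<close>. The letters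
  of a lattice word are an initial segment, so the number of distinct letters is the number of
  rows.\<close>

definition syt_of :: "nat list \<Rightarrow> nat list list" where
  "syt_of w = map (\<lambda>r. filter (\<lambda>a. w ! (a - 1) = r) [1..<Suc (length w)]) [0..<card {r. r \<in> set w}]"

lemma count_list_card: "count_list w r = card {a \<in> {1..length w}. w ! (a - 1) = r}"
proof -
  have "count_list w r = card {i. i < length w \<and> w ! i = r}"
    by (simp add: count_list_eq_length_filter length_filter_conv_card eq_commute)
  also have "\<dots> = card {a \<in> {1..length w}. w ! (a - 1) = r}"
    by (rule bij_betw_same_card[of Suc], rule bij_betw_byWitness[where f' = "\<lambda>a. a - 1"]) auto
  finally show ?thesis .
qed

lemma lattice_set:
  assumes "lattice w" shows "set w = {..<card (set w)}"
proof -
  have am: "count_list w (Suc r) \<le> count_list w r" for r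
    using assms unfolding lattice_def by (metis order_refl take_all)
  have dn: "r' \<in> set w" if "r \<in> set w" "r' \<le> r" for r r'
  proof -
    have "count_list w r \<le> count_list w r'"
      using that(2) by (induction r rule: dec_induct) (auto intro: le_trans[OF am])
    then show ?thesis using that(1) by (metis count_list_0_iff le_zero_eq)
  qed
  show ?thesis
  proof (cases "w = []")
    case False
    then have M: "Max (set w) \<in> set w" by simp
    define m where "m = Max (set w)"
    have e: "set w = {..m}" using dn[OF M] Max_ge[of "set w"] unfolding m_def by blast
    have c: "card (set w) = Suc m" unfolding e by simp
    show ?thesis unfolding c lessThan_Suc_atMost by (rule e)
  qed simp
qed

lemma syt_of_nth:
  assumes "r < length (syt_of w)"
  shows "set (syt_of w ! r) = {a \<in> {1..length w}. w ! (a - 1) = r}" "sorted_wrt (<) (syt_of w ! r)"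
proof -
  have e: "syt_of w ! r = filter (\<lambda>a. w ! (a - 1) = r) [1..<Suc (length w)]" using assms by (simp add: syt_of_def)
  show "set (syt_of w ! r) = {a \<in> {1..length w}. w ! (a - 1) = r}" unfolding e by auto
  show "sorted_wrt (<) (syt_of w ! r)" unfolding e by (rule sorted_wrt_filter) (simp add: sorted_wrt_upt del: upt_Suc)
qed

lemma syt_of_length_nth:
  assumes "r < length (syt_of w)" shows "length (syt_of w ! r) = count_list w r"
proof -
  have "distinct (syt_of w ! r)" using syt_of_nth(2)[OF assms] by (simp add: strict_sorted_iff)
  then show ?thesis unfolding count_list_card syt_of_nth(1)[OF assms, symmetric] by (simp add: distinct_card)
qed

lemma strict_sorted_nth_le:
  assumes s: "sorted_wrt (<) (xs :: nat list)" and c: "c < card {y \<in> set xs. y \<le> x}" shows "xs ! c \<le> x"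
proof (rule ccontr)
  assume n: "\<not> xs ! c \<le> x"
  have "c < length xs" using c card_mono[of "set xs" "{y \<in> set xs. y \<le> x}"] card_length[of xs] by auto
  have "{y \<in> set xs. y \<le> x} \<subseteq> (!) xs ` {..<c}"
  proof
    fix y assume "y \<in> {y \<in> set xs. y \<le> x}"
    then obtain d where d: "d < length xs" "y = xs ! d" "xs ! d \<le> x" by (auto simp: in_set_conv_nth)
    then have "d < c" using sorted_wrt_nth_less[OF s, of c d] n \<open>c < length xs\<close> by (metis leD le_less_trans less_imp_le linorder_neqE_nat)
    then show "y \<in> (!) xs ` {..<c}" using d by blast
  qed
  then have "card {y \<in> set xs. y \<le> x} \<le> c" using surj_card_le[of "{..<c}" _ "(!) xs"] by simp
  then show False using c by simp
qed

lemma syt_of_SYT: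
  assumes lw: "lattice w" shows "syt_of w \<in> SYT (length w)"
proof -
  let ?T = "syt_of w" and ?L = "card (set w)"
  have len: "length ?T = ?L" by (simp add: syt_of_def)
  note T = syt_of_nth[of _ w] syt_of_length_nth[of _ w]
  have am: "count_list w (Suc r) \<le> count_list w r" for r
    using lw unfolding lattice_def by (metis order_refl take_all)
  have am': "r \<le> r' \<Longrightarrow> count_list w r' \<le> count_list w r" for r r'
    by (induction r' rule: dec_induct) (auto intro: le_trans[OF am])
  have sh: "shape ?T = map (count_list w) [0..<?L]"
    by (rule nth_equalityI) (simp_all add: shape_def len T)
  have "(\<Sum>r<?L. count_list w r) = length w"
    by (rule sum_count_set) (use lattice_set[OF lw] in auto)
  then have P: "is_partition (length w) (shape ?T)"
    unfolding is_partition_def sh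
    using lattice_set[OF lw] am'
    by (auto simp: sorted_wrt_map sorted_wrt_iff_nth_less count_list_0_iff interv_sum_list_conv_sum_set_nat atLeast0LessThan)
  moreover have sc: "set (concat ?T) = {1..length w}"
  proof -
    have "set ?T = (!) ?T ` {..<?L}" unfolding len[symmetric] by (auto simp: set_conv_nth)
    then have "set (concat ?T) = (\<Union>r<?L. set (?T ! r))" by simp
    also have "\<dots> = (\<Union>r<?L. {a \<in> {1..length w}. w ! (a - 1) = r})" using T(1) len by simp
    also have "\<dots> = {1..length w}"
    proof -
      have "w ! (a - 1) < ?L" if "a \<in> {1..length w}" for a
      proof -
        have "w ! (a - 1) \<in> set w" using that by (intro nth_mem) auto
        then show ?thesis using lattice_set[OF lw] by blast
      qed
      then show ?thesis by auto
    qed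
    finally show ?thesis .
  qed
  moreover have "distinct (concat ?T)"
  proof (rule card_distinct)
    have "length (concat ?T) = sum_list (shape ?T)" by (simp add: length_concat shape_def)
    also have "\<dots> = length w" using P by (simp add: is_partition_def)
    finally show "card (set (concat ?T)) = length (concat ?T)" using sc by simp
  qed
  moreover have "\<forall>row\<in>set ?T. sorted_wrt (<) row" using T(2) by (metis in_set_conv_nth)
  \<comment> \<open>The prefix ending at the entry \<open>?x\<close> contains \<open>Suc r\<close>
    at least \<open>c + 1\<close> times, hence \<open>r\<close> as often; so the box below holds a
    smaller entry.\<close>
  moreover have "?T ! r ! c < ?T ! Suc r ! c" if r: "Suc r < length ?T" and c: "c < length (?T ! Suc r)" for r c
  proof -
    let ?x = "?T ! Suc r ! c"
    have r': "r < length ?T" using r by simp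
    have x: "?x \<in> set (?T ! Suc r)" using c by (rule nth_mem)
    then have x1: "?x \<in> {1..length w}" "w ! (?x - 1) = Suc r" using T(1)[OF r] by auto
    have cnt: "card {y \<in> set (?T ! s). y \<le> ?x} = count_list (take ?x w) s" if s: "s < length ?T" for s
    proof -
      have "{y \<in> set (?T ! s). y \<le> ?x} = {a \<in> {1..length (take ?x w)}. take ?x w ! (a - 1) = s}"
        unfolding T(1)[OF s] using x1(1) by auto
      then show ?thesis by (simp only: count_list_card)
    qed
    have "Suc c \<le> card {y \<in> set (?T ! Suc r). y \<le> ?x}"
    proof -
      have s: "sorted_wrt (<) (?T ! Suc r)" by (rule T(2)[OF r])
      have sub: "(!) (?T ! Suc r) ` {..c} \<subseteq> {y \<in> set (?T ! Suc r). y \<le> ?x}"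
        using c sorted_wrt_nth_less[OF s, of _ c] by (auto simp: le_less)
      have "inj_on ((!) (?T ! Suc r)) {..c}"
        using s c by (intro inj_on_nth) (auto simp: strict_sorted_iff)
      then have "card ((!) (?T ! Suc r) ` {..c}) = Suc c" by (simp add: card_image)
      then show ?thesis using card_mono[OF _ sub] by simp
    qed
    also have "\<dots> \<le> card {y \<in> set (?T ! r). y \<le> ?x}"
      unfolding cnt[OF r] cnt[OF r'] using lw by (simp add: lattice_def)
    finally have "?T ! r ! c \<le> ?x" by (intro strict_sorted_nth_le[OF T(2)[OF r']]) simp
    moreover have "?T ! r ! c \<noteq> ?x"
    proof
      have "c < length (?T ! r)" using c am[of r] T(3)[OF r] T(3)[OF r'] by simp
      then have "?T ! r ! c \<in> set (?T ! r)" by simp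
      moreover assume "?T ! r ! c = ?x"
      ultimately show False using T(1)[OF r'] x1(2) by auto
    qed
    ultimately show ?thesis by simp
  qed
  ultimately show ?thesis by (simp add: SYT_def)
qed

lemma rw_syt_of:
  assumes "lattice w" "a \<in> {1..length w}" shows "rw (syt_of w) a = w ! (a - 1)"
proof -
  note S = syt_of_SYT[OF assms(1)]
  have r: "rw (syt_of w) a < length (syt_of w)" by (rule SYT_rwcl(1)[OF S assms(2)])
  have "a \<in> set (syt_of w ! rw (syt_of w) a)" unfolding SYT_row_set[OF S r] using assms(2) by simp
  then show ?thesis unfolding syt_of_nth(1)[OF r] by simp
qed

lemma syt_of_inj:
  assumes "lattice w" "lattice w'" "length w = length w'" "syt_of w = syt_of w'" shows "w = w'"
proof (rule nth_equalityI)
  fix i assume "i < length w"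
  then show "w ! i = w' ! i"
    using rw_syt_of[OF assms(1), of "Suc i"] rw_syt_of[OF assms(2), of "Suc i"] assms(3,4) by simp
qed (rule assms(3))

lemma shape_syt_of:
  assumes "lattice w" "lattice w'" "\<And>r. count_list w r = count_list w' r" shows "shape (syt_of w) = shape (syt_of w')"
proof -
  have "set w = set w'" using assms(3) by (metis count_list_0_iff subsetI subset_antisym)
  then have l: "length (syt_of w) = length (syt_of w')" by (simp add: syt_of_def)
  then show ?thesis
    by (intro nth_equalityI) (simp_all add: shape_def syt_of_length_nth assms(3))
qed

lemma finite_SYT [simp]: "finite (SYT n)"
proof -
  have "SYT n \<subseteq> {T. set T \<subseteq> {r. set r \<subseteq> {1..n} \<and> length r \<le> n} \<and> length T \<le> n}"
  proof
    fix T assume T: "T \<in> SYT n"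
    have l: "sum_list (map length T) = n" and z: "\<forall>r\<in>set T. length r \<noteq> 0"
      using T by (auto simp: SYT_def is_partition_def shape_def image_iff)
    have "length T \<le> n"
    proof -
      have "(\<Sum>r\<leftarrow>T. 1) \<le> (\<Sum>r\<leftarrow>T. length r)" using z by (intro sum_list_mono) (auto simp: One_nat_def Suc_le_eq)
      then show ?thesis using l by (simp add: sum_list_triv)
    qed
    moreover have "set r \<subseteq> {1..n}" "length r \<le> n" if "r \<in> set T" for r
    proof -
      show "set r \<subseteq> {1..n}" using T that by (auto simp: SYT_def)
      show "length r \<le> n" using member_le_sum_list[of "length r" "map length T"] that l by auto
    qed
    ultimately show "T \<in> {T. set T \<subseteq> {r. set r \<subseteq> {1..n} \<and> length r \<le> n} \<and> length T \<le> n}" by auto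
  qed
  moreover have "finite {T :: nat list list. set T \<subseteq> {r. set r \<subseteq> {1..n} \<and> length r \<le> n} \<and> length T \<le> n}"
    by (intro finite_lists_length_le) auto
  ultimately show ?thesis by (rule finite_subset)
qed

lemma finite_fam [simp]: "finite (fam n \<nu>)"
  by (rule finite_subset[of _ "SYT n \<times> SYT n"]) (auto simp: fam_def)

text \<open>Pairs of words with a common shape, one of content \<open>al\<close> and one with all
  multiplicities 1, embed into \<open>fam\<close>. A lower bound suffices, because independence
  gives the reverse inequality.\<close>

lemma kostka_sum_le_card_fam:
  assumes \<nu>: "sorted_content al = map \<nu> [1..<Suc n]" and N: "N > n" shows "kostka_sum N al \<le> card (fam n \<nu>)"
proof -
  have n: "sum_list al = n" using arg_cong[OF \<nu>, of length] by simp
  let ?o = "replicate n 1 :: nat list"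
  have o: "sum_list ?o = n" by (simp add: sum_list_replicate)
  let ?X = "\<lambda>kap. strip_words N al kap \<times> strip_words N ?o kap"
  let ?f = "\<lambda>(s, t). (syt_of s, syt_of t)"
  have l: "lattice s" "lattice t" "length s = n" "length t = n" "count_list s r = kap r" "count_list t r = kap r"
    if "kap \<in> box_parts N n" "(s, t) \<in> ?X kap" for kap s t r
    using strip_words_lattice[of kap N al s] strip_words_lattice[of kap N ?o t] strip_words_length[of kap N al s] strip_words_length[of kap N ?o t]
      strip_words_count[of kap N al s r] strip_words_count[of kap N ?o t r] that by (auto simp: n o)
  have "card (\<Union>kap\<in>box_parts N n. ?X kap) = (\<Sum>kap\<in>box_parts N n. card (?X kap))"
  proof (rule card_UN_disjoint)
    show "\<forall>i\<in>box_parts N n. finite (?X i)" using card_strip_words[of _ N al] card_strip_words[of _ N ?o] by (simp add: n o)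
    show "\<forall>i\<in>box_parts N n. \<forall>j\<in>box_parts N n. i \<noteq> j \<longrightarrow> ?X i \<inter> ?X j = {}"
    proof (intro ballI impI, rule ccontr)
      fix i j assume ij: "i \<in> box_parts N n" "j \<in> box_parts N n" "i \<noteq> j" "?X i \<inter> ?X j \<noteq> {}"
      then obtain s t where "(s, t) \<in> ?X i" "(s, t) \<in> ?X j" by blast
      then have "i r = j r" for r using l(5)[OF ij(1), of s t r] l(5)[OF ij(2), of s t r] by simp
      then show False using ij(3) by auto
    qed
  qed simp
  also have "\<dots> = kostka_sum N al"
    unfolding kostka_sum_def n using card_strip_words[of _ N al] card_strip_words[of _ N ?o]
    by (intro sum.cong refl) (simp add: n o card_cartesian_product)
  finally have c: "card (\<Union>kap\<in>box_parts N n. ?X kap) = kostka_sum N al" .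
  have inj: "inj_on ?f (\<Union>kap\<in>box_parts N n. ?X kap)"
  proof (rule inj_onI)
    fix x y assume "x \<in> (\<Union>kap\<in>box_parts N n. ?X kap)" "y \<in> (\<Union>kap\<in>box_parts N n. ?X kap)" and e: "?f x = ?f y"
    then obtain k k' where k: "k \<in> box_parts N n" "x \<in> ?X k" "k' \<in> box_parts N n" "y \<in> ?X k'" by blast
    obtain s t s' t' where xy: "x = (s, t)" "y = (s', t')" by (metis surj_pair)
    note lx = l[OF k(1) k(2)[unfolded xy(1)]] and ly = l[OF k(3) k(4)[unfolded xy(2)]]
    show "x = y" using e syt_of_inj[OF lx(1) ly(1)] syt_of_inj[OF lx(2) ly(2)] lx(3,4) ly(3,4) by (simp add: xy)
  qed
  have im: "?f ` (\<Union>kap\<in>box_parts N n. ?X kap) \<subseteq> fam n \<nu>"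
  proof (intro subsetI, elim imageE UN_E)
    fix z x kap assume k: "kap \<in> box_parts N n" "x \<in> ?X kap" and z: "z = ?f x"
    obtain s t where x: "x = (s, t)" by (metis surj_pair)
    note lx = l[OF k(1) k(2)[unfolded x]]
    have S: "syt_of s \<in> SYT n" "syt_of t \<in> SYT n" using syt_of_SYT[OF lx(1)] syt_of_SYT[OF lx(2)] lx(3,4) by auto
    have sh: "shape (syt_of s) = shape (syt_of t)" by (rule shape_syt_of[OF lx(1,2)]) (simp add: lx(5,6))
    have nu: "sorted_content al ! p = \<nu> (Suc p)" if "p < n" for p using that by (simp add: \<nu> plus_1_eq_Suc del: upt_Suc)
    have "compat n \<nu> (syt_of s)"
      unfolding compat_def
    proof (intro conjI allI impI)
      fix a b assume ab: "1 \<le> a" "a \<le> b" "b \<le> n"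
      have "sorted_content al ! (a - 1) \<le> sorted_content al ! (b - 1)" using sorted_sorted_content[of al] ab by (intro sorted_nth_mono) (auto simp: n)
      then show "\<nu> a \<le> \<nu> b" using nu[of "a - 1"] nu[of "b - 1"] ab by simp
    next
      fix a assume a: "1 \<le> a" "a < n" "\<nu> a = \<nu> (Suc a)"
      then have "sorted_content al ! (a - 1) = sorted_content al ! Suc (a - 1)" using nu[of "a - 1"] nu[of a] by simp
      then have "s ! Suc (a - 1) \<le> s ! (a - 1)"
        using strip_words_blocks[of kap N al s "a - 1"] k x a lx(3) by (simp add: n)
      then have "rw (syt_of s) (Suc a) \<le> rw (syt_of s) a" using rw_syt_of[OF lx(1), of a] rw_syt_of[OF lx(1), of "Suc a"] a lx(3) by simp
      then show "a \<notin> descents (syt_of s)" using descents_rw[OF S(1)] by (metis not_le)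
    qed
    then show "z \<in> fam n \<nu>" using S sh by (simp add: z x fam_def)
  qed
  show ?thesis using card_inj_on_le[OF inj im finite_fam] unfolding c .
qed

definition orb :: "nat \<Rightarrow> (nat \<Rightarrow> nat) \<Rightarrow> (nat \<Rightarrow>\<^sub>0 nat) set" where
  "orb n \<nu> = {expo n (\<nu> \<circ> \<pi>) | \<pi>. \<pi> permutes {1..n}}"

lemma finite_orb [simp]: "finite (orb n \<nu>)"
  unfolding orb_def by simp

text \<open>Rearrangements of \<nu> inject into the words of its content, which the Kostka identity
  counts.\<close>

lemma card_orb_le_card_fam:
  assumes mono: "\<And>a b. 1 \<le> a \<Longrightarrow> a \<le> b \<Longrightarrow> b \<le> n \<Longrightarrow> \<nu> a \<le> \<nu> b"
  shows "card (orb n \<nu>) \<le> card (fam n \<nu>)"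
proof -
  \<comment> \<open>A strict bound for the values; the inserted 0 keeps the maximum defined for
    \<open>n = 0\<close>.\<close>
  define M where "M = Suc (Max (insert 0 (\<nu> ` {1..n})))"
  have M: "\<nu> a < M" if "a \<in> {1..n}" for a unfolding M_def less_Suc_eq_le using that by (intro Max_ge) auto
  define cnt where "cnt v = card {a \<in> {1..n}. \<nu> a = v}" for v
  define al where "al = rev (map cnt [0..<M])"
  let ?l = "map \<nu> [1..<Suc n]"
  have cl: "count_list ?l v = cnt v" for v
  proof -
    have "count_list ?l v = card {a \<in> {1..n}. ?l ! (a - 1) = v}" using count_list_card[of ?l v] by (simp del: upt_Suc)
    also have "{a \<in> {1..n}. ?l ! (a - 1) = v} = {a \<in> {1..n}. \<nu> a = v}" by (auto simp del: upt_Suc)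
    finally show ?thesis by (simp add: cnt_def)
  qed
  have cnt0: "cnt v = 0" if "v \<ge> M" for v 
  proof -
    have "{a \<in> {1..n}. \<nu> a = v} = {}" using M that leD by blast
    then show ?thesis unfolding cnt_def by (simp only: card.empty)
  qed
  have "mset (sorted_content al) = mset ?l"
    by (rule multiset_eqI) (simp only: count_mset cl count_sorted_content, simp add: al_def cnt0)
  moreover have "sorted ?l" unfolding sorted_wrt_map sorted_wrt_iff_nth_less using mono by (auto simp: sorted_wrt_iff_nth_less simp del: upt_Suc)
  ultimately have nu: "sorted_content al = ?l" using sorted_sorted_content[of al] by (metis sorted_sort_id properties_for_sort)
  have n: "sum_list al = n" using arg_cong[OF nu, of length] by simp
  \<comment> \<open>\<open>al\<close> lists the multiplicities with the largest value first, so a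
    value \<open>v\<close> becomes the letter \<open>M - 1 - v\<close>.\<close>
  let ?g = "\<lambda>m. map (\<lambda>i. M - 1 - lookup m i) [1..<Suc n]"
  have "inj_on ?g (orb n \<nu>)"
  proof (rule inj_onI)
    fix x y assume "x \<in> orb n \<nu>" "y \<in> orb n \<nu>" and e: "?g x = ?g y"
    then obtain \<pi> \<rho> where p: "\<pi> permutes {1..n}" "\<rho> permutes {1..n}" "x = expo n (\<nu> \<circ> \<pi>)" "y = expo n (\<nu> \<circ> \<rho>)" by (auto simp: orb_def)
    show "x = y" unfolding p(3,4) expo_eq_iff
    proof
      fix i assume i: "i \<in> {1..n}"
      then have "M - 1 - lookup x i = M - 1 - lookup y i" using e by (auto simp del: upt_Suc)
      moreover have "lookup x i < M" "lookup y i < M" using M permutes_in_image[OF p(1), of i] permutes_in_image[OF p(2), of i] i by (auto simp: p(3,4))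
      ultimately show "(\<nu> \<circ> \<pi>) i = (\<nu> \<circ> \<rho>) i" using i by (simp add: p(3,4))
    qed
  qed
  moreover have "?g ` orb n \<nu> \<subseteq> content_words al"
  proof
    fix w assume "w \<in> ?g ` orb n \<nu>"
    then obtain \<pi> where p: "\<pi> permutes {1..n}" "w = ?g (expo n (\<nu> \<circ> \<pi>))" by (auto simp: orb_def)
    have w: "w = map (\<lambda>i. M - 1 - \<nu> (\<pi> i)) [1..<Suc n]" unfolding p(2) by (rule map_cong) auto
    have \<nu>\<pi>: "\<nu> (\<pi> i) < M" if "i \<in> {1..n}" for i using M permutes_in_image[OF p(1), of i] that by blast
    have "count_list w j = al ! j" if j: "j < M" for j
    proof -
      have "count_list w j = card {a \<in> {1..n}. w ! (a - 1) = j}" unfolding count_list_card by (simp add: w del: upt_Suc)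
      also have "{a \<in> {1..n}. w ! (a - 1) = j} = {a \<in> {1..n}. \<nu> (\<pi> a) = M - 1 - j}"
        using \<nu>\<pi> j by (force simp: w simp del: upt_Suc)
      also have "card \<dots> = card (\<pi> ` {a \<in> {1..n}. \<nu> (\<pi> a) = M - 1 - j})"
        by (rule card_image[symmetric, OF permutes_inj_on[OF p(1)]])
      also have "\<pi> ` {a \<in> {1..n}. \<nu> (\<pi> a) = M - 1 - j} = {a \<in> {1..n}. \<nu> a = M - 1 - j}"
      proof (intro equalityI subsetI)
        fix x assume x: "x \<in> {a \<in> {1..n}. \<nu> a = M - 1 - j}"
        then obtain y where "y \<in> {1..n}" "x = \<pi> y" using permutes_image[OF p(1)] by blast
        then show "x \<in> \<pi> ` {a \<in> {1..n}. \<nu> (\<pi> a) = M - 1 - j}" using x by blast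
      qed (use permutes_in_image[OF p(1)] in auto)
      also have "card \<dots> = al ! j" using j by (simp add: al_def rev_nth cnt_def One_nat_def)
      finally show ?thesis .
    qed
    moreover have "length al = M" by (simp add: al_def)
    moreover have "set w \<subseteq> {..<M}" using \<nu>\<pi> M_def by (auto simp: w simp del: upt_Suc)
    ultimately show "w \<in> content_words al" by (simp add: content_words_def)
  qed
  ultimately have "card (orb n \<nu>) \<le> card (content_words al)" using card_content_words[of al "Suc n"] n by (intro card_inj_on_le) auto
  also have "\<dots> = kostka_sum (Suc n) al" using card_content_words[of al "Suc n"] n by simp
  also have "\<dots> \<le> card (fam n \<nu>)" by (rule kostka_sum_le_card_fam[OF nu]) simp
  finally show ?thesis .
qed

section \<open>Leading parts and spanning\<close>

lemma lookup_times_single: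
  "lookup (P * Poly_Mapping.single k 1) x = (\<Sum>m\<in>keys P. if m + k = x then lookup P m else 0)"
  for P :: qpoly
proof -
  have "P * Poly_Mapping.single k 1 = (\<Sum>m\<in>keys P. const (lookup P m) * Poly_Mapping.single (m + k) 1)"
    by (subst qpoly_expand) (simp add: sum_distrib_right mult.assoc mult_single)
  then show ?thesis by (auto simp: lookup_sum lookup_single when_def intro!: sum.cong)
qed

section \<open>Dominance and sums of squares\<close>

definition sqsum :: "nat \<Rightarrow> (nat \<Rightarrow> nat) \<Rightarrow> nat" where "sqsum n b = (\<Sum>i=1..n. b i * b i)"
text \<open>For weakly increasing \<nu> this is the sum of the \<open>j\<close> largest
  values.\<close>

definition tops :: "nat \<Rightarrow> (nat \<Rightarrow> nat) \<Rightarrow> nat \<Rightarrow> nat" where "tops n \<nu> j = (\<Sum>a\<in>{n + 1 - j..n}. \<nu> a)"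

text \<open>Elements of \<open>A\<close> outside the final segment have values at most that at the
  threshold \<open>n + 1 - card A\<close>, missing elements have values at least that. As many are
  missing as are extra, so equality of sums pins all of them to the threshold value.\<close>

lemma tops_max:
  assumes mono: "\<And>a b. 1 \<le> a \<Longrightarrow> a \<le> b \<Longrightarrow> b \<le> n \<Longrightarrow> \<nu> a \<le> \<nu> b" and A: "A \<subseteq> {1..n}"
  defines "B \<equiv> {n + 1 - card A..n}"
  shows "sum \<nu> A \<le> tops n \<nu> (card A)"
    and "sum \<nu> A = tops n \<nu> (card A) \<Longrightarrow> x \<in> A - B \<union> (B - A) \<Longrightarrow> \<nu> x = \<nu> (n + 1 - card A)"
proof -
  let ?t = "\<nu> (n + 1 - card A)"
  have fin: "finite A" using A by (rule finite_subset) simp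
  have cA: "card A \<le> n" using card_mono[OF _ A] by simp
  have cB: "card B = card A" using cA by (simp add: B_def)
  have BN: "B \<subseteq> {1..n}" using cA by (auto simp: B_def)
  have finB: "finite B" by (simp add: B_def)
  have c: "card (A - B) = card (B - A)"
    using card_le_sym_Diff[OF fin finB] card_le_sym_Diff[OF finB fin] cB by simp
  have le: "\<nu> x \<le> ?t" if "x \<in> A - B" for x
  proof (rule mono)
    show "1 \<le> x" "x \<le> n + 1 - card A" using that A by (auto simp: B_def)
    show "n + 1 - card A \<le> n" using that fin by (cases "card A") auto
  qed
  have ge: "?t \<le> \<nu> x" if "x \<in> B - A" for x
    by (rule mono) (use that cA in \<open>auto simp: B_def\<close>)
  have sA: "sum \<nu> A = sum \<nu> (A \<inter> B) + sum \<nu> (A - B)" using sum.Int_Diff[OF fin] .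
  have sB: "tops n \<nu> (card A) = sum \<nu> (A \<inter> B) + sum \<nu> (B - A)"
    unfolding tops_def B_def[symmetric] using sum.Int_Diff[of B \<nu> A] by (simp add: B_def Int_commute)
  have l1: "sum \<nu> (A - B) \<le> card (A - B) * ?t" using sum_bounded_above[of "A - B" \<nu> ?t] le by simp
  have l2: "card (B - A) * ?t \<le> sum \<nu> (B - A)" using sum_bounded_below[of "B - A" ?t \<nu>] ge by simp
  show "sum \<nu> A \<le> tops n \<nu> (card A)" unfolding sA sB using l1 l2 c by simp
  assume "sum \<nu> A = tops n \<nu> (card A)" and x: "x \<in> A - B \<union> (B - A)"
  then have e1: "sum \<nu> (A - B) = (\<Sum>x\<in>A - B. ?t)" and e2: "(\<Sum>x\<in>B - A. ?t) = sum \<nu> (B - A)"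
    unfolding sA sB using l1 l2 c by auto
  show "\<nu> x = ?t"
  proof (cases "x \<in> A - B")
    case True
    then show ?thesis using sum_mono_inv[OF e1 le] fin by simp
  next
    case False
    then have "x \<in> B - A" using x by blast
    from sum_mono_inv[OF e2 ge this] show ?thesis by (simp add: B_def)
  qed
qed

lemma exchange_perm:
  assumes fin: "finite A" "finite B" and c: "card A = card B"
  obtains \<kappa> where "\<kappa> permutes (A - B \<union> (B - A))" "\<kappa> ` A = B"
proof -
  have c': "card (A - B) = card (B - A)"
    using card_le_sym_Diff[of A B] card_le_sym_Diff[of B A] fin c by (simp add: le_antisym)
  obtain g where g: "bij_betw g (A - B) (B - A)" using finite_same_card_bij[of "A - B" "B - A"] fin c' by auto
  obtain g' where g': "bij_betw g' (B - A) (A - B)" using finite_same_card_bij[of "B - A" "A - B"] fin c' by auto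
  define \<kappa> where "\<kappa> x = (if x \<in> A - B then g x else if x \<in> B - A then g' x else x)" for x
  have k1: "bij_betw \<kappa> (A - B) (B - A)" using g by (rule bij_betw_cong[THEN iffD1, rotated]) (simp add: \<kappa>_def)
  have k2: "bij_betw \<kappa> (B - A) (A - B)" using g' by (rule bij_betw_cong[THEN iffD1, rotated]) (auto simp: \<kappa>_def)
  have "bij_betw \<kappa> (A - B \<union> (B - A)) (B - A \<union> (A - B))" by (rule bij_betw_combine[OF k1 k2]) auto
  then have p: "\<kappa> permutes (A - B \<union> (B - A))" by (intro bij_imp_permutes) (auto simp: \<kappa>_def Un_commute)
  have "\<kappa> ` A = \<kappa> ` (A - B) \<union> \<kappa> ` (A \<inter> B)" by blast
  also have "\<kappa> ` (A - B) = B - A" using k1 by (rule bij_betw_imp_surj_on)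
  also have "\<kappa> ` (A \<inter> B) = A \<inter> B" by (auto simp: \<kappa>_def)
  also have "(B - A) \<union> (A \<inter> B) = B" by blast
  finally show ?thesis using p that by blast
qed

text \<open>The bound by \<open>tops\<close> is dominance of the sorted exponents by \<nu>. It is
  carried along because it limits the gain in the sum of squares when the next elementary symmetric
  polynomial is multiplied in.\<close>

definition below :: "nat \<Rightarrow> (nat \<Rightarrow> nat) \<Rightarrow> nat list list \<Rightarrow> nat list list \<Rightarrow> (nat \<Rightarrow>\<^sub>0 nat) \<Rightarrow> bool" where
  "below n \<nu> S T m \<longleftrightarrow> keys m \<subseteq> {1..n} \<and>
     (\<forall>J. J \<subseteq> {1..n} \<longrightarrow> sum (lookup m) J \<le> tops n \<nu> (card J)) \<and>
     (\<Sum>i=1..n. lookup m i) = (\<Sum>i=1..n. \<nu> i) \<and>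
     (sqsum n (lookup m) < sqsum n \<nu> \<or> (\<exists>\<rho>\<in>refs n \<nu> S. m = expo n (\<nu> \<circ> \<rho> \<circ> tperm n S T)))"

definition topped :: "nat \<Rightarrow> (nat \<Rightarrow> nat) \<Rightarrow> nat list list \<Rightarrow> nat list list \<Rightarrow> qpoly \<Rightarrow> bool" where
  "topped n \<nu> S T P \<longleftrightarrow> compat n \<nu> S \<and> (\<forall>m\<in>keys P. lookup P m \<ge> 0 \<and> below n \<nu> S T m) \<and>
     lookup P (expo n (\<nu> \<circ> tperm n S T)) > 0"

lemma topped_nonneg: "topped n \<nu> S T P \<Longrightarrow> lookup P m \<ge> 0"
  by (cases "m \<in> keys P") (simp add: topped_def, simp add: in_keys_iff)

lemma sum_perm_nat: "\<pi> permutes {1..n} \<Longrightarrow> (\<Sum>i=1..n. f (\<pi> i)) = (\<Sum>i=1..n. f i)" for f :: "nat \<Rightarrow> nat"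
  by (rule sum.permute[symmetric, unfolded comp_def])

lemma tops_Suc:
  assumes "j \<le> n" "r \<le> n"
  shows "tops n (\<lambda>a. \<nu> a + (if n < a + r then 1 else 0)) j = tops n \<nu> j + min j r"
proof -
  have "{a \<in> {n + 1 - j..n}. n < a + r} = {n + 1 - min j r..n}" using assms by auto
  then have "card {a \<in> {n + 1 - j..n}. n < a + r} = min j r" using assms by simp
  then show ?thesis by (simp add: tops_def sum.distrib sum.If_cases Int_def)
qed

text \<open>Raising the exponents on \<open>J\<close> adds \<open>r\<close> plus twice their sum
  over \<open>J\<close> to the sum of squares, which is most when \<open>J\<close> carries the
  \<open>r\<close> largest. Equality leaves only exchanges between equal values of \<nu>; these have
  equal labels and are absorbed into \<open>refs\<close>.\<close>

lemma below_step:
  assumes S: "S \<in> SYT n" and T: "T \<in> SYT n" and sh: "shape S = shape T" and c: "compat n \<nu> S" and r: "1 \<le> r" "r \<le> n"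
    and m: "below n \<nu> S T m" and J: "J \<subseteq> {1..n}" "card J = r"
  defines "\<nu>' \<equiv> \<lambda>a. \<nu> a + (if n < a + r then 1 else 0)"
  shows "below n \<nu>' S T (m + expo n (\<lambda>i. if i \<in> J then 1 else 0))"
proof -
  let ?e = "expo n (\<lambda>i. if i \<in> J then 1 else 0)" and ?p = "tperm n S T"
  note pp = tperm_permutes[OF S T sh]
  have finJ: "finite J" using J(1) by (rule finite_subset) simp
  have l: "lookup (m + ?e) i = lookup m i + (if i \<in> J then 1 else 0)" for i
    using J by (auto simp: lookup_add)
  have sumJ: "(\<Sum>i\<in>A. if i \<in> J then 1 else 0) = card (A \<inter> J)" if "A \<subseteq> {1..n}" for A
    using finite_subset[OF that] by (simp add: sum.If_cases)
  have k: "keys (m + ?e) \<subseteq> {1..n}"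
    using keys_add[of m ?e] keys_expo[of n] m by (auto simp: below_def)
  have d: "sum (lookup (m + ?e)) A \<le> tops n \<nu>' (card A)" if A: "A \<subseteq> {1..n}" for A
  proof -
    have fA: "finite A" using A by (rule finite_subset) simp
    have cA: "card A \<le> n" using card_mono[OF _ A] by simp
    have "sum (lookup (m + ?e)) A = sum (lookup m) A + card (A \<inter> J)"
      unfolding l sum.distrib sumJ[OF A] ..
    also have "\<dots> \<le> tops n \<nu> (card A) + min (card A) r"
      using m A card_mono[OF fA, of "A \<inter> J"] card_mono[OF finJ, of "A \<inter> J"] J(2)
      by (intro add_mono) (auto simp: below_def)
    also have "\<dots> = tops n \<nu>' (card A)" unfolding \<nu>'_def using tops_Suc[OF cA r(2)] by simp
    finally show ?thesis .
  qed
  have cB: "card {a \<in> {1..n}. n < a + r} = r"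
  proof -
    have "{a \<in> {1..n}. n < a + r} = {n + 1 - r..n}" using r by auto
    then show ?thesis using r by simp
  qed
  have sB: "(\<Sum>a=1..n. if n < a + r then f a else 0) = sum f {n + 1 - r..n}" for f :: "nat \<Rightarrow> nat"
  proof -
    have "{a \<in> {1..n}. n < a + r} = {n + 1 - r..n}" using r by auto
    then show ?thesis by (simp add: sum.If_cases Int_def)
  qed
  have dg: "(\<Sum>i=1..n. lookup (m + ?e) i) = (\<Sum>i=1..n. \<nu>' i)"
  proof -
    have "(\<Sum>i=1..n. lookup (m + ?e) i) = (\<Sum>i=1..n. \<nu> i) + r"
      unfolding l sum.distrib using sumJ[of "{1..n}"] m J by (simp add: below_def Int_absorb1)
    also have "\<dots> = (\<Sum>i=1..n. \<nu>' i)"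
      unfolding \<nu>'_def sum.distrib sB[of "\<lambda>_. 1"] using r by simp
    finally show ?thesis .
  qed
  have sqm: "sqsum n (lookup (m + ?e)) = sqsum n (lookup m) + 2 * sum (lookup m) J + r"
  proof -
    have "sqsum n (lookup (m + ?e)) = (\<Sum>i=1..n. lookup m i * lookup m i + (if i \<in> J then 2 * lookup m i + 1 else 0))"
      unfolding sqsum_def l by (rule sum.cong) (auto simp: algebra_simps)
    also have "\<dots> = sqsum n (lookup m) + (\<Sum>i\<in>J. 2 * lookup m i + 1)"
      unfolding sum.distrib sqsum_def using J(1) by (simp add: sum.If_cases Int_absorb1)
    finally show ?thesis using J by (simp add: sum.distrib sum_distrib_left)
  qed
  have sq\<nu>: "sqsum n \<nu>' = sqsum n \<nu> + 2 * tops n \<nu> r + r"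
  proof -
    have "sqsum n \<nu>' = (\<Sum>i=1..n. \<nu> i * \<nu> i + (if n < i + r then 2 * \<nu> i + 1 else 0))"
      unfolding sqsum_def \<nu>'_def by (rule sum.cong) (auto simp: algebra_simps)
    also have "\<dots> = sqsum n \<nu> + (\<Sum>i\<in>{n + 1 - r..n}. 2 * \<nu> i + 1)"
      unfolding sum.distrib sqsum_def sB[of "\<lambda>i. 2 * \<nu> i + 1"] ..
    finally show ?thesis using r by (simp add: sum.distrib sum_distrib_left tops_def)
  qed
  have mJ: "sum (lookup m) J \<le> tops n \<nu> r" using m J by (auto simp: below_def)
  have "sqsum n (lookup (m + ?e)) < sqsum n \<nu>' \<or> (\<exists>\<rho>\<in>refs n \<nu>' S. m + ?e = expo n (\<nu>' \<circ> \<rho> \<circ> ?p))"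
  proof (cases "sqsum n (lookup m) < sqsum n \<nu>")
    case True
    then show ?thesis unfolding sqm sq\<nu> using mJ by simp
  next
    case False
    then obtain \<rho> where \<rho>: "\<rho> \<in> refs n \<nu> S" and me: "m = expo n (\<nu> \<circ> \<rho> \<circ> ?p)" using m by (auto simp: below_def)
    have \<rho>p: "\<rho> permutes {1..n}" using \<rho> by (simp add: refs_def)
    have rpp: "\<rho> \<circ> ?p permutes {1..n}" by (rule permutes_compose[OF pp \<rho>p])
    have lm: "lookup m i = \<nu> (\<rho> (?p i))" if "i \<in> {1..n}" for i using that by (simp add: me)
    have "sqsum n (lookup m) = (\<Sum>i=1..n. \<nu> ((\<rho> \<circ> ?p) i) * \<nu> ((\<rho> \<circ> ?p) i))"
      unfolding sqsum_def by (rule sum.cong) (simp_all add: lm)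
    also have "\<dots> = sqsum n \<nu>" unfolding sqsum_def by (rule sum_perm_nat[OF rpp])
    finally have sqe: "sqsum n (lookup m) = sqsum n \<nu>" .
    show ?thesis
    proof (cases "sum (lookup m) J = tops n \<nu> r")
      case False
      then show ?thesis unfolding sqm sq\<nu> using mJ sqe by simp
    next
      case True
      \<comment> \<open>\<open>?A\<close> holds the entries raised by \<open>J\<close>,
        \<open>?B\<close> the entries that should be raised. They differ only where \<nu> is
        constant, so the exchange \<open>\<kappa>\<close> of their difference does not change
        \<nu>.\<close>
      let ?A = "(\<rho> \<circ> ?p) ` J" and ?B = "{n + 1 - r..n}"
      have AN: "?A \<subseteq> {1..n}" using image_mono[OF J(1), of "\<rho> \<circ> ?p"] permutes_image[OF rpp] by simp
      have injJ: "inj_on (\<rho> \<circ> ?p) J" by (rule permutes_inj_on[OF rpp])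
      have cA: "card ?A = r" using card_image[OF injJ] J(2) by simp
      have "sum \<nu> ?A = (\<Sum>i\<in>J. \<nu> ((\<rho> \<circ> ?p) i))" unfolding sum.reindex[OF injJ] by (rule sum.cong) simp_all
      also have "\<dots> = sum (lookup m) J" using J(1) lm by (intro sum.cong) auto
      finally have sA: "sum \<nu> ?A = tops n \<nu> (card ?A)" using True cA by simp
      have const: "\<nu> x = \<nu> (n + 1 - r)" if "x \<in> ?A - ?B \<union> (?B - ?A)" for x
        using tops_max(2)[OF compat_mono[OF c] AN sA] that cA by simp
      obtain \<kappa> where \<kappa>: "\<kappa> permutes (?A - ?B \<union> (?B - ?A))" "\<kappa> ` ?A = ?B"
        by (rule exchange_perm[of ?A ?B]) (use finJ cA r in auto)
      have sub: "?A - ?B \<union> (?B - ?A) \<subseteq> {1..n}" using AN r by auto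
      have \<kappa>p: "\<kappa> permutes {1..n}" by (rule permutes_subset[OF \<kappa>(1) sub])
      have \<nu>\<kappa>: "\<nu> (\<kappa> x) = \<nu> x" for x
      proof (cases "x \<in> ?A - ?B \<union> (?B - ?A)")
        case True
        then have "\<kappa> x \<in> ?A - ?B \<union> (?B - ?A)" using permutes_in_image[OF \<kappa>(1)] by blast
        then show ?thesis using const True by metis
      next
        case False
        then show ?thesis using permutes_not_in[OF \<kappa>(1)] by simp
      qed
      have lab\<kappa>: "lab S (\<kappa> x) = lab S x" if "x \<in> {1..n}" for x
        using compat_lab[OF S c _ that \<nu>\<kappa>] permutes_in_image[OF \<kappa>p] that by blast
      have "\<kappa> \<circ> \<rho> \<in> refs n \<nu>' S"
        using \<rho> lab\<kappa> permutes_in_image[OF \<rho>p] permutes_compose[OF \<rho>p \<kappa>p] by (simp add: refs_def)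
      moreover have "m + ?e = expo n (\<nu>' \<circ> (\<kappa> \<circ> \<rho>) \<circ> ?p)"
      proof (rule poly_mapping_eqI)
        fix i
        show "lookup (m + ?e) i = lookup (expo n (\<nu>' \<circ> (\<kappa> \<circ> \<rho>) \<circ> ?p)) i"
        proof (cases "i \<in> {1..n}")
          case True
          let ?x = "(\<rho> \<circ> ?p) i"
          have xi: "?x \<in> {1..n}" using permutes_in_image[OF rpp] True by blast
          have ki: "\<kappa> ?x \<in> {1..n}" using permutes_in_image[OF \<kappa>p] xi by blast
          have "n < \<kappa> ?x + r \<longleftrightarrow> \<kappa> ?x \<in> ?B" using ki r by auto
          also have "\<dots> \<longleftrightarrow> ?x \<in> ?A" using \<kappa>(2) permutes_inj[OF \<kappa>p] by (metis inj_image_mem_iff)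
          also have "\<dots> \<longleftrightarrow> i \<in> J" using permutes_inj[OF rpp] by (metis inj_image_mem_iff)
          finally show ?thesis unfolding l using True lm[OF True] \<nu>\<kappa>[of ?x] by (simp add: \<nu>'_def)
        next
          case False
          then show ?thesis unfolding l using J(1) k by (auto simp: me)
        qed
      qed
      ultimately show ?thesis by blast
    qed
  qed
  then show ?thesis unfolding below_def using k d dg by blast
qed

text \<open>All coefficients are nonnegative, so the leading monomial cannot cancel; the choice of
  the boxes with the \<open>r\<close> largest entries produces it.\<close>

lemma topped_step:
  assumes S: "S \<in> SYT n" and T: "T \<in> SYT n" and sh: "shape S = shape T" and r: "1 \<le> r" "r \<le> n" and P: "topped n \<nu> S T P"
  shows "topped n (\<lambda>a. \<nu> a + (if n < a + r then 1 else 0)) S T (P * esym n r)"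
proof -
  let ?\<nu> = "\<lambda>a. \<nu> a + (if n < a + r then 1 else 0)" and ?p = "tperm n S T"
  let ?Js = "{J. J \<subseteq> {1..n} \<and> card J = r}" and ?e = "\<lambda>J. expo n (\<lambda>i. if i \<in> J then 1 else 0)"
  note pp = tperm_permutes[OF S T sh]
  have c: "compat n \<nu> S" using P by (simp add: topped_def)
  have finJs: "finite ?Js" by simp
  have lk: "lookup (P * esym n r) x = (\<Sum>J\<in>?Js. \<Sum>m\<in>keys P. if m + ?e J = x then lookup P m else 0)" for x
    unfolding esym_alt sum_distrib_left lookup_sum xm_def lookup_times_single ..
  have nn: "(if m + ?e J = x then lookup P m else 0) \<ge> 0" for J m x using topped_nonneg[OF P] by simp
  have c': "compat n ?\<nu> S"
    unfolding compat_def
  proof (intro conjI allI impI)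
    fix a b assume "1 \<le> a" "a \<le> b" "b \<le> n"
    then show "?\<nu> a \<le> ?\<nu> b" using compat_mono[OF c, of a b] by auto
  next
    fix a assume a: "1 \<le> a" "a < n" "?\<nu> a = ?\<nu> (Suc a)"
    then have "\<nu> a = \<nu> (Suc a)" using compat_mono[OF c, of a "Suc a"] by (auto split: if_splits)
    then show "a \<notin> descents S" using c a by (simp add: compat_def)
  qed
  have "lookup (P * esym n r) x \<ge> 0 \<and> below n ?\<nu> S T x" if "x \<in> keys (P * esym n r)" for x
  proof
    show "lookup (P * esym n r) x \<ge> 0" unfolding lk by (intro sum_nonneg nn)
    have "lookup (P * esym n r) x \<noteq> 0" using that by (simp add: in_keys_iff)
    then obtain J where J: "J \<in> ?Js" "(\<Sum>m\<in>keys P. if m + ?e J = x then lookup P m else 0) \<noteq> 0"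
      unfolding lk by (rule sum.not_neutral_contains_not_neutral)
    from J(2) obtain m where "m \<in> keys P" "(if m + ?e J = x then lookup P m else 0) \<noteq> 0"
      by (rule sum.not_neutral_contains_not_neutral)
    then have "J \<in> ?Js" "m \<in> keys P" "m + ?e J = x" using J(1) by (auto split: if_splits)
    then show "below n ?\<nu> S T x" using below_step[OF S T sh c r, of m J] P by (auto simp: topped_def)
  qed
  moreover have "lookup (P * esym n r) (expo n (?\<nu> \<circ> ?p)) > 0"
  proof -
    let ?J = "{j \<in> {1..n}. n < ?p j + r}"
    have "?p ` ?J = {n + 1 - r..n}"
    proof (intro equalityI subsetI)
      fix x assume "x \<in> ?p ` ?J"
      then show "x \<in> {n + 1 - r..n}" using permutes_in_image[OF pp] by auto
    next
      fix x assume x: "x \<in> {n + 1 - r..n}"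
      then have "x \<in> {1..n}" using r by auto
      then obtain j where "j \<in> {1..n}" "x = ?p j" using permutes_image[OF pp] by blast
      then show "x \<in> ?p ` ?J" using x r by auto
    qed
    then have "card ?J = r" using card_image[OF permutes_inj_on[OF pp], of ?J] r by simp
    then have J: "?J \<in> ?Js" by auto
    have e: "expo n (\<nu> \<circ> ?p) + ?e ?J = expo n (?\<nu> \<circ> ?p)" by (rule poly_mapping_eqI) (simp add: lookup_add)
    have pos: "lookup P (expo n (\<nu> \<circ> ?p)) > 0" using P by (simp add: topped_def)
    then have k: "expo n (\<nu> \<circ> ?p) \<in> keys P" by (simp add: in_keys_iff)
    show ?thesis unfolding lk
    proof (rule sum_pos2[OF finJs J])
      show "0 < (\<Sum>m\<in>keys P. if m + ?e ?J = expo n (?\<nu> \<circ> ?p) then lookup P m else 0)"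
        by (rule sum_pos2[OF _ k]) (use topped_nonneg[OF P] pos e in simp_all)
    qed (intro sum_nonneg nn)
  qed
  ultimately show ?thesis using c' by (simp add: topped_def)
qed

lemma topped_power:
  assumes S: "S \<in> SYT n" and T: "T \<in> SYT n" and sh: "shape S = shape T" and r: "1 \<le> r" "r \<le> n" and P: "topped n \<nu> S T P"
  shows "topped n (\<lambda>a. \<nu> a + (if n < a + r then k else 0)) S T (P * esym n r ^ k)"
proof (induction k)
  case 0
  have "(\<lambda>a. \<nu> a + (if n < a + r then 0 else 0)) = \<nu>" by auto
  then show ?case using P by simp
next
  case (Suc k)
  have *: "(\<lambda>a. \<nu> a + (if n < a + r then Suc k else 0)) = (\<lambda>a. (\<nu> a + (if n < a + r then k else 0)) + (if n < a + r then 1 else 0))"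
    by auto
  show ?case unfolding * power_Suc2 mult.assoc[symmetric] by (rule topped_step[OF S T sh r Suc])
qed

lemma compat_self: "S \<in> SYT n \<Longrightarrow> compat n (lab S) S"
  unfolding compat_def using lab_mono[of S n] lab_Suc[of S n] by auto

lemma topped_base:
  assumes S: "S \<in> SYT n" and T: "T \<in> SYT n" and sh: "shape S = shape T"
  shows "topped n (lab S) S T (xm n (\<lambda>i. lab S (tperm n S T i)))"
proof -
  let ?p = "tperm n S T"
  note pp = tperm_permutes[OF S T sh]
  have e: "(\<lambda>i. lab S (?p i)) = lab S \<circ> ?p" by auto
  have "below n (lab S) S T (expo n (lab S \<circ> ?p))"
    unfolding below_def
  proof (intro conjI allI impI)
    fix J :: "nat set" assume J: "J \<subseteq> {1..n}"
    have "sum (lookup (expo n (lab S \<circ> ?p))) J = (\<Sum>j\<in>J. lab S (?p j))" using J by (intro sum.cong) auto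
    also have "\<dots> = sum (lab S) (?p ` J)"
      by (rule sum.reindex[OF permutes_inj_on[OF pp], symmetric, unfolded comp_def])
    also have "\<dots> \<le> tops n (lab S) (card (?p ` J))"
      by (rule tops_max(1)) (use lab_mono[OF S] image_mono[OF J, of ?p] permutes_image[OF pp] in auto)
    finally show "sum (lookup (expo n (lab S \<circ> ?p))) J \<le> tops n (lab S) (card J)"
      by (simp add: card_image permutes_inj_on[OF pp])
  next
    have "(\<Sum>i=1..n. lookup (expo n (lab S \<circ> ?p)) i) = (\<Sum>i=1..n. lab S (?p i))" by (rule sum.cong) auto
    then show "(\<Sum>i=1..n. lookup (expo n (lab S \<circ> ?p)) i) = (\<Sum>i=1..n. lab S i)" using sum_perm_nat[OF pp] by simp
  next
    show "sqsum n (lookup (expo n (lab S \<circ> ?p))) < sqsum n (lab S) \<or> (\<exists>\<rho>\<in>refs n (lab S) S. expo n (lab S \<circ> ?p) = expo n (lab S \<circ> \<rho> \<circ> ?p))"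
      using id_refs[of n "lab S" S] by (intro disjI2 bexI[of _ id]) auto
  qed (rule keys_expo)
  then show ?thesis unfolding topped_def e using compat_self[OF S] by (simp add: xm_def)
qed

lemma topped_prod:
  assumes S: "S \<in> SYT n" and T: "T \<in> SYT n" and sh: "shape S = shape T" and R: "R \<subseteq> {1..n}"
  shows "topped n (\<lambda>a. lab S a + (\<Sum>r\<in>R. if n < a + r then i r else 0)) S T
    (xm n (\<lambda>i. lab S (tperm n S T i)) * (\<Prod>r\<in>R. esym n r ^ i r))"
proof -
  have "finite R" using R by (rule finite_subset) simp
  then show ?thesis using R
  proof (induction R rule: finite_induct)
    case empty
    then show ?case using topped_base[OF S T sh] by simp
  next
    case (insert r R)
    then have "1 \<le> r" "r \<le> n" by auto
    moreover have "(\<lambda>a. lab S a + (\<Sum>r\<in>insert r R. if n < a + r then i r else 0))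
        = (\<lambda>a. lab S a + (\<Sum>r\<in>R. if n < a + r then i r else 0) + (if n < a + r then i r else 0))"
      using insert.hyps by (intro ext) simp
    moreover have "x * (\<Prod>r\<in>insert r R. esym n r ^ i r) = x * (\<Prod>r\<in>R. esym n r ^ i r) * esym n r ^ i r" for x
      unfolding prod.insert[OF insert.hyps] mult.assoc by (subst (2) mult.commute) (rule refl)
    moreover have "R \<subseteq> {1..n}" using insert.prems by simp
    ultimately show ?case using topped_power[OF S T sh _ _ insert.IH, of r "i r"] by (simp only:)
  qed
qed

text \<open>\<open>e_r\<close> raises the entries \<open>n - r + 1, ..., n\<close>, so its exponent
  has to be the jump of \<nu> minus the label between \<open>n - r\<close> and
  \<open>n - r + 1\<close>; labels jump by 1 at descents. For \<open>r = n\<close> all entries are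
  raised, and the label of entry 1 is 0.\<close>

definition expn :: "nat \<Rightarrow> (nat \<Rightarrow> nat) \<Rightarrow> nat list list \<Rightarrow> nat \<Rightarrow> nat" where
  "expn n \<nu> S r = (if r = n then \<nu> 1 else \<nu> (n - r + 1) - \<nu> (n - r) - (if n - r \<in> descents S then 1 else 0))"

text \<open>A telescoping sum. The truncated subtraction in \<open>expn\<close> is exact because a
  compatible \<nu> increases at every descent.\<close>

lemma expn_sum:
  assumes S: "S \<in> SYT n" and c: "compat n \<nu> S" and a: "1 \<le> a" "a \<le> n"
  shows "lab S a + (\<Sum>r=1..n. if n < a + r then expn n \<nu> S r else 0) = \<nu> a"
proof -
  have *: "(\<Sum>r=1..n. if n < a + r then expn n \<nu> S r else 0) = (\<Sum>r\<in>{n + 1 - a..n}. expn n \<nu> S r)" if "1 \<le> a" "a \<le> n" for a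
  proof -
    have "{r \<in> {1..n}. n < a + r} = {n + 1 - a..n}" using that by auto
    then show ?thesis by (simp add: sum.If_cases Int_def)
  qed
  have "lab S a + (\<Sum>r\<in>{n + 1 - a..n}. expn n \<nu> S r) = \<nu> a" using a
  proof (induction a rule: dec_induct)
    case base
    then show ?case by (simp add: expn_def)
  next
    case (step a)
    have an: "1 \<le> a" "a < n" using step by auto
    have "{n + 1 - Suc a..n} = insert (n - a) {n + 1 - a..n}" using an by auto
    then have "(\<Sum>r\<in>{n + 1 - Suc a..n}. expn n \<nu> S r) = expn n \<nu> S (n - a) + (\<Sum>r\<in>{n + 1 - a..n}. expn n \<nu> S r)"
      using an by simp
    moreover have "expn n \<nu> S (n - a) = \<nu> (Suc a) - \<nu> a - (if a \<in> descents S then 1 else 0)"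
    proof -
      have "n - a \<noteq> n" "n - (n - a) = a" using an by auto
      then show ?thesis by (simp add: expn_def Suc_eq_plus1)
    qed
    moreover have "\<nu> a \<le> \<nu> (Suc a)" using compat_mono[OF c, of a "Suc a"] an by simp
    moreover have "a \<in> descents S \<Longrightarrow> \<nu> a \<noteq> \<nu> (Suc a)" using c an by (auto simp: compat_def)
    ultimately show ?case using step.IH an lab_Suc[OF S an] by (auto split: if_splits)
  qed
  then show ?thesis using *[OF a] by simp
qed

definition top_part :: "nat \<Rightarrow> nat \<Rightarrow> qpoly \<Rightarrow> qpoly" where
  "top_part n q P = (\<Sum>m\<in>{m \<in> keys P. sqsum n (lookup m) = q}. Poly_Mapping.single m (lookup P m))"

lemma lookup_top_part: "lookup (top_part n q P) m = (if sqsum n (lookup m) = q then lookup P m else 0)"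
  by (auto simp: top_part_def lookup_sum lookup_single when_def in_keys_iff)

text \<open>Passes from the invariant to the leading parts of the independence theorem. Two exponent
  functions appear since the one that \<open>topped_prod\<close> produces equals the intended one
  only on \<open>{1..n}\<close>.\<close>

lemma topped_cong:
  assumes "\<And>a. a \<in> {1..n} \<Longrightarrow> \<nu> a = \<nu>' a" "compat n \<nu>' S" "S \<in> SYT n" "T \<in> SYT n" "shape S = shape T" "topped n \<nu> S T P"
  shows "lead n \<nu>' S T (top_part n (sqsum n \<nu>') P)"
    and "m \<in> keys P \<Longrightarrow> keys m \<subseteq> {1..n} \<and> (\<Sum>i=1..n. lookup m i) = (\<Sum>i=1..n. \<nu>' i) \<and> sqsum n (lookup m) \<le> sqsum n \<nu>'"
proof -
  note pp = tperm_permutes[OF assms(3-5)]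
  have sq: "sqsum n \<nu> = sqsum n \<nu>'" unfolding sqsum_def using assms(1) by (intro sum.cong) auto
  have e: "expo n (\<nu> \<circ> \<rho> \<circ> tperm n S T) = expo n (\<nu>' \<circ> \<rho> \<circ> tperm n S T)" if "\<rho> permutes {1..n}" for \<rho>
  proof -
    have "(\<rho> \<circ> tperm n S T) i \<in> {1..n}" if "i \<in> {1..n}" for i
      using permutes_in_image[OF permutes_compose[OF pp \<open>\<rho> permutes {1..n}\<close>]] that by blast
    then show ?thesis unfolding expo_eq_iff using assms(1) by simp
  qed
  have sqp: "sqsum n (lookup (expo n (\<nu>' \<circ> \<rho> \<circ> tperm n S T))) = sqsum n \<nu>'" if "\<rho> permutes {1..n}" for \<rho>
  proof -
    have "sqsum n (lookup (expo n (\<nu>' \<circ> \<rho> \<circ> tperm n S T))) = (\<Sum>i=1..n. \<nu>' ((\<rho> \<circ> tperm n S T) i) * \<nu>' ((\<rho> \<circ> tperm n S T) i))"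
      unfolding sqsum_def by (rule sum.cong) auto
    then show ?thesis unfolding sqsum_def using sum_perm_nat[OF permutes_compose[OF pp that]] by simp
  qed
  have b: "below n \<nu> S T m" "lookup P m \<ge> 0" if "m \<in> keys P" for m using assms(6) that by (auto simp: topped_def)
  have r: "\<rho> permutes {1..n}" if "\<rho> \<in> refs n \<nu> S" for \<rho> using that by (simp add: refs_def)
  show "m \<in> keys P \<Longrightarrow> keys m \<subseteq> {1..n} \<and> (\<Sum>i=1..n. lookup m i) = (\<Sum>i=1..n. \<nu>' i) \<and> sqsum n (lookup m) \<le> sqsum n \<nu>'"
  proof -
    assume m: "m \<in> keys P"
    have "(\<Sum>i=1..n. \<nu> i) = (\<Sum>i=1..n. \<nu>' i)" using assms(1) by (intro sum.cong) auto
    moreover have "sqsum n (lookup m) \<le> sqsum n \<nu>'"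
      using b(1)[OF m] sqp e r unfolding below_def sq by (metis less_imp_le order_refl)
    ultimately show ?thesis using b(1)[OF m] by (simp add: below_def)
  qed
  show "lead n \<nu>' S T (top_part n (sqsum n \<nu>') P)"
    unfolding lead_def
  proof (intro conjI ballI)
    fix m assume "m \<in> keys (top_part n (sqsum n \<nu>') P)"
    then have m: "sqsum n (lookup m) = sqsum n \<nu>'" "m \<in> keys P"
      by (auto simp: in_keys_iff lookup_top_part split: if_splits)
    show "lookup (top_part n (sqsum n \<nu>') P) m \<ge> 0" using b(2)[OF m(2)] by (simp add: lookup_top_part)
    obtain \<rho> where "\<rho> \<in> refs n \<nu> S" "m = expo n (\<nu> \<circ> \<rho> \<circ> tperm n S T)" using b(1)[OF m(2)] m(1) by (auto simp: below_def sq)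
    moreover have "\<rho> \<in> refs n \<nu>' S" using calculation by (simp add: refs_def)
    ultimately show "\<exists>\<rho>\<in>refs n \<nu>' S. m = expo n (\<nu>' \<circ> \<rho> \<circ> tperm n S T)" using e r by blast
  next
    have "lookup P (expo n (\<nu>' \<circ> tperm n S T)) > 0"
      using assms(6) e[OF permutes_id] by (simp add: topped_def)
    then show "lookup (top_part n (sqsum n \<nu>') P) (expo n (\<nu>' \<circ> tperm n S T)) > 0"
      using sqp[OF permutes_id] by (simp add: lookup_top_part)
  qed
qed

section \<open>Finite families and dimension counts\<close>

definition indep_fam :: "'i set \<Rightarrow> ('i \<Rightarrow> qpoly) \<Rightarrow> bool" where
  "indep_fam I w \<longleftrightarrow> (\<forall>c. (\<Sum>i\<in>I. const (c i) * w i) = 0 \<longrightarrow> (\<forall>i\<in>I. c i = 0))"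

lemma independent_family:
  assumes fin: "finite I" and ind: "indep_fam I w"
  shows "inj_on w I" "qv.independent (w ` I)"
proof -
  show inj: "inj_on w I"
  proof (rule inj_onI, rule ccontr)
    fix i j assume ij: "i \<in> I" "j \<in> I" "w i = w j" "i \<noteq> j"
    let ?c = "\<lambda>x. if x = i then (1::rat) else if x = j then -1 else 0"
    have "(\<Sum>x\<in>I. const (?c x) * w x) = (\<Sum>x\<in>{i, j}. const (?c x) * w x)"
      using ij fin by (intro sum.mono_neutral_right) auto
    also have "\<dots> = 0" using ij by (simp add: const_arith)
    finally have e: "(\<Sum>x\<in>I. const (?c x) * w x) = 0" .
    have "\<forall>x\<in>I. ?c x = 0" using mp[OF spec[OF ind[unfolded indep_fam_def], of ?c] e] .
    from bspec[OF this ij(1)] show False by simp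
  qed
  show "qv.independent (w ` I)"
  proof
    assume "qv.dependent (w ` I)"
    then obtain u where u: "\<exists>v\<in>w ` I. u v \<noteq> 0" "(\<Sum>v\<in>w ` I. const (u v) * v) = 0"
      using qv.dependent_finite[of "w ` I"] fin by auto
    have "(\<Sum>i\<in>I. const (u (w i)) * w i) = 0" using u(2) by (simp add: sum.reindex[OF inj])
    then have "u (w i) = 0" if "i \<in> I" for i 
      using ind[unfolded indep_fam_def, rule_format, of "\<lambda>i. u (w i)"] that by blast
    then show False using u(1) by auto
  qed
qed

text \<open>A vector of \<open>B\<close> outside the span would enlarge the family to an independent
  set in the span of \<open>B\<close> with more than \<open>card B\<close> members.\<close>

lemma independent_family_spans:
  assumes fin: "finite I" and ind: "indep_fam I w"
    and B: "finite B" "w ` I \<subseteq> qv.span B" "card B \<le> card I"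
  shows "B \<subseteq> qv.span (w ` I)"
proof (rule ccontr)
  note i = independent_family[OF fin ind]
  assume "\<not> B \<subseteq> qv.span (w ` I)"
  then obtain b where b: "b \<in> B" "b \<notin> qv.span (w ` I)" by blast
  then have "b \<notin> w ` I" using qv.span_base by blast
  have "qv.independent (insert b (w ` I))" using i(2) b(2) by (rule qv.independent_insertI[rotated])
  moreover have "insert b (w ` I) \<subseteq> qv.span B" using B(2) b(1) qv.span_base by blast
  ultimately have "card (insert b (w ` I)) \<le> card B" using qv.independent_span_bound[OF B(1)] by blast
  then show False using \<open>b \<notin> w ` I\<close> fin i(1) B(3) by (simp add: card_image)
qed

lemma span_image_sum:
  assumes "finite I" "p \<in> qv.span (w ` I)"
  obtains c where "p = (\<Sum>i\<in>I. const (c i) * w i)"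
proof -
  obtain J where J: "J \<subseteq> I" "w ` J = w ` I" "inj_on w J" using subset_image_inj[of "w ` I" w I] by auto
  have "finite (w ` J)" using assms(1) J(1) finite_subset by blast
  then have "qv.span (w ` J) = range (\<lambda>u. \<Sum>v\<in>w ` J. const (u v) * v)" by (rule qv.span_finite)
  then obtain u where "p = (\<Sum>v\<in>w ` J. const (u v) * v)" using assms(2) J(2) by auto
  then have "p = (\<Sum>i\<in>J. const (u (w i)) * w i)" by (simp add: sum.reindex[OF J(3)])
  also have "\<dots> = (\<Sum>i\<in>I. const (if i \<in> J then u (w i) else 0) * w i)"
    using J(1) assms(1) by (intro sum.mono_neutral_cong_left) auto
  finally show ?thesis by (rule that)
qed

lemma keys_span: "keys p \<subseteq> A \<Longrightarrow> p \<in> qv.span ((\<lambda>m. Poly_Mapping.single m 1) ` A)"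
  by (subst qpoly_expand, intro qv.span_sum qv.span_scale qv.span_base) auto

lemma galg_op_keys:
  assumes "galg_op n F" "\<And>m \<pi>. m \<in> keys p \<Longrightarrow> \<pi> permutes {1..n} \<Longrightarrow> Poly_Mapping.map_key \<pi> m \<in> A"
  shows "keys (F p) \<subseteq> A"
proof
  fix x assume x: "x \<in> keys (F p)"
  from galg_op_expand[OF assms(1)] obtain y where y: "F p = (\<Sum>\<pi> | \<pi> permutes {1..n}. const (y \<pi>) * perm_act \<pi> p)" by blast
  have "(\<Sum>\<pi> | \<pi> permutes {1..n}. y \<pi> * lookup (perm_act \<pi> p) x) \<noteq> 0"
    using x unfolding y in_keys_iff lookup_sum by simp
  then obtain \<pi> where \<pi>: "\<pi> permutes {1..n}" "lookup (perm_act \<pi> p) x \<noteq> 0"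
    by (metis (mono_tags, lifting) mem_Collect_eq mult_zero_right sum.neutral)
  note b = permutes_bij[OF \<pi>(1)]
  have "Poly_Mapping.map_key \<pi> x \<in> keys p" using \<pi>(2) by (simp add: lookup_perm_act b in_keys_iff)
  from assms(2)[OF this permutes_inv[OF \<pi>(1)]] show "x \<in> A" by (simp add: map_key_inv b)
qed

lemma lead_keys:
  assumes "(S, T) \<in> fam n \<nu>" "lead n \<nu> S T v" shows "keys v \<subseteq> orb n \<nu>"
proof
  fix m assume "m \<in> keys v"
  then obtain \<rho> where \<rho>: "\<rho> \<in> refs n \<nu> S" "m = expo n (\<nu> \<circ> \<rho> \<circ> tperm n S T)" using assms(2) by (auto simp: lead_def)
  have "\<rho> \<circ> tperm n S T permutes {1..n}"
    using \<rho>(1) assms(1) by (intro permutes_compose tperm_permutes) (auto simp: refs_def fam_def)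
  then show "m \<in> orb n \<nu>" unfolding orb_def \<rho>(2) comp_assoc by blast
qed

lemma orb_map_key: "m \<in> orb n \<nu> \<Longrightarrow> \<pi> permutes {1..n} \<Longrightarrow> Poly_Mapping.map_key \<pi> m \<in> orb n \<nu>"
  unfolding orb_def using map_key_expo permutes_compose by (fastforce simp: comp_assoc)

lemma fam_indep_fam:
  assumes "\<And>S T. (S, T) \<in> fam n \<nu> \<Longrightarrow> lead n \<nu> S T (v (S, T))"
  shows "indep_fam (fam n \<nu>) (\<lambda>x. young n (rw (snd x)) (cl (snd x)) (v x))"
  unfolding indep_fam_def
proof (intro allI impI ballI)
  fix c x assume "(\<Sum>x\<in>fam n \<nu>. const (c x) * young n (rw (snd x)) (cl (snd x)) (v x)) = 0" "x \<in> fam n \<nu>"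
  then show "c x = 0" using fam_independent[OF finite_fam, of n \<nu> v c x] assms by blast
qed

text \<open>The family is independent, lies in the span of the monomials of one orbit and has at
  least as many members as there are such monomials.\<close>

theorem fam_spans:
  assumes mono: "\<And>a b. 1 \<le> a \<Longrightarrow> a \<le> b \<Longrightarrow> b \<le> n \<Longrightarrow> \<nu> a \<le> \<nu> b"
    and v: "\<And>S T. (S, T) \<in> fam n \<nu> \<Longrightarrow> lead n \<nu> S T (v (S, T))"
    and m: "m \<in> orb n \<nu>"
  obtains c where "Poly_Mapping.single m 1 = (\<Sum>x\<in>fam n \<nu>. const (c x) * young n (rw (snd x)) (cl (snd x)) (v x))"
proof -
  let ?w = "\<lambda>x. young n (rw (snd x)) (cl (snd x)) (v x)" and ?B = "(\<lambda>m. Poly_Mapping.single m 1) ` orb n \<nu> :: qpoly set"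
  have "?w ` fam n \<nu> \<subseteq> qv.span ?B"
  proof (rule image_subsetI)
    fix x assume x: "x \<in> fam n \<nu>"
    then have "keys (v x) \<subseteq> orb n \<nu>" using lead_keys v by (metis prod.collapse)
    then show "?w x \<in> qv.span ?B"
      by (intro keys_span galg_op_keys[OF galg_op_young] orb_map_key) auto
  qed
  moreover have "card ?B \<le> card (fam n \<nu>)"
    using card_image_le[of "orb n \<nu>" "\<lambda>m. Poly_Mapping.single m 1 :: qpoly"] card_orb_le_card_fam[of n \<nu>, OF mono] by simp
  ultimately have "?B \<subseteq> qv.span (?w ` fam n \<nu>)"
    using independent_family_spans[of "fam n \<nu>" ?w ?B] fam_indep_fam[of n \<nu> v, OF v] by simp
  then have "Poly_Mapping.single m 1 \<in> qv.span (?w ` fam n \<nu>)" using m by blast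
  then obtain c where "Poly_Mapping.single m 1 = (\<Sum>x\<in>fam n \<nu>. const (c x) * ?w x)"
    by (rule span_image_sum[OF finite_fam])
  then show ?thesis by (rule that)
qed

text \<open>The same independence read as an upper bound, which the count of the index set
  uses.\<close>

lemma card_fam_le_card_orb:
  assumes v: "\<And>S T. (S, T) \<in> fam n \<nu> \<Longrightarrow> lead n \<nu> S T (v (S, T))"
  shows "card (fam n \<nu>) \<le> card (orb n \<nu>)"
proof -
  let ?w = "\<lambda>x. young n (rw (snd x)) (cl (snd x)) (v x)" and ?B = "(\<lambda>m. Poly_Mapping.single m 1) ` orb n \<nu> :: qpoly set"
  note ind = fam_indep_fam[of n \<nu> v, OF v]
  have "?w ` fam n \<nu> \<subseteq> qv.span ?B"
  proof (rule image_subsetI)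
    fix x assume x: "x \<in> fam n \<nu>"
    then have "keys (v x) \<subseteq> orb n \<nu>" using lead_keys v by (metis prod.collapse)
    then show "?w x \<in> qv.span ?B"
      by (intro keys_span galg_op_keys[OF galg_op_young] orb_map_key) auto
  qed
  then have "card (?w ` fam n \<nu>) \<le> card ?B"
    using qv.independent_span_bound[of ?B "?w ` fam n \<nu>"] independent_family(2)[OF finite_fam ind] by simp
  then have "card (fam n \<nu>) \<le> card ?B" using independent_family(1)[OF finite_fam ind] by (simp add: card_image)
  also have "\<dots> \<le> card (orb n \<nu>)" by (rule card_image_le) simp
  finally show ?thesis .
qed

lemma lead_monomial:
  assumes "(S, T) \<in> fam n \<nu>" shows "lead n \<nu> S T (xm n (\<nu> \<circ> tperm n S T))"
  unfolding lead_def xm_def using id_refs[of n \<nu> S] by (auto simp: lookup_single intro!: bexI[of _ id])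

section \<open>Straightening\<close>

definition degm :: "nat \<Rightarrow> (nat \<Rightarrow>\<^sub>0 nat) \<Rightarrow> nat" where "degm n m = (\<Sum>i=1..n. lookup m i)"

definition Hom :: "nat \<Rightarrow> nat \<Rightarrow> qpoly set" where
  "Hom n d = {p. \<forall>m\<in>keys p. keys m \<subseteq> {1..n} \<and> degm n m = d}"

text \<open>A permutation maximizing the pairing of \<open>b\<close> with positions sorts
  it.\<close>

lemma sort_exists:
  fixes b :: "nat \<Rightarrow> nat" and n :: nat
  obtains \<nu> \<pi> where "\<pi> permutes {1..n}" "b = \<nu> \<circ> \<pi>" "\<And>a b. 1 \<le> a \<Longrightarrow> a \<le> b \<Longrightarrow> b \<le> n \<Longrightarrow> \<nu> a \<le> \<nu> b"
proof -
  let ?f = "\<lambda>\<pi>. \<Sum>i=1..n. i * b (\<pi> i)"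
  have fin: "finite (?f ` {\<pi>. \<pi> permutes {1..n}})" "?f ` {\<pi>. \<pi> permutes {1..n}} \<noteq> {}"
    using permutes_id[of "{1..n}"] by (simp_all add: finite_permutations exI[of _ id])
  from Max_in[OF this] obtain \<pi> where \<pi>: "\<pi> permutes {1..n}" "?f \<pi> = Max (?f ` {\<pi>. \<pi> permutes {1..n}})" by auto
  have mx: "?f \<rho> \<le> ?f \<pi>" if "\<rho> permutes {1..n}" for \<rho> using Max_ge[OF fin(1)] that \<pi>(2) by simp
  have mono: "b (\<pi> i) \<le> b (\<pi> j)" if ij: "1 \<le> i" "i \<le> j" "j \<le> n" for i j
  proof (rule ccontr)
    assume n: "\<not> b (\<pi> i) \<le> b (\<pi> j)"
    then have lt: "i < j" using ij by (cases "i = j") auto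
    have in1: "i \<in> {1..n}" "j \<in> {1..n}" using ij lt by auto
    have "?f \<pi> < ?f (\<pi> \<circ> Transposition.transpose i j)"
      using sum_swap_less[OF in1, of "\<lambda>i. i" "b \<circ> \<pi>"] lt n by (simp add: comp_def)
    then show False using mx[OF permutes_compose[OF permutes_swap_id[OF in1] \<pi>(1)]] by simp
  qed
  show ?thesis
  proof (rule that)
    show "pinv \<pi> permutes {1..n}" by (rule permutes_inv[OF \<pi>(1)])
    show "b = (b \<circ> \<pi>) \<circ> pinv \<pi>" using permutes_inverses(1)[OF \<pi>(1)] by auto
    show "(b \<circ> \<pi>) i \<le> (b \<circ> \<pi>) j" if "1 \<le> i" "i \<le> j" "j \<le> n" for i j using mono that by simp
  qed
qed

definition basis_elt :: "nat \<Rightarrow> nat \<Rightarrow> nat list list \<times> nat list list \<times> (nat \<Rightarrow> nat) \<Rightarrow> qpoly" where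
  "basis_elt n k = (\<lambda>(S, T, i). higher_specht n S T * (\<Prod>d=1..n - k. esym n d ^ i d))"

text \<open>Exponents vanish outside the range so that each tuple is a single function; the bound is
  written as a sum to avoid subtraction of naturals.\<close>

definition basis_idx :: "nat \<Rightarrow> nat \<Rightarrow> (nat list list \<times> nat list list \<times> (nat \<Rightarrow> nat)) set" where
  "basis_idx n k = {(S, T, i). S \<in> SYT n \<and> T \<in> SYT n \<and> shape S = shape T \<and> (\<forall>r. r \<notin> {1..n - k} \<longrightarrow> i r = 0) \<and>
     (\<Sum>d=1..n - k. i d) + des S < k}"

definition basis_deg :: "nat \<Rightarrow> nat \<Rightarrow> nat list list \<times> nat list list \<times> (nat \<Rightarrow> nat) \<Rightarrow> nat" where
  "basis_deg n k = (\<lambda>(S, T, i). (\<Sum>a=1..n. lab S a) + (\<Sum>d=1..n - k. d * i d))"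

lemma lab_des:
  assumes S: "S \<in> SYT n" and n: "1 \<le> n" shows "lab S n = des S"
proof -
  have *: "lab S a = card (descents S \<inter> {1..<a})" if "1 \<le> a" "a \<le> n" for a using that
  proof (induction a rule: dec_induct)
    case (step a)
    have an: "1 \<le> a" "a < n" using step by auto
    have "{1..<Suc a} = insert a {1..<a}" using an by auto
    then show ?case using step lab_Suc[OF S an] by (auto simp: Int_insert_right)
  qed simp
  have "descents S \<subseteq> {1..<n}" using descents_rw[OF S] by auto
  then show ?thesis using *[OF n] by (simp add: des_def Int_absorb2)
qed

lemma young_sym:
  assumes "\<And>\<pi>. \<pi> permutes {1..n} \<Longrightarrow> perm_act \<pi> e = e" shows "young n f h (p * e) = young n f h p * e"
  unfolding young_def by (simp add: rowop_sym[OF assms] colop_sym[OF assms])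

lemma perm_act_esym_prod: "\<pi> permutes {1..n} \<Longrightarrow> perm_act \<pi> (\<Prod>r\<in>R. esym n r ^ i r) = (\<Prod>r\<in>R. esym n r ^ i r)"
  by (simp add: perm_act_prod perm_act_power perm_act_esym permutes_bij)

section \<open>Homogeneous polynomials\<close>

lemma degm_add: "degm n (a + b) = degm n a + degm n b"
  by (simp add: degm_def lookup_add sum.distrib)

lemma Hom_mult: "p \<in> Hom n d \<Longrightarrow> q \<in> Hom n e \<Longrightarrow> p * q \<in> Hom n (d + e)"
proof -
  assume pq: "p \<in> Hom n d" "q \<in> Hom n e"
  have "keys m \<subseteq> {1..n} \<and> degm n m = d + e" if "m \<in> keys (p * q)" for m
  proof -
    have "m \<in> {a + b | a b. a \<in> keys p \<and> b \<in> keys q}" using keys_mult[of p q] that by (rule subsetD)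
    then obtain a b where ab: "m = a + b" "a \<in> keys p" "b \<in> keys q" by blast
    then have "keys a \<subseteq> {1..n}" "degm n a = d" "keys b \<subseteq> {1..n}" "degm n b = e" using pq by (auto simp: Hom_def)
    then show ?thesis using keys_add[of a b] by (auto simp: ab(1) degm_add)
  qed
  then show ?thesis by (auto simp: Hom_def)
qed

lemma Hom_one: "1 \<in> Hom n 0"
proof -
  have "(1 :: qpoly) = Poly_Mapping.single 0 1" by simp
  then show ?thesis by (simp add: Hom_def degm_def del: single_one)
qed

lemma Hom_power: "p \<in> Hom n d \<Longrightarrow> p ^ k \<in> Hom n (d * k)"
  by (induction k) (auto simp: Hom_one dest: Hom_mult)

lemma Hom_prod: "(\<And>x. x \<in> A \<Longrightarrow> f x \<in> Hom n (d x)) \<Longrightarrow> (\<Prod>x\<in>A. f x) \<in> Hom n (\<Sum>x\<in>A. d x)"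
  by (induction A rule: infinite_finite_induct) (auto simp: Hom_one Hom_mult)

lemma Hom_zero: "0 \<in> Hom n d" by (simp add: Hom_def)

lemma Hom_add: "p \<in> Hom n d \<Longrightarrow> q \<in> Hom n d \<Longrightarrow> p + q \<in> Hom n d"
  using keys_add[of p q] by (auto simp: Hom_def)

lemma Hom_sum: "(\<And>x. x \<in> A \<Longrightarrow> f x \<in> Hom n d) \<Longrightarrow> (\<Sum>x\<in>A. f x) \<in> Hom n d"
  by (induction A rule: infinite_finite_induct) (auto simp: Hom_zero Hom_add)

lemma Hom_xm: "xm n b \<in> Hom n (\<Sum>i=1..n. b i)"
  unfolding Hom_def xm_def using keys_expo[of n b] by (auto simp: degm_def)

lemma Hom_esym: "esym n r \<in> Hom n r"
  unfolding esym_alt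
proof (rule Hom_sum)
  fix J assume J: "J \<in> {J. J \<subseteq> {1..n} \<and> card J = r}"
  have "(\<Sum>i=1..n. if i \<in> J then 1 else 0) = r" using J by (simp add: sum.If_cases Int_absorb1)
  then show "xm n (\<lambda>i. if i \<in> J then 1 else 0) \<in> Hom n r" using Hom_xm[of n "\<lambda>i. if i \<in> J then 1 else 0"] by simp
qed

lemma map_key_keys: "\<pi> permutes {1..n} \<Longrightarrow> keys m \<subseteq> {1..n} \<Longrightarrow> Poly_Mapping.map_key \<pi> m = expo n (lookup m \<circ> \<pi>)"
  using map_key_expo[of \<pi> n "lookup m"] by (simp add: expo_lookup)

lemma degm_expo: "degm n (expo n b) = (\<Sum>i=1..n. b i)"
  by (simp add: degm_def)

lemma galg_op_Hom: "galg_op n F \<Longrightarrow> p \<in> Hom n d \<Longrightarrow> F p \<in> Hom n d"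
proof -
  assume F: "galg_op n F" and p: "p \<in> Hom n d"
  have "keys (F p) \<subseteq> {m. keys m \<subseteq> {1..n} \<and> degm n m = d}"
  proof (rule galg_op_keys[OF F])
    fix m \<pi> assume m: "m \<in> keys p" and \<pi>: "\<pi> permutes {1..n}"
    then have k: "keys m \<subseteq> {1..n}" "degm n m = d" using p by (auto simp: Hom_def)
    have "degm n (expo n (lookup m \<circ> \<pi>)) = d"
      using sum_perm_nat[OF \<pi>, of "lookup m"] k(2) by (simp add: degm_expo, simp add: degm_def)
    then show "Poly_Mapping.map_key \<pi> m \<in> {m. keys m \<subseteq> {1..n} \<and> degm n m = d}"
      unfolding map_key_keys[OF \<pi> k(1)] using keys_expo by simp
  qed
  then show ?thesis by (auto simp: Hom_def)
qed

lemma Hom_higher_specht: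
  assumes "S \<in> SYT n" "T \<in> SYT n" "shape S = shape T" shows "higher_specht n S T \<in> Hom n (\<Sum>a=1..n. lab S a)"
  unfolding higher_specht_young[OF assms]
  using galg_op_Hom[OF galg_op_young Hom_xm, of n "rw T" "cl T" "\<lambda>i. lab S (tperm n S T i)"]
    sum_perm_nat[OF tperm_permutes[OF assms], of "lab S"] by simp

lemma Hom_basis_elt: "x \<in> basis_idx n k \<Longrightarrow> basis_elt n k x \<in> Hom n (basis_deg n k x)"
  unfolding basis_elt_def basis_deg_def basis_idx_def by (auto intro!: Hom_mult Hom_higher_specht Hom_prod Hom_power Hom_esym)

lemma sqsum_map_key:
  assumes "\<pi> permutes {1..n}" "keys m \<subseteq> {1..n}" shows "sqsum n (lookup (Poly_Mapping.map_key \<pi> m)) = sqsum n (lookup m)"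
proof -
  have "sqsum n (lookup (Poly_Mapping.map_key \<pi> m)) = (\<Sum>i=1..n. lookup m (\<pi> i) * lookup m (\<pi> i))"
    unfolding map_key_keys[OF assms] sqsum_def by (rule sum.cong) auto
  then show ?thesis unfolding sqsum_def using sum_perm_nat[OF assms(1)] by simp
qed

text \<open>\<open>Z\<close> is abstract because this is applied both to the ideal and to the
  polynomials that drop in degree on the surjections. Induction runs on the sum of squares:
  \<open>fam_spans\<close> writes the monomial through leading parts of products, a product differs
  from its leading part by smaller monomials, and the product itself lies in \<open>Z\<close> if it
  has a factor \<open>e_r\<close> with \<open>r > n - k\<close> and is a basis member
  otherwise.\<close>

theorem straighten:
  assumes k: "1 \<le> k" "k \<le> n" and Z: "qv.subspace Z"
    and H1: "\<And>b i. (\<Sum>i=1..n. b i) = D \<Longrightarrow> i \<in> {1..n} \<Longrightarrow> k \<le> b i \<Longrightarrow> xm n b \<in> Z"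
    and H2: "\<And>r p. n - k < r \<Longrightarrow> r \<le> n \<Longrightarrow> r \<le> D \<Longrightarrow> p \<in> Hom n (D - r) \<Longrightarrow> esym n r * p \<in> Z"
  shows "(\<Sum>i=1..n. b i) = D \<Longrightarrow> xm n b \<in> qv.span (Z \<union> basis_elt n k ` {x \<in> basis_idx n k. basis_deg n k x = D})"
proof (induction "sqsum n b" arbitrary: b rule: less_induct)
  case less
  let ?V = "qv.span (Z \<union> basis_elt n k ` {x \<in> basis_idx n k. basis_deg n k x = D})"
  obtain \<nu> \<pi> where \<pi>: "\<pi> permutes {1..n}" and b: "b = \<nu> \<circ> \<pi>" and mono: "\<And>a b. 1 \<le> a \<Longrightarrow> a \<le> b \<Longrightarrow> b \<le> n \<Longrightarrow> \<nu> a \<le> \<nu> b"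
    using sort_exists[of n b] by blast
  have sD: "(\<Sum>i=1..n. \<nu> i) = D" using sum_perm_nat[OF \<pi>, of \<nu>] less.prems b by simp
  have sq: "sqsum n b = sqsum n \<nu>" unfolding sqsum_def b using sum_perm_nat[OF \<pi>, of "\<lambda>i. \<nu> i * \<nu> i"] by simp
  show ?case
  proof (cases "\<exists>i\<in>{1..n}. k \<le> b i")
    case True
    then show ?thesis using H1[OF less.prems] by (intro qv.span_base) blast
  next
    case False
    have "\<nu> n < k"
    proof -
      have "n \<in> {1..n}" using k by auto
      then obtain i where "i \<in> {1..n}" "n = \<pi> i" using permutes_image[OF \<pi>] by blast
      then show ?thesis using False b by (metis comp_apply not_le)
    qed
    \<comment> \<open>The exponents for which the product with the cocharge monomial has leading
      exponents \<nu>.\<close>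
    let ?E = "\<lambda>S. \<Prod>r=1..n. esym n r ^ expn n \<nu> S r"
    let ?P = "\<lambda>(S, T). xm n (\<lambda>i. lab S (tperm n S T i)) * ?E S"
    let ?v = "\<lambda>x. top_part n (sqsum n \<nu>) (?P x)"
    have tc: "lead n \<nu> S T (?v (S, T))"
      "m \<in> keys (?P (S, T)) \<Longrightarrow> keys m \<subseteq> {1..n} \<and> (\<Sum>i=1..n. lookup m i) = (\<Sum>i=1..n. \<nu> i) \<and> sqsum n (lookup m) \<le> sqsum n \<nu>"
      if x: "(S, T) \<in> fam n \<nu>" for S T m
    proof -
      have S: "S \<in> SYT n" "T \<in> SYT n" "shape S = shape T" "compat n \<nu> S" using x by (auto simp: fam_def)
      have e: "lab S a + (\<Sum>r\<in>{1..n}. if n < a + r then expn n \<nu> S r else 0) = \<nu> a" if "a \<in> {1..n}" for a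
        using expn_sum[OF S(1,4)] that by simp
      note t = topped_cong[OF e S(4) S(1-3) topped_prod[OF S(1-3) subset_refl]]
      show "lead n \<nu> S T (?v (S, T))" using t(1) by simp
      show "m \<in> keys (?P (S, T)) \<Longrightarrow> keys m \<subseteq> {1..n} \<and> (\<Sum>i=1..n. lookup m i) = (\<Sum>i=1..n. \<nu> i) \<and> sqsum n (lookup m) \<le> sqsum n \<nu>"
        using t(2) by simp
    qed
    have "expo n b \<in> orb n \<nu>" using \<pi> b by (auto simp: orb_def)
    from fam_spans[where v = ?v, OF mono tc(1) this] obtain c where
      c: "xm n b = (\<Sum>x\<in>fam n \<nu>. const (c x) * young n (rw (snd x)) (cl (snd x)) (?v x))" unfolding xm_def by blast
    have "young n (rw T) (cl T) (?v (S, T)) \<in> ?V" if x: "(S, T) \<in> fam n \<nu>" for S T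
    proof -
      have S: "S \<in> SYT n" "T \<in> SYT n" "shape S = shape T" "compat n \<nu> S" using x by (auto simp: fam_def)
      \<comment> \<open>The lower terms have a smaller sum of squares, which the symmetrizer
        preserves, so the induction hypothesis covers them.\<close>
      let ?w = "?P (S, T) - ?v (S, T)"
      have kw: "m \<in> keys (?P (S, T)) \<and> sqsum n (lookup m) < sqsum n \<nu>" if m: "m \<in> keys ?w" for m
      proof -
        have "lookup ?w m \<noteq> 0" using m by (simp add: in_keys_iff)
        then have "lookup (?P (S, T)) m \<noteq> 0" "sqsum n (lookup m) \<noteq> sqsum n \<nu>"
          by (auto simp: lookup_minus lookup_top_part split: if_splits)
        then show ?thesis using tc(2)[OF x, of m] by (simp add: in_keys_iff)
      qed
      let ?A = "{m. keys m \<subseteq> {1..n} \<and> degm n m = D \<and> sqsum n (lookup m) < sqsum n \<nu>}"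
      have "keys (young n (rw T) (cl T) ?w) \<subseteq> ?A"
      proof (rule galg_op_keys[OF galg_op_young])
        fix m \<rho> assume m: "m \<in> keys ?w" and \<rho>: "\<rho> permutes {1..n}"
        have km: "keys m \<subseteq> {1..n}" "degm n m = D" "sqsum n (lookup m) < sqsum n \<nu>"
          using tc(2)[OF x] kw[OF m] sD by (auto simp: degm_def)
        have "degm n (expo n (lookup m \<circ> \<rho>)) = D"
          using sum_perm_nat[OF \<rho>, of "lookup m"] km(2) by (simp add: degm_expo, simp add: degm_def)
        then show "Poly_Mapping.map_key \<rho> m \<in> ?A"
          using sqsum_map_key[OF \<rho> km(1)] km keys_expo[of n] unfolding map_key_keys[OF \<rho> km(1)] by simp
      qed
      then have "young n (rw T) (cl T) ?w \<in> qv.span ((\<lambda>m. Poly_Mapping.single m 1) ` ?A)" by (rule keys_span)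
      also have "\<dots> \<subseteq> ?V"
      proof (rule qv.span_minimal)
        show "(\<lambda>m. Poly_Mapping.single m 1) ` ?A \<subseteq> ?V"
        proof (rule image_subsetI)
          fix m assume m: "m \<in> ?A"
          have "xm n (lookup m) \<in> ?V" using less.hyps[of "lookup m"] m sq by (simp add: degm_def)
          then show "Poly_Mapping.single m 1 \<in> ?V" using m by (simp add: xm_def expo_lookup)
        qed
      qed (rule qv.subspace_span)
      finally have w: "young n (rw T) (cl T) ?w \<in> ?V" .
      have yP: "young n (rw T) (cl T) (?P (S, T)) = higher_specht n S T * ?E S"
        unfolding higher_specht_young[OF S(1-3)] by (simp add: young_sym[OF perm_act_esym_prod])
      have HomP: "higher_specht n S T * ?E S \<in> Hom n D"
      proof -
        have "keys (young n (rw T) (cl T) (?P (S, T))) \<subseteq> {m. keys m \<subseteq> {1..n} \<and> degm n m = D}"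
        proof (rule galg_op_keys[OF galg_op_young])
          fix m \<rho> assume m: "m \<in> keys (?P (S, T))" and \<rho>: "\<rho> permutes {1..n}"
          have km: "keys m \<subseteq> {1..n}" "degm n m = D"
            using tc(2)[OF x m] sD by (auto simp: degm_def)
          have "degm n (expo n (lookup m \<circ> \<rho>)) = D"
            using sum_perm_nat[OF \<rho>, of "lookup m"] km(2) by (simp add: degm_expo, simp add: degm_def)
          then show "Poly_Mapping.map_key \<rho> m \<in> {m. keys m \<subseteq> {1..n} \<and> degm n m = D}"
            using keys_expo[of n] unfolding map_key_keys[OF \<rho> km(1)] by simp
        qed
        then show ?thesis unfolding yP by (auto simp: Hom_def)
      qed
      have dg: "(\<Sum>a=1..n. lab S a) + (\<Sum>r=1..n. r * expn n \<nu> S r) = D"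
      proof -
        have "D = (\<Sum>a=1..n. lab S a + (\<Sum>r=1..n. if n < a + r then expn n \<nu> S r else 0))"
          unfolding sD[symmetric] by (rule sum.cong) (use expn_sum[OF S(1,4)] in auto)
        also have "\<dots> = (\<Sum>a=1..n. lab S a) + (\<Sum>r=1..n. \<Sum>a=1..n. if n < a + r then expn n \<nu> S r else 0)"
          unfolding sum.distrib by (subst (2) sum.swap) (rule refl)
        also have "(\<Sum>r=1..n. \<Sum>a=1..n. if n < a + r then expn n \<nu> S r else 0) = (\<Sum>r=1..n. r * expn n \<nu> S r)"
        proof (rule sum.cong[OF refl])
          fix r assume r: "r \<in> {1..n}"
          have "{a \<in> {1..n}. n < a + r} = {n + 1 - r..n}" using r by auto
          then show "(\<Sum>a=1..n. if n < a + r then expn n \<nu> S r else 0) = r * expn n \<nu> S r"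
            using r by (simp add: sum.If_cases Int_def)
        qed
        finally show ?thesis by simp
      qed
      have P: "young n (rw T) (cl T) (?P (S, T)) \<in> ?V"
      proof (cases "\<exists>r. n - k < r \<and> r \<le> n \<and> expn n \<nu> S r > 0")
        case True
        then obtain r where r: "n - k < r" "r \<le> n" "expn n \<nu> S r > 0" by blast
        then have rN: "r \<in> {1..n}" by auto
        \<comment> \<open>One factor \<open>e_r\<close> is split off; the cofactor is homogeneous of
          degree \<open>D - r\<close>, as \<open>H2\<close> requires.\<close>
        let ?i = "\<lambda>s. if s = r then expn n \<nu> S s - 1 else expn n \<nu> S s"
        have Ei: "?E S = esym n r * (\<Prod>s=1..n. esym n s ^ ?i s)"
        proof -
          have "?E S = esym n r ^ expn n \<nu> S r * (\<Prod>s\<in>{1..n} - {r}. esym n s ^ expn n \<nu> S s)"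
            using rN by (simp add: prod.remove)
          moreover have "(\<Prod>s=1..n. esym n s ^ ?i s) = esym n r ^ (expn n \<nu> S r - 1) * (\<Prod>s\<in>{1..n} - {r}. esym n s ^ expn n \<nu> S s)"
            using rN by (subst prod.remove[of _ r]) (auto intro!: prod.cong)
          moreover have "esym n r ^ expn n \<nu> S r = esym n r * esym n r ^ (expn n \<nu> S r - 1)"
            using r(3) by (metis One_nat_def Suc_pred power_Suc)
          ultimately show ?thesis by (simp add: mult.assoc)
        qed
        have si: "(\<Sum>s=1..n. s * expn n \<nu> S s) = r + (\<Sum>s=1..n. s * ?i s)"
        proof -
          have "(\<Sum>s=1..n. s * expn n \<nu> S s) = r * expn n \<nu> S r + (\<Sum>s\<in>{1..n} - {r}. s * expn n \<nu> S s)"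
            using rN by (simp add: sum.remove)
          moreover have "(\<Sum>s=1..n. s * ?i s) = r * (expn n \<nu> S r - 1) + (\<Sum>s\<in>{1..n} - {r}. s * expn n \<nu> S s)"
            using rN by (subst sum.remove[of _ r]) (auto intro!: sum.cong)
          moreover have "r * expn n \<nu> S r = r + r * (expn n \<nu> S r - 1)" using r(3) by (cases "expn n \<nu> S r") auto
          ultimately show ?thesis by simp
        qed
        have "higher_specht n S T * (\<Prod>s=1..n. esym n s ^ ?i s) \<in> Hom n ((\<Sum>a=1..n. lab S a) + (\<Sum>s=1..n. s * ?i s))"
          by (intro Hom_mult Hom_higher_specht[OF S(1-3)] Hom_prod Hom_power Hom_esym)
        also have "(\<Sum>a=1..n. lab S a) + (\<Sum>s=1..n. s * ?i s) = D - r" using dg si by simp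
        finally have "esym n r * (higher_specht n S T * (\<Prod>s=1..n. esym n s ^ ?i s)) \<in> Z"
          using dg si by (intro H2 r) auto
        then show ?thesis unfolding yP Ei by (intro qv.span_base) (simp add: mult.left_commute)
      next
        case False
        let ?i = "\<lambda>r. if r \<in> {1..n - k} then expn n \<nu> S r else 0"
        have z: "expn n \<nu> S r = 0" if "r \<in> {1..n} - {1..n - k}" for r using False that k by auto
        have Ei: "?E S = (\<Prod>d=1..n - k. esym n d ^ ?i d)"
          by (rule prod.mono_neutral_cong_right) (use z k in auto)
        have si: "(\<Sum>r=1..n. r * expn n \<nu> S r) = (\<Sum>d=1..n - k. d * ?i d)"
          by (rule sum.mono_neutral_cong_right) (use z k in auto)
        have s1: "(\<Sum>r=1..n. expn n \<nu> S r) = (\<Sum>d=1..n - k. ?i d)"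
          by (rule sum.mono_neutral_cong_right) (use z k in auto)
        \<comment> \<open>Entry \<open>n\<close> has label \<open>des S\<close> and is raised by
          every factor, so the descents plus the number of factors make up \<open>\<nu> n\<close>,
          which is less than \<open>k\<close>.\<close>
        have "lab S n + (\<Sum>r=1..n. if n < n + r then expn n \<nu> S r else 0) = \<nu> n"
          using expn_sum[OF S(1,4), of n] k by simp
        moreover have "(\<Sum>r=1..n. if n < n + r then expn n \<nu> S r else 0) = (\<Sum>r=1..n. expn n \<nu> S r)"
          by (rule sum.cong) auto
        ultimately have "des S + (\<Sum>d=1..n - k. ?i d) < k" using lab_des[OF S(1)] k s1 \<open>\<nu> n < k\<close> by simp
        then have "(S, T, ?i) \<in> basis_idx n k" using S by (simp add: basis_idx_def add.commute)
        moreover have "basis_deg n k (S, T, ?i) = D" using dg si by (simp add: basis_deg_def)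
        moreover have "young n (rw T) (cl T) (?P (S, T)) = basis_elt n k (S, T, ?i)" unfolding yP Ei by (simp add: basis_elt_def)
        ultimately show ?thesis by (intro qv.span_base) (auto intro!: image_eqI)
      qed
      have "?v (S, T) = ?P (S, T) - ?w" by simp
      then have "young n (rw T) (cl T) (?v (S, T)) = young n (rw T) (cl T) (?P (S, T)) - young n (rw T) (cl T) ?w"
        using qlin_diff[OF qlin_young] by metis
      then show ?thesis using qv.span_diff[OF P w] by simp
    qed
    then show ?thesis unfolding c by (intro qv.span_sum qv.span_scale) auto
  qed
qed

section \<open>Surjections as a point set\<close>

definition monv :: "nat \<Rightarrow> (nat \<Rightarrow> nat) \<Rightarrow> (nat \<Rightarrow>\<^sub>0 nat) \<Rightarrow> rat" where
  "monv n x m = (\<Prod>i=1..n. of_nat (x i) ^ lookup m i)"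

definition evl :: "nat \<Rightarrow> (nat \<Rightarrow> nat) \<Rightarrow> qpoly \<Rightarrow> rat" where
  "evl n x p = (\<Sum>m\<in>keys p. lookup p m * monv n x m)"

lemma evl_superset: "finite A \<Longrightarrow> keys p \<subseteq> A \<Longrightarrow> evl n x p = (\<Sum>m\<in>A. lookup p m * monv n x m)"
  unfolding evl_def by (rule sum.mono_neutral_left) (auto simp: in_keys_iff)

lemma evl_add: "evl n x (p + q) = evl n x p + evl n x q"
  using evl_superset[of "keys p \<union> keys q" "p + q" n x] evl_superset[of "keys p \<union> keys q" p n x]
    evl_superset[of "keys p \<union> keys q" q n x] keys_add[of p q]
  by (simp add: lookup_add distrib_right sum.distrib)

lemma evl_scale: "evl n x (const c * p) = c * evl n x p"
proof -
  have "keys (const c * p) \<subseteq> keys p" by (auto simp: in_keys_iff)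
  then show ?thesis by (simp add: evl_superset[of "keys p"] sum_distrib_left mult.assoc)
qed

lemma evl_zero [simp]: "evl n x 0 = 0" by (simp add: evl_def)

lemma evl_sum: "evl n x (sum f A) = (\<Sum>a\<in>A. evl n x (f a))"
  by (induction A rule: infinite_finite_induct) (auto simp: evl_add)

lemma evl_diff: "evl n x (p - q) = evl n x p - evl n x q"
  using evl_add[of n x "p - q" q] by simp

lemma evl_single: "evl n x (Poly_Mapping.single m c) = c * monv n x m"
  by (cases "c = 0") (simp_all add: evl_def)

lemma monv_add: "monv n x (a + b) = monv n x a * monv n x b"
  by (simp add: monv_def lookup_add power_add prod.distrib)

lemma evl_mult: "evl n x (p * q) = evl n x p * evl n x q"
proof -
  have "p * q = (\<Sum>a\<in>keys p. \<Sum>b\<in>keys q. const (lookup p a) * (const (lookup q b) * Poly_Mapping.single (a + b) 1))"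
  proof -
    have "p * q = (\<Sum>a\<in>keys p. const (lookup p a) * Poly_Mapping.single a 1) * (\<Sum>b\<in>keys q. const (lookup q b) * Poly_Mapping.single b 1)"
      using qpoly_expand[of p] qpoly_expand[of q] by simp
    also have "\<dots> = (\<Sum>a\<in>keys p. \<Sum>b\<in>keys q. const (lookup p a) * Poly_Mapping.single a 1 * (const (lookup q b) * Poly_Mapping.single b 1))"
      by (rule sum_product)
    also have "\<dots> = (\<Sum>a\<in>keys p. \<Sum>b\<in>keys q. const (lookup p a) * (const (lookup q b) * Poly_Mapping.single (a + b) 1))"
    proof (intro sum.cong refl)
      fix a b
      have "Poly_Mapping.single (a + b) 1 = Poly_Mapping.single a 1 * (Poly_Mapping.single b 1 :: qpoly)" by (simp add: mult_single)
      then show "const (lookup p a) * Poly_Mapping.single a 1 * (const (lookup q b) * Poly_Mapping.single b 1)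
        = const (lookup p a) * (const (lookup q b) * Poly_Mapping.single (a + b) 1)"
        by (simp only: mult.assoc mult.left_commute[of "Poly_Mapping.single a 1"])
    qed
    finally show ?thesis .
  qed
  then have "evl n x (p * q) = (\<Sum>a\<in>keys p. \<Sum>b\<in>keys q. lookup p a * (lookup q b * monv n x (a + b)))"
    by (simp only: evl_sum evl_scale evl_single mult_1_left)
  also have "\<dots> = (\<Sum>a\<in>keys p. \<Sum>b\<in>keys q. (lookup p a * monv n x a) * (lookup q b * monv n x b))"
    by (intro sum.cong refl) (simp only: monv_add mult.assoc mult.left_commute)
  also have "\<dots> = evl n x p * evl n x q" unfolding evl_def by (rule sum_product[symmetric])
  finally show ?thesis .
qed

lemma evl_const [simp]: "evl n x (const c) = c"
  by (simp add: const_def evl_single monv_def)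

lemma evl_one [simp]: "evl n x 1 = 1" using evl_const[of n x 1] by simp

lemma evl_prod: "evl n x (prod f A) = (\<Prod>a\<in>A. evl n x (f a))"
  by (induction A rule: infinite_finite_induct) (auto simp: evl_mult)

lemma evl_pvar: "i \<in> {1..n} \<Longrightarrow> evl n x (pvar i) = of_nat (x i)"
proof -
  assume i: "i \<in> {1..n}"
  have "monv n x (Poly_Mapping.single i 1) = (\<Prod>j=1..n. if j = i then of_nat (x i) else 1)"
    unfolding monv_def by (rule prod.cong) (auto simp: lookup_single)
  then show ?thesis using i by (simp add: pvar_def evl_single)
qed

text \<open>The value 0 outside \<open>{1..n}\<close> makes each surjection a single
  function.\<close>

definition surjs :: "nat \<Rightarrow> nat \<Rightarrow> (nat \<Rightarrow> nat) set" where
  "surjs n k = {x. x ` {1..n} = {1..k} \<and> (\<forall>i. i \<notin> {1..n} \<longrightarrow> x i = 0)}"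

lemma finite_surjs [simp]: "finite (surjs n k)"
proof -
  have "finite {f. \<forall>i. (i \<in> {1..n} \<longrightarrow> f i \<in> {1..k}) \<and> (i \<notin> {1..n} \<longrightarrow> f i = (0::nat))}"
    by (rule finite_set_of_finite_funs) auto
  moreover have "surjs n k \<subseteq> {f. \<forall>i. (i \<in> {1..n} \<longrightarrow> f i \<in> {1..k}) \<and> (i \<notin> {1..n} \<longrightarrow> f i = 0)}"
    by (auto simp: surjs_def)
  ultimately show ?thesis by (rule finite_subset[rotated])
qed

lemma fps_nth_prod_linear:
  fixes a :: "'i \<Rightarrow> rat"
  assumes "finite A"
  shows "fps_nth (\<Prod>i\<in>A. 1 + fps_const (a i) * fps_X) r = (\<Sum>J | J \<subseteq> A \<and> card J = r. \<Prod>j\<in>J. a j)"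
proof -
  have "(\<Prod>i\<in>A. 1 + fps_const (a i) * fps_X) = (\<Prod>i\<in>A. fps_const (a i) * fps_X + 1)" by (simp add: add.commute)
  also have "\<dots> = (\<Sum>J\<in>Pow A. (\<Prod>j\<in>J. fps_const (a j) * fps_X))"
    using prod_add[OF assms, of "\<lambda>i. fps_const (a i) * fps_X" "\<lambda>_. 1"] by simp
  also have "\<dots> = (\<Sum>J\<in>Pow A. fps_const (\<Prod>j\<in>J. a j) * fps_X ^ card J)"
  proof (rule sum.cong[OF refl])
    fix J assume "J \<in> Pow A"
    then have "finite J" using assms finite_subset by auto
    then show "(\<Prod>j\<in>J. fps_const (a j) * fps_X) = fps_const (\<Prod>j\<in>J. a j) * fps_X ^ card J"
    proof (induction J rule: finite_induct)
      case (insert x F)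
      have "fps_const (a x) * fps_X * (fps_const (\<Prod>j\<in>F. a j) * fps_X ^ card F)
          = fps_const (a x) * fps_const (\<Prod>j\<in>F. a j) * (fps_X * fps_X ^ card F)"
        by (simp only: mult.assoc mult.left_commute)
      then show ?case using insert by simp
    qed simp
  qed
  finally have "fps_nth (\<Prod>i\<in>A. 1 + fps_const (a i) * fps_X) r = (\<Sum>J\<in>Pow A. if card J = r then (\<Prod>j\<in>J. a j) else 0)"
    by (auto simp: fps_sum_nth fps_X_power_nth intro!: sum.cong)
  also have "\<dots> = (\<Sum>J | J \<subseteq> A \<and> card J = r. \<Prod>j\<in>J. a j)"
    using assms by (simp add: sum.If_cases Int_def)
  finally show ?thesis .
qed

lemma evl_esym: "evl n x (esym n r) = fps_nth (\<Prod>i=1..n. 1 + fps_const (of_nat (x i)) * fps_X) r"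
proof -
  have "evl n x (esym n r) = (\<Sum>J | J \<subseteq> {1..n} \<and> card J = r. \<Prod>j\<in>J. evl n x (pvar j))"
    by (simp add: esym_def evl_sum evl_prod)
  also have "\<dots> = (\<Sum>J | J \<subseteq> {1..n} \<and> card J = r. \<Prod>j\<in>J. of_nat (x j))"
    by (intro sum.cong prod.cong refl) (auto simp: evl_pvar)
  finally show ?thesis using fps_nth_prod_linear[of "{1..n}" "\<lambda>i. of_nat (x i)" r] by simp
qed

text \<open>Complete homogeneous polynomials at \<open>-1, ..., -k\<close>.\<close>

definition hcoef :: "nat \<Rightarrow> nat \<Rightarrow> rat" where
  "hcoef k = fps_nth (inverse (\<Prod>j=1..k. 1 + fps_const (of_nat j) * fps_X))"

text \<open>Dividing out the values \<open>1,...,k\<close>, all of which occur among the coordinates, leaves a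
  generating function of degree \<open>n - k\<close>.\<close>

lemma esym_on_surjs:
  assumes x: "x \<in> surjs n k" and r: "n - k < r"
  shows "(\<Sum>j=0..r. hcoef k j * evl n x (esym n (r - j))) = 0" "hcoef k 0 = 1"
proof -
  let ?P = "\<Prod>j=1..k. 1 + fps_const (of_nat j :: rat) * fps_X"
  have im: "x ` {1..n} = {1..k}" using x by (simp add: surjs_def)
  \<comment> \<open>One coordinate for each value \<open>1, ..., k\<close>; the other
    \<open>n - k\<close> coordinates give the remaining factors.\<close>
  obtain A where A: "A \<subseteq> {1..n}" "inj_on x A" "x ` A = {1..k}"
    using subset_image_inj[of "{1..k}" x "{1..n}"] im by auto
  have cA: "card A = k" using card_image[OF A(2)] A(3) by simp
  have finA: "finite A" using A(1) by (rule finite_subset) simp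
  have "(\<Prod>i\<in>A. 1 + fps_const (of_nat (x i)) * fps_X) = ?P"
    using prod.reindex[OF A(2), of "\<lambda>j. 1 + fps_const (of_nat j :: rat) * fps_X"] A(3) by simp
  then have E: "(\<Prod>i=1..n. 1 + fps_const (of_nat (x i)) * fps_X) = ?P * (\<Prod>i\<in>{1..n} - A. 1 + fps_const (of_nat (x i)) * fps_X)"
    using prod.subset_diff[OF A(1), of "\<lambda>i. 1 + fps_const (of_nat (x i) :: rat) * fps_X"] by (simp add: mult.commute)
  have "fps_nth ?P 0 = 1" by (induction k) simp_all
  then have inv: "inverse ?P * ?P = 1" by (intro inverse_mult_eq_1) simp
  show "hcoef k 0 = 1" using \<open>fps_nth ?P 0 = 1\<close> by (simp add: hcoef_def)
  have "inverse ?P * (\<Prod>i=1..n. 1 + fps_const (of_nat (x i)) * fps_X) = (\<Prod>i\<in>{1..n} - A. 1 + fps_const (of_nat (x i)) * fps_X)"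
    unfolding E mult.assoc[symmetric] inv by simp
  then have "(\<Sum>j=0..r. hcoef k j * evl n x (esym n (r - j))) = fps_nth (\<Prod>i\<in>{1..n} - A. 1 + fps_const (of_nat (x i)) * fps_X) r"
    unfolding hcoef_def evl_esym fps_mult_nth[symmetric] by simp
  also have "\<dots> = (\<Sum>J | J \<subseteq> {1..n} - A \<and> card J = r. \<Prod>j\<in>J. of_nat (x j))" by (rule fps_nth_prod_linear) simp
  also have "{J. J \<subseteq> {1..n} - A \<and> card J = r} = {}"
  proof -
    have "card ({1..n} - A) = n - k" using A(1) finA cA by (simp add: card_Diff_subset)
    then have "card J \<le> n - k" if "J \<subseteq> {1..n} - A" for J using card_mono[of "{1..n} - A" J] that by simp
    then show ?thesis using r by (metis (mono_tags, lifting) empty_Collect_eq not_le)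
  qed
  finally show "(\<Sum>j=0..r. hcoef k j * evl n x (esym n (r - j))) = 0" by simp
qed

section \<open>Lower degree on the point set\<close>

definition Low :: "nat \<Rightarrow> nat \<Rightarrow> qpoly set" where
  "Low n D = {p. \<forall>m\<in>keys p. keys m \<subseteq> {1..n} \<and> degm n m < D}"

lemma Low_zero [simp]: "0 \<in> Low n D" by (simp add: Low_def)

lemma Low_add: "p \<in> Low n D \<Longrightarrow> q \<in> Low n D \<Longrightarrow> p + q \<in> Low n D"
  using keys_add[of p q] by (auto simp: Low_def)

lemma Low_scale: "p \<in> Low n D \<Longrightarrow> const c * p \<in> Low n D"
  by (auto simp: Low_def in_keys_iff)

lemma Low_sum: "(\<And>x. x \<in> A \<Longrightarrow> f x \<in> Low n D) \<Longrightarrow> (\<Sum>x\<in>A. f x) \<in> Low n D"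
  by (induction A rule: infinite_finite_induct) (auto simp: Low_add)

lemma Low_subspace: "qv.subspace (Low n D)"
  by (auto simp: qv.subspace_def Low_add Low_scale)

lemma Hom_Low: "p \<in> Hom n d \<Longrightarrow> d < D \<Longrightarrow> p \<in> Low n D"
  by (auto simp: Hom_def Low_def)

lemma Low_mono: "p \<in> Low n d \<Longrightarrow> d \<le> D \<Longrightarrow> p \<in> Low n D"
  by (auto simp: Low_def)

lemma Low_mult: "p \<in> Low n D \<Longrightarrow> q \<in> Hom n e \<Longrightarrow> p * q \<in> Low n (D + e)"
proof -
  assume pq: "p \<in> Low n D" "q \<in> Hom n e"
  have "keys m \<subseteq> {1..n} \<and> degm n m < D + e" if "m \<in> keys (p * q)" for m
  proof -
    have "m \<in> {a + b | a b. a \<in> keys p \<and> b \<in> keys q}" using keys_mult[of p q] that by (rule subsetD)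
    then obtain a b where ab: "m = a + b" "a \<in> keys p" "b \<in> keys q" by blast
    then have "keys a \<subseteq> {1..n}" "degm n a < D" "keys b \<subseteq> {1..n}" "degm n b = e" using pq by (auto simp: Hom_def Low_def)
    then show ?thesis using keys_add[of a b] by (auto simp: ab(1) degm_add)
  qed
  then show ?thesis by (auto simp: Low_def)
qed

lemma Hom_pvar: "i \<in> {1..n} \<Longrightarrow> pvar i \<in> Hom n 1"
  unfolding Hom_def pvar_def by (auto simp: degm_def lookup_single when_def sum.delta)

definition agree :: "nat \<Rightarrow> nat \<Rightarrow> qpoly set \<Rightarrow> qpoly set" where
  "agree n k V = {p. \<exists>q\<in>V. \<forall>x\<in>surjs n k. evl n x p = evl n x q}"

lemma agreeI: "q \<in> V \<Longrightarrow> (\<And>x. x \<in> surjs n k \<Longrightarrow> evl n x p = evl n x q) \<Longrightarrow> p \<in> agree n k V"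
  by (auto simp: agree_def)

lemma agreeD: "p \<in> agree n k V \<Longrightarrow> \<exists>q. q \<in> V \<and> (\<forall>x\<in>surjs n k. evl n x p = evl n x q)"
  unfolding agree_def by blast

lemma agree_subspace:
  assumes V: "qv.subspace V" shows "qv.subspace (agree n k V)"
  unfolding qv.subspace_def
proof (intro conjI ballI allI)
  show "0 \<in> agree n k V" by (rule agreeI[OF qv.subspace_0[OF V]]) simp
  fix p assume "p \<in> agree n k V"
  from agreeD[OF this] obtain q where q: "q \<in> V" "\<forall>x\<in>surjs n k. evl n x p = evl n x q" by blast
  show "const c * p \<in> agree n k V" for c
    by (rule agreeI[OF qv.subspace_scale[OF V q(1), of c]]) (simp add: evl_scale q(2))
  fix p' assume "p' \<in> agree n k V"
  from agreeD[OF this] obtain q' where q': "q' \<in> V" "\<forall>x\<in>surjs n k. evl n x p' = evl n x q'" by blast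
  show "p + p' \<in> agree n k V"
    by (rule agreeI[OF qv.subspace_add[OF V q(1) q'(1)]]) (simp add: evl_add q(2) q'(2))
qed

text \<open>A form of degree \<open>D\<close> belongs here iff it is the leading form of a
  polynomial vanishing on all surjections, or zero.\<close>

definition surj_low :: "nat \<Rightarrow> nat \<Rightarrow> nat \<Rightarrow> qpoly set" where
  "surj_low n k D = agree n k (Low n D)"

lemma surj_low_subspace: "qv.subspace (surj_low n k D)"
  unfolding surj_low_def by (rule agree_subspace[OF Low_subspace])

lemma surj_low_mult:
  assumes "p \<in> surj_low n k D" "q \<in> Hom n e" shows "p * q \<in> surj_low n k (D + e)"
proof -
  from agreeD[OF assms(1)[unfolded surj_low_def]] obtain l where
    l: "l \<in> Low n D" "\<forall>x\<in>surjs n k. evl n x p = evl n x l" by blast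
  show ?thesis unfolding surj_low_def by (rule agreeI[OF Low_mult[OF l(1) assms(2)]]) (simp add: evl_mult l(2))
qed

lemma monic_Low:
  assumes i: "i \<in> {1..n}" shows "(\<Prod>j=1..k. pvar i - const (of_nat j)) - pvar i ^ k \<in> Low n k"
proof (induction k)
  case (Suc k)
  define l where "l = (\<Prod>j=1..k. pvar i - const (of_nat j)) - pvar i ^ k"
  have l: "l \<in> Low n k" using Suc by (simp add: l_def)
  have "(\<Prod>j=1..Suc k. pvar i - const (of_nat j)) - pvar i ^ Suc k
      = l * pvar i + (const (- of_nat (Suc k)) * pvar i ^ k + const (- of_nat (Suc k)) * l)"
    unfolding l_def by (simp add: algebra_simps const_arith(3))
  moreover have "l * pvar i \<in> Low n (Suc k)" using Low_mult[OF l Hom_pvar[OF i]] by (simp add: Suc_eq_plus1)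
  moreover have "pvar i ^ k \<in> Low n (Suc k)" using Hom_power[OF Hom_pvar[OF i], of k] by (intro Hom_Low) auto
  moreover have "l \<in> Low n (Suc k)" using l by (rule Low_mono) simp
  ultimately show ?case by (auto intro!: Low_add Low_scale)
qed simp

text \<open>A coordinate of a surjection takes values in \<open>{1..k}\<close>, so the monic product
  of the \<open>x - j\<close> over these \<open>j\<close> vanishes, and \<open>x^k\<close> agrees
  with its lower terms.\<close>

lemma surj_low_power:
  assumes i: "i \<in> {1..n}" shows "pvar i ^ k \<in> surj_low n k k"
proof -
  let ?l = "(\<Prod>j=1..k. pvar i - const (of_nat j)) - pvar i ^ k"
  have "evl n x (pvar i ^ k) = evl n x (const (-1) * ?l)" if x: "x \<in> surjs n k" for x
  proof -
    have "x i \<in> {1..k}" using x i by (auto simp: surjs_def)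
    then have "(\<Prod>j=1..k. evl n x (pvar i - const (of_nat j))) = 0"
      by (intro prod_zero bexI[of _ "x i"]) (simp_all add: evl_diff evl_pvar[OF i])
    then show ?thesis by (simp add: evl_scale evl_diff evl_prod)
  qed
  then show ?thesis unfolding surj_low_def by (rule agreeI[OF Low_scale[OF monic_Low[OF i]]])
qed

text \<open>The recurrence of \<open>esym_on_surjs\<close> has leading coefficient
  \<open>hcoef k 0 = 1\<close> and can be solved for \<open>esym n r\<close>.\<close>

lemma surj_low_esym:
  assumes r: "n - k < r" shows "esym n r \<in> surj_low n k r"
proof -
  let ?q = "\<Sum>j=1..r. const (- hcoef k j) * esym n (r - j)"
  have "?q \<in> Low n r"
    by (intro Low_sum Low_scale Hom_Low[OF Hom_esym]) auto
  moreover have "evl n x (esym n r) = evl n x ?q" if x: "x \<in> surjs n k" for x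
  proof -
    have "(\<Sum>j=0..r. hcoef k j * evl n x (esym n (r - j))) = evl n x (esym n r) + (\<Sum>j=1..r. hcoef k j * evl n x (esym n (r - j)))"
      using esym_on_surjs(2)[OF x r] by (simp add: sum.atLeast_Suc_atMost[of 0] One_nat_def)
    moreover have "evl n x ?q = - (\<Sum>j=1..r. hcoef k j * evl n x (esym n (r - j)))"
      unfolding evl_sum evl_scale by (simp add: sum_negf)
    ultimately show ?thesis using esym_on_surjs(1)[OF x r] by linarith
  qed
  ultimately show ?thesis unfolding surj_low_def by (rule agreeI)
qed

lemma xm_split_power:
  fixes b :: "nat \<Rightarrow> nat"
  assumes "i \<in> {1..n}" "k \<le> b i" shows "xm n b = pvar i ^ k * xm n (b(i := b i - k))"
proof -
  have "xm n (\<lambda>j. if j = i then k else 0) = pvar i ^ k"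
    unfolding xm_prod using assms(1) by (simp add: prod.delta if_distrib cong: if_cong) 
  then have "pvar i ^ k * xm n (b(i := b i - k)) = xm n (\<lambda>j. (if j = i then k else 0) + (b(i := b i - k)) j)"
    by (simp only: xm_mult[symmetric])
  also have "\<dots> = xm n b" by (rule xm_cong) (use assms in auto)
  finally show ?thesis ..
qed

lemma sum_split_power:
  fixes b :: "nat \<Rightarrow> nat"
  assumes "i \<in> {1..n}" "k \<le> b i" shows "(\<Sum>j=1..n. b j) = k + (\<Sum>j=1..n. (b(i := b i - k)) j)"
  using assms by (simp add: sum.remove[of _ i] )

definition wspan :: "nat \<Rightarrow> nat \<Rightarrow> nat \<Rightarrow> qpoly set" where
  "wspan n k D = agree n k (qv.span (basis_elt n k ` {x \<in> basis_idx n k. basis_deg n k x < D}))"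

lemma wspan_subspace: "qv.subspace (wspan n k D)"
  unfolding wspan_def by (rule agree_subspace[OF qv.subspace_span])

lemma wspan_mono:
  assumes "p \<in> wspan n k d" "d \<le> D" shows "p \<in> wspan n k D"
proof -
  have "qv.span (basis_elt n k ` {x \<in> basis_idx n k. basis_deg n k x < d}) \<subseteq> qv.span (basis_elt n k ` {x \<in> basis_idx n k. basis_deg n k x < D})"
    by (rule qv.span_mono) (use assms(2) in auto)
  then show ?thesis using assms(1) unfolding wspan_def agree_def by blast
qed

text \<open>Straightening with \<open>surj_low n k D\<close> for \<open>Z\<close>: whatever falls
  into \<open>Z\<close> agrees on the surjections with something of lower degree, so induction on
  the degree applies.\<close>

lemma Low_wspan:
  assumes k: "1 \<le> k" "k \<le> n" shows "p \<in> Low n D \<Longrightarrow> p \<in> wspan n k D"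
proof (induction D arbitrary: p)
  case 0
  then have "keys p = {}" by (auto simp: Low_def)
  then have "p = 0" by simp
  then show ?case using qv.subspace_0[OF wspan_subspace] by simp
next
  case (Suc D)
  have zzw: "surj_low n k D \<subseteq> wspan n k (Suc D)"
  proof
    fix p assume "p \<in> surj_low n k D"
    from agreeD[OF this[unfolded surj_low_def]] obtain q where
      q: "q \<in> Low n D" "\<forall>x\<in>surjs n k. evl n x p = evl n x q" by blast
    from Suc.IH[OF q(1)] have "q \<in> wspan n k (Suc D)" by (rule wspan_mono) simp
    from agreeD[OF this[unfolded wspan_def]] obtain s where
      s: "s \<in> qv.span (basis_elt n k ` {x \<in> basis_idx n k. basis_deg n k x < Suc D})"
      "\<forall>x\<in>surjs n k. evl n x q = evl n x s" by blast
    show "p \<in> wspan n k (Suc D)" unfolding wspan_def by (rule agreeI[OF s(1)]) (simp add: q(2) s(2))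
  qed
  have mon: "xm n b \<in> wspan n k (Suc D)" if b: "(\<Sum>i=1..n. b i) = D" for b
  proof -
    have "xm n b \<in> qv.span (surj_low n k D \<union> basis_elt n k ` {x \<in> basis_idx n k. basis_deg n k x = D})"
    proof (rule straighten[OF k surj_low_subspace _ _ b])
      fix b i assume b: "(\<Sum>i=1..n. b i) = D" "i \<in> {1..n}" "k \<le> b i"
      have "pvar i ^ k * xm n (b(i := b i - k)) \<in> surj_low n k (k + (\<Sum>j=1..n. (b(i := b i - k)) j))"
        by (rule surj_low_mult[OF surj_low_power[OF b(2)] Hom_xm])
      then show "xm n b \<in> surj_low n k D"
        using xm_split_power[of i n k b] sum_split_power[of i n k b] b by simp
    next
      fix r p assume r: "n - k < r" "r \<le> n" "r \<le> D" "p \<in> Hom n (D - r)"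
      show "esym n r * p \<in> surj_low n k D" using surj_low_mult[OF surj_low_esym[OF r(1)] r(4)] r(3) by simp
    qed
    also have "\<dots> \<subseteq> wspan n k (Suc D)"
    proof (rule qv.span_minimal[OF _ wspan_subspace])
      have "basis_elt n k y \<in> wspan n k (Suc D)" if "y \<in> basis_idx n k" "basis_deg n k y = D" for y
        unfolding wspan_def using that by (intro agreeI[of "basis_elt n k y"] qv.span_base) auto
      then show "surj_low n k D \<union> basis_elt n k ` {x \<in> basis_idx n k. basis_deg n k x = D} \<subseteq> wspan n k (Suc D)" using zzw by auto
    qed
    finally show ?thesis .
  qed
  have "const (lookup p m) * Poly_Mapping.single m 1 \<in> wspan n k (Suc D)" if m: "m \<in> keys p" for m
  proof (rule qv.subspace_scale[OF wspan_subspace])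
    have km: "keys m \<subseteq> {1..n}" "degm n m < Suc D" using Suc.prems m by (auto simp: Low_def)
    show "Poly_Mapping.single m 1 \<in> wspan n k (Suc D)"
    proof (cases "degm n m = D")
      case True
      then show ?thesis using mon[of "lookup m"] km(1) by (simp add: degm_def xm_def expo_lookup)
    next
      case False
      then have "Poly_Mapping.single m 1 \<in> Low n D" using km by (simp add: Low_def)
      from Suc.IH[OF this] show ?thesis by (rule wspan_mono) simp
    qed
  qed
  then show ?case by (subst qpoly_expand) (intro qv.subspace_sum[OF wspan_subspace])
qed

section \<open>Counting the index set\<close>

definition shape_pairs :: "nat \<Rightarrow> (nat list list \<times> nat list list) set" where
  "shape_pairs n = {(S, T). S \<in> SYT n \<and> T \<in> SYT n \<and> shape S = shape T}"

definition exp_tuples :: "nat \<Rightarrow> nat \<Rightarrow> nat \<Rightarrow> (nat \<Rightarrow> nat) set" where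
  "exp_tuples m k d = {i. (\<forall>r. r \<notin> {1..m} \<longrightarrow> i r = 0) \<and> (\<Sum>r=1..m. i r) + d < k}"

text \<open>The weakly increasing sequence that starts at level 1 and jumps by 1 just after each
  element of \<open>D\<close>.\<close>

definition descent_levels :: "nat set \<Rightarrow> nat \<Rightarrow> nat" where "descent_levels D a = 1 + card {d \<in> D. d < a}"

lemma finite_shape_pairs [simp]: "finite (shape_pairs n)"
  by (rule finite_subset[of _ "SYT n \<times> SYT n"]) (auto simp: shape_pairs_def)

text \<open>Stars and bars: a slack coordinate turns the inequality into a sum of
  \<open>m + 1\<close> naturals equal to \<open>k - 1 - d\<close>.\<close>

lemma card_exp_tuples:
  assumes "d < k" shows "finite (exp_tuples m k d)" "card (exp_tuples m k d) \<le> (k - 1 - d + m) choose (k - 1 - d)"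
proof -
  let ?N = "k - 1 - d" and ?g = "\<lambda>i. (k - 1 - d - (\<Sum>r=1..m. i r)) # map i [1..<Suc m]"
  let ?L = "{l :: nat list. length l = Suc m \<and> sum_list l = ?N}"
  have s: "sum_list (map i [1..<Suc m]) = (\<Sum>r=1..m. i r)" for i :: "nat \<Rightarrow> nat"
    by (simp add: interv_sum_list_conv_sum_set_nat atLeastLessThanSuc_atLeastAtMost del: upt_Suc)
  have sub: "?g ` exp_tuples m k d \<subseteq> ?L"
    using assms by (auto simp: exp_tuples_def s simp del: upt_Suc)
  have inj: "inj_on ?g (exp_tuples m k d)"
  proof (rule inj_onI)
    fix i j assume ij: "i \<in> exp_tuples m k d" "j \<in> exp_tuples m k d" "?g i = ?g j"
    then have "i r = j r" if "r \<in> {1..m}" for r using that by (auto simp del: upt_Suc)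
    moreover have "i r = j r" if "r \<notin> {1..m}" for r using ij(1,2) that unfolding exp_tuples_def by simp
    ultimately show "i = j" by blast
  qed
  have fin: "finite ?L"
  proof (rule finite_subset)
    show "?L \<subseteq> {l. set l \<subseteq> {..?N} \<and> length l = Suc m}" using member_le_sum_list by fastforce
  qed (rule finite_lists_length_eq, simp)
  show "finite (exp_tuples m k d)" using finite_imageD[OF finite_subset[OF sub fin] inj] .
  have "card (exp_tuples m k d) \<le> card ?L" by (rule card_inj_on_le[OF inj sub fin])
  then show "card (exp_tuples m k d) \<le> (?N + m) choose ?N" using card_length_sum_list[of "Suc m" ?N] by simp
qed

text \<open>With \<open>d\<close> the size of \<open>E\<close>, the complement of \<open>E\<close>
  in \<open>{1..<n}\<close> has \<open>(k - 1 - d) + (n - k)\<close> elements, so the stars and bars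
  number counts the ways to enlarge \<open>E\<close> to \<open>k - 1\<close> elements.\<close>

lemma card_exp_tuples_le:
  assumes k: "1 \<le> k" "k \<le> n" and E: "E \<subseteq> {1..<n}"
  shows "finite (exp_tuples (n - k) k (card E))" "card (exp_tuples (n - k) k (card E)) \<le> card {D. E \<subseteq> D \<and> D \<subseteq> {1..<n} \<and> card D = k - 1}"
proof -
  have finE: "finite E" using E by (rule finite_subset) simp
  let ?R = "{D. E \<subseteq> D \<and> D \<subseteq> {1..<n} \<and> card D = k - 1}"
  show "finite (exp_tuples (n - k) k (card E))"
  proof (cases "card E < k")
    case False
    then have "exp_tuples (n - k) k (card E) = {}" by (auto simp: exp_tuples_def)
    then show ?thesis by simp
  qed (rule card_exp_tuples(1))
  show "card (exp_tuples (n - k) k (card E)) \<le> card ?R"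
  proof (cases "card E < k")
    case False
    then have "exp_tuples (n - k) k (card E) = {}" by (auto simp: exp_tuples_def)
    then show ?thesis by simp
  next
    case True
    let ?N = "k - 1 - card E" and ?A = "{1..<n} - E"
    let ?B = "{B. B \<subseteq> ?A \<and> card B = ?N}"
    have cA: "card ?A = n - 1 - card E" using E finE by (simp add: card_Diff_subset)
    have "card E \<le> n - 1" using card_mono[OF _ E] by simp
    then have "card ?A = ?N + (n - k)" using cA True k by simp
    then have "card (exp_tuples (n - k) k (card E)) \<le> card ?B"
      using card_exp_tuples(2)[OF True, of "n - k"] n_subsets[of ?A ?N] by simp
    also have "\<dots> \<le> card ?R"
    proof (rule card_inj_on_le[of "\<lambda>B. B \<union> E"])
      show "inj_on (\<lambda>B. B \<union> E) ?B" by (rule inj_onI) blast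
      show "(\<lambda>B. B \<union> E) ` ?B \<subseteq> ?R"
      proof (rule image_subsetI)
        fix B assume B: "B \<in> ?B"
        then have "finite B" "B \<inter> E = {}" using finite_subset[of B ?A] by auto
        then have "card (B \<union> E) = k - 1" using B finE True by (simp add: card_Un_disjoint)
        then show "B \<union> E \<in> ?R" using B E by auto
      qed
    qed simp
    finally show ?thesis .
  qed
qed

lemma descent_levels_Suc: "finite D \<Longrightarrow> descent_levels D (Suc a) = descent_levels D a + (if a \<in> D then 1 else 0)"
proof -
  assume "finite D"
  moreover have "{d \<in> D. d < Suc a} = (if a \<in> D then insert a {d \<in> D. d < a} else {d \<in> D. d < a})"
    by (auto simp: less_Suc_eq)
  ultimately show ?thesis by (simp add: descent_levels_def)
qed

lemma descent_levels_mono: "finite D \<Longrightarrow> a \<le> b \<Longrightarrow> descent_levels D a \<le> descent_levels D b"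
  unfolding descent_levels_def by (intro add_left_mono card_mono) auto

lemma compat_descent_levels:
  assumes "S \<in> SYT n" "finite D" shows "compat n (descent_levels D) S \<longleftrightarrow> descents S \<subseteq> D"
proof -
  have "descents S \<subseteq> {1..<n}" using descents_rw[OF assms(1)] by auto
  moreover have "descent_levels D a = descent_levels D (Suc a) \<longleftrightarrow> a \<notin> D" for a using descent_levels_Suc[OF assms(2), of a] by simp
  ultimately have "(\<forall>a. 1 \<le> a \<longrightarrow> a < n \<longrightarrow> descent_levels D a = descent_levels D (Suc a) \<longrightarrow> a \<notin> descents S) \<longleftrightarrow> descents S \<subseteq> D"
    by (meson atLeastLessThan_iff subset_iff)
  then show ?thesis unfolding compat_def using descent_levels_mono[OF assms(2)] by simp
qed

lemma descent_levels_image: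
  assumes D: "D \<subseteq> {1..<n}" "card D = k - 1" and k: "1 \<le> k" "k \<le> n" shows "descent_levels D ` {1..n} = {1..k}"
proof -
  have fin: "finite D" using D(1) by (rule finite_subset) simp
  have "{d \<in> D. d < 1} = {}" using D by auto
  then have n1: "descent_levels D 1 = 1" by (simp add: descent_levels_def)
  have "{d \<in> D. d < n} = D" using D by auto
  then have nn: "descent_levels D n = k" using D k by (simp add: descent_levels_def)
  have sub: "{1..descent_levels D a} \<subseteq> descent_levels D ` {1..a}" if "1 \<le> a" for a using that
  proof (induction a rule: dec_induct)
    case base then show ?case using n1 by auto
  next
    case (step a)
    have "{1..descent_levels D (Suc a)} \<subseteq> insert (descent_levels D (Suc a)) {1..descent_levels D a}" using descent_levels_Suc[OF fin, of a] by auto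
    also have "\<dots> \<subseteq> descent_levels D ` {1..Suc a}" using step by (auto intro!: imageI)
    finally show ?case .
  qed
  show ?thesis
  proof
    show "descent_levels D ` {1..n} \<subseteq> {1..k}" using descent_levels_mono[OF fin, of _ n] nn by (auto simp: descent_levels_def)
    show "{1..k} \<subseteq> descent_levels D ` {1..n}" using sub[of n] nn k by simp
  qed
qed

text \<open>An orbit determines its sorted member, and the jumps of that member are the elements of
  \<open>D\<close>.\<close>

lemma orb_descent_levels_disjoint:
  assumes D: "D \<subseteq> {1..<n}" "D' \<subseteq> {1..<n}" and m: "m \<in> orb n (descent_levels D)" "m \<in> orb n (descent_levels D')" shows "D = D'"
proof -
  have fin: "finite D" "finite D'" using D by (auto intro: finite_subset)
  obtain \<pi> \<rho> where p: "\<pi> permutes {1..n}" "\<rho> permutes {1..n}" "expo n (descent_levels D \<circ> \<pi>) = expo n (descent_levels D' \<circ> \<rho>)"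
    using m unfolding orb_def by (smt (verit) mem_Collect_eq)
  let ?\<theta> = "\<pi> \<circ> pinv \<rho>"
  have \<theta>: "?\<theta> permutes {1..n}" by (intro permutes_compose permutes_inv p)
  have e: "descent_levels D' i = descent_levels D (?\<theta> i)" if i: "i \<in> {1..n}" for i
  proof -
    have "pinv \<rho> i \<in> {1..n}" using permutes_in_image[OF permutes_inv[OF p(2)]] i by blast
    then have "(descent_levels D \<circ> \<pi>) (pinv \<rho> i) = (descent_levels D' \<circ> \<rho>) (pinv \<rho> i)" using p(3) unfolding expo_eq_iff by blast
    then show ?thesis by (simp add: permutes_inverses(1)[OF p(2)])
  qed
  have eq: "descent_levels D i = descent_levels D' i" if i: "i \<in> {1..n}" for i
    by (rule sorted_rearrangement_eq[OF \<theta>, where f = "\<lambda>_. 0" and key = "\<lambda>i. i" and u = "descent_levels D" and v = "descent_levels D'"])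
      (use e[symmetric] i descent_levels_mono[OF fin(1)] descent_levels_mono[OF fin(2)] in auto)
  have "a \<in> D \<longleftrightarrow> a \<in> D'" if "a \<in> {1..<n}" for a
    using eq[of a] eq[of "Suc a"] descent_levels_Suc[OF fin(1), of a] descent_levels_Suc[OF fin(2), of a] that by (auto split: if_splits)
  then show ?thesis using D by blast
qed

lemma basis_idx_alt: "basis_idx n k = (\<lambda>((S, T), i). (S, T, i)) ` (SIGMA st:shape_pairs n. exp_tuples (n - k) k (des (fst st)))"
  by (auto simp: basis_idx_def shape_pairs_def exp_tuples_def image_iff)

text \<open>Replace the exponent tuples of \<open>S\<close> by sets \<open>D\<close> containing its
  descents and exchange the sums. For fixed \<open>D\<close> the pairs form
  \<open>fam n (descent_levels D)\<close>, no larger than its orbit; the orbits are disjoint and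
  consist of exponent vectors of surjections.\<close>

lemma card_basis_idx:
  assumes k: "1 \<le> k" "k \<le> n" shows "finite (basis_idx n k)" "card (basis_idx n k) \<le> card (surjs n k)"
proof -
  let ?DD = "{D. D \<subseteq> {1..<n} \<and> card D = k - 1}"
  have ds: "descents S \<subseteq> {1..<n}" if "S \<in> SYT n" for S using descents_rw[OF that] by auto
  have fS: "finite (SIGMA st:shape_pairs n. exp_tuples (n - k) k (des (fst st)))"
    using card_exp_tuples_le(1)[OF k ds] by (intro finite_SigmaI finite_shape_pairs) (auto simp: des_def shape_pairs_def)
  then show "finite (basis_idx n k)" unfolding basis_idx_alt by (rule finite_imageI)
  have fD: "finite D" if "D \<in> ?DD" for D using that by (auto intro: finite_subset)
  have "card (basis_idx n k) \<le> card (SIGMA st:shape_pairs n. exp_tuples (n - k) k (des (fst st)))"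
    unfolding basis_idx_alt by (rule card_image_le[OF fS])
  also have "\<dots> = (\<Sum>st\<in>shape_pairs n. card (exp_tuples (n - k) k (des (fst st))))"
    using card_exp_tuples_le(1)[OF k ds] by (intro card_SigmaI finite_shape_pairs) (auto simp: des_def shape_pairs_def)
  also have "\<dots> \<le> (\<Sum>st\<in>shape_pairs n. card {D \<in> ?DD. descents (fst st) \<subseteq> D})"
  proof (rule sum_mono)
    fix st assume "st \<in> shape_pairs n"
    then have "fst st \<in> SYT n" by (auto simp: shape_pairs_def)
    from card_exp_tuples_le(2)[OF k ds[OF this]] show "card (exp_tuples (n - k) k (des (fst st))) \<le> card {D \<in> ?DD. descents (fst st) \<subseteq> D}"
      by (simp add: des_def conj_commute conj_left_commute)
  qed
  also have "\<dots> = (\<Sum>st\<in>shape_pairs n. \<Sum>D\<in>?DD. if descents (fst st) \<subseteq> D then 1 else 0)"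
    by (intro sum.cong refl) (simp add: sum.If_cases Int_def)
  also have "\<dots> = (\<Sum>D\<in>?DD. \<Sum>st\<in>shape_pairs n. if descents (fst st) \<subseteq> D then 1 else 0)" by (rule sum.swap)
  also have "\<dots> = (\<Sum>D\<in>?DD. card (fam n (descent_levels D)))"
  proof (rule sum.cong[OF refl])
    fix D assume "D \<in> ?DD"
    then have "{st \<in> shape_pairs n. descents (fst st) \<subseteq> D} = fam n (descent_levels D)"
      using compat_descent_levels[OF _ fD] by (auto simp: fam_def shape_pairs_def)
    then show "(\<Sum>st\<in>shape_pairs n. if descents (fst st) \<subseteq> D then 1 else 0) = card (fam n (descent_levels D))"
      by (simp add: sum.If_cases Int_def)
  qed
  also have "\<dots> \<le> (\<Sum>D\<in>?DD. card (orb n (descent_levels D)))"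
  proof (rule sum_mono)
    fix D show "card (fam n (descent_levels D)) \<le> card (orb n (descent_levels D))"
      \<comment> \<open>Plain monomials serve as leading parts here.\<close>
      by (rule card_fam_le_card_orb[where v = "\<lambda>x. xm n (descent_levels D \<circ> tperm n (fst x) (snd x))"]) (simp only: lead_monomial fst_conv snd_conv)
  qed
  also have "\<dots> = card (\<Union>D\<in>?DD. orb n (descent_levels D))"
    by (rule card_UN_disjoint[symmetric]) (use orb_descent_levels_disjoint in \<open>auto\<close>)
  also have "\<dots> \<le> card (expo n ` surjs n k)"
  proof (rule card_mono)
    show "(\<Union>D\<in>?DD. orb n (descent_levels D)) \<subseteq> expo n ` surjs n k"
    proof (intro UN_least subsetI)
      fix D m assume D: "D \<in> ?DD" and "m \<in> orb n (descent_levels D)"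
      then obtain \<pi> where \<pi>: "\<pi> permutes {1..n}" "m = expo n (descent_levels D \<circ> \<pi>)" by (auto simp: orb_def)
      let ?x = "\<lambda>i. if i \<in> {1..n} then descent_levels D (\<pi> i) else 0"
      have "?x ` {1..n} = descent_levels D ` \<pi> ` {1..n}" by auto
      also have "\<dots> = {1..k}" unfolding permutes_image[OF \<pi>(1)] using descent_levels_image[of D n k] D k by simp
      finally have "?x \<in> surjs n k" by (simp add: surjs_def)
      moreover have "m = expo n ?x" unfolding \<pi>(2) expo_eq_iff by simp
      ultimately show "m \<in> expo n ` surjs n k" by blast
    qed
  qed simp
  also have "\<dots> \<le> card (surjs n k)" by (rule card_image_le) simp
  finally show "card (basis_idx n k) \<le> card (surjs n k)" .
qed

section \<open>Independence modulo the ideal\<close>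

text \<open>Functions on the point set are coded as combinations of distinct monomials, so that
  dimension arguments stay within the space of polynomials.\<close>

definition eval_vec :: "nat \<Rightarrow> nat \<Rightarrow> qpoly \<Rightarrow> qpoly" where
  "eval_vec n k p = (\<Sum>x\<in>surjs n k. const (evl n x p) * xm n x)"

lemma qlin_eval_vec: "qlin (eval_vec n k)"
  unfolding qlin_def eval_vec_def evl_add evl_scale const_arith distrib_right sum.distrib sum_distrib_left mult.assoc by simp

lemma eval_vec_cong: "(\<And>x. x \<in> surjs n k \<Longrightarrow> evl n x p = evl n x q) \<Longrightarrow> eval_vec n k p = eval_vec n k q"
  unfolding eval_vec_def by (rule sum.cong) auto

lemma Low_exists: "(\<And>m. m \<in> keys p \<Longrightarrow> keys m \<subseteq> {1..n}) \<Longrightarrow> \<exists>D. p \<in> Low n D"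
  by (intro exI[of _ "Suc (Max (insert 0 (degm n ` keys p)))"]) (auto simp: Low_def less_Suc_eq_le)

lemma Low_ring:
  "p \<in> Low n D \<Longrightarrow> q \<in> Low n E \<Longrightarrow> \<exists>F. p * q \<in> Low n F"
proof (rule Low_exists)
  fix m assume pq: "p \<in> Low n D" "q \<in> Low n E" and "m \<in> keys (p * q)"
  then have "m \<in> {a + b | a b. a \<in> keys p \<and> b \<in> keys q}" using keys_mult[of p q] by blast
  then obtain a b where "m = a + b" "a \<in> keys p" "b \<in> keys q" by blast
  then show "keys m \<subseteq> {1..n}" using keys_add[of a b] pq by (auto simp: Low_def)
qed

lemma Low_prod: "finite A \<Longrightarrow> (\<And>a. a \<in> A \<Longrightarrow> \<exists>D. f a \<in> Low n D) \<Longrightarrow> \<exists>D. (\<Prod>a\<in>A. f a) \<in> Low n D"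
proof (induction A rule: finite_induct)
  case empty
  show ?case using Hom_Low[OF Hom_one, of 1] by auto
next
  case (insert a A)
  then obtain D E where "f a \<in> Low n D" "(\<Prod>a\<in>A. f a) \<in> Low n E" by blast
  from Low_ring[OF this] show ?case using insert by simp
qed

text \<open>Lagrange interpolation: the product of the \<open>x_i - j\<close> over all
  \<open>j\<close> other than the value of \<open>x0\<close> at \<open>i\<close> vanishes at every
  surjection but \<open>x0\<close>. By \<open>Low_wspan\<close> it agrees on the surjections with a
  combination of the basis.\<close>

lemma xm_in_eval_vec_span:
  assumes k: "1 \<le> k" "k \<le> n" and x0: "x0 \<in> surjs n k"
  shows "xm n x0 \<in> qv.span ((\<lambda>y. eval_vec n k (basis_elt n k y)) ` basis_idx n k)"
proof -
  let ?L = "\<Prod>i=1..n. \<Prod>j\<in>{1..k} - {x0 i}. pvar i - const (of_nat j) :: qpoly"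
  have Lx: "evl n x ?L = (\<Prod>i=1..n. \<Prod>j\<in>{1..k} - {x0 i}. of_nat (x i) - of_nat j)" for x
    unfolding evl_prod by (intro prod.cong refl) (simp add: evl_diff evl_pvar)
  have zero: "evl n x ?L = 0" if x: "x \<in> surjs n k" "x \<noteq> x0" for x
  proof -
    have "\<exists>i\<in>{1..n}. x i \<noteq> x0 i"
    proof (rule ccontr)
      assume "\<not> ?thesis"
      then have "x i = x0 i" for i using x(1) x0 unfolding surjs_def by (cases "i \<in> {1..n}") auto
      then show False using x(2) by auto
    qed
    then obtain i where i: "i \<in> {1..n}" "x i \<noteq> x0 i" by blast
    have "x i \<in> {1..k} - {x0 i}" using x(1) i by (auto simp: surjs_def)
    then have "(\<Prod>j\<in>{1..k} - {x0 i}. of_nat (x i) - of_nat j :: rat) = 0" by (intro prod_zero) (auto intro!: bexI[of _ "x i"])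
    then show ?thesis unfolding Lx using i(1) by (intro prod_zero) auto
  qed
  have nz: "evl n x0 ?L \<noteq> 0" unfolding Lx by simp
  have lin: "\<exists>D. pvar i - const (of_nat j) \<in> Low n D" if "i \<in> {1..n}" for i j
  proof -
    have "const (- of_nat j) * 1 \<in> Low n 2" by (rule Low_scale, rule Hom_Low[OF Hom_one]) simp
    moreover have "pvar i \<in> Low n 2" by (rule Hom_Low[OF Hom_pvar[OF that]]) simp
    ultimately have "pvar i + const (- of_nat j) * 1 \<in> Low n 2" by (rule Low_add[rotated])
    moreover have "pvar i + const (- of_nat j) * 1 = pvar i - const (of_nat j)" by (simp only: const_arith(3) mult_1_right) simp
    ultimately show ?thesis by auto
  qed
  have "\<exists>D. ?L \<in> Low n D" by (intro Low_prod lin) auto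
  then obtain D where "?L \<in> Low n D" by blast
  from agreeD[OF Low_wspan[OF k this, unfolded wspan_def]] obtain s where
    s: "s \<in> qv.span (basis_elt n k ` {x \<in> basis_idx n k. basis_deg n k x < D})" "\<forall>x\<in>surjs n k. evl n x ?L = evl n x s" by blast
  have "eval_vec n k ?L = const (evl n x0 ?L) * xm n x0"
  proof -
    have "eval_vec n k ?L = (\<Sum>x\<in>{x0}. const (evl n x ?L) * xm n x)"
      unfolding eval_vec_def using x0 zero by (intro sum.mono_neutral_right) auto
    then show ?thesis by simp
  qed
  then have "xm n x0 = const (inverse (evl n x0 ?L)) * eval_vec n k ?L" using nz by simp
  also have "eval_vec n k ?L = eval_vec n k s" by (rule eval_vec_cong) (use s(2) in blast)
  finally have e: "xm n x0 = const (inverse (evl n x0 ?L)) * eval_vec n k s" .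
  have "eval_vec n k s \<in> qv.span (eval_vec n k ` basis_elt n k ` {x \<in> basis_idx n k. basis_deg n k x < D})"
    by (rule qlin_span[OF qlin_eval_vec s(1)])
  also have "\<dots> \<subseteq> qv.span ((\<lambda>y. eval_vec n k (basis_elt n k y)) ` basis_idx n k)" by (rule qv.span_mono) auto
  finally show ?thesis unfolding e by (rule qv.span_scale)
qed

text \<open>A relation would make one member redundant, and fewer than \<open>card B\<close> vectors
  would span an independent set of that size.\<close>

lemma spanning_family_independent:
  assumes fin: "finite I" and B: "finite B" "qv.independent B" "B \<subseteq> qv.span (w ` I)" "card I \<le> card B"
  shows "indep_fam I w"
  unfolding indep_fam_def
proof (intro allI impI ballI, rule ccontr)
  fix c i assume z: "(\<Sum>i\<in>I. const (c i) * w i) = 0" and i: "i \<in> I" and nz: "c i \<noteq> 0"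
  let ?W = "w ` (I - {i})"
  have "const (c i) * w i + (\<Sum>j\<in>I - {i}. const (c j) * w j) = 0" using z fin i by (simp add: sum.remove)
  then have "const (c i) * w i = - (\<Sum>j\<in>I - {i}. const (c j) * w j)" by (rule eq_neg_iff_add_eq_0[THEN iffD2])
  then have "w i = const (inverse (c i)) * - (\<Sum>j\<in>I - {i}. const (c j) * w j)" using nz by (metis qv.scale_one qv.scale_scale left_inverse)
  also have "\<dots> \<in> qv.span ?W" by (intro qv.span_scale qv.span_neg qv.span_sum qv.span_base) auto
  finally have wi: "w i \<in> qv.span ?W" .
  have "w ` I \<subseteq> qv.span ?W"
  proof (rule image_subsetI)
    fix j assume "j \<in> I"
    then show "w j \<in> qv.span ?W" using wi by (cases "j = i") (auto intro: qv.span_base)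
  qed
  then have "qv.span (w ` I) \<subseteq> qv.span ?W" by (rule qv.span_minimal[OF _ qv.subspace_span])
  then have "B \<subseteq> qv.span ?W" using B(3) by blast
  then have "card B \<le> card ?W" using qv.independent_span_bound[OF _ B(2)] fin by simp
  also have "\<dots> \<le> card (I - {i})" by (rule card_image_le) (use fin in simp)
  also have "\<dots> < card I" by (rule card_Diff1_less[OF fin i])
  finally show False using B(4) by simp
qed

lemma basis_elt_indep_surjs:
  assumes k: "1 \<le> k" "k \<le> n" shows "indep_fam (basis_idx n k) (\<lambda>y. eval_vec n k (basis_elt n k y))"
proof (rule spanning_family_independent[OF card_basis_idx(1)[OF k]])
  have ind: "indep_fam (surjs n k) (xm n)"
    unfolding indep_fam_def
  proof (intro allI impI ballI)
    fix c x assume z: "(\<Sum>x\<in>surjs n k. const (c x) * xm n x) = 0" and x: "x \<in> surjs n k"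
    have e: "expo n x = expo n y \<longleftrightarrow> x = y" if "y \<in> surjs n k" for y
    proof
      assume "expo n x = expo n y"
      then have "x i = y i" for i using x that unfolding surjs_def expo_eq_iff by (cases "i \<in> {1..n}") auto
      then show "x = y" by auto
    qed simp
    have "0 = lookup (\<Sum>x\<in>surjs n k. const (c x) * xm n x) (expo n x)" unfolding z by simp
    also have "\<dots> = (\<Sum>y\<in>surjs n k. if y = x then c y else 0)"
      unfolding lookup_sum by (rule sum.cong) (auto simp: lookup_xm e)
    finally show "c x = 0" using x by simp
  qed
  note i = independent_family[OF finite_surjs ind]
  show "finite (xm n ` surjs n k)" by simp
  show "qv.independent (xm n ` surjs n k)" by (rule i(2))
  show "xm n ` surjs n k \<subseteq> qv.span ((\<lambda>y. eval_vec n k (basis_elt n k y)) ` basis_idx n k)" using xm_in_eval_vec_span[OF k] by blast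
  show "card (basis_idx n k) \<le> card (xm n ` surjs n k)" using card_basis_idx(2)[OF k] i(1) by (simp add: card_image)
qed

section \<open>Homogeneous components\<close>

definition hpart :: "nat \<Rightarrow> nat \<Rightarrow> qpoly \<Rightarrow> qpoly" where
  "hpart n D p = (\<Sum>m\<in>{m \<in> keys p. degm n m = D}. Poly_Mapping.single m (lookup p m))"

lemma lookup_hpart: "lookup (hpart n D p) m = (if degm n m = D then lookup p m else 0)"
  by (auto simp: hpart_def lookup_sum lookup_single when_def in_keys_iff)

lemma qlin_hpart: "qlin (hpart n D)"
  unfolding qlin_def by (auto intro!: poly_mapping_eqI simp: lookup_hpart lookup_add)

lemma hpart_Hom: "p \<in> Hom n d \<Longrightarrow> hpart n D p = (if D = d then p else 0)"
  by (rule poly_mapping_eqI) (auto simp: lookup_hpart Hom_def in_keys_iff)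

lemma hpart_mult_single:
  "hpart n D (Poly_Mapping.single a 1 * p) = (if degm n a \<le> D then Poly_Mapping.single a 1 * hpart n (D - degm n a) p else 0)"
proof (rule qlin_eqI[of "\<lambda>p. hpart n D (Poly_Mapping.single a 1 * p)" "\<lambda>p. if degm n a \<le> D then Poly_Mapping.single a 1 * hpart n (D - degm n a) p else 0"])
  show "qlin (\<lambda>p. hpart n D (Poly_Mapping.single a 1 * p))" by (rule qlin_comp[OF qlin_hpart qlin_mult(2)])
  show "qlin (\<lambda>p. if degm n a \<le> D then Poly_Mapping.single a 1 * hpart n (D - degm n a) p else 0)"
    using qlin_comp[OF qlin_mult(2) qlin_hpart, of "Poly_Mapping.single a 1"] by (auto simp: qlin_def)
  fix m
  have h: "hpart n E (Poly_Mapping.single m 1) = (if degm n m = E then Poly_Mapping.single m 1 else 0)" for m E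
    by (rule poly_mapping_eqI) (auto simp: lookup_hpart lookup_single when_def)
  show "hpart n D (Poly_Mapping.single a 1 * Poly_Mapping.single m 1)
    = (if degm n a \<le> D then Poly_Mapping.single a 1 * hpart n (D - degm n a) (Poly_Mapping.single m 1) else 0)"
    by (auto simp: mult_single h degm_add)
qed

text \<open>An ideal whose elements restrict, in each degree, to functions on the surjections of lower degree;
  it contains the generators of \<open>ideal_I n k\<close>.\<close>

definition vanishing :: "nat \<Rightarrow> nat \<Rightarrow> qpoly set" where
  "vanishing n k = {p. (\<forall>m\<in>keys p. keys m \<subseteq> {1..n}) \<and> (\<forall>D. hpart n D p \<in> surj_low n k D)}"

lemma vanishing_zero: "0 \<in> vanishing n k"
  using qv.subspace_0[OF surj_low_subspace] by (simp add: vanishing_def qlin_0[OF qlin_hpart])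

lemma vanishing_add: "p \<in> vanishing n k \<Longrightarrow> q \<in> vanishing n k \<Longrightarrow> p + q \<in> vanishing n k"
  unfolding vanishing_def mem_Collect_eq qlin_add[OF qlin_hpart]
  using keys_add[of p q] qv.subspace_add[OF surj_low_subspace] by blast

lemma vanishing_scale: "p \<in> vanishing n k \<Longrightarrow> const c * p \<in> vanishing n k"
  using qv.subspace_scale[OF surj_low_subspace] by (auto simp: vanishing_def qlin_scale[OF qlin_hpart] in_keys_iff)

lemma vanishing_sum: "(\<And>x. x \<in> A \<Longrightarrow> f x \<in> vanishing n k) \<Longrightarrow> (\<Sum>x\<in>A. f x) \<in> vanishing n k"
  by (induction A rule: infinite_finite_induct) (auto simp: vanishing_zero vanishing_add)

lemma vanishing_mult:
  assumes p: "p \<in> vanishing n k" and q: "\<And>m. m \<in> keys q \<Longrightarrow> keys m \<subseteq> {1..n}" shows "q * p \<in> vanishing n k"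
proof -
  have "Poly_Mapping.single a 1 * p \<in> vanishing n k" if a: "keys a \<subseteq> {1..n}" for a
    unfolding vanishing_def mem_Collect_eq
  proof (intro conjI ballI allI)
    fix m assume "m \<in> keys (Poly_Mapping.single a 1 * p)"
    then have "m \<in> {x + y | x y. x \<in> keys (Poly_Mapping.single a (1::rat)) \<and> y \<in> keys p}" using keys_mult by blast
    then obtain y where "m = a + y" "y \<in> keys p" by auto
    then show "keys m \<subseteq> {1..n}" using keys_add[of a y] p a by (auto simp: vanishing_def)
  next
    fix D
    show "hpart n D (Poly_Mapping.single a 1 * p) \<in> surj_low n k D"
    proof (cases "degm n a \<le> D")
      case True
      have "hpart n (D - degm n a) p * Poly_Mapping.single a 1 \<in> surj_low n k (D - degm n a + degm n a)"
        using p a by (intro surj_low_mult) (auto simp: vanishing_def Hom_def)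
      then show ?thesis using True unfolding hpart_mult_single by (simp add: mult.commute)
    next
      case False
      then show ?thesis using qv.subspace_0[OF surj_low_subspace] by (simp add: hpart_mult_single)
    qed
  qed
  then have "(\<Sum>m\<in>keys q. const (lookup q m) * (Poly_Mapping.single m 1 * p)) \<in> vanishing n k"
    using q by (intro vanishing_sum vanishing_scale) auto
  also have "(\<Sum>m\<in>keys q. const (lookup q m) * (Poly_Mapping.single m 1 * p)) = q * p"
    by (subst (3) qpoly_expand) (simp add: sum_distrib_right mult.assoc)
  finally show ?thesis .
qed

lemma vanishing_Hom:
  assumes "p \<in> Hom n d" "p \<in> surj_low n k d" shows "p \<in> vanishing n k"
  unfolding vanishing_def mem_Collect_eq
proof (intro conjI ballI allI)
  show "keys m \<subseteq> {1..n}" if "m \<in> keys p" for m using assms(1) that by (auto simp: Hom_def)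
  show "hpart n D p \<in> surj_low n k D" for D
    unfolding hpart_Hom[OF assms(1)] using assms(2) qv.subspace_0[OF surj_low_subspace] by simp
qed

text \<open>The component in the degree of \<open>y\<close> agrees on the surjections with something
  of lower degree, hence with a combination of basis members of lower degree. The difference is a
  relation between functions on the surjections, where the basis is independent.\<close>

lemma basis_elt_indep_vanishing:
  assumes k: "1 \<le> k" "k \<le> n" and c: "(\<Sum>y\<in>basis_idx n k. const (c y) * basis_elt n k y) \<in> vanishing n k" and y: "y \<in> basis_idx n k"
  shows "c y = 0"
proof -
  note fin = card_basis_idx(1)[OF k]
  let ?D = "basis_deg n k y"
  let ?E = "{x \<in> basis_idx n k. basis_deg n k x = ?D}" and ?L = "{x \<in> basis_idx n k. basis_deg n k x < ?D}"
  have "hpart n ?D (\<Sum>y\<in>basis_idx n k. const (c y) * basis_elt n k y) = (\<Sum>y\<in>basis_idx n k. const (c y) * (if basis_deg n k y = ?D then basis_elt n k y else 0))"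
    unfolding qlin_sum[OF qlin_hpart] qlin_scale[OF qlin_hpart] using hpart_Hom[OF Hom_basis_elt] by (intro sum.cong refl) auto
  also have "\<dots> = (\<Sum>y\<in>?E. const (c y) * basis_elt n k y)"
    using fin by (intro sum.mono_neutral_cong_right) auto
  finally have hE: "hpart n ?D (\<Sum>y\<in>basis_idx n k. const (c y) * basis_elt n k y) = (\<Sum>y\<in>?E. const (c y) * basis_elt n k y)" .
  have "hpart n ?D (\<Sum>y\<in>basis_idx n k. const (c y) * basis_elt n k y) \<in> surj_low n k ?D" using c unfolding vanishing_def by blast
  then have "(\<Sum>y\<in>?E. const (c y) * basis_elt n k y) \<in> surj_low n k ?D" unfolding hE .
  from agreeD[OF this[unfolded surj_low_def]] obtain q where q: "q \<in> Low n ?D"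
    "\<forall>x\<in>surjs n k. evl n x (\<Sum>y\<in>?E. const (c y) * basis_elt n k y) = evl n x q" by blast
  from agreeD[OF Low_wspan[OF k q(1), unfolded wspan_def]] obtain s where
    s: "s \<in> qv.span (basis_elt n k ` ?L)" "\<forall>x\<in>surjs n k. evl n x q = evl n x s" by blast
  have "finite ?L" using fin by simp
  from span_image_sum[OF this s(1)] obtain e where e: "s = (\<Sum>y\<in>?L. const (e y) * basis_elt n k y)" by blast
  \<comment> \<open>The two index sets have different degrees, so the relation keeps the coefficient
    of \<open>y\<close>.\<close>
  let ?c = "\<lambda>x. if x \<in> ?E then c x else if x \<in> ?L then - e x else 0"
  let ?w = "\<lambda>y. eval_vec n k (basis_elt n k y)"
  have "eval_vec n k (\<Sum>y\<in>?E. const (c y) * basis_elt n k y) = eval_vec n k s"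
    by (rule eval_vec_cong) (use q(2) s(2) in simp)
  then have pe: "(\<Sum>y\<in>?E. const (c y) * ?w y) = (\<Sum>y\<in>?L. const (e y) * ?w y)"
    unfolding e by (simp add: qlin_sum[OF qlin_eval_vec] qlin_scale[OF qlin_eval_vec])
  have "(\<Sum>x\<in>basis_idx n k. const (?c x) * ?w x) = (\<Sum>x\<in>?E \<union> ?L. const (?c x) * ?w x)"
    using fin by (intro sum.mono_neutral_right) auto
  also have "\<dots> = (\<Sum>x\<in>?E. const (?c x) * ?w x) + (\<Sum>x\<in>?L. const (?c x) * ?w x)"
    using fin by (intro sum.union_disjoint) auto
  also have "(\<Sum>x\<in>?L. const (?c x) * ?w x) = (\<Sum>x\<in>?L. - (const (e x) * ?w x))"
    by (rule sum.cong) (auto simp: const_arith)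
  also have "(\<Sum>x\<in>?E. const (?c x) * ?w x) = (\<Sum>x\<in>?E. const (c x) * ?w x)"
    by (rule sum.cong) auto
  finally have z: "(\<Sum>x\<in>basis_idx n k. const (?c x) * ?w x) = 0" unfolding pe by (simp add: sum_negf)
  have "\<forall>x\<in>basis_idx n k. ?c x = 0" using mp[OF spec[OF basis_elt_indep_surjs[OF k, unfolded indep_fam_def], of ?c] z] .
  from bspec[OF this y] show ?thesis using y by simp
qed

section \<open>The action on tableaux of a fixed shape\<close>

lemma Stab_cong: "(\<And>i. i \<in> {1..n} \<Longrightarrow> f i = f' i) \<Longrightarrow> Stab n f = Stab n f'"
proof -
  assume e: "\<And>i. i \<in> {1..n} \<Longrightarrow> f i = f' i"
  have "(\<forall>i. f (\<pi> i) = f i) \<longleftrightarrow> (\<forall>i. f' (\<pi> i) = f' i)" if p: "\<pi> permutes {1..n}" for \<pi>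
  proof -
    have "f (\<pi> i) = f i \<longleftrightarrow> f' (\<pi> i) = f' i" for i
      using e permutes_in_image[OF p, of i] permutes_not_in[OF p, of i] by (cases "i \<in> {1..n}") auto
    then show ?thesis by simp
  qed
  then show ?thesis unfolding Stab_def by blast
qed

lemma young_cong:
  assumes "\<And>i. i \<in> {1..n} \<Longrightarrow> f i = f' i" "\<And>i. i \<in> {1..n} \<Longrightarrow> h i = h' i" shows "young n f h p = young n f' h' p"
proof -
  have "Stab n f = Stab n f'" "Stab n h = Stab n h'" 
    using Stab_cong[of n f f'] Stab_cong[of n h h'] assms by blast+
  then show ?thesis unfolding young_def rowop_def colop_def by simp
qed

lemma tperm_inv:
  assumes "T \<in> SYT n" "U \<in> SYT n" "shape T = shape U" "j \<in> {1..n}"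
  shows "pinv (tperm n T U) j \<in> {1..n}" "rw U (pinv (tperm n T U) j) = rw T j" "cl U (pinv (tperm n T U) j) = cl T j"
    "box_of U (pinv (tperm n T U) j) = box_of T j"
proof -
  let ?g = "tperm n T U"
  note p = tperm_permutes[OF assms(1-3)]
  show i: "pinv ?g j \<in> {1..n}" using permutes_in_image[OF permutes_inv[OF p]] assms(4) by blast
  show r: "rw U (pinv ?g j) = rw T j" "cl U (pinv ?g j) = cl T j"
    using tperm_spec(2,3)[OF assms(1-3) i] by (simp_all add: permutes_inverses(1)[OF p])
  show "box_of U (pinv ?g j) = box_of T j" using r by (simp add: rw_def cl_def prod_eq_iff)
qed

abbreviation young_of :: "nat \<Rightarrow> nat list list \<Rightarrow> qpoly \<Rightarrow> qpoly" where "young_of n T \<equiv> young n (rw T) (cl T)"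

lemma young_of_transport:
  assumes "T \<in> SYT n" "U \<in> SYT n" "shape T = shape U"
  shows "perm_act (tperm n T U) (young_of n U p) = young_of n T (perm_act (tperm n T U) p)"
  unfolding young_conj[OF tperm_permutes[OF assms]]
  by (rule young_cong) (simp_all only: comp_apply tperm_inv[OF assms])

lemma young_of_transport_inv:
  assumes "T \<in> SYT n" "U \<in> SYT n" "shape T = shape U"
  shows "young_of n T q = perm_act (tperm n T U) (young_of n U (perm_act (pinv (tperm n T U)) q))"
proof -
  note p = tperm_permutes[OF assms]
  have "perm_act (tperm n T U) (perm_act (pinv (tperm n T U)) q) = perm_act (tperm n T U \<circ> pinv (tperm n T U)) q"
    using p by (simp add: perm_act_comp permutes_bij bij_imp_bij_inv)
  then show ?thesis unfolding young_of_transport[OF assms] by (simp add: permutes_inv_o[OF p])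
qed

text \<open>For fixed \<open>S\<close>, all higher Specht polynomials are permutations of one of
  them, because the cocharge exponents are attached to boxes and move along with the
  tableau.\<close>

lemma higher_specht_transport:
  assumes "S \<in> SYT n" "T \<in> SYT n" "U \<in> SYT n" "shape S = shape U" "shape T = shape U"
  shows "perm_act (tperm n T U) (higher_specht n S U) = higher_specht n S T"
proof -
  have sT: "shape S = shape T" using assms(4,5) by simp
  note p = tperm_permutes[OF assms(2,3,5)]
  have "perm_act (tperm n T U) (xm n (\<lambda>i. lab S (tperm n S U i))) = xm n (\<lambda>i. lab S (tperm n S T i))"
    unfolding perm_act_xm[OF p]
  proof (rule xm_cong)
    fix i assume i: "i \<in> {1..n}"
    note t = tperm_inv[OF assms(2,3,5) i]
    show "((\<lambda>i. lab S (tperm n S U i)) \<circ> pinv (tperm n T U)) i = lab S (tperm n S T i)"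
      using t(1,4) i by (simp add: tperm_def)
  qed
  then show ?thesis
    unfolding higher_specht_young[OF assms(1,3,4)] higher_specht_young[OF assms(1,2) sT] young_of_transport[OF assms(2,3,5)] by simp
qed

lemma lens_inj:
  assumes "T \<in> SYT n" "U \<in> SYT n" "lens T = lens U" shows "shape T = shape U"
proof -
  have l: "r < length T \<longleftrightarrow> lens T r > 0" if T: "T \<in> SYT n" for T r
  proof -
    have "0 \<notin> set (shape T)" using T by (simp add: SYT_def is_partition_def)
    moreover have "length (T ! r) \<in> set (shape T)" if "r < length T" using that by (simp add: shape_def)
    ultimately have "length (T ! r) \<noteq> 0" if "r < length T" using that by metis
    then show ?thesis by (simp add: lens_def)
  qed
  have len: "length T = length U" using l[OF assms(1)] l[OF assms(2)] assms(3) by (metis linorder_neqE_nat less_irrefl)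
  show ?thesis
  proof (rule nth_equalityI)
    fix i assume "i < length (shape T)"
    then have i: "i < length T" "i < length U" using len by (simp_all add: shape_def)
    then show "shape T ! i = shape U ! i" using fun_cong[OF assms(3), of i] by (simp add: shape_def lens_def)
  qed (simp add: shape_def len)
qed

definition same_shape :: "nat \<Rightarrow> nat list list \<Rightarrow> nat list list set" where
  "same_shape n U = {T \<in> SYT n. shape T = shape U}"

lemma finite_same_shape [simp]: "finite (same_shape n U)" by (simp add: same_shape_def)

lemma fam_id: "fam n id = shape_pairs n"
  by (auto simp: fam_def shape_pairs_def compat_def)

text \<open>\<open>fam_spans\<close> with \<nu> the identity expands the translate in symmetrizers
  of standard tableaux, first at \<open>xm n id\<close> and thereby as an identity of operators.
  Applied to values of the symmetrizer of \<open>U\<close>, the terms of other shapes vanish and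
  each remaining term becomes a multiple of a transported copy.\<close>

lemma perm_straighten:
  assumes U: "U \<in> SYT n" and g: "g permutes {1..n}"
  shows "\<exists>c. \<forall>p. perm_act g (young_of n U p) = (\<Sum>T\<in>same_shape n U. const (c T) * perm_act (tperm n T U) (young_of n U p))"
proof -
  let ?v = "\<lambda>x. xm n (id \<circ> tperm n (fst x) (snd x))" and ?w = "\<lambda>x. young_of n (snd x) (xm n (id \<circ> tperm n (fst x) (snd x)))"
  have v: "lead n id S T (?v (S, T))" if "(S, T) \<in> fam n id" for S T using lead_monomial[OF that] by simp
  have gE: "galg_op n (\<lambda>p. perm_act g (young_of n U p))" by (rule galg_op_comp[OF galg_op_perm[OF g] galg_op_young])
  have "keys (perm_act g (young_of n U (xm n id))) \<subseteq> orb n id"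
  proof (rule galg_op_keys[OF gE])
    fix m \<pi> assume "m \<in> keys (xm n id)" and \<pi>: "\<pi> permutes {1..n}"
    then have "m = expo n id" by (simp add: xm_def)
    then have "Poly_Mapping.map_key \<pi> m = expo n (id \<circ> \<pi>)" by (simp only: map_key_expo[OF \<pi>])
    then show "Poly_Mapping.map_key \<pi> m \<in> orb n id" using \<pi> unfolding orb_def by blast
  qed
  then have "perm_act g (young_of n U (xm n id)) \<in> qv.span ((\<lambda>m. Poly_Mapping.single m 1) ` orb n id)" by (rule keys_span)
  also have "\<dots> \<subseteq> qv.span (?w ` shape_pairs n)"
  proof (rule qv.span_minimal[OF _ qv.subspace_span], rule image_subsetI)
    fix m assume m: "m \<in> orb n id"
    obtain c where c: "Poly_Mapping.single m 1 = (\<Sum>x\<in>fam n id. const (c x) * ?w x)"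
      using fam_spans[of n id ?v m, OF _ v m] by auto
    then show "Poly_Mapping.single m 1 \<in> qv.span (?w ` shape_pairs n)"
      unfolding c fam_id by (intro qv.span_sum qv.span_scale qv.span_base imageI)
  qed
  finally obtain c where c: "perm_act g (young_of n U (xm n id)) = (\<Sum>x\<in>shape_pairs n. const (c x) * ?w x)"
    by (rule span_image_sum[OF finite_shape_pairs])
  \<comment> \<open>The inverse permutation carries \<open>xm n id\<close> to the filling by
    \<open>S\<close>, so every term becomes an operator applied to the same polynomial.\<close>
  let ?O = "\<lambda>x p. young_of n (snd x) (perm_act (pinv (tperm n (fst x) (snd x))) p)"
  have pt: "tperm n (fst x) (snd x) permutes {1..n}" if "x \<in> shape_pairs n" for x
    using that by (intro tperm_permutes) (auto simp: shape_pairs_def)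
  have O: "?O x (xm n id) = ?w x" if "x \<in> shape_pairs n" for x
    unfolding perm_act_xm[OF permutes_inv[OF pt[OF that]]] permutes_inv_inv[OF pt[OF that]] ..
  have gO: "galg_op n (?O x)" if "x \<in> shape_pairs n" for x
    by (rule galg_op_comp[OF galg_op_young galg_op_perm[OF permutes_inv[OF pt[OF that]]]])
  have exp: "perm_act g (young_of n U p) = (\<Sum>x\<in>shape_pairs n. const (c x) * ?O x p)" for p
  proof (rule galg_op_eqI[OF gE])
    show "galg_op n (\<lambda>p. \<Sum>x\<in>shape_pairs n. const (c x) * ?O x p)" by (intro galg_op_sum galg_op_scale gO)
    show "perm_act g (young_of n U (xm n id)) = (\<Sum>x\<in>shape_pairs n. const (c x) * ?O x (xm n id))"
      unfolding c by (rule sum.cong[OF refl]) (simp only: O)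
  qed
  \<comment> \<open>Different shapes annihilate each other. For equal shapes, transport to
    \<open>U\<close> puts an operator between two copies of one symmetrizer, which leaves a
    scalar.\<close>
  have "\<exists>k. \<forall>p. ?O x (young_of n U p) = const k * (if shape (snd x) = shape U then perm_act (tperm n (snd x) U) (young_of n U p) else 0)"
    if x: "x \<in> shape_pairs n" for x
  proof -
    have T: "snd x \<in> SYT n" using x by (auto simp: shape_pairs_def)
    have gp: "galg_op n (perm_act (pinv (tperm n (fst x) (snd x))))" by (rule galg_op_perm[OF permutes_inv[OF pt[OF x]]])
    show ?thesis
    proof (cases "shape (snd x) = shape U")
      case False
      then have "lens U \<noteq> lens (snd x)" using lens_inj[OF T U] by auto
      from young_young_distinct[OF SYT_tab[OF U] SYT_tab[OF T] this gp] show ?thesis using False by simp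
    next
      case True
      let ?g = "tperm n (snd x) U"
      have gi: "galg_op n (perm_act (pinv ?g))" by (rule galg_op_perm[OF permutes_inv[OF tperm_permutes[OF T U True]]])
      have "galg_op n (\<lambda>q. rowop n (rw U) (perm_act (pinv ?g) (perm_act (pinv (tperm n (fst x) (snd x))) (colop n (cl U) q))))"
        by (intro galg_op_comp[OF galg_op_rowop] galg_op_comp[OF gi] galg_op_comp[OF gp] galg_op_colop)
      from colop_galg_op_rowop[OF SYT_tab[OF U] this] obtain k where
        k: "\<And>p. young_of n U (perm_act (pinv ?g) (perm_act (pinv (tperm n (fst x) (snd x))) (young_of n U p))) = const k * young_of n U p"
        unfolding young_def by blast
      have "?O x (young_of n U p) = const k * perm_act ?g (young_of n U p)" for p
        unfolding young_of_transport_inv[OF T U True] k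
        by (rule qlin_scale[OF galg_op_qlin[OF galg_op_perm[OF tperm_permutes[OF T U True]]]])
      then show ?thesis using True by auto
    qed
  qed
  then obtain k where k: "\<And>x p. x \<in> shape_pairs n \<Longrightarrow> ?O x (young_of n U p) = const (k x) * (if shape (snd x) = shape U then perm_act (tperm n (snd x) U) (young_of n U p) else 0)"
    by metis
  \<comment> \<open>Supplies the inner copy of the symmetrizer to which the operator expansion is
    applied.\<close>
  obtain h where h: "h \<noteq> 0" "\<And>p. young_of n U (young_of n U p) = const h * young_of n U p"
    using young_idem[OF SYT_tab[OF U]] by blast
  let ?Q = "shape_pairs n"
  define d where "d T = (\<Sum>S\<in>{S. (S, T) \<in> ?Q}. inverse h * (c (S, T) * k (S, T)))" for T
  have "perm_act g (young_of n U p) = (\<Sum>T\<in>same_shape n U. const (d T) * perm_act (tperm n T U) (young_of n U p))" for p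
  proof -
    let ?A = "\<lambda>T. perm_act (tperm n T U) (young_of n U p)"
    have "const h * perm_act g (young_of n U p) = perm_act g (young_of n U (young_of n U p))"
      unfolding h(2) by (rule qlin_scale[OF galg_op_qlin[OF galg_op_perm[OF g]], symmetric])
    also have "\<dots> = (\<Sum>x\<in>?Q. const (c x) * (const (k x) * (if shape (snd x) = shape U then ?A (snd x) else 0)))"
      unfolding exp by (rule sum.cong[OF refl]) (simp only: k)
    finally have "perm_act g (young_of n U p) = const (inverse h) * (\<Sum>x\<in>?Q. const (c x) * (const (k x) * (if shape (snd x) = shape U then ?A (snd x) else 0)))"
      using h(1) by (metis left_inverse qv.scale_one qv.scale_scale)
    also have "\<dots> = (\<Sum>x\<in>?Q. const (inverse h * (c x * k x)) * (if shape (snd x) = shape U then ?A (snd x) else 0))"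
      by (simp only: sum_distrib_left const_arith(2) mult.assoc)
    also have "\<dots> = (\<Sum>x\<in>{x \<in> ?Q. shape (snd x) = shape U}. const (inverse h * (c x * k x)) * ?A (snd x))"
      by (rule sum.mono_neutral_cong_right) auto
    also have "{x \<in> ?Q. shape (snd x) = shape U} = (\<lambda>(T, S). (S, T)) ` (SIGMA T:same_shape n U. {S. (S, T) \<in> ?Q})"
      by (auto simp: shape_pairs_def same_shape_def)
    also have "(\<Sum>x\<in>\<dots>. const (inverse h * (c x * k x)) * ?A (snd x)) = (\<Sum>(T, S)\<in>(SIGMA T:same_shape n U. {S. (S, T) \<in> ?Q}). const (inverse h * (c (S, T) * k (S, T))) * ?A T)"
      by (subst sum.reindex) (auto simp: inj_on_def intro!: sum.cong)
    also have "\<dots> = (\<Sum>T\<in>same_shape n U. \<Sum>S\<in>{S. (S, T) \<in> ?Q}. const (inverse h * (c (S, T) * k (S, T))) * ?A T)"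
    proof (rule sum.Sigma[symmetric])
      show "\<forall>T\<in>same_shape n U. finite {S. (S, T) \<in> ?Q}"
        using finite_SYT[of n] by (auto simp: shape_pairs_def intro: finite_subset[rotated])
    qed simp
    also have "\<dots> = (\<Sum>T\<in>same_shape n U. const (d T) * ?A T)"
      unfolding d_def const_sum sum_distrib_right ..
    finally show ?thesis .
  qed
  then show ?thesis by blast
qed

theorem galg_op_straighten:
  assumes U: "U \<in> SYT n" and F: "galg_op n F"
  shows "\<exists>c. \<forall>p. F (young_of n U p) = (\<Sum>T\<in>same_shape n U. const (c T) * perm_act (tperm n T U) (young_of n U p))"
proof -
  from galg_op_expand[OF F] obtain y where y: "\<forall>p. F p = (\<Sum>\<pi> | \<pi> permutes {1..n}. const (y \<pi>) * perm_act \<pi> p)" ..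
  have "\<forall>\<pi>\<in>{\<pi>. \<pi> permutes {1..n}}. \<exists>c. \<forall>p. perm_act \<pi> (young_of n U p) = (\<Sum>T\<in>same_shape n U. const (c T) * perm_act (tperm n T U) (young_of n U p))"
    using perm_straighten[OF U] by blast
  from bchoice[OF this] obtain c where
    c: "\<forall>\<pi>\<in>{\<pi>. \<pi> permutes {1..n}}. \<forall>p. perm_act \<pi> (young_of n U p) = (\<Sum>T\<in>same_shape n U. const (c \<pi> T) * perm_act (tperm n T U) (young_of n U p))" ..
  have "F (young_of n U p) = (\<Sum>T\<in>same_shape n U. const (\<Sum>\<pi> | \<pi> permutes {1..n}. y \<pi> * c \<pi> T) * perm_act (tperm n T U) (young_of n U p))" for p
  proof -
    have "F (young_of n U p) = (\<Sum>\<pi> | \<pi> permutes {1..n}. \<Sum>T\<in>same_shape n U. const (y \<pi>) * (const (c \<pi> T) * perm_act (tperm n T U) (young_of n U p)))"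
      unfolding spec[OF y] sum_distrib_left[symmetric] by (rule sum.cong[OF refl]) (simp only: c[rule_format])
    also have "\<dots> = (\<Sum>T\<in>same_shape n U. \<Sum>\<pi> | \<pi> permutes {1..n}. const (y \<pi>) * (const (c \<pi> T) * perm_act (tperm n T U) (young_of n U p)))"
      by (rule sum.swap)
    also have "\<dots> = (\<Sum>T\<in>same_shape n U. const (\<Sum>\<pi> | \<pi> permutes {1..n}. y \<pi> * c \<pi> T) * perm_act (tperm n T U) (young_of n U p))"
      by (simp only: const_sum sum_distrib_right const_arith(2) mult.assoc)
    finally show ?thesis .
  qed
  then show ?thesis by (intro exI[of _ "\<lambda>T. \<Sum>\<pi> | \<pi> permutes {1..n}. y \<pi> * c \<pi> T"] allI)
qed

section \<open>Quotients of polynomial spaces as vector spaces\<close>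

abbreviation QQ :: "rat ring" where "QQ \<equiv> class_ring"

text \<open>\<open>M\<close> is \<open>P\<close> modulo \<open>I\<close>, with projection \<open>q\<close>; \<open>I\<close> may be larger than \<open>P\<close>.\<close>

locale presented =
  fixes M :: "(rat, 'a) module" (structure) and P :: "qpoly set" and q :: "qpoly \<Rightarrow> 'a" and I :: "qpoly set"
  assumes P: "qv.subspace P" and I: "qv.subspace I"
    and carr: "carrier M = q ` P"
    and q_add: "a \<in> P \<Longrightarrow> b \<in> P \<Longrightarrow> q a \<oplus> q b = q (a + b)"
    and q_smult: "a \<in> P \<Longrightarrow> c \<odot>\<^bsub>M\<^esub> q a = q (const c * a)"
    and q_zero: "\<zero> = q 0"
    and q_eq: "a \<in> P \<Longrightarrow> b \<in> P \<Longrightarrow> q a = q b \<longleftrightarrow> a - b \<in> I"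
begin

lemmas PP = qv.subspace_0[OF P] qv.subspace_add[OF P] qv.subspace_scale[OF P] qv.subspace_sum[OF P]

lemma is_abelian_group: "abelian_group M"
proof (rule abelian_groupI)
  fix x y z assume "x \<in> carrier M" "y \<in> carrier M" "z \<in> carrier M"
  then obtain a b c where e: "a \<in> P" "b \<in> P" "c \<in> P" "x = q a" "y = q b" "z = q c" unfolding carr by blast
  show "x \<oplus> y \<in> carrier M" using e by (simp add: carr q_add PP)
  show "x \<oplus> y \<oplus> z = x \<oplus> (y \<oplus> z)" using e by (simp add: q_add PP add.assoc)
  show "x \<oplus> y = y \<oplus> x" using e by (simp add: q_add add.commute)
  show "\<zero> \<oplus> x = x" using e by (simp add: q_zero q_add PP)
  have "const (-1) * a + a = const (-1 + 1) * a" by (simp only: const_arith distrib_right qv.scale_one)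
  then have "q (const (-1) * a) \<oplus> x = \<zero>"
    unfolding e(4) using q_add[OF PP(3)[OF e(1), of "-1"] e(1)] by (simp add: q_zero)
  then show "\<exists>y\<in>carrier M. y \<oplus> x = \<zero>" using e PP(3)[OF e(1), of "-1"] unfolding carr by blast
qed (simp add: carr q_zero PP)

lemma is_module: "Module.module QQ M"
proof (rule moduleI)
  show "cring QQ" by (rule class_cring.cring_axioms)
  show "abelian_group M" by (rule is_abelian_group)
  fix a b x y assume "x \<in> carrier M" "y \<in> carrier M"
  then obtain r s where e: "r \<in> P" "s \<in> P" "x = q r" "y = q s" unfolding carr by blast
  show "a \<odot>\<^bsub>M\<^esub> x \<in> carrier M" using e by (simp add: carr q_smult PP)
  show "(a \<oplus>\<^bsub>QQ\<^esub> b) \<odot>\<^bsub>M\<^esub> x = a \<odot>\<^bsub>M\<^esub> x \<oplus> b \<odot>\<^bsub>M\<^esub> x" using e by (simp add: q_smult q_add PP const_arith distrib_right)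
  show "a \<odot>\<^bsub>M\<^esub> (x \<oplus> y) = a \<odot>\<^bsub>M\<^esub> x \<oplus> a \<odot>\<^bsub>M\<^esub> y" using e by (simp add: q_smult q_add PP distrib_left)
  show "(a \<otimes>\<^bsub>QQ\<^esub> b) \<odot>\<^bsub>M\<^esub> x = a \<odot>\<^bsub>M\<^esub> (b \<odot>\<^bsub>M\<^esub> x)" using e by (simp add: q_smult PP)
  show "\<one>\<^bsub>QQ\<^esub> \<odot>\<^bsub>M\<^esub> x = x" using e by (simp add: q_smult)
qed

lemma is_vectorspace: "vectorspace QQ M"
  unfolding vectorspace_def using is_module class_field by blast

sublocale vectorspace QQ M by (rule is_vectorspace)

lemma q_in: "a \<in> P \<Longrightarrow> q a \<in> carrier M" by (simp add: carr)

lemma q_sum: "finite A \<Longrightarrow> (\<And>x. x \<in> A \<Longrightarrow> f x \<in> P) \<Longrightarrow> (\<Oplus>x\<in>A. q (f x)) = q (\<Sum>x\<in>A. f x)"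
proof (induction A rule: finite_induct)
  case (insert x A)
  then have "(\<Oplus>x\<in>insert x A. q (f x)) = q (f x) \<oplus> (\<Oplus>x\<in>A. q (f x))"
    by (intro M.finsum_insert) (auto simp: q_in)
  then show ?case using insert by (simp add: q_add PP)
qed (simp add: q_zero)

lemma q_lincomb:
  assumes "finite J" "\<And>j. j \<in> J \<Longrightarrow> w j \<in> P" "inj_on (\<lambda>j. q (w j)) J"
  shows "lincomb a ((\<lambda>j. q (w j)) ` J) = q (\<Sum>j\<in>J. const (a (q (w j))) * w j)"
proof -
  have "lincomb a ((\<lambda>j. q (w j)) ` J) = (\<Oplus>j\<in>J. a (q (w j)) \<odot>\<^bsub>M\<^esub> q (w j))"
    unfolding lincomb_def by (rule finsum_reindex[OF _ assms(3)]) (use assms(2) in \<open>auto simp: q_in\<close>)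
  also have "\<dots> = (\<Oplus>j\<in>J. q (const (a (q (w j))) * w j))"
    by (rule M.finsum_cong') (use assms(2) in \<open>auto simp: q_in q_smult PP\<close>)
  also have "\<dots> = q (\<Sum>j\<in>J. const (a (q (w j))) * w j)" by (rule q_sum) (use assms in \<open>auto simp: PP\<close>)
  finally show ?thesis .
qed

lemma inj_family:
  assumes fin: "finite J" and w: "\<And>j. j \<in> J \<Longrightarrow> w j \<in> P"
    and ind: "\<And>c. (\<Sum>j\<in>J. const (c j) * w j) \<in> I \<Longrightarrow> \<forall>j\<in>J. c j = 0"
  shows "inj_on (\<lambda>j. q (w j)) J"
proof (rule inj_onI, rule ccontr)
  fix i j assume ij: "i \<in> J" "j \<in> J" "q (w i) = q (w j)" "i \<noteq> j"
  let ?c = "\<lambda>x. if x = i then (1::rat) else if x = j then -1 else 0"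
  have "(\<Sum>x\<in>J. const (?c x) * w x) = (\<Sum>x\<in>{i, j}. const (?c x) * w x)"
    using ij fin by (intro sum.mono_neutral_right) auto
  also have "\<dots> = w i - w j" using ij by (simp add: const_arith)
  also have "\<dots> \<in> I" using q_eq[OF w[OF ij(1)] w[OF ij(2)]] ij(3) by simp
  finally have "\<forall>x\<in>J. ?c x = 0" by (rule ind)
  from bspec[OF this ij(1)] show False by simp
qed

lemma basis_family:
  assumes fin: "finite J" and w: "\<And>j. j \<in> J \<Longrightarrow> w j \<in> P"
    and ind: "\<And>c. (\<Sum>j\<in>J. const (c j) * w j) \<in> I \<Longrightarrow> \<forall>j\<in>J. c j = 0"
    and gen: "\<And>a. a \<in> P \<Longrightarrow> \<exists>c. a - (\<Sum>j\<in>J. const (c j) * w j) \<in> I"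
  shows "basis ((\<lambda>j. q (w j)) ` J)"
proof -
  let ?B = "(\<lambda>j. q (w j)) ` J"
  have inj: "inj_on (\<lambda>j. q (w j)) J" by (rule inj_family[of J w]) (rule fin, erule w, erule ind)
  have lc: "lincomb a ?B = q (\<Sum>j\<in>J. const (a (q (w j))) * w j)" for a
    by (rule q_lincomb[of J w]) (rule fin, erule w, rule inj)
  have sub: "?B \<subseteq> carrier M" using w by (auto simp: q_in)
  have "lin_indpt ?B"
  proof (rule finite_lin_indpt2)
    fix a assume "lincomb a ?B = \<zero>"
    then have z: "q (\<Sum>j\<in>J. const (a (q (w j))) * w j) = q 0" by (simp only: lc q_zero)
    have "(\<Sum>j\<in>J. const (a (q (w j))) * w j) \<in> P" by (rule PP(4)) (rule PP(3)[OF w])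
    from iffD1[OF q_eq[OF this PP(1)] z] have "(\<Sum>j\<in>J. const (a (q (w j))) * w j) \<in> I" unfolding diff_0_right .
    from ind[of "\<lambda>j. a (q (w j))", OF this] show "\<forall>v\<in>?B. a v = \<zero>\<^bsub>QQ\<^esub>" unfolding class_ring_simps by blast
  qed (use fin sub in auto)
  moreover have "span ?B = carrier M"
  proof
    show "span ?B \<subseteq> carrier M" by (rule span_is_subset2[OF sub])
    show "carrier M \<subseteq> span ?B"
    proof
      fix x assume "x \<in> carrier M"
      then obtain a where a: "a \<in> P" "x = q a" unfolding carr by blast
      obtain c where c: "a - (\<Sum>j\<in>J. const (c j) * w j) \<in> I" using gen[OF a(1)] by blast
      let ?c = "\<lambda>v. c (inv_into J (\<lambda>j. q (w j)) v)"
      have "lincomb ?c ?B = q (\<Sum>j\<in>J. const (c j) * w j)"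
        unfolding lc by (intro arg_cong[where f = q] sum.cong) (simp_all add: inv_into_f_f[OF inj])
      also have "\<dots> = x" unfolding a(2) using q_eq[of a "\<Sum>j\<in>J. const (c j) * w j"] a(1) c w by (simp add: PP)
      finally have "x = lincomb ?c ?B" ..
      then show "x \<in> span ?B" unfolding span_def using fin by auto
    qed
  qed
  ultimately show ?thesis using sub by (simp add: basis_def)
qed

lemma restrict_presented:
  assumes "qv.subspace P'" "P' \<subseteq> P" shows "presented (M\<lparr>carrier := q ` P'\<rparr>) P' q I"
  using assms I by unfold_locales (auto simp: q_add q_smult q_zero q_eq subset_iff)

lemma subspace_image:
  assumes "qv.subspace P'" "P' \<subseteq> P" shows "VectorSpace.subspace QQ (q ` P') M"
proof (unfold_locales)
  show "q ` P' \<subseteq> carrier M" using assms(2) by (auto simp: carr)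
  show "\<zero> \<in> q ` P'" using qv.subspace_0[OF assms(1)] by (simp add: q_zero)
  fix v w c assume "v \<in> q ` P'" 
  then obtain a where a: "a \<in> P'" "v = q a" by blast
  show "c \<odot>\<^bsub>M\<^esub> v \<in> q ` P'" using a assms(2) qv.subspace_scale[OF assms(1) a(1), of c] by (auto simp: q_smult subset_iff)
  assume "w \<in> q ` P'"
  then obtain b where b: "b \<in> P'" "w = q b" by blast
  show "v \<oplus> w \<in> q ` P'" using a b assms(2) qv.subspace_add[OF assms(1) a(1) b(1)] by (auto simp: q_add subset_iff)
qed

text \<open>Decompositions exist by grouping the expansion of an element by blocks; they are unique
  because the whole family is independent modulo \<open>I\<close>.\<close>

lemma direct_sum_blocks:
  assumes fin: "finite J" and w: "\<And>j. j \<in> J \<Longrightarrow> w j \<in> P"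
    and ind: "\<And>c. (\<Sum>j\<in>J. const (c j) * w j) \<in> I \<Longrightarrow> \<forall>j\<in>J. c j = 0"
    and gen: "\<And>a. a \<in> P \<Longrightarrow> \<exists>c. a - (\<Sum>j\<in>J. const (c j) * w j) \<in> I"
    and part: "finite \<P>" "\<And>X Y. X \<in> \<P> \<Longrightarrow> Y \<in> \<P> \<Longrightarrow> X \<noteq> Y \<Longrightarrow> idx X \<inter> idx Y = {}" "(\<Union>X\<in>\<P>. idx X) = J"
  shows "internal_direct_sum M \<P> (\<lambda>X. q ` qv.span (w ` idx X))"
proof -
  let ?W = "\<lambda>X. qv.span (w ` idx X)"
  have XJ: "idx X \<subseteq> J" "finite (idx X)" if "X \<in> \<P>" for X using that part(3) fin finite_subset[of "idx X" J] by auto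
  have WP: "?W X \<subseteq> P" if "X \<in> \<P>" for X
    using XJ(1)[OF that] w by (intro qv.span_minimal[OF _ P]) auto
  have sumP: "(\<Sum>X\<in>\<P>. p X) \<in> P" if "\<And>X. X \<in> \<P> \<Longrightarrow> p X \<in> ?W X" for p
    using that WP by (intro PP) auto
  have split: "(\<Sum>j\<in>J. g j) = (\<Sum>X\<in>\<P>. \<Sum>j\<in>idx X. g j)" for g :: "_ \<Rightarrow> qpoly"
    unfolding part(3)[symmetric] by (rule sum.UNION_disjoint) (use part XJ(2) in blast)+
  have uniq: "p X = p' X" if p: "\<And>X. X \<in> \<P> \<Longrightarrow> p X \<in> ?W X" and p': "\<And>X. X \<in> \<P> \<Longrightarrow> p' X \<in> ?W X"
    and e: "(\<Sum>X\<in>\<P>. p X) - (\<Sum>X\<in>\<P>. p' X) \<in> I" and X: "X \<in> \<P>" for p p' X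
  proof -
    have "\<exists>d. p Y - p' Y = (\<Sum>j\<in>idx Y. const (d j) * w j)" if "Y \<in> \<P>" for Y
      using span_image_sum[OF XJ(2)[OF that] qv.span_diff[OF p[OF that] p'[OF that]]] by metis
    then obtain d where d: "\<And>Y. Y \<in> \<P> \<Longrightarrow> p Y - p' Y = (\<Sum>j\<in>idx Y. const (d Y j) * w j)" by metis
    \<comment> \<open>The block of an index, so that the coefficients chosen block by block become
      one function on \<open>J\<close>.\<close>
    define X0 where "X0 j = (THE Y. Y \<in> \<P> \<and> j \<in> idx Y)" for j
    have X0: "X0 j = Y" if "Y \<in> \<P>" "j \<in> idx Y" for Y j
      unfolding X0_def using that part(2) by (intro the_equality) blast+
    have "(\<Sum>j\<in>J. const (d (X0 j) j) * w j) = (\<Sum>X\<in>\<P>. \<Sum>j\<in>idx X. const (d (X0 j) j) * w j)" by (rule split)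
    also have "\<dots> = (\<Sum>Y\<in>\<P>. p Y - p' Y)"
      by (rule sum.cong[OF refl]) (simp add: d X0 cong: sum.cong)
    also have "\<dots> \<in> I" using e by (simp add: sum_subtractf)
    finally have z: "\<forall>j\<in>J. d (X0 j) j = 0" by (rule ind)
    have "p X - p' X = (\<Sum>j\<in>idx X. const (d (X0 j) j) * w j)" unfolding d[OF X] by (rule sum.cong) (simp_all add: X0[OF X])
    also have "\<dots> = 0" using z XJ(1)[OF X] by (intro sum.neutral) auto
    finally show ?thesis by simp
  qed
  show ?thesis
    unfolding internal_direct_sum_def
  proof (intro conjI ballI part(1))
    show "q ` ?W X \<subseteq> carrier M" if "X \<in> \<P>" for X using WP[OF that] by (auto simp: carr)
    fix v assume "v \<in> carrier M"
    then obtain a where a: "a \<in> P" "v = q a" unfolding carr by blast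
    obtain c where c: "a - (\<Sum>j\<in>J. const (c j) * w j) \<in> I" using gen[OF a(1)] by blast
    let ?p = "\<lambda>X. \<Sum>j\<in>idx X. const (c j) * w j"
    have p: "?p X \<in> ?W X" for X by (intro qv.span_sum qv.span_scale qv.span_base) auto
    have vp: "v = q (\<Sum>X\<in>\<P>. ?p X)"
      unfolding a(2) using q_eq[OF a(1) sumP[of ?p]] p c split[of "\<lambda>j. const (c j) * w j"] by simp
    have sumq: "(\<Oplus>X\<in>\<P>. u X) = q (\<Sum>X\<in>\<P>. p X)" if "\<And>X. X \<in> \<P> \<Longrightarrow> u X = q (p X)" "\<And>X. X \<in> \<P> \<Longrightarrow> p X \<in> ?W X" for u p
    proof -
      have "(\<Oplus>X\<in>\<P>. u X) = (\<Oplus>X\<in>\<P>. q (p X))"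
        by (rule M.finsum_cong') (use that WP in \<open>auto simp: q_in subset_iff\<close>)
      also have "\<dots> = q (\<Sum>X\<in>\<P>. p X)" by (rule q_sum[OF part(1)]) (use that WP in blast)
      finally show ?thesis .
    qed
    show "\<exists>!u. u \<in> (\<Pi>\<^sub>E X\<in>\<P>. q ` ?W X) \<and> v = (\<Oplus>X\<in>\<P>. u X)"
    proof (rule ex1I[of _ "\<lambda>X\<in>\<P>. q (?p X)"])
      show "(\<lambda>X\<in>\<P>. q (?p X)) \<in> (\<Pi>\<^sub>E X\<in>\<P>. q ` ?W X) \<and> v = (\<Oplus>X\<in>\<P>. (\<lambda>X\<in>\<P>. q (?p X)) X)"
        using p sumq[of "\<lambda>X\<in>\<P>. q (?p X)" ?p] vp by (auto simp: restrict_PiE_iff)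
      fix u assume u: "u \<in> (\<Pi>\<^sub>E X\<in>\<P>. q ` ?W X) \<and> v = (\<Oplus>X\<in>\<P>. u X)"
      then have "\<forall>X\<in>\<P>. \<exists>r. r \<in> ?W X \<and> u X = q r" by (auto simp: PiE_iff)
      from bchoice[OF this] obtain r where r: "\<And>X. X \<in> \<P> \<Longrightarrow> r X \<in> ?W X" "\<And>X. X \<in> \<P> \<Longrightarrow> u X = q (r X)" by blast
      have "q (\<Sum>X\<in>\<P>. r X) = q (\<Sum>X\<in>\<P>. ?p X)" using sumq[of u r] r u vp by simp
      then have "(\<Sum>X\<in>\<P>. r X) - (\<Sum>X\<in>\<P>. ?p X) \<in> I" using q_eq[OF sumP[of r] sumP[of ?p]] r(1) p by blast
      from uniq[OF r(1) p this] have "u X = q (?p X)" if "X \<in> \<P>" for X using r(2) that by simp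
      then show "u = (\<lambda>X\<in>\<P>. q (?p X))" using u by (auto simp: PiE_iff extensional_def fun_eq_iff)
    qed
  qed
qed

end

locale presented_Sn = presented +
  fixes n :: nat and act
  assumes act_q: "\<sigma> permutes {1..n} \<Longrightarrow> a \<in> P \<Longrightarrow> act \<sigma> (q a) = q (perm_act \<sigma> a)"
    and act_P: "\<sigma> permutes {1..n} \<Longrightarrow> a \<in> P \<Longrightarrow> perm_act \<sigma> a \<in> P"
begin

lemma is_Sn_module: "Sn_module n M act"
proof (intro Sn_module.intro Sn_module_axioms.intro is_vectorspace)
  fix \<sigma> \<tau> :: "nat \<Rightarrow> nat" and v
  show "act \<sigma> \<in> LinearCombinations.module_hom QQ M M" if s: "\<sigma> permutes {1..n}"
    unfolding LinearCombinations.module_hom_def mem_Collect_eq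
  proof (intro conjI allI impI)
    note l = qlin_perm_act[OF permutes_bij[OF s]]
    show "act \<sigma> \<in> carrier M \<rightarrow> carrier M" using act_q[OF s] act_P[OF s] by (auto simp: carr)
    show "act \<sigma> (m1 \<oplus> m2) = act \<sigma> m1 \<oplus> act \<sigma> m2" if "m1 \<in> carrier M \<and> m2 \<in> carrier M" for m1 m2
      using that act_q[OF s] act_P[OF s] by (auto simp: carr q_add PP qlin_add[OF l])
    show "act \<sigma> (r \<odot>\<^bsub>M\<^esub> m) = r \<odot>\<^bsub>M\<^esub> act \<sigma> m" if "r \<in> carrier QQ \<and> m \<in> carrier M" for r m
      using that act_q[OF s] act_P[OF s] by (auto simp: carr q_smult PP qlin_scale[OF l])
  qed
  show "act id v = v" if "v \<in> carrier M" using that act_q[OF permutes_id] by (auto simp: carr)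
  show "act (\<sigma> \<circ> \<tau>) v = act \<sigma> (act \<tau> v)" if "\<sigma> permutes {1..n}" "\<tau> permutes {1..n}" "v \<in> carrier M"
    using that act_q act_P by (auto simp: carr permutes_compose perm_act_comp permutes_bij)
qed

lemma restrict_Sn:
  assumes "qv.subspace P'" "P' \<subseteq> P" "\<And>\<sigma> a. \<sigma> permutes {1..n} \<Longrightarrow> a \<in> P' \<Longrightarrow> perm_act \<sigma> a \<in> P'"
  shows "presented_Sn (M\<lparr>carrier := q ` P'\<rparr>) P' q I n act"
  using restrict_presented[OF assms(1,2)] assms(2,3) act_q
  by (intro presented_Sn.intro presented_Sn_axioms.intro) auto

lemma submodule_image:
  assumes "qv.subspace P'" "P' \<subseteq> P" "\<And>\<sigma> a. \<sigma> permutes {1..n} \<Longrightarrow> a \<in> P' \<Longrightarrow> perm_act \<sigma> a \<in> P'"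
  shows "Sn_submodule n M act (q ` P')"
  unfolding Sn_submodule_def using subspace_image[OF assms(1,2)] assms(2,3) act_q by (auto simp: subset_iff)

text \<open>A submodule is closed under sums, scalars and permutations, hence under the whole group
  algebra.\<close>

lemma submodule_galg_op:
  assumes U: "Sn_submodule n M act U" and a: "a \<in> P" "q a \<in> U" and F: "galg_op n F"
  shows "F a \<in> P \<and> q (F a) \<in> U"
proof -
  from galg_op_expand[OF F] obtain y where y: "F a = (\<Sum>\<pi> | \<pi> permutes {1..n}. const (y \<pi>) * perm_act \<pi> a)" by blast
  have sub: "submodule QQ U M" using U by (simp add: Sn_submodule_def VectorSpace.subspace_def)
  interpret U: submodule QQ U M by (rule sub)
  have "perm_act \<pi> a \<in> P \<and> q (perm_act \<pi> a) \<in> U" if p: "\<pi> permutes {1..n}" for \<pi>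
  proof -
    have "act \<pi> ` U \<subseteq> U" using U p unfolding Sn_submodule_def by blast
    with imageI[OF a(2), of "act \<pi>"] show ?thesis unfolding act_q[OF p a(1)] using act_P[OF p a(1)] by blast
  qed
  then have t: "const (y \<pi>) * perm_act \<pi> a \<in> P \<and> q (const (y \<pi>) * perm_act \<pi> a) \<in> U" if "\<pi> permutes {1..n}" for \<pi>
    using that U.smult_closed[of "y \<pi>" "q (perm_act \<pi> a)"] by (auto simp: PP q_smult)
  have "(\<Sum>\<pi>\<in>A. const (y \<pi>) * perm_act \<pi> a) \<in> P \<and> q (\<Sum>\<pi>\<in>A. const (y \<pi>) * perm_act \<pi> a) \<in> U"
    if "finite A" "A \<subseteq> {\<pi>. \<pi> permutes {1..n}}" for A
    using that
  proof (induction A rule: finite_induct)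
    case empty
    then show ?case using U.zero_closed by (simp add: PP q_zero)
  next
    case (insert \<pi> A)
    then have "\<pi> permutes {1..n}" by auto
    from t[OF this] insert show ?case using U.m_closed by (simp add: PP q_add[symmetric])
  qed
  from this[OF finite_perms subset_refl] show ?thesis unfolding y .
qed

end

section \<open>The ideal\<close>

lemma poly_ring_simps [simp]:
  "a \<otimes>\<^bsub>poly_ring n\<^esub> b = a * b" "a \<oplus>\<^bsub>poly_ring n\<^esub> b = a + b"
  "\<one>\<^bsub>poly_ring n\<^esub> = 1" "\<zero>\<^bsub>poly_ring n\<^esub> = 0"
  by (simp_all add: poly_ring_def)

lemma poly_ring_iff: "p \<in> carrier (poly_ring n) \<longleftrightarrow> (\<forall>m\<in>keys p. keys m \<subseteq> {1..n})"
  by (simp add: poly_ring_def)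

lemma poly_ring_add: "p \<in> carrier (poly_ring n) \<Longrightarrow> r \<in> carrier (poly_ring n) \<Longrightarrow> p + r \<in> carrier (poly_ring n)"
  using Poly_Mapping.keys_add[of p r] by (auto simp: poly_ring_iff)

lemma poly_ring_mult:
  assumes "p \<in> carrier (poly_ring n)" "r \<in> carrier (poly_ring n)" shows "p * r \<in> carrier (poly_ring n)"
  unfolding poly_ring_iff
proof
  fix m assume "m \<in> keys (p * r)"
  then obtain a b where ab: "m = a + b" "a \<in> keys p" "b \<in> keys r" using keys_mult[of p r] by blast
  then have "keys m \<subseteq> keys a \<union> keys b" using Poly_Mapping.keys_add[of a b] by simp
  then show "keys m \<subseteq> {1..n}" using assms ab unfolding poly_ring_iff by blast
qed

lemma poly_ring_const: "const c \<in> carrier (poly_ring n)"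
  by (auto simp: poly_ring_iff const_def split: if_splits)

lemma poly_ring_zero: "0 \<in> carrier (poly_ring n)" by (simp add: poly_ring_iff)

lemma poly_ring_subspace: "qv.subspace (carrier (poly_ring n))"
  by (intro qv.subspaceI poly_ring_zero poly_ring_add poly_ring_mult poly_ring_const)

lemma poly_ring_cring: "cring (poly_ring n)"
proof (rule cringI)
  show "abelian_group (poly_ring n)"
  proof (rule abelian_groupI; simp add: poly_ring_add poly_ring_zero add.assoc add.commute)
    fix x assume "x \<in> carrier (poly_ring n)"
    then show "\<exists>y\<in>carrier (poly_ring n). x + y = 0"
      by (intro bexI[of _ "- x"]) (simp_all add: poly_ring_iff)
  qed
  show "comm_monoid (poly_ring n)"
    by (rule comm_monoidI)
      (use poly_ring_const[of 1 n] in \<open>simp_all add: poly_ring_mult const_simps(2) mult.assoc mult.commute\<close>)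
qed (simp add: distrib_right)

lemma Hom_poly_ring: "p \<in> Hom n d \<Longrightarrow> p \<in> carrier (poly_ring n)"
  by (simp add: Hom_def poly_ring_iff)

lemma galg_op_poly_ring:
  assumes "galg_op n F" "p \<in> carrier (poly_ring n)" shows "F p \<in> carrier (poly_ring n)"
proof -
  have "keys (F p) \<subseteq> {m. keys m \<subseteq> {1..n}}"
  proof (rule galg_op_keys[OF assms(1)])
    fix m \<pi> assume m: "m \<in> keys p" "\<pi> permutes {1..n}"
    then have "keys m \<subseteq> {1..n}" using assms(2) by (simp add: poly_ring_iff)
    then show "Poly_Mapping.map_key \<pi> m \<in> {m. keys m \<subseteq> {1..n}}"
      using permutes_in_image[OF m(2)] by (auto simp: keys_map_key permutes_inj[OF m(2)])
  qed
  then show ?thesis by (auto simp: poly_ring_iff)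
qed

lemma poly_idealI:
  assumes "J \<subseteq> carrier (poly_ring n)" "0 \<in> J" "\<And>a b. a \<in> J \<Longrightarrow> b \<in> J \<Longrightarrow> a + b \<in> J"
    and l: "\<And>a r. a \<in> J \<Longrightarrow> r \<in> carrier (poly_ring n) \<Longrightarrow> r * a \<in> J"
  shows "ideal J (poly_ring n)"
proof -
  interpret R: cring "poly_ring n" by (rule poly_ring_cring)
  have m: "\<ominus>\<^bsub>poly_ring n\<^esub> a \<in> J" if a: "a \<in> J" for a
  proof -
    have "\<ominus>\<^bsub>poly_ring n\<^esub> a = const (-1) * a"
      by (rule R.minus_equality) (use subsetD[OF assms(1) a] in \<open>simp_all add: const_arith(3) poly_ring_iff\<close>)
    then show ?thesis using l[OF a poly_ring_const] by metis
  qed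
  show ?thesis
  proof (rule idealI[OF R.ring_axioms])
    show "subgroup J (add_monoid (poly_ring n))"
      by (rule R.add.subgroupI) (use assms m in \<open>auto simp: a_inv_def[symmetric]\<close>)
  qed (use l in \<open>simp_all add: mult.commute\<close>)
qed

lemma poly_idealD:
  assumes "ideal J (poly_ring n)"
  shows "J \<subseteq> carrier (poly_ring n)" "0 \<in> J" "\<And>a b. a \<in> J \<Longrightarrow> b \<in> J \<Longrightarrow> a + b \<in> J"
    "\<And>a r. a \<in> J \<Longrightarrow> r \<in> carrier (poly_ring n) \<Longrightarrow> r * a \<in> J"
proof -
  interpret J: ideal J "poly_ring n" by (rule assms)
  show "J \<subseteq> carrier (poly_ring n)" by (rule J.a_subset)
  show "0 \<in> J" using additive_subgroup.zero_closed[OF J.additive_subgroup_axioms] by simp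
  show "\<And>a b. a \<in> J \<Longrightarrow> b \<in> J \<Longrightarrow> a + b \<in> J" using additive_subgroup.a_closed[OF J.additive_subgroup_axioms] by simp
  show "\<And>a r. a \<in> J \<Longrightarrow> r \<in> carrier (poly_ring n) \<Longrightarrow> r * a \<in> J" using J.I_l_closed by simp
qed

definition gens :: "nat \<Rightarrow> nat \<Rightarrow> qpoly set" where
  "gens n k = {pvar i ^ k | i. i \<in> {1..n}} \<union> {esym n d | d. d \<in> {n - k + 1..n}}"

lemma pvar_power_Hom: "i \<in> {1..n} \<Longrightarrow> pvar i ^ k \<in> Hom n k"
  using Hom_power[OF Hom_pvar, of i n k] by simp

lemma gens_poly_ring: "gens n k \<subseteq> carrier (poly_ring n)"
  using Hom_poly_ring[OF pvar_power_Hom] Hom_poly_ring[OF Hom_esym] by (auto simp: gens_def)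

lemma ideal_I_ideal: "ideal (ideal_I n k) (poly_ring n)"
  unfolding ideal_I_def gens_def[symmetric]
  by (rule ring.genideal_ideal[OF cring.axioms(1)[OF poly_ring_cring] gens_poly_ring])

lemmas ideal_I_closed = poly_idealD[OF ideal_I_ideal]

lemma ideal_I_gens: "gens n k \<subseteq> ideal_I n k"
  unfolding ideal_I_def gens_def[symmetric]
  by (rule ring.genideal_self[OF cring.axioms(1)[OF poly_ring_cring] gens_poly_ring])

lemma ideal_I_minimal: "ideal J (poly_ring n) \<Longrightarrow> gens n k \<subseteq> J \<Longrightarrow> ideal_I n k \<subseteq> J"
  unfolding ideal_I_def gens_def[symmetric]
  by (rule ring.genideal_minimal[OF cring.axioms(1)[OF poly_ring_cring]])

lemma ideal_I_subspace: "qv.subspace (ideal_I n k)"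
  by (intro qv.subspaceI ideal_I_closed poly_ring_const)

lemma ideal_I_vanishing: "ideal_I n k \<subseteq> vanishing n k"
proof (rule ideal_I_minimal[OF poly_idealI])
  show "vanishing n k \<subseteq> carrier (poly_ring n)" by (auto simp: vanishing_def poly_ring_iff)
  show "gens n k \<subseteq> vanishing n k"
    unfolding gens_def
  proof (safe)
    fix i assume "i \<in> {1..n}"
    then show "pvar i ^ k \<in> vanishing n k" by (intro vanishing_Hom[OF pvar_power_Hom surj_low_power])
  next
    fix d assume "d \<in> {n - k + 1..n}"
    then have "n - k < d" by auto
    then show "esym n d \<in> vanishing n k" by (intro vanishing_Hom[OF Hom_esym surj_low_esym])
  qed
qed (auto simp: vanishing_zero poly_ring_iff intro: vanishing_add vanishing_mult)

text \<open>The polynomials whose image under \<sigma> lies in the ideal form an ideal themselves.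
  It contains the generators, as \<sigma> permutes the powers of the variables and fixes each
  \<open>esym n d\<close>.\<close>

lemma ideal_I_perm:
  assumes s: "\<sigma> permutes {1..n}" and p: "p \<in> ideal_I n k" shows "perm_act \<sigma> p \<in> ideal_I n k"
proof -
  let ?J = "{p \<in> carrier (poly_ring n). perm_act \<sigma> p \<in> ideal_I n k}"
  note b = permutes_bij'[OF s] note l = qlin_perm_act[OF b]
  have "ideal_I n k \<subseteq> ?J"
  proof (rule ideal_I_minimal[OF poly_idealI])
    show "gens n k \<subseteq> ?J"
    proof
      fix g assume g: "g \<in> gens n k"
      then have "perm_act \<sigma> g \<in> gens n k"
        unfolding gens_def
      proof (elim UnE)
        assume "g \<in> {pvar i ^ k | i. i \<in> {1..n}}"
        then obtain i where i: "i \<in> {1..n}" "g = pvar i ^ k" by blast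
        have "\<sigma> i \<in> {1..n}" using permutes_in_image[OF s] i(1) by blast
        moreover have "perm_act \<sigma> g = pvar (\<sigma> i) ^ k" by (simp add: i(2) perm_act_power perm_act_pvar b)
        ultimately show "perm_act \<sigma> g \<in> {pvar i ^ k | i. i \<in> {1..n}} \<union> {esym n d | d. d \<in> {n - k + 1..n}}" by blast
      next
        assume "g \<in> {esym n d | d. d \<in> {n - k + 1..n}}"
        then show "perm_act \<sigma> g \<in> {pvar i ^ k | i. i \<in> {1..n}} \<union> {esym n d | d. d \<in> {n - k + 1..n}}"
          using perm_act_esym[OF s] by auto
      qed
      then show "g \<in> ?J" using g gens_poly_ring ideal_I_gens by blast
    qed
    show "0 \<in> ?J" using ideal_I_closed(2) by (simp add: poly_ring_zero qlin_0[OF l])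
    show "\<And>x y. x \<in> ?J \<Longrightarrow> y \<in> ?J \<Longrightarrow> x + y \<in> ?J" using ideal_I_closed(3) by (auto simp: poly_ring_add qlin_add[OF l])
    show "\<And>x r. x \<in> ?J \<Longrightarrow> r \<in> carrier (poly_ring n) \<Longrightarrow> r * x \<in> ?J"
      using ideal_I_closed(4) galg_op_poly_ring[OF galg_op_perm[OF s]] by (auto simp: poly_ring_mult perm_act_mult b)
  qed auto
  then show ?thesis using p by blast
qed

section \<open>The quotient\<close>

abbreviation qt :: "nat \<Rightarrow> nat \<Rightarrow> qpoly \<Rightarrow> qpoly set" where
  "qt n k p \<equiv> ideal_I n k +>\<^bsub>poly_ring n\<^esub> p"

lemma qt_alt: "qt n k p = (\<lambda>h. h + p) ` ideal_I n k"
  unfolding a_r_coset_def' by auto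

lemma qt_eq_iff:
  assumes "a \<in> carrier (poly_ring n)" "b \<in> carrier (poly_ring n)"
  shows "qt n k a = qt n k b \<longleftrightarrow> a - b \<in> ideal_I n k"
proof
  assume "qt n k a = qt n k b"
  moreover have "a \<in> qt n k a" unfolding qt_alt using ideal_I_closed(2) by force
  ultimately obtain h where "h \<in> ideal_I n k" "a = h + b" unfolding qt_alt by blast
  then show "a - b \<in> ideal_I n k" by simp
next
  have *: "qt n k a \<subseteq> qt n k b" if "a - b \<in> ideal_I n k" for a b
  proof
    fix x assume "x \<in> qt n k a"
    then obtain h where h: "h \<in> ideal_I n k" "x = h + a" unfolding qt_alt by blast
    have "x = (h + (a - b)) + b" by (simp add: h(2))
    then show "x \<in> qt n k b" unfolding qt_alt using ideal_I_closed(3)[OF h(1) that] by blast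
  qed
  assume d: "a - b \<in> ideal_I n k"
  then have "b - a \<in> ideal_I n k" using qv.subspace_neg[OF ideal_I_subspace d] by simp
  with * d show "qt n k a = qt n k b" by blast
qed

lemma quotient_presented:
  "presented_Sn (quotient_module n (ideal_I n k)) (carrier (poly_ring n)) (qt n k) (ideal_I n k) n coset_act"
proof (intro presented_Sn.intro presented.intro presented_Sn_axioms.intro poly_ring_subspace ideal_I_subspace)
  interpret J: ideal "ideal_I n k" "poly_ring n" by (rule ideal_I_ideal)
  show "carrier (quotient_module n (ideal_I n k)) = qt n k ` carrier (poly_ring n)"
    by (auto simp: quotient_module_def FactRing_def A_RCOSETS_def' Let_def)
  fix a b :: qpoly and c \<sigma> assume a: "a \<in> carrier (poly_ring n)"
  show "qt n k a \<oplus>\<^bsub>quotient_module n (ideal_I n k)\<^esub> qt n k b = qt n k (a + b)" if "b \<in> carrier (poly_ring n)"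
    using J.a_rcos_sum[OF a that] by (simp add: quotient_module_def FactRing_def Let_def)
  show "c \<odot>\<^bsub>quotient_module n (ideal_I n k)\<^esub> qt n k a = qt n k (const c * a)"
    using J.rcoset_mult_add[OF poly_ring_const a] by (simp add: quotient_module_def FactRing_def Let_def)
  show "qt n k a = qt n k b \<longleftrightarrow> a - b \<in> ideal_I n k" if "b \<in> carrier (poly_ring n)" by (rule qt_eq_iff[OF a that])
  assume s: "\<sigma> permutes {1..n}"
  show "perm_act \<sigma> a \<in> carrier (poly_ring n)" by (rule galg_op_poly_ring[OF galg_op_perm[OF s] a])
  \<comment> \<open>The ideal is mapped onto itself, so the image of a coset is a full
    coset.\<close>
  have "h \<in> perm_act \<sigma> ` ideal_I n k" if "h \<in> ideal_I n k" for h
  proof (rule image_eqI)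
    show "perm_act (pinv \<sigma>) h \<in> ideal_I n k" by (rule ideal_I_perm[OF permutes_inv[OF s] that])
    have "perm_act \<sigma> (perm_act (pinv \<sigma>) h) = perm_act (\<sigma> \<circ> pinv \<sigma>) h"
      by (rule perm_act_comp[symmetric]) (use s permutes_inv[OF s] permutes_bij' in blast)+
    then show "h = perm_act \<sigma> (perm_act (pinv \<sigma>) h)" by (simp add: permutes_inv_o(1)[OF s])
  qed
  then have e: "perm_act \<sigma> ` ideal_I n k = ideal_I n k" using ideal_I_perm[OF s] by blast
  have "coset_act \<sigma> (qt n k a) = (\<lambda>h. h + perm_act \<sigma> a) ` perm_act \<sigma> ` ideal_I n k"
    by (simp add: coset_act_def qt_alt image_image qlin_add[OF qlin_perm_act[OF permutes_bij'[OF s]]])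
  then show "coset_act \<sigma> (qt n k a) = qt n k (perm_act \<sigma> a)" by (simp add: e qt_alt)
qed (simp add: quotient_module_def FactRing_def Let_def qt_alt)

lemma basis_elt_poly_ring: "x \<in> basis_idx n k \<Longrightarrow> basis_elt n k x \<in> carrier (poly_ring n)"
  by (rule Hom_poly_ring[OF Hom_basis_elt])

text \<open>Straightening with the ideal for \<open>Z\<close>; its hypotheses are membership of
  multiples of the generators.\<close>

lemma basis_elt_span:
  assumes k: "1 \<le> k" "k \<le> n" and p: "p \<in> carrier (poly_ring n)"
  shows "\<exists>c. p - (\<Sum>y\<in>basis_idx n k. const (c y) * basis_elt n k y) \<in> ideal_I n k"
proof -
  let ?I = "ideal_I n k" and ?V = "qv.span (ideal_I n k \<union> basis_elt n k ` basis_idx n k)"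
  have "xm n b \<in> ?V" for b
  proof -
    have "xm n b \<in> qv.span (?I \<union> basis_elt n k ` {x \<in> basis_idx n k. basis_deg n k x = (\<Sum>i=1..n. b i)})"
    proof (rule straighten[OF k ideal_I_subspace _ _ refl])
      fix b :: "nat \<Rightarrow> nat" and i assume b: "i \<in> {1..n}" "k \<le> b i"
      have "pvar i ^ k \<in> ?I" using ideal_I_gens b(1) unfolding gens_def by blast
      from ideal_I_closed(4)[OF this Hom_poly_ring[OF Hom_xm[of n "b(i := b i - k)"]]]
      show "xm n b \<in> ?I" unfolding xm_split_power[of i n k b, OF b] by (simp add: mult.commute)
    next
      fix r d p assume r: "n - k < r" "r \<le> n" "p \<in> Hom n d"
      have "r \<in> {n - k + 1..n}" using r by auto
      then have "esym n r \<in> ?I" using ideal_I_gens[of n k] unfolding gens_def by blast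
      from ideal_I_closed(4)[OF this Hom_poly_ring[OF r(3)]] show "esym n r * p \<in> ?I" by (simp add: mult.commute)
    qed
    then show ?thesis by (rule subsetD[OF qv.span_mono, rotated]) auto
  qed
  then have m: "Poly_Mapping.single m 1 \<in> ?V" if "keys m \<subseteq> {1..n}" for m
    using that expo_lookup[of m n] unfolding xm_def by metis
  have "p \<in> ?V"
    by (subst qpoly_expand) (use p m in \<open>auto simp: poly_ring_iff intro!: qv.span_sum qv.span_scale\<close>)
  then obtain u v where uv: "p = u + v" "u \<in> qv.span ?I" "v \<in> qv.span (basis_elt n k ` basis_idx n k)"
    unfolding qv.span_Un by auto
  obtain c where c: "v = (\<Sum>y\<in>basis_idx n k. const (c y) * basis_elt n k y)" using span_image_sum[OF card_basis_idx(1)[OF k] uv(3)] .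
  have "u \<in> ?I" using uv(2) qv.span_minimal[OF subset_refl ideal_I_subspace] by blast
  then show ?thesis using uv(1) c by (intro exI[of _ c]) simp
qed

lemma basis_elt_indep:
  assumes k: "1 \<le> k" "k \<le> n" and c: "(\<Sum>y\<in>basis_idx n k. const (c y) * basis_elt n k y) \<in> ideal_I n k"
  shows "\<forall>y\<in>basis_idx n k. c y = 0"
  using basis_elt_indep_vanishing[OF k] c ideal_I_vanishing by blast

section \<open>Left ideals of the group algebra\<close>

lemma group_algebra_iff: "f \<in> carrier (group_algebra n) \<longleftrightarrow> (\<forall>\<pi>. \<not> \<pi> permutes {1..n} \<longrightarrow> f \<pi> = 0)"
  by (simp add: group_algebra_def)

lemma gmult_group_algebra: "gmult n f g \<in> carrier (group_algebra n)"
proof -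
  have "gmult n f g \<pi> = 0" if "\<not> \<pi> permutes {1..n}" for \<pi>
    unfolding gmult_def using permutes_compose that by (intro sum.neutral ballI) auto
  then show ?thesis by (simp add: group_algebra_iff)
qed

text \<open>Faithfulness of the action on polynomials, which lets equations in the group algebra be
  checked as equations of operators.\<close>

lemma gralg_eqI:
  assumes "y \<in> carrier (group_algebra n)" "z \<in> carrier (group_algebra n)" "\<And>p. gact n y p = gact n z p"
  shows "y = z"
proof
  fix \<pi> show "y \<pi> = z \<pi>"
    using assms(1,2) gact_eqI(2)[OF assms(3), of \<pi>] by (cases "\<pi> permutes {1..n}") (auto simp: group_algebra_iff)
qed

lemma gact_add: "gact n (\<lambda>\<pi>. y \<pi> + z \<pi>) p = gact n y p + gact n z p"
  by (simp add: gact_def const_arith(1) distrib_right sum.distrib)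

lemma gact_smult: "gact n (\<lambda>\<pi>. c * y \<pi>) p = const c * gact n y p"
  unfolding gact_def sum_distrib_left by (rule sum.cong) (simp_all only: const_arith mult.assoc)

lemma galg_op_gact:
  assumes "galg_op n F" obtains f where "f \<in> carrier (group_algebra n)" "F = gact n f"
proof -
  obtain y where y: "F = gact n y" using assms by (auto simp: galg_op_def)
  let ?f = "\<lambda>\<pi>. if \<pi> permutes {1..n} then y \<pi> else 0"
  have "gact n ?f = gact n y" unfolding gact_def by (intro ext sum.cong) simp_all
  then show ?thesis using that[of ?f] y by (simp add: group_algebra_iff)
qed

lemma irrep_closed:
  assumes "y \<in> carrier (irrep n lam)"
  shows "z \<in> carrier (irrep n lam) \<Longrightarrow> (\<lambda>\<pi>. y \<pi> + z \<pi>) \<in> carrier (irrep n lam)"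
    "(\<lambda>\<pi>. c * y \<pi>) \<in> carrier (irrep n lam)"
    "\<omega> permutes {1..n} \<Longrightarrow> irrep_act n \<omega> y \<in> carrier (irrep n lam)"
proof -
  let ?e = "young_idempotent n (fill_rows 1 lam)"
  obtain f where f: "f \<in> carrier (group_algebra n)" "y = gmult n f ?e" using assms by (auto simp: irrep_def)
  have z: "(\<lambda>\<pi>. c * y \<pi>) \<in> carrier (group_algebra n)" if "y \<in> carrier (group_algebra n)" for c and y :: gralg
    using that by (simp add: group_algebra_iff)
  have a: "(\<lambda>\<pi>. y \<pi> + z \<pi>) \<in> carrier (group_algebra n)"
    if "y \<in> carrier (group_algebra n)" "z \<in> carrier (group_algebra n)" for y z :: gralg
    using that by (simp add: group_algebra_iff)
  have "(\<lambda>\<pi>. c * y \<pi>) = gmult n (\<lambda>\<pi>. c * f \<pi>) ?e"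
    unfolding f(2) by (rule gralg_eqI[OF z[OF gmult_group_algebra] gmult_group_algebra]) (simp add: gact_smult gact_gmult)
  moreover have "(\<lambda>\<pi>. c * f \<pi>) \<in> carrier (group_algebra n)" by (rule z[OF f(1)])
  ultimately show "(\<lambda>\<pi>. c * y \<pi>) \<in> carrier (irrep n lam)" unfolding irrep_def by auto
  have "irrep_act n \<omega> y = gmult n (gmult n (gdelta \<omega>) f) ?e"
    unfolding irrep_act_def f(2) by (rule gralg_eqI[where n = n]) (simp_all add: gmult_group_algebra gact_gmult)
  then show "irrep_act n \<omega> y \<in> carrier (irrep n lam)" unfolding irrep_def using gmult_group_algebra by auto
  show "(\<lambda>\<pi>. y \<pi> + z \<pi>) \<in> carrier (irrep n lam)" if zi: "z \<in> carrier (irrep n lam)"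
  proof -
    obtain g where g: "g \<in> carrier (group_algebra n)" "z = gmult n g ?e" using zi by (auto simp: irrep_def)
    have "(\<lambda>\<pi>. y \<pi> + z \<pi>) = gmult n (\<lambda>\<pi>. f \<pi> + g \<pi>) ?e"
      unfolding f(2) g(2)
      by (rule gralg_eqI[OF a[OF gmult_group_algebra gmult_group_algebra] gmult_group_algebra]) (simp add: gact_add gact_gmult)
    moreover have "(\<lambda>\<pi>. f \<pi> + g \<pi>) \<in> carrier (group_algebra n)" by (rule a[OF f(1) g(1)])
    ultimately show ?thesis unfolding irrep_def by auto
  qed
qed

section \<open>The row filling\<close>

lemma shape_fill_rows: "shape (fill_rows s lam) = lam"
  by (induction lam arbitrary: s) (simp_all add: shape_def)

lemma length_fill_rows: "length (fill_rows s lam) = length lam"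
  using arg_cong[OF shape_fill_rows[of s lam], of length] by (simp add: shape_def)

lemma fill_rows_nth:
  "r < length lam \<Longrightarrow> fill_rows s lam ! r = [s + sum_list (take r lam)..<s + sum_list (take r lam) + lam ! r]"
  by (induction lam arbitrary: s r) (auto simp: nth_Cons' take_Cons' add.assoc gr0_conv_Suc split: nat.splits)

lemma concat_fill_rows: "concat (fill_rows s lam) = [s..<s + sum_list lam]"
  by (induction lam arbitrary: s) (simp_all add: upt_add_eq_append[OF le_add1] add.assoc[symmetric])

lemma fill_rows_SYT:
  assumes "is_partition n lam" shows "fill_rows 1 lam \<in> SYT n"
  unfolding SYT_def mem_Collect_eq shape_fill_rows
proof (intro conjI ballI allI impI assms)
  let ?T = "fill_rows 1 lam"
  show "distinct (concat ?T)" by (simp add: concat_fill_rows)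
  show "set (concat ?T) = {1..n}" using assms by (auto simp: concat_fill_rows is_partition_def)
  fix row assume "row \<in> set ?T"
  then show "sorted_wrt (<) row"
    by (auto simp: in_set_conv_nth length_fill_rows fill_rows_nth simp del: upt_Suc)
next
  let ?T = "fill_rows 1 lam"
  fix r c assume a: "Suc r < length ?T \<and> c < length (?T ! Suc r)"
  then have l: "Suc r < length lam" "c < lam ! Suc r" using fill_rows_nth[of "Suc r" lam 1] by (auto simp: length_fill_rows)
  have "lam ! Suc r \<le> lam ! r" using assms l(1) sorted_wrt_nth_less[of "(\<ge>)" lam r "Suc r"] by (simp add: is_partition_def)
  moreover have "lam ! r \<in> set lam" using l(1) by simp
  then have "lam ! r \<noteq> 0" using assms unfolding is_partition_def by metis
  ultimately show "?T ! r ! c < ?T ! Suc r ! c"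
    using l by (simp add: fill_rows_nth take_Suc_conv_app_nth del: upt_Suc)
qed

section \<open>The blocks\<close>

text \<open>One block: the first tableau and the exponents are fixed, the second tableau varies. The
  generator \<open>v0\<close> belongs to the filling \<open>U\<close> whose Young idempotent defines
  \<open>irrep\<close>, so no change of tableau is needed for the isomorphism.\<close>

locale block =
  fixes n k :: nat and S :: "nat list list" and i :: "nat \<Rightarrow> nat"
  assumes k: "1 \<le> k" "k \<le> n" and Si: "(S, S, i) \<in> basis_idx n k"
begin

abbreviation "M \<equiv> quotient_module n (ideal_I n k)"
abbreviation "U \<equiv> fill_rows 1 (shape S)"
abbreviation "e \<equiv> \<Prod>d=1..n - k. esym n d ^ i d"
abbreviation "p0 \<equiv> xm n (\<lambda>j. lab S (tperm n S U j)) * e"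
abbreviation "v0 \<equiv> basis_elt n k (S, U, i)"
abbreviation "X \<equiv> (\<lambda>T. (S, T, i)) ` same_shape n S"
abbreviation "V \<equiv> qv.span (basis_elt n k ` X)"
abbreviation "M' \<equiv> M\<lparr>carrier := qt n k ` V\<rparr>"

lemma S: "S \<in> SYT n" and U: "U \<in> SYT n" "shape U = shape S" and part: "is_partition n (shape S)"
proof -
  show S: "S \<in> SYT n" using Si by (simp add: basis_idx_def)
  then show p: "is_partition n (shape S)" by (simp add: SYT_def)
  show "U \<in> SYT n" by (rule fill_rows_SYT[OF p])
  show "shape U = shape S" by (rule shape_fill_rows)
qed

lemma shpU: "same_shape n U = same_shape n S" using U(2) by (simp add: same_shape_def)

lemma X: "X \<subseteq> basis_idx n k" "finite X" "(S, U, i) \<in> X"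
proof -
  show "X \<subseteq> basis_idx n k" using Si by (auto simp: basis_idx_def same_shape_def)
  have "U \<in> same_shape n S" using U by (simp add: same_shape_def)
  then show "(S, U, i) \<in> X" by blast
qed simp

lemma e_sym: "\<pi> permutes {1..n} \<Longrightarrow> perm_act \<pi> e = e" by (rule perm_act_esym_prod)

lemma v0: "v0 = young_of n U p0"
proof -
  have "young_of n U p0 = young_of n U (xm n (\<lambda>j. lab S (tperm n S U j))) * e" by (rule young_sym) (erule e_sym)
  then show ?thesis unfolding basis_elt_def case_prod_conv higher_specht_young[OF S U(1) U(2)[symmetric]] by (rule sym)
qed

lemma basis_elt_transport: "T \<in> same_shape n S \<Longrightarrow> basis_elt n k (S, T, i) = perm_act (tperm n T U) v0"
proof -
  assume T: "T \<in> same_shape n S"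
  then have T': "T \<in> SYT n" "shape T = shape U" using U by (simp_all add: same_shape_def)
  note p = tperm_permutes[OF T'(1) U(1) T'(2)]
  show ?thesis
    unfolding basis_elt_def case_prod_conv perm_act_mult[OF permutes_bij'[OF p]] e_sym[OF p]
      higher_specht_transport[OF S T'(1) U(1) U(2)[symmetric] T'(2)] ..
qed

text \<open>The coefficients stem from straightening the operator and not from the polynomial. If
  they all vanish, \<open>F\<close> kills every value of the symmetrizer, which later yields
  injectivity.\<close>

lemma galg_op_v0:
  assumes "galg_op n F"
  obtains c where "F v0 = (\<Sum>x\<in>X. const (c x) * basis_elt n k x)"
    "(\<forall>x\<in>X. c x = 0) \<longrightarrow> (\<forall>p. F (young_of n U p) = 0)"
proof -
  obtain c where c: "\<And>p. F (young_of n U p) = (\<Sum>T\<in>same_shape n S. const (c T) * perm_act (tperm n T U) (young_of n U p))"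
    using galg_op_straighten[OF U(1) assms] unfolding shpU by blast
  have inj: "inj_on (\<lambda>T. (S, T, i)) (same_shape n S)" by (rule inj_onI) simp
  have "F v0 = (\<Sum>T\<in>same_shape n S. const (c T) * basis_elt n k (S, T, i))"
    unfolding v0 c by (rule sum.cong[OF refl]) (simp only: basis_elt_transport v0)
  also have "\<dots> = (\<Sum>x\<in>X. const (c (fst (snd x))) * basis_elt n k x)"
    unfolding sum.reindex[OF inj] by simp
  finally show ?thesis
  proof (rule that, intro impI)
    assume z: "\<forall>x\<in>X. c (fst (snd x)) = 0"
    have "c T = 0" if "T \<in> same_shape n S" for T using bspec[OF z imageI[OF that]] by simp
    then show "\<forall>p. F (young_of n U p) = 0" unfolding c by simp
  qed
qed

text \<open>The span is the cyclic module generated by \<open>v0\<close>: its generators are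
  permutations of \<open>v0\<close>, and straightening brings every operator applied to
  \<open>v0\<close> back into the span.\<close>

lemma V_iff: "a \<in> V \<longleftrightarrow> (\<exists>F. galg_op n F \<and> a = F v0)"
proof
  let ?G = "{a. \<exists>F. galg_op n F \<and> a = F v0}"
  have "V \<subseteq> ?G"
  proof (rule qv.span_minimal)
    show "qv.subspace ?G"
    proof (rule qv.subspaceI)
      show "0 \<in> ?G" using galg_op_zero by blast
      show "x + y \<in> ?G" if "x \<in> ?G" "y \<in> ?G" for x y using that galg_op_add by blast
      show "const c * x \<in> ?G" if "x \<in> ?G" for c x using that galg_op_scale by blast
    qed
    show "basis_elt n k ` X \<subseteq> ?G"
    proof
      fix a assume "a \<in> basis_elt n k ` X"
      then obtain T where T: "T \<in> same_shape n S" "a = basis_elt n k (S, T, i)" by blast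
      have "tperm n T U permutes {1..n}" by (rule tperm_permutes) (use T U in \<open>simp_all add: same_shape_def\<close>)
      then show "a \<in> ?G" unfolding T(2) basis_elt_transport[OF T(1)] using galg_op_perm by blast
    qed
  qed
  then show "a \<in> V \<Longrightarrow> \<exists>F. galg_op n F \<and> a = F v0" by blast
  assume "\<exists>F. galg_op n F \<and> a = F v0"
  then obtain F where F: "galg_op n F" "a = F v0" by blast
  obtain c where c: "F v0 = (\<Sum>x\<in>X. const (c x) * basis_elt n k x)" using galg_op_v0[OF F(1)] .
  show "a \<in> V" unfolding F(2) c by (intro qv.span_sum qv.span_scale qv.span_base) (erule imageI)
qed

lemma V: "qv.subspace V" "V \<subseteq> carrier (poly_ring n)" "\<And>\<sigma> a. \<sigma> permutes {1..n} \<Longrightarrow> a \<in> V \<Longrightarrow> perm_act \<sigma> a \<in> V"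
proof -
  show "V \<subseteq> carrier (poly_ring n)"
    using X(1) basis_elt_poly_ring by (intro qv.span_minimal[OF _ poly_ring_subspace]) auto
  show "perm_act \<sigma> a \<in> V" if s: "\<sigma> permutes {1..n}" and a: "a \<in> V" for \<sigma> a
  proof -
    obtain F where F: "galg_op n F" "a = F v0" using iffD1[OF V_iff a] by blast
    show ?thesis unfolding F(2) by (rule iffD2[OF V_iff]) (use galg_op_comp[OF galg_op_perm[OF s] F(1)] in blast)
  qed
qed (rule qv.subspace_span)

lemma v0_V: "v0 \<in> V" by (rule qv.span_base[OF imageI[OF X(3)]])

lemma indep: "(\<Sum>x\<in>X. const (c x) * basis_elt n k x) \<in> ideal_I n k \<Longrightarrow> \<forall>x\<in>X. c x = 0"
proof -
  assume z: "(\<Sum>x\<in>X. const (c x) * basis_elt n k x) \<in> ideal_I n k"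
  let ?c = "\<lambda>x. if x \<in> X then c x else 0"
  have "(\<Sum>x\<in>basis_idx n k. const (?c x) * basis_elt n k x) = (\<Sum>x\<in>X. const (?c x) * basis_elt n k x)"
    by (rule sum.mono_neutral_right[OF card_basis_idx(1)[OF k] X(1)]) simp
  also have "\<dots> = (\<Sum>x\<in>X. const (c x) * basis_elt n k x)" by (rule sum.cong) simp_all
  finally have "\<forall>x\<in>basis_idx n k. ?c x = 0" using z by (intro basis_elt_indep[OF k]) simp
  note z = this
  show ?thesis
  proof
    fix x assume x: "x \<in> X"
    from bspec[OF z subsetD[OF X(1) x]] x show "c x = 0" by simp
  qed
qed

lemma v0_I: "v0 \<notin> ideal_I n k"
proof
  assume "v0 \<in> ideal_I n k"
  moreover have "(\<Sum>x\<in>X. const (if x = (S, U, i) then 1 else 0) * basis_elt n k x) = v0"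
    using X(2,3) by (subst sum.remove[of X "(S, U, i)"]) (simp_all add: sum.neutral)
  ultimately have "\<forall>x\<in>X. (if x = (S, U, i) then 1 else 0) = (0::rat)" by (intro indep) simp
  from bspec[OF this X(3)] show False by simp
qed

sublocale Q: presented_Sn M "carrier (poly_ring n)" "qt n k" "ideal_I n k" n coset_act by (rule quotient_presented)

sublocale Q': presented_Sn M' V "qt n k" "ideal_I n k" n coset_act by (rule Q.restrict_Sn[OF V])

lemma block_submodule: "Sn_submodule n M coset_act (qt n k ` V)" by (rule Q.submodule_image[OF V])

lemma block_basis: "vectorspace.basis QQ M' ((\<lambda>x. qt n k (basis_elt n k x)) ` X)"
proof (rule Q'.basis_family[OF X(2)])
  show "basis_elt n k x \<in> V" if "x \<in> X" for x by (rule qv.span_base[OF imageI[OF that]])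
  fix a assume a: "a \<in> V"
  obtain c where "a = (\<Sum>x\<in>X. const (c x) * basis_elt n k x)" using span_image_sum[OF X(2) a] .
  then show "\<exists>c. a - (\<Sum>x\<in>X. const (c x) * basis_elt n k x) \<in> ideal_I n k" using ideal_I_closed(2) by (intro exI[of _ c]) simp
qed (rule indep)

text \<open>A nonzero element of a submodule is the class of some \<open>F v0\<close>. By
  \<open>young_irreducible\<close> an operator leads back to \<open>v0\<close>, which generates
  everything.\<close>

lemma block_irreducible: "Sn_irreducible n M' coset_act"
  unfolding Sn_irreducible_def
proof (intro conjI allI impI)
  show "Sn_module n M' coset_act" by (rule Q'.is_Sn_module)
  have z: "\<zero>\<^bsub>M'\<^esub> = qt n k 0" by (rule Q'.q_zero)
  have "qt n k v0 \<noteq> qt n k 0" using Q'.q_eq[OF v0_V Q'.PP(1)] v0_I by simp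
  then show "carrier M' \<noteq> {\<zero>\<^bsub>M'\<^esub>}" unfolding z using v0_V by auto
  fix Y assume Y: "Sn_submodule n M' coset_act Y"
  have sub: "submodule QQ Y M'" using Y by (simp add: Sn_submodule_def VectorSpace.subspace_def)
  have YM: "Y \<subseteq> qt n k ` V" using submodule.subset[OF sub] by simp
  have "Y = carrier M'" if ne: "Y \<noteq> {\<zero>\<^bsub>M'\<^esub>}"
  proof -
    have "\<zero>\<^bsub>M'\<^esub> \<in> Y" by (rule submodule.zero_closed[OF sub])
    then obtain y where y: "y \<in> Y" "y \<noteq> \<zero>\<^bsub>M'\<^esub>" using ne by blast
    obtain a where a: "a \<in> V" "y = qt n k a" using YM y(1) by blast
    obtain F where F: "galg_op n F" "a = F v0" using iffD1[OF V_iff a(1)] by blast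
    have nz: "F (young_of n U p0) \<noteq> 0"
    proof
      assume "F (young_of n U p0) = 0"
      then have "a = 0" unfolding F(2) v0 .
      then show False using y(2) unfolding z a(2) by blast
    qed
    obtain G where G: "galg_op n G" "\<And>p. G (F (young_of n U p)) = young_of n U p"
      using young_irreducible[OF SYT_tab[OF U(1)] F(1) nz] by metis
    have "qt n k (G a) \<in> Y" using Q'.submodule_galg_op[OF Y a(1) _ G(1)] y(1) a(2) by simp
    then have v: "qt n k v0 \<in> Y" using G(2)[of p0] by (simp add: F(2) v0)
    have "qt n k b \<in> Y" if b: "b \<in> V" for b
    proof -
      obtain F where F: "galg_op n F" "b = F v0" using iffD1[OF V_iff b] by blast
      show ?thesis using Q'.submodule_galg_op[OF Y v0_V v F(1)] F(2) by simp
    qed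
    then show ?thesis using YM by auto
  qed
  then show "Y = {\<zero>\<^bsub>M'\<^esub>} \<or> Y = carrier M'" by blast
qed

text \<open>The natural map goes from the left ideal, sending \<open>y\<close> to the class of
  \<open>y\<close> applied to \<open>p0\<close>; its inverse is the required one. It is injective
  because a difference sent into the ideal has zero coefficients by \<open>indep\<close>, so by
  \<open>galg_op_v0\<close> it is zero as an operator and hence in the group algebra.\<close>

lemma block_isomorphic: "Sn_isomorphic n M' coset_act (irrep n (shape S)) (irrep_act n)"
proof -
  let ?N = "irrep n (shape S)" and ?\<phi> = "\<lambda>y. qt n k (gact n y p0)"
  let ?\<epsilon> = "young_idempotent n U"
  let ?g = "inv_into (carrier ?N) ?\<phi>"
  have g\<epsilon>: "gact n (gmult n f ?\<epsilon>) p = gact n f (young_of n U p)" for f p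
    by (simp add: gact_gmult gact_young_idempotent[OF U(1)])
  have N: "carrier ?N = {gmult n f ?\<epsilon> | f. f \<in> carrier (group_algebra n)}" by (simp add: irrep_def)
  have VN: "gact n y p0 \<in> V" if "y \<in> carrier ?N" for y
  proof -
    obtain f where "y = gmult n f ?\<epsilon>" using \<open>y \<in> carrier ?N\<close> N by blast
    then show ?thesis unfolding V_iff v0 using g\<epsilon> by (auto simp: galg_op_def)
  qed
  have "qt n k ` V \<subseteq> ?\<phi> ` carrier ?N"
  proof
    fix x assume "x \<in> qt n k ` V"
    then obtain a where a: "a \<in> V" "x = qt n k a" by blast
    obtain F where F: "galg_op n F" "a = F v0" using iffD1[OF V_iff a(1)] by blast
    obtain f where f: "f \<in> carrier (group_algebra n)" "F = gact n f" using galg_op_gact[OF F(1)] .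
    have "x = ?\<phi> (gmult n f ?\<epsilon>)" unfolding g\<epsilon> a(2) F(2) f(2) v0 ..
    then show "x \<in> ?\<phi> ` carrier ?N" using f(1) N by blast
  qed
  then have im: "?\<phi> ` carrier ?N = qt n k ` V" using VN by blast
  have inj: "inj_on ?\<phi> (carrier ?N)"
  proof (rule inj_onI)
    fix y1 y2 assume y: "y1 \<in> carrier ?N" "y2 \<in> carrier ?N" "?\<phi> y1 = ?\<phi> y2"
    obtain f1 f2 where f: "y1 = gmult n f1 ?\<epsilon>" "y2 = gmult n f2 ?\<epsilon>" using y(1,2) N by blast
    let ?F = "\<lambda>p. gact n f1 p + const (-1) * gact n f2 p"
    have F: "galg_op n ?F" by (intro galg_op_add galg_op_scale) (auto simp: galg_op_def)
    obtain c where c: "?F v0 = (\<Sum>x\<in>X. const (c x) * basis_elt n k x)"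
      "(\<forall>x\<in>X. c x = 0) \<longrightarrow> (\<forall>p. ?F (young_of n U p) = 0)" using galg_op_v0[OF F] .
    have "gact n y1 p0 - gact n y2 p0 \<in> ideal_I n k" using Q'.q_eq[OF VN[OF y(1)] VN[OF y(2)]] y(3) by simp
    then have "?F v0 \<in> ideal_I n k" unfolding f g\<epsilon> v0 by (simp add: const_arith(3))
    then have "\<forall>x\<in>X. c x = 0" unfolding c(1) by (rule indep)
    then have "\<forall>p. ?F (young_of n U p) = 0" using c(2) by blast
    then have "gact n y1 p = gact n y2 p" for p unfolding f g\<epsilon> by (simp add: const_arith(3))
    then show "y1 = y2" by (rule gralg_eqI[rotated 2]) (simp_all add: f gmult_group_algebra)
  qed
  have bij: "bij_betw ?\<phi> (carrier ?N) (carrier M')" using inj im by (simp add: bij_betw_def)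
  have g: "?g (?\<phi> y) = y" if "y \<in> carrier ?N" for y by (rule inv_into_f_f[OF inj that])
  have ex: "\<exists>y\<in>carrier ?N. m = ?\<phi> y" if m: "m \<in> carrier M'" for m
  proof -
    have "m \<in> ?\<phi> ` carrier ?N" using m im by simp
    then show ?thesis by blast
  qed
  have "?g \<in> LinearCombinations.module_hom QQ M' ?N"
    unfolding LinearCombinations.module_hom_def mem_Collect_eq
  proof (intro conjI allI impI)
    show "?g \<in> carrier M' \<rightarrow> carrier ?N" using ex g by fastforce
    show "?g (m1 \<oplus>\<^bsub>M'\<^esub> m2) = ?g m1 \<oplus>\<^bsub>?N\<^esub> ?g m2" if m: "m1 \<in> carrier M' \<and> m2 \<in> carrier M'" for m1 m2
    proof -
      obtain y1 where y1: "y1 \<in> carrier ?N" "m1 = ?\<phi> y1" using ex[OF conjunct1[OF m]] by (rule bexE)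
      obtain y2 where y2: "y2 \<in> carrier ?N" "m2 = ?\<phi> y2" using ex[OF conjunct2[OF m]] by (rule bexE)
      note y = y1 y2
      have "m1 \<oplus>\<^bsub>M'\<^esub> m2 = ?\<phi> (\<lambda>\<pi>. y1 \<pi> + y2 \<pi>)"
        unfolding y(2,4) gact_add by (rule Q'.q_add[OF VN[OF y(1)] VN[OF y(3)]])
      then have "?g (m1 \<oplus>\<^bsub>M'\<^esub> m2) = (\<lambda>\<pi>. y1 \<pi> + y2 \<pi>)" using g[OF irrep_closed(1)[OF y(1,3)]] by simp
      also have "\<dots> = y1 \<oplus>\<^bsub>?N\<^esub> y2" by (simp add: irrep_def group_algebra_def)
      finally show ?thesis unfolding y(2,4) g[OF y(1)] g[OF y(3)] .
    qed
    show "?g (r \<odot>\<^bsub>M'\<^esub> m) = r \<odot>\<^bsub>?N\<^esub> ?g m" if m: "r \<in> carrier QQ \<and> m \<in> carrier M'" for r m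
    proof -
      obtain y where y: "y \<in> carrier ?N" "m = ?\<phi> y" using ex[OF conjunct2[OF m]] by (rule bexE)
      have "r \<odot>\<^bsub>M'\<^esub> m = ?\<phi> (\<lambda>\<pi>. r * y \<pi>)" unfolding y(2) gact_smult by (rule Q'.q_smult[OF VN[OF y(1)]])
      then have "?g (r \<odot>\<^bsub>M'\<^esub> m) = (\<lambda>\<pi>. r * y \<pi>)" using g[OF irrep_closed(2)[OF y(1)]] by simp
      also have "\<dots> = r \<odot>\<^bsub>?N\<^esub> y" by (simp add: irrep_def group_algebra_def)
      finally show ?thesis unfolding y(2) g[OF y(1)] .
    qed
  qed
  moreover have "bij_betw ?g (carrier M') (carrier ?N)" by (rule bij_betw_inv_into[OF bij])
  moreover have "?g (coset_act \<sigma> m) = irrep_act n \<sigma> (?g m)" if s: "\<sigma> permutes {1..n}" and m: "m \<in> carrier M'" for \<sigma> m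
  proof -
    obtain y where y: "y \<in> carrier ?N" "m = ?\<phi> y" using ex[OF m] by (rule bexE)
    have "coset_act \<sigma> m = ?\<phi> (irrep_act n \<sigma> y)"
      unfolding y(2) irrep_act_def gact_gmult gact_gdelta[OF s] by (rule Q'.act_q[OF s VN[OF y(1)]])
    then show ?thesis using g[OF irrep_closed(3)[OF y(1) s]] g[OF y(1)] y(2) by simp
  qed
  ultimately show ?thesis unfolding Sn_isomorphic_def by blast
qed

end

lemma basis_B_basis_elt: "basis_B n k = basis_elt n k ` basis_idx n k"
proof (intro equalityI subsetI)
  fix p assume "p \<in> basis_B n k"
  then obtain S T i where p: "p = higher_specht n S T * (\<Prod>d=1..n - k. esym n d ^ i d)" "S \<in> SYT n" "T \<in> SYT n"
    "shape S = shape T" "int (\<Sum>d=1..n - k. i d) < int k - int (des S)" unfolding basis_B_def by blast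
  \<comment> \<open>Clears the exponents outside the range, which the product never sees.\<close>
  define j where "j r = (if r \<in> {1..n - k} then i r else 0)" for r
  have "(\<Sum>d=1..n - k. j d) = (\<Sum>d=1..n - k. i d)" "(\<Prod>d=1..n - k. esym n d ^ j d) = (\<Prod>d=1..n - k. esym n d ^ i d)"
    by (auto simp: j_def intro!: sum.cong prod.cong)
  moreover have "(\<Sum>d=1..n - k. i d) + des S < k"
    using p(5) by (simp only: of_nat_add[symmetric] less_diff_eq of_nat_less_iff)
  ultimately have "p = basis_elt n k (S, T, j)" "(S, T, j) \<in> basis_idx n k" using p(1-4) by (auto simp: basis_elt_def basis_idx_def j_def)
  then show "p \<in> basis_elt n k ` basis_idx n k" by blast
next
  fix p assume "p \<in> basis_elt n k ` basis_idx n k"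
  then obtain S T i where x: "(S, T, i) \<in> basis_idx n k" "p = basis_elt n k (S, T, i)" by (metis imageE prod_cases3)
  then have "(\<Sum>d=1..n - k. i d) + des S < k" by (simp add: basis_idx_def)
  then have "int (\<Sum>d=1..n - k. i d) < int k - int (des S)"
    by (simp only: of_nat_add[symmetric] less_diff_eq of_nat_less_iff)
  then show "p \<in> basis_B n k" unfolding basis_B_def using x by (auto simp: basis_elt_def basis_idx_def)
qed

theorem theorem1p7:
  fixes n k :: nat
  assumes "1 \<le> k" and "k \<le> n"
  shows "descends_to_higher_specht_basis n (ideal_I n k) (basis_B n k)"
proof -
  let ?M = "quotient_module n (ideal_I n k)" and ?J = "basis_idx n k"
  let ?qb = "\<lambda>x. qt n k (basis_elt n k x)"
  \<comment> \<open>The block of an index: same first tableau and exponents, any second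
    tableau.\<close>
  let ?cls = "\<lambda>y. {x \<in> ?J. fst x = fst y \<and> snd (snd x) = snd (snd y)}"
  \<comment> \<open>The partition has to consist of sets of cosets; injectivity of
    \<open>?qb\<close> on the index set recovers the indices.\<close>
  define idx where "idx C = {x \<in> ?J. ?qb x \<in> C}" for C
  define W where "W C = qt n k ` qv.span (basis_elt n k ` idx C)" for C
  \<comment> \<open>The first tableau is constant on a block, so any representative gives the
    shape.\<close>
  define lam where "lam C = shape (fst (SOME x. x \<in> idx C))" for C
  define \<P> where "\<P> = (\<lambda>y. ?qb ` ?cls y) ` ?J"
  interpret Q: presented_Sn ?M "carrier (poly_ring n)" "qt n k" "ideal_I n k" n coset_act by (rule quotient_presented)
  note fin = card_basis_idx(1)[OF assms]
  have inj: "inj_on ?qb ?J"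
    by (rule Q.inj_family) (rule fin, erule basis_elt_poly_ring, erule basis_elt_indep[OF assms])
  have bas: "vectorspace.basis QQ ?M (?qb ` ?J)"
    by (rule Q.basis_family) (rule fin, erule basis_elt_poly_ring, erule basis_elt_indep[OF assms], erule basis_elt_span[OF assms])
  have idx: "idx (?qb ` ?cls y) = ?cls y" for y
    unfolding idx_def using inj by (auto dest: inj_onD)
  have idx_cls: "idx C = ?cls x \<and> C = ?qb ` ?cls x" if C: "C \<in> \<P>" and x: "x \<in> idx C" for C x
  proof -
    from C[unfolded \<P>_def] obtain y where y: "C = ?qb ` ?cls y" "y \<in> ?J" by (rule imageE)
    have "x \<in> ?cls y" using x unfolding y(1) idx .
    then have e: "?cls y = ?cls x" by simp
    show ?thesis unfolding y(1) idx e by (rule conjI[OF refl refl])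
  qed
  have ne: "\<exists>x. x \<in> idx C" if "C \<in> \<P>" for C
  proof -
    from that[unfolded \<P>_def] obtain y where y: "C = ?qb ` ?cls y" "y \<in> ?J" by (rule imageE)
    then show ?thesis unfolding y(1) idx by blast
  qed
  have in_P: "\<exists>C\<in>\<P>. x \<in> idx C" if "x \<in> ?J" for x
    using that idx[of x] unfolding \<P>_def by blast
  have disj: "idx C \<inter> idx D = {}" if "C \<in> \<P>" "D \<in> \<P>" "C \<noteq> D" for C D
    using idx_cls that by blast
  have un: "(\<Union>C\<in>\<P>. idx C) = ?J" using in_P unfolding idx_def by blast
  have C_idx: "C = ?qb ` idx C" if C: "C \<in> \<P>" for C
  proof -
    obtain x where "x \<in> idx C" using ne[OF C] ..
    from idx_cls[OF C this] have "idx C = ?cls x" "C = ?qb ` ?cls x" by blast+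
    then show ?thesis by (simp only:)
  qed
  have part: "partition_on (?qb ` ?J) \<P>"
  proof (rule partition_onI)
    show "\<Union>\<P> = ?qb ` ?J" unfolding un[symmetric] image_UN using C_idx by auto
    show "disjnt C D" if "C \<in> \<P>" "D \<in> \<P>" "C \<noteq> D" for C D
    proof -
      note CD = that
      have "C \<inter> D = {}"
      proof (rule ccontr)
        assume "C \<inter> D \<noteq> {}"
        then obtain z where z: "z \<in> C" "z \<in> D" by blast
        obtain x where x: "x \<in> idx C" "z = ?qb x" using z(1) C_idx[OF CD(1)] by blast
        then have "x \<in> idx D" using z(2) unfolding idx_def by blast
        then show False using disj[OF CD] x(1) by blast
      qed
      then show ?thesis by (simp add: disjnt_def)
    qed
    show "{} \<notin> \<P>" using ne unfolding idx_def by blast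
  qed
  have ds: "internal_direct_sum ?M \<P> W"
    unfolding W_def
    by (rule Q.direct_sum_blocks[OF fin _ _ _ _ disj un])
      (erule basis_elt_poly_ring, erule basis_elt_indep[OF assms], erule basis_elt_span[OF assms], simp_all add: \<P>_def fin)
  have strip_word: "is_partition n (lam C) \<and> Sn_submodule n ?M coset_act (W C) \<and>
      vectorspace.basis QQ (?M\<lparr>carrier := W C\<rparr>) C \<and>
      Sn_isomorphic n (?M\<lparr>carrier := W C\<rparr>) coset_act (irrep n (lam C)) (irrep_act n) \<and>
      Sn_irreducible n (?M\<lparr>carrier := W C\<rparr>) coset_act" if C: "C \<in> \<P>" for C
  proof -
    have s: "(SOME x. x \<in> idx C) \<in> idx C" using ne[OF C] by (rule someI_ex)
    obtain S T i where y: "(SOME x. x \<in> idx C) = (S, T, i)" by (metis prod_cases3)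
    have cls: "idx C = ?cls (S, T, i)" using conjunct1[OF idx_cls[OF C s]] unfolding y .
    have J: "(S, T, i) \<in> ?J" using s unfolding y unfolding idx_def by blast
    interpret block n k S i
      by (unfold_locales) (use assms J in \<open>auto simp: basis_idx_def\<close>)
    have X': "idx C = X" unfolding cls using J by (auto simp: basis_idx_def same_shape_def)
    have W: "W C = qt n k ` V" unfolding W_def X' ..
    have lam: "lam C = shape S" unfolding lam_def y by simp
    have C': "C = ?qb ` X" using C_idx[OF C] X' by simp
    show ?thesis
      unfolding W lam using block_basis part block_submodule block_irreducible block_isomorphic C'
      by simp
  qed
  have "inj_on (qt n k) (basis_elt n k ` ?J)" using inj_on_imageI[of "qt n k" "basis_elt n k" ?J] inj by (simp add: comp_def)
  moreover have "basis_elt n k ` ?J \<subseteq> carrier (poly_ring n)" using basis_elt_poly_ring by blast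
  moreover have "higher_specht_basis n ?M coset_act (qt n k ` basis_elt n k ` ?J)"
    unfolding higher_specht_basis_def image_image
    using Q.is_Sn_module bas part strip_word ds by blast
  ultimately show ?thesis unfolding descends_to_higher_specht_basis_def basis_B_basis_elt Let_def by blast
qed

end
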